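(* Suppose that $\lambda<0$, that either $r_0\subset\mathcal{A}_{0,I}$ or $r_0\subset\mathcal{A}_{0,III}$, and that either $r_L\subset\mathcal{A}_{m,II}$ or $r_L\subset\mathcal{A}_{m,IV}$. Assume that for every $i\in\{0,\dots,m\}$ there are $d_i,e_i\in\{c_{1,i},c_{2,i}\}$ with $d_i\neq e_i$ and integers $0\leq\alpha_i<\beta_i$ such that, for every $\kappa\in\{I,III\}$, $$\mathcal{T}_{i,\kappa+1}(d_i)+\mathcal{T}_{i,\kappa+2}(d_i)+\alpha_i\mathcal{T}_i(d_i)>\tau_i,\qquad \mathcal{T}_{i,\kappa}(e_i)+\mathcal{T}_{i,\kappa+1}(e_i)+\beta_i\mathcal{T}_i(e_i)<\tau_i,$$ and that, for all $i\in\{0,\dots,m-1\}$, the four transition times $\mathcal{S}_{i,II\to I}$, $\mathcal{S}_{i,IV\to III}$, $\mathcal{S}_{i,IV\to I}$, $\mathcal{S}_{i,II\to III}$ are all $\leq\varsigma_i$. Then, for each such choice of $r_0$ and $r_L$, the boundary value problem $$x'=h(y),\quad y'=-\lambda x-a(t)g(x),\quad (x(0),y(0))\in r_0,\quad (x(L),y(L))\in r_L$$ has at least $$4^m\prod_{i=0}^m(\beta_i-\alpha_i)$$ solutions. Moreover, these solutions are classified by their nodal properties as follows. Let $\kappa_0\in\{I,III\}$ and $q_L\in\{II,IV\}$ be such that $r_0\subset\mathcal{A}_{0,\kappa_0}$ and $r_L\subset\mathcal{A}_{m,q_L}$. For every $(\kappa_1,\dots,\kappa_m)\in\{I,III\}^m$,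 every $(q_0,\dots,q_{m-1})\in\{II,IV\}^m$ and every $(j_0,\dots,j_m)$ with $1\leq j_i\leq\beta_i-\alpha_i$, there is at least one such solution with $(x(t_i),y(t_i))\in\mathcal{A}_{i,\kappa_i}$ for $i\in\{0,\dots,m\}$, $(x(s_i),y(s_i))\in\mathcal{A}_{i,q_i}$ for $i\in\{0,\dots,m-1\}$ and, for $i\leq m-1$: \begin{itemize} \item if $q_i=\kappa_i-1$: $x$ has exactly $2(\alpha_i+j_i)-1$ zeroes in $(t_i,s_i)$ and $y$ exactly $2(\alpha_i+j_i)$ zeroes in $[t_i,s_i]$; if $q_i=\kappa_i+1$: $x$ has exactly $2(\alpha_i+j_i)$ zeroes in $(t_i,s_i)$ and $y$ exactly $2(\alpha_i+j_i)+1$ zeroes in $[t_i,s_i]$; \item if $(q_i,\kappa_{i+1})\in\{(II,I),(IV,III)\}$: in $[s_i,t_{i+1}]$, $x$ has exactly one zero and $y$ has none; if $(q_i,\kappa_{i+1})\in\{(IV,I),(II,III)\}$: in $[s_i,t_{i+1}]$, $x$ has no zero and $y$ has exactly one; \end{itemize} while on the last interval $x$ has exactly $2(\alpha_m+j_m)-1$ zeroes in $(t_m,s_m)$ and $y$ exactly $2(\alpha_m+j_m)$ zeroes in $[t_m,s_m]$ if $q_L=\kappa_m-1$, and $x$ has exactly $2(\alpha_m+j_m)$ zeroes in $(t_m,s_m)$ and $y$ exactly $2(\alpha_m+j_m)+1$ zeroes in $[t_m,s_m]$ if $q_L=\kappa_m+1$.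
   Context: Setting. $m\geq1$, $0=t_0<s_0<t_1<\dots<s_{m-1}<t_m<s_m=L$, $\tau_i:=s_i-t_i$, $\varsigma_i:=t_{i+1}-s_i$. The weight is $a(t)=\mu_i>0$ for $t\in[t_i,s_i]$, $i\in\{0,\dots,m\}$, and $a=0$ on $(s_i,t_{i+1})$, $i\in\{0,\dots,m-1\}$. The function $h:(\varrho_-,\varrho_+)\to\mathbb{R}$, $-\infty\leq\varrho_-<0<\varrho_+\leq+\infty$, is the inverse of an increasing homeomorphism between open intervals containing $0$ (so $h$ is continuous and strictly increasing), with $h(0)=0$; $g:\mathbb{R}\to\mathbb{R}$ is continuous with $g(0)=0$ and $g(s)s>0$ for $s\neq0$. Let $(\mathcal{N}_{i,\lambda})$ be $x'=h(y)$, $y'=-\lambda x-\mu_i g(x)$ and $(\mathcal{L}_\lambda)$ be $x'=h(y)$, $y'=-\lambda x$. Uniqueness of solutions of all initial value problems for these systems is assumed; solutions are in the Carathéodory sense. Put $H(y)=\int_0^y h$, $G(x)=\int_0^x g$, $F_{i,\lambda}(x)=\frac{\lambda}{2}x^2+\mu_iG(x)$, $\mathcal{H}_i(x,y)=H(y)+F_{i,\lambda}(x)$, $H(\varrho_\pm)=\lim_{y\to\varrho_\pm}H(y)$, $H^*=\min\{H(\varrho_-),H(\varrho_+)\}$. $H_+^{-1}$, $H_-^{-1}$ are the inverses of $H$ restricted to $[0,\varrho_+)$, $(\varrho_-,0]$, and $G_+^{-1}$, $G_-^{-1}$ the inverses of $G$ on the positive and negative half-lines. Annuli. For each $i$, $0<c_{1,i}<c_{2,i}<H^*$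 are such that for every $c\in[c_{1,i},c_{2,i}]$ there are $x_-(c)<0<x_+(c)$ with $F_{i,\lambda}(x_\pm(c))=c$, $F_{i,\lambda}<c$ on $(x_-(c),x_+(c))$, $F_{i,\lambda}'(x_-(c))<0<F_{i,\lambda}'(x_+(c))$; for $c\in\{c_{1,i},c_{2,i}\}$ these points $x_\pm(c)$ refer to $F_{i,\lambda}$. The annulus $\mathcal{A}_i=\{c_{1,i}\leq\mathcal{H}_i\leq c_{2,i}\}$ is the union of the corresponding closed orbits around the origin and is assumed to lie in $\mathbb{R}\times(\varrho_-,\varrho_+)$. $\mathcal{A}_{i,j}$, $j\in\{I,II,III,IV\}$, is the intersection of $\mathcal{A}_i$ with the $j$-th closed quadrant. $y_-(c)<0<y_+(c)$ are given by $H(y_\pm(c))=c$. The sets $r_0\subset\mathcal{A}_0$ and $r_L\subset\mathcal{A}_m$ are arcs, each connecting the inner with the outer boundary of the corresponding annulus. Times. $\mathcal{T}_{i,I}(c)=\int_0^{x_+(c)}\frac{dx}{(h\circ H_+^{-1})(c-F_{i,\lambda}(x))}$, $\mathcal{T}_{i,IV}(c)=\int_0^{x_+(c)}\frac{dx}{-(h\circ H_-^{-1})(c-F_{i,\lambda}(x))}$, $\mathcal{T}_{i,III}(c)=\int_{x_-(c)}^0\frac{dx}{-(h\circ H_-^{-1})(c-F_{i,\lambda}(x))}$, $\mathcal{T}_{i,II}(c)=\int_{x_-(c)}^0\frac{dx}{(h\circ H_+^{-1})(c-F_{i,\lambda}(x))}$ are the times spent in each quadrant by the orbit $\mathcal{H}_i=c$,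 and $\mathcal{T}_i(c)$ is their sum (the period). Quadrant indices are added in the cyclic clockwise order $IV\prec III\prec II\prec I\prec IV$: $I+1=IV$, $IV+1=III$, $III+1=II$, $II+1=I$ (so $I-1=II$, $III-1=IV$). Transition times for $\lambda<0$ (the arcs of level lines of $H(y)+\frac{\lambda}{2}x^2$ involved are assumed to lie in the strip $\mathbb{R}\times(\varrho_-,\varrho_+)$). Put $y_{+,i}=\min\{y_+(c_{1,i}),y_+(c_{1,i+1})\}$, $y_{-,i}=\max\{y_-(c_{1,i}),y_-(c_{1,i+1})\}$, $x_{+,i}=\min\{x_+(c_{1,i}),x_+(c_{1,i+1})\}$, $x_{-,i}=\max\{x_-(c_{1,i}),x_-(c_{1,i+1})\}$. Then $$\mathcal{S}_{i,II\to I}=\int_{x_\ell}^{x_r}\frac{dx}{(h\circ H_+^{-1})(H(y_{+,i})-\frac{\lambda}{2}x^2)},\quad x_\ell=G_-^{-1}(\mu_i^{-1}[c_{2,i}-H(y_{+,i})]),\ x_r=G_+^{-1}(\mu_{i+1}^{-1}[c_{2,i+1}-H(y_{+,i})]);$$ $$\mathcal{S}_{i,IV\to III}=\int_{x_\ell'}^{x_r'}\frac{dx}{-(h\circ H_-^{-1})(H(y_{-,i})-\frac{\lambda}{2}x^2)},\quad x_r'=G_+^{-1}(\mu_i^{-1}[c_{2,i}-H(y_{-,i})]),\ x_\ell'=G_-^{-1}(\mu_{i+1}^{-1}[c_{2,i+1}-H(y_{-,i})]);$$ $$\mathcal{S}_{i,IV\to I}=\int_{x_{+,i}}^{x_{r_2}}\frac{dx}{(h\circ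 H_+^{-1})(\frac{\lambda}{2}(x_{+,i}^2-x^2))}+\int_{x_{+,i}}^{x_{r_1}}\frac{dx}{-(h\circ H_-^{-1})(\frac{\lambda}{2}(x_{+,i}^2-x^2))},$$ with $x_{r_1}=G_+^{-1}\big(G(x_+(c_{2,i}))+\frac{\lambda}{2\mu_i}[x_+^2(c_{2,i})-x_{+,i}^2]\big)$ and $x_{r_2}=G_+^{-1}\big(G(x_+(c_{2,i+1}))+\frac{\lambda}{2\mu_{i+1}}[x_+^2(c_{2,i+1})-x_{+,i}^2]\big)$; $$\mathcal{S}_{i,II\to III}=\int_{x_{\ell_1}}^{x_{-,i}}\frac{dx}{(h\circ H_+^{-1})(\frac{\lambda}{2}(x_{-,i}^2-x^2))}+\int_{x_{\ell_2}}^{x_{-,i}}\frac{dx}{-(h\circ H_-^{-1})(\frac{\lambda}{2}(x_{-,i}^2-x^2))},$$ with $x_{\ell_1}=G_-^{-1}\big(G(x_-(c_{2,i}))+\frac{\lambda}{2\mu_i}[x_-^2(c_{2,i})-x_{-,i}^2]\big)$ and $x_{\ell_2}=G_-^{-1}\big(G(x_-(c_{2,i+1}))+\frac{\lambda}{2\mu_{i+1}}[x_-^2(c_{2,i+1})-x_{-,i}^2]\big)$. *)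

theory Defs
  imports "HOL-Analysis.Analysis"
begin

text \<open>Closed quadrants. \<open>qsucc\<close> is the clockwise cyclic successor, i.e. the order in which
  the orbits visit the quadrants; \<open>qpred\<close> is its inverse.\<close>

datatype quadrant = QI | QII | QIII | QIV

fun qsucc :: "quadrant \<Rightarrow> quadrant" where
  "qsucc QI = QIV"
| "qsucc QIV = QIII"
| "qsucc QIII = QII"
| "qsucc QII = QI"

fun qpred :: "quadrant \<Rightarrow> quadrant" where
  "qpred QI = QII"
| "qpred QII = QIII"
| "qpred QIII = QIV"
| "qpred QIV = QI"

fun quadrant_set :: "quadrant \<Rightarrow> (real \<times> real) set" where
  "quadrant_set QI = {(x, y). 0 \<le> x \<and> 0 \<le> y}"
| "quadrant_set QII = {(x, y). x \<le> 0 \<and> 0 \<le> y}"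
| "quadrant_set QIII = {(x, y). x \<le> 0 \<and> y \<le> 0}"
| "quadrant_set QIV = {(x, y). 0 \<le> x \<and> y \<le> 0}"

text \<open>Finiteness is required explicitly because \<open>card\<close> of an infinite set is \<open>0\<close>.\<close>

definition has_exactly_zeros :: "(real \<Rightarrow> real) \<Rightarrow> real set \<Rightarrow> nat \<Rightarrow> bool" where
  "has_exactly_zeros f A n \<longleftrightarrow> finite {\<tau> \<in> A. f \<tau> = 0} \<and> card {\<tau> \<in> A. f \<tau> = 0} = n"

text \<open>The usual \<open>\<epsilon>\<close>-\<open>\<delta>\<close> notion: a division of a subset of \<open>[a, b]\<close> is a finite family of
  non-overlapping compact subintervals.\<close>

definition abs_continuous_on_interval :: "real \<Rightarrow> real \<Rightarrow> (real \<Rightarrow> real) \<Rightarrow> bool" where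
  "abs_continuous_on_interval a b f \<longleftrightarrow>
    (\<forall>\<epsilon>>0. \<exists>\<delta>>0. \<forall>\<D> S. \<D> division_of S \<and> S \<subseteq> {a..b} \<and> (\<Sum>K\<in>\<D>. Sup K - Inf K) < \<delta>
        \<longrightarrow> (\<Sum>K\<in>\<D>. \<bar>f (Sup K) - f (Inf K)\<bar>) < \<epsilon>)"

text \<open>Caratheodory solutions on \<open>[a, b]\<close> of \<open>x' = h(y)\<close>, \<open>y' = f(t, x)\<close> where \<open>h\<close> is only
  meaningful on \<open>(rm, rp)\<close>.\<close>

definition caratheodory_solution ::
  "ereal \<Rightarrow> ereal \<Rightarrow> (real \<Rightarrow> real) \<Rightarrow> (real \<Rightarrow> real \<Rightarrow> real) \<Rightarrow> real \<Rightarrow> real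
    \<Rightarrow> (real \<Rightarrow> real) \<Rightarrow> (real \<Rightarrow> real) \<Rightarrow> bool" where
  "caratheodory_solution rm rp h f a b x y \<longleftrightarrow>
    abs_continuous_on_interval a b x \<and> abs_continuous_on_interval a b y \<and>
    (\<forall>\<tau>\<in>{a..b}. y \<tau> \<in> einterval rm rp) \<and>
    (AE \<tau> in lebesgue. \<tau> \<in> {a..b} \<longrightarrow>
       (x has_real_derivative h (y \<tau>)) (at \<tau> within {a..b}) \<and>
       (y has_real_derivative f \<tau> (x \<tau>)) (at \<tau> within {a..b}))"

definition unique_ivp_solutions ::
  "ereal \<Rightarrow> ereal \<Rightarrow> (real \<Rightarrow> real) \<Rightarrow> (real \<Rightarrow> real) \<Rightarrow> bool" where
  "unique_ivp_solutions rm rp h f \<longleftrightarrow>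
    (\<forall>a b \<tau>\<^sub>0 x y u v.
       \<tau>\<^sub>0 \<in> {a..b} \<and>
       caratheodory_solution rm rp h (\<lambda>_. f) a b x y \<and>
       caratheodory_solution rm rp h (\<lambda>_. f) a b u v \<and>
       x \<tau>\<^sub>0 = u \<tau>\<^sub>0 \<and> y \<tau>\<^sub>0 = v \<tau>\<^sub>0
       \<longrightarrow> (\<forall>\<tau>\<in>{a..b}. x \<tau> = u \<tau> \<and> y \<tau> = v \<tau>))"

definition primitive0 :: "(real \<Rightarrow> real) \<Rightarrow> real \<Rightarrow> real" where
  "primitive0 f z = (LBINT u=0..z. f u)"

definition potential :: "real \<Rightarrow> real \<Rightarrow> (real \<Rightarrow> real) \<Rightarrow> real \<Rightarrow> real" where
  "potential lam \<mu> g x = lam / 2 * x\<^sup>2 + \<mu> * primitive0 g x"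

definition H_plus_inv :: "ereal \<Rightarrow> (real \<Rightarrow> real) \<Rightarrow> real \<Rightarrow> real" where
  "H_plus_inv rp h = the_inv_into {y. 0 \<le> y \<and> ereal y < rp} (primitive0 h)"

definition H_minus_inv :: "ereal \<Rightarrow> (real \<Rightarrow> real) \<Rightarrow> real \<Rightarrow> real" where
  "H_minus_inv rm h = the_inv_into {y. rm < ereal y \<and> y \<le> 0} (primitive0 h)"

definition G_plus_inv :: "(real \<Rightarrow> real) \<Rightarrow> real \<Rightarrow> real" where
  "G_plus_inv g = the_inv_into {0..} (primitive0 g)"

definition G_minus_inv :: "(real \<Rightarrow> real) \<Rightarrow> real \<Rightarrow> real" where
  "G_minus_inv g = the_inv_into {..0} (primitive0 g)"

definition H_star :: "ereal \<Rightarrow> ereal \<Rightarrow> (real \<Rightarrow> real) \<Rightarrow> ereal" where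
  "H_star rm rp h =
    min (Lim (at_right rm) (\<lambda>y. ereal (primitive0 h (real_of_ereal y))))
        (Lim (at_left rp) (\<lambda>y. ereal (primitive0 h (real_of_ereal y))))"

text \<open>The standing setting: \<open>xm i c < 0 < xp i c\<close> are the points \<open>x\<^sub>\<plusminus>(c)\<close> of the \<open>i\<close>-th potential,
  which the assumptions determine uniquely for \<open>c1 i \<le> c \<le> c2 i\<close>; the parameters \<open>rm\<close>, \<open>rp\<close> are
  the (possibly infinite) end points of the domain of \<open>h\<close>.\<close>

locale annular_system =
  fixes m :: nat and L :: real
    and t s :: "nat \<Rightarrow> real"
    and \<mu> :: "nat \<Rightarrow> real" and a :: "real \<Rightarrow> real"
    and rm rp :: ereal and h g :: "real \<Rightarrow> real" and lam :: real
    and c1 c2 :: "nat \<Rightarrow> real"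
    and xm xp :: "nat \<Rightarrow> real \<Rightarrow> real"
  assumes m_ge_1: "1 \<le> m"
    and t_0: "t 0 = 0"
    and t_less_s: "\<And>i. i \<le> m \<Longrightarrow> t i < s i"
    and s_less_t: "\<And>i. i < m \<Longrightarrow> s i < t (Suc i)"
    and s_m: "s m = L"
    and \<mu>_pos: "\<And>i. i \<le> m \<Longrightarrow> 0 < \<mu> i"
    and weight_on: "\<And>i \<tau>. i \<le> m \<Longrightarrow> \<tau> \<in> {t i..s i} \<Longrightarrow> a \<tau> = \<mu> i"
    and weight_gap: "\<And>i \<tau>. i < m \<Longrightarrow> \<tau> \<in> {s i<..<t (Suc i)} \<Longrightarrow> a \<tau> = 0"
    and rm_neg: "rm < 0" and rp_pos: "0 < rp"
    and h_inverse_homeo: "\<exists>jm jp \<phi>. jm < (0::ereal) \<and> 0 < jp \<and>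
          strict_mono_on (einterval jm jp) \<phi> \<and>
          homeomorphism (einterval jm jp) (einterval rm rp) \<phi> h"
    and h_0: "h 0 = 0"
    and g_cont: "continuous_on UNIV g" and g_0: "g 0 = 0"
    and g_sign: "\<And>z. z \<noteq> 0 \<Longrightarrow> 0 < g z * z"
    and unique_N: "\<And>i. i \<le> m \<Longrightarrow> unique_ivp_solutions rm rp h (\<lambda>x. - lam * x - \<mu> i * g x)"
    and unique_L: "unique_ivp_solutions rm rp h (\<lambda>x. - lam * x)"
    and c1_pos: "\<And>i. i \<le> m \<Longrightarrow> 0 < c1 i"
    and c1_less_c2: "\<And>i. i \<le> m \<Longrightarrow> c1 i < c2 i"
    and c2_less: "\<And>i. i \<le> m \<Longrightarrow> ereal (c2 i) < H_star rm rp h"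
    and xm_neg: "\<And>i c. i \<le> m \<Longrightarrow> c \<in> {c1 i..c2 i} \<Longrightarrow> xm i c < 0"
    and xp_pos: "\<And>i c. i \<le> m \<Longrightarrow> c \<in> {c1 i..c2 i} \<Longrightarrow> 0 < xp i c"
    and F_xm: "\<And>i c. i \<le> m \<Longrightarrow> c \<in> {c1 i..c2 i} \<Longrightarrow> potential lam (\<mu> i) g (xm i c) = c"
    and F_xp: "\<And>i c. i \<le> m \<Longrightarrow> c \<in> {c1 i..c2 i} \<Longrightarrow> potential lam (\<mu> i) g (xp i c) = c"
    and F_less: "\<And>i c x. i \<le> m \<Longrightarrow> c \<in> {c1 i..c2 i} \<Longrightarrow> x \<in> {xm i c<..<xp i c}
          \<Longrightarrow> potential lam (\<mu> i) g x < c"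
    and F'_xm: "\<And>i c. i \<le> m \<Longrightarrow> c \<in> {c1 i..c2 i} \<Longrightarrow> deriv (potential lam (\<mu> i) g) (xm i c) < 0"
    and F'_xp: "\<And>i c. i \<le> m \<Longrightarrow> c \<in> {c1 i..c2 i} \<Longrightarrow> 0 < deriv (potential lam (\<mu> i) g) (xp i c)"
    \<comment> \<open>the annuli lie in the strip: over every \<open>x\<close> between \<open>xm i c\<close> and \<open>xp i c\<close> both the upper and
        the lower arc of the level line \<open>c\<close> exist inside the domain of \<open>h\<close>\<close>
    and annulus_strip_upper: "\<And>i c x. i \<le> m \<Longrightarrow> c \<in> {c1 i..c2 i} \<Longrightarrow> x \<in> {xm i c..xp i c}
          \<Longrightarrow> \<exists>y\<ge>0. ereal y < rp \<and> primitive0 h y + potential lam (\<mu> i) g x = c"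
    and annulus_strip_lower: "\<And>i c x. i \<le> m \<Longrightarrow> c \<in> {c1 i..c2 i} \<Longrightarrow> x \<in> {xm i c..xp i c}
          \<Longrightarrow> \<exists>y\<le>0. rm < ereal y \<and> primitive0 h y + potential lam (\<mu> i) g x = c"
begin

abbreviation "H \<equiv> primitive0 h"
abbreviation "G \<equiv> primitive0 g"
abbreviation "F i \<equiv> potential lam (\<mu> i) g"
abbreviation "Hp_inv \<equiv> H_plus_inv rp h"
abbreviation "Hm_inv \<equiv> H_minus_inv rm h"
abbreviation "Gp_inv \<equiv> G_plus_inv g"
abbreviation "Gm_inv \<equiv> G_minus_inv g"

text \<open>The restriction on \<open>x\<close> selects the closed orbit around the origin: for \<open>lam < 0\<close> the full
  level set may have further components.\<close>

definition orbit :: "nat \<Rightarrow> real \<Rightarrow> (real \<times> real) set" where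
  "orbit i c = {(x, y). x \<in> {xm i c..xp i c} \<and> y \<in> einterval rm rp \<and> H y + F i x = c}"

definition annulus :: "nat \<Rightarrow> (real \<times> real) set" where
  "annulus i = (\<Union>c\<in>{c1 i..c2 i}. orbit i c)"

definition annulus_quadrant :: "nat \<Rightarrow> quadrant \<Rightarrow> (real \<times> real) set" where
  "annulus_quadrant i q = annulus i \<inter> quadrant_set q"

definition connecting_arc :: "nat \<Rightarrow> (real \<times> real) set \<Rightarrow> bool" where
  "connecting_arc i r \<longleftrightarrow> r \<subseteq> annulus i \<and>
     (\<exists>\<gamma>. arc \<gamma> \<and> path_image \<gamma> = r \<and> pathstart \<gamma> \<in> orbit i (c1 i) \<and> pathfinish \<gamma> \<in> orbit i (c2 i))"

fun quadrant_time :: "nat \<Rightarrow> quadrant \<Rightarrow> real \<Rightarrow> real" where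
  "quadrant_time i QI c = (LBINT x=0..xp i c. 1 / h (Hp_inv (c - F i x)))"
| "quadrant_time i QIV c = (LBINT x=0..xp i c. 1 / - h (Hm_inv (c - F i x)))"
| "quadrant_time i QIII c = (LBINT x=xm i c..0. 1 / - h (Hm_inv (c - F i x)))"
| "quadrant_time i QII c = (LBINT x=xm i c..0. 1 / h (Hp_inv (c - F i x)))"

definition period :: "nat \<Rightarrow> real \<Rightarrow> real" where
  "period i c = quadrant_time i QI c + quadrant_time i QII c
     + quadrant_time i QIII c + quadrant_time i QIV c"

definition y_plus :: "nat \<Rightarrow> real" where
  "y_plus i = min (Hp_inv (c1 i)) (Hp_inv (c1 (Suc i)))"

definition y_minus :: "nat \<Rightarrow> real" where
  "y_minus i = max (Hm_inv (c1 i)) (Hm_inv (c1 (Suc i)))"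

definition x_plus :: "nat \<Rightarrow> real" where
  "x_plus i = min (xp i (c1 i)) (xp (Suc i) (c1 (Suc i)))"

definition x_minus :: "nat \<Rightarrow> real" where
  "x_minus i = max (xm i (c1 i)) (xm (Suc i) (c1 (Suc i)))"

definition xl :: "nat \<Rightarrow> real" where
  "xl i = Gm_inv ((c2 i - H (y_plus i)) / \<mu> i)"

definition xr :: "nat \<Rightarrow> real" where
  "xr i = Gp_inv ((c2 (Suc i) - H (y_plus i)) / \<mu> (Suc i))"

definition xl' :: "nat \<Rightarrow> real" where
  "xl' i = Gm_inv ((c2 (Suc i) - H (y_minus i)) / \<mu> (Suc i))"

definition xr' :: "nat \<Rightarrow> real" where
  "xr' i = Gp_inv ((c2 i - H (y_minus i)) / \<mu> i)"

definition xr1 :: "nat \<Rightarrow> real" where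
  "xr1 i = Gp_inv (G (xp i (c2 i)) + lam / (2 * \<mu> i) * ((xp i (c2 i))\<^sup>2 - (x_plus i)\<^sup>2))"

definition xr2 :: "nat \<Rightarrow> real" where
  "xr2 i = Gp_inv (G (xp (Suc i) (c2 (Suc i)))
     + lam / (2 * \<mu> (Suc i)) * ((xp (Suc i) (c2 (Suc i)))\<^sup>2 - (x_plus i)\<^sup>2))"

definition xl1 :: "nat \<Rightarrow> real" where
  "xl1 i = Gm_inv (G (xm i (c2 i)) + lam / (2 * \<mu> i) * ((xm i (c2 i))\<^sup>2 - (x_minus i)\<^sup>2))"

definition xl2 :: "nat \<Rightarrow> real" where
  "xl2 i = Gm_inv (G (xm (Suc i) (c2 (Suc i)))
     + lam / (2 * \<mu> (Suc i)) * ((xm (Suc i) (c2 (Suc i)))\<^sup>2 - (x_minus i)\<^sup>2))"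

definition S_II_I :: "nat \<Rightarrow> real" where
  "S_II_I i = (LBINT x=xl i..xr i. 1 / h (Hp_inv (H (y_plus i) - lam / 2 * x\<^sup>2)))"

definition S_IV_III :: "nat \<Rightarrow> real" where
  "S_IV_III i = (LBINT x=xl' i..xr' i. 1 / - h (Hm_inv (H (y_minus i) - lam / 2 * x\<^sup>2)))"

definition S_IV_I :: "nat \<Rightarrow> real" where
  "S_IV_I i =
     (LBINT x=x_plus i..xr2 i. 1 / h (Hp_inv (lam / 2 * ((x_plus i)\<^sup>2 - x\<^sup>2))))
   + (LBINT x=x_plus i..xr1 i. 1 / - h (Hm_inv (lam / 2 * ((x_plus i)\<^sup>2 - x\<^sup>2))))"

definition S_II_III :: "nat \<Rightarrow> real" where
  "S_II_III i =
     (LBINT x=xl1 i..x_minus i. 1 / h (Hp_inv (lam / 2 * ((x_minus i)\<^sup>2 - x\<^sup>2))))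
   + (LBINT x=xl2 i..x_minus i. 1 / - h (Hm_inv (lam / 2 * ((x_minus i)\<^sup>2 - x\<^sup>2))))"

text \<open>The arcs of level lines of \<open>H(y) + lam/2 x\<^sup>2\<close> underlying the four transition times lie in the
  strip: the level line \<open>H(y) + lam/2 x\<^sup>2 = e\<close> has, over all of \<open>[u, v]\<close>, a point in the upper
  (resp. lower) half of the strip.\<close>

definition upper_arc_in_strip :: "real \<Rightarrow> real \<Rightarrow> real \<Rightarrow> bool" where
  "upper_arc_in_strip e u v \<longleftrightarrow>
     (\<forall>x\<in>{u..v}. \<exists>y\<ge>0. ereal y < rp \<and> H y + lam / 2 * x\<^sup>2 = e)"

definition lower_arc_in_strip :: "real \<Rightarrow> real \<Rightarrow> real \<Rightarrow> bool" where
  "lower_arc_in_strip e u v \<longleftrightarrow>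
     (\<forall>x\<in>{u..v}. \<exists>y\<le>0. rm < ereal y \<and> H y + lam / 2 * x\<^sup>2 = e)"

definition transition_arcs_in_strip :: "nat \<Rightarrow> bool" where
  "transition_arcs_in_strip i \<longleftrightarrow>
     upper_arc_in_strip (H (y_plus i)) (xl i) (xr i) \<and>
     lower_arc_in_strip (H (y_minus i)) (xl' i) (xr' i) \<and>
     upper_arc_in_strip (lam / 2 * (x_plus i)\<^sup>2) (x_plus i) (xr2 i) \<and>
     lower_arc_in_strip (lam / 2 * (x_plus i)\<^sup>2) (x_plus i) (xr1 i) \<and>
     upper_arc_in_strip (lam / 2 * (x_minus i)\<^sup>2) (xl1 i) (x_minus i) \<and>
     lower_arc_in_strip (lam / 2 * (x_minus i)\<^sup>2) (xl2 i) (x_minus i)"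

text \<open>Solutions are functions on \<open>[0, L]\<close>; as total functions they are made extensional so that
  distinct elements of the set are distinct as functions on \<open>[0, L]\<close>.\<close>

definition bvp_solutions ::
  "(real \<times> real) set \<Rightarrow> (real \<times> real) set \<Rightarrow> ((real \<Rightarrow> real) \<times> (real \<Rightarrow> real)) set" where
  "bvp_solutions r0 rL =
     {(x, y). x \<in> extensional {0..L} \<and> y \<in> extensional {0..L} \<and>
        caratheodory_solution rm rp h (\<lambda>\<tau> z. - lam * z - a \<tau> * g z) 0 L x y \<and>
        (x 0, y 0) \<in> r0 \<and> (x L, y L) \<in> rL}"

end

end

theory Submission
  imports Defs
begin

text \<open>
  Parametrise each quadrant of an annulus by the energy \<open>c\<close> and an angle \<open>v\<close>. Where the weight is
  \<open>\<mu>\<^sub>i\<close> the energy is conserved, and the time inequalities say that within \<open>\<tau>\<^sub>i\<close> the level \<open>e\<^sub>i\<close>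
  turns further than the level \<open>d\<^sub>i\<close>. Hence on every path that joins the two boundary circles in a
  quadrant I or III there are, for each admissible number of turns, states whose images form a path
  across a quadrant II or IV from one axis to the other. On a gap, where \<open>a = 0\<close> and \<open>\<lambda> < 0\<close>, the
  origin is a saddle. The path just found runs from the stable manifold, near which the transit takes
  arbitrarily long, to an orbit on which, by the bound on the transition times, the way from the outer
  circle of one annulus to that of the next takes at most \<open>\<varsigma>\<^sub>i\<close>. So its images contain a path that
  joins the boundary circles of the next annulus, and the argument repeats. In the last annulus a path
  from axis to axis must cross the arc \<open>r\<^sub>L\<close>.

  Orbits are described throughout by quadratures along level curves, so that neither global existence
  nor continuous dependence on initial data is needed; the image paths come from the intermediate
  value theorem applied to travel times.
\<close>

text \<open>Two Hamiltonians are in play: \<open>H y + lam / 2 * x^2 + \<mu> i * G x\<close> in the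
  i-th annulus, and the same without the last term in a gap. A state of level c and gap energy E
  satisfies \<open>\<mu> i * G x = c - E\<close>; this explains the inverses of G in the limits of
  the transition times, and it lets the level of the next annulus serve as a coordinate along a gap
  orbit. Positive gap energy carries a state over the y-axis (II to I, IV to III), negative gap
  energy over the x-axis (II to III, IV to I). A path across quadrant II or IV from axis to axis
  contains both, so from each exit quadrant both entry quadrants can be reached: two times two
  choices per gap, the origin of the factor \<open>4 ^ m\<close>. The x-axis passages are y-axis
  passages after an exchange of x and y, because \<open>lam < 0\<close> makes the linear force
  monotone in the right sense. A recurrent obstacle is the time integral over x, which is singular
  where an orbit meets the x-axis; it is either reparametrised or recovered from the solution
  itself. In \<open>smooth_sol\<close> derivatives are asked only at interior times, since solutions
  arise by inverting a time function that is controlled in the interior.\<close>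

definition smooth_sol :: "(real \<Rightarrow> real) \<Rightarrow> (real \<Rightarrow> real) \<Rightarrow> real \<Rightarrow> (real \<Rightarrow> real) \<Rightarrow> (real \<Rightarrow> real) \<Rightarrow> bool" where
  "smooth_sol k f T x y \<longleftrightarrow> 0 \<le> T \<and> continuous_on {0..T} x \<and> continuous_on {0..T} y \<and>
     (\<forall>\<tau>\<in>{0<..<T}. (x has_real_derivative k (y \<tau>)) (at \<tau>) \<and> (y has_real_derivative - f (x \<tau>)) (at \<tau>))"

lemma continuous_on_interior_isCont:
  fixes f :: "real \<Rightarrow> real"
  assumes "continuous_on {a..b} f" "u \<in> {a<..<b}"
  shows "isCont f u"
  using assms continuous_on_interior interior_atLeastAtMost_real by blast

lemma strict_mono_inverse_on_interval:
  fixes \<theta> :: "real \<Rightarrow> real"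
  assumes ab: "a \<le> b" and cont: "continuous_on {a..b} \<theta>" and mono: "strict_mono_on {a..b} \<theta>"
  obtains g where "continuous_on {\<theta> a..\<theta> b} g" "g ` {\<theta> a..\<theta> b} \<subseteq> {a..b}"
    "\<And>t. t \<in> {\<theta> a..\<theta> b} \<Longrightarrow> \<theta> (g t) = t" "\<And>u. u \<in> {a..b} \<Longrightarrow> g (\<theta> u) = u"
    "strict_mono_on {\<theta> a..\<theta> b} g"
proof -
  have inj: "inj_on \<theta> {a..b}" using mono strict_mono_on_imp_inj_on by blast
  have img: "\<theta> ` {a..b} = {\<theta> a..\<theta> b}"
  proof
    show "\<theta> ` {a..b} \<subseteq> {\<theta> a..\<theta> b}"
      using mono ab by (auto intro!: strict_mono_on_leD[OF mono])
    show "{\<theta> a..\<theta> b} \<subseteq> \<theta> ` {a..b}"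
    proof
      fix t assume "t \<in> {\<theta> a..\<theta> b}"
      then obtain u where "a \<le> u" "u \<le> b" "\<theta> u = t" using IVT'[of \<theta> a t b] ab cont by auto
      then show "t \<in> \<theta> ` {a..b}" by auto
    qed
  qed
  define g where "g = the_inv_into {a..b} \<theta>"
  have g1: "g (\<theta> u) = u" if "u \<in> {a..b}" for u using that inj by (simp add: g_def the_inv_into_f_f)
  have g2: "\<theta> (g t) = t" "g t \<in> {a..b}" if "t \<in> {\<theta> a..\<theta> b}" for t
    using that inj unfolding g_def img[symmetric]
    by (auto simp: f_the_inv_into_f the_inv_into_f_f)
  have c: "continuous_on {\<theta> a..\<theta> b} g"
    unfolding img[symmetric] by (rule continuous_on_inv[OF cont]) (auto simp: g1)
  have "strict_mono_on {\<theta> a..\<theta> b} g"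
  proof (rule strict_mono_onI)
    fix r s assume rs: "r \<in> {\<theta> a..\<theta> b}" "s \<in> {\<theta> a..\<theta> b}" "r < s"
    show "g r < g s"
    proof (rule ccontr)
      assume "\<not> g r < g s"
      then have "\<theta> (g s) \<le> \<theta> (g r)"
        using strict_mono_on_leD[OF mono, of "g s" "g r"] g2(2)[OF rs(1)] g2(2)[OF rs(2)] by auto
      then show False using g2 rs by auto
    qed
  qed
  then show ?thesis using that c g1 g2 by blast
qed

text \<open>Along a level curve of \<open>K(q) + F(p)\<close>, any linear functional of \<open>(p, q)\<close> whose derivative along
  the Hamiltonian field does not vanish is an admissible parameter.\<close>

lemma level_curve_derivative:
  fixes p q K F :: "real \<Rightarrow> real"
  assumes cp: "isCont p u" and cq: "isCont q u"
    and ev: "\<forall>\<^sub>F v in at u. K (q v) + F (p v) = c \<and> a * p v + b * q v = v"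
    and eu: "K (q u) + F (p u) = c" "a * p u + b * q u = u"
    and dK: "(K has_real_derivative k) (at (q u))" and dF: "(F has_real_derivative f) (at (p u))"
    and nz: "a * k - b * f \<noteq> 0"
  shows "(p has_real_derivative k / (a * k - b * f)) (at u)"
    and "(q has_real_derivative - f / (a * k - b * f)) (at u)"
proof -
  \<comment> \<open>Caratheodory's form of the derivative factors the increments of K and F exactly.
    Conservation and the parameter equation then form a linear system for the increments of p and q
    with determinant \<open>D\<close>; \<open>rel\<close> is Cramer's rule. Differentiability of p
    and q is thereby an outcome, with continuity as the only input about them.\<close>
  obtain \<phi> where \<phi>: "\<And>z. K z - K (q u) = \<phi> z * (z - q u)" "isCont \<phi> (q u)" "\<phi> (q u) = k"
    using dK unfolding CARAT_DERIV by blast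
  obtain \<psi> where \<psi>: "\<And>z. F z - F (p u) = \<psi> z * (z - p u)" "isCont \<psi> (p u)" "\<psi> (p u) = f"
    using dF unfolding CARAT_DERIV by blast
  define D where "D v = a * \<phi> (q v) - b * \<psi> (p v)" for v
  have c1: "isCont (\<lambda>v. \<phi> (q v)) u" using isCont_o2[OF cq \<phi>(2)] .
  have c2: "isCont (\<lambda>v. \<psi> (p v)) u" using isCont_o2[OF cp \<psi>(2)] .
  have cD: "isCont D u" unfolding D_def by (intro continuous_intros c1 c2)
  have Du: "D u = a * k - b * f" by (simp add: D_def \<phi> \<psi>)
  have "(D \<longlongrightarrow> D u) (at u)" using cD by (simp add: isCont_def)
  then have evD: "\<forall>\<^sub>F v in at u. D v \<noteq> 0"
    using nz Du by (intro tendsto_imp_eventually_ne) auto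
  have rel: "(p v - p u) * D v = \<phi> (q v) * (v - u) \<and> (q v - q u) * D v = - \<psi> (p v) * (v - u)"
    if "K (q v) + F (p v) = c \<and> a * p v + b * q v = v" for v
  proof -
    have 1: "\<phi> (q v) * (q v - q u) + \<psi> (p v) * (p v - p u) = 0"
      using \<phi>(1)[of "q v"] \<psi>(1)[of "p v"] that eu by linarith
    have 2: "a * (p v - p u) + b * (q v - q u) = v - u"
      using that eu by (simp add: algebra_simps)
    have "(p v - p u) * D v = \<phi> (q v) * (a * (p v - p u) + b * (q v - q u))
         - b * (\<phi> (q v) * (q v - q u) + \<psi> (p v) * (p v - p u))"
      unfolding D_def by (simp add: algebra_simps)
    moreover have "(q v - q u) * D v = - \<psi> (p v) * (a * (p v - p u) + b * (q v - q u))
         + a * (\<phi> (q v) * (q v - q u) + \<psi> (p v) * (p v - p u))"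
      unfolding D_def by (simp add: algebra_simps)
    ultimately show ?thesis unfolding 1 2 by simp
  qed
  have ne: "\<forall>\<^sub>F v in at u. v \<noteq> u" by (simp add: eventually_at_filter)
  have tl1: "((\<lambda>v. \<phi> (q v) / D v) \<longlongrightarrow> k / (a * k - b * f)) (at u)"
    using c1 cD nz Du by (auto intro!: tendsto_eq_intros simp: isCont_def \<phi>)
  have tl2: "((\<lambda>v. - \<psi> (p v) / D v) \<longlongrightarrow> - f / (a * k - b * f)) (at u)"
    using c2 cD nz Du by (auto intro!: tendsto_eq_intros simp: isCont_def \<psi>)
  show "(p has_real_derivative k / (a * k - b * f)) (at u)"
    unfolding has_field_derivative_iff
  proof (rule Lim_transform_eventually[OF tl1])
    show "\<forall>\<^sub>F v in at u. \<phi> (q v) / D v = (p v - p u) / (v - u)"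
      using ev evD ne by eventually_elim (use rel in \<open>auto simp: field_simps\<close>)
  qed
  show "(q has_real_derivative - f / (a * k - b * f)) (at u)"
    unfolding has_field_derivative_iff
  proof (rule Lim_transform_eventually[OF tl2])
    show "\<forall>\<^sub>F v in at u. - \<psi> (p v) / D v = (q v - q u) / (v - u)"
      using ev evD ne by eventually_elim (use rel in \<open>auto simp: field_simps\<close>)
  qed
qed

text \<open>Along a solution the parameter \<open>u = a * p + b * q\<close> grows at the rate
  \<open>a * k q - b * f p\<close>. So \<open>\<theta>\<close> is the clock of the curve, and its
  inverse \<open>\<upsilon>\<close>, inserted into the curve, gives the solution. The rate is
  controlled in the interior only: at an end it may vanish, as it does where a curve runs into an
  equilibrium.\<close>

lemma smooth_sol_along_curve:
  fixes p q \<theta> K F k f :: "real \<Rightarrow> real"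
  assumes uu: "u1 \<le> u2"
    and cp: "continuous_on {u1..u2} p" and cq: "continuous_on {u1..u2} q"
    and c\<theta>: "continuous_on {u1..u2} \<theta>"
    and lev: "\<And>u. u \<in> {u1..u2} \<Longrightarrow> K (q u) + F (p u) = c"
    and par: "\<And>u. u \<in> {u1..u2} \<Longrightarrow> a * p u + b * q u = u"
    and dK: "\<And>y. (K has_real_derivative k y) (at y)" and dF: "\<And>x. (F has_real_derivative f x) (at x)"
    and pos: "\<And>u. u \<in> {u1<..<u2} \<Longrightarrow> 0 < a * k (q u) - b * f (p u)"
    and d\<theta>: "\<And>u. u \<in> {u1<..<u2} \<Longrightarrow> (\<theta> has_real_derivative 1 / (a * k (q u) - b * f (p u))) (at u)"
    and T: "T = \<theta> u2 - \<theta> u1"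
  obtains \<upsilon> where "continuous_on {0..T} \<upsilon>" "\<upsilon> 0 = u1" "\<upsilon> T = u2" "strict_mono_on {0..T} \<upsilon>"
    "\<upsilon> ` {0..T} \<subseteq> {u1..u2}" "\<And>\<tau>. \<tau> \<in> {0<..<T} \<Longrightarrow> \<upsilon> \<tau> \<in> {u1<..<u2}"
    "smooth_sol k f T (\<lambda>\<tau>. p (\<upsilon> \<tau>)) (\<lambda>\<tau>. q (\<upsilon> \<tau>))"
proof -
  have mono: "strict_mono_on {u1..u2} \<theta>"
  proof (rule strict_mono_onI)
    fix r s assume rs: "r \<in> {u1..u2}" "s \<in> {u1..u2}" "r < s"
    show "\<theta> r < \<theta> s"
    proof (rule DERIV_pos_imp_increasing_open[OF rs(3)])
      fix x assume "r < x" "x < s"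
      then have "x \<in> {u1<..<u2}" using rs by auto
      then show "\<exists>y. (\<theta> has_real_derivative y) (at x) \<and> 0 < y"
        using d\<theta> pos by (meson divide_pos_pos zero_less_one)
    next
      show "continuous_on {r..s} \<theta>" using rs by (intro continuous_on_subset[OF c\<theta>]) auto
    qed
  qed
  obtain g where g: "continuous_on {\<theta> u1..\<theta> u2} g" "g ` {\<theta> u1..\<theta> u2} \<subseteq> {u1..u2}"
    "\<And>t. t \<in> {\<theta> u1..\<theta> u2} \<Longrightarrow> \<theta> (g t) = t" "\<And>u. u \<in> {u1..u2} \<Longrightarrow> g (\<theta> u) = u"
    "strict_mono_on {\<theta> u1..\<theta> u2} g"
    using strict_mono_inverse_on_interval[OF uu c\<theta> mono] by metis
  have T0: "0 \<le> T" using T strict_mono_on_leD[OF mono, of u1 u2] uu by simp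
  define \<upsilon> where "\<upsilon> \<tau> = g (\<theta> u1 + \<tau>)" for \<tau>
  have rng: "\<theta> u1 + \<tau> \<in> {\<theta> u1..\<theta> u2}" if "\<tau> \<in> {0..T}" for \<tau> using that T by auto
  have c\<upsilon>: "continuous_on {0..T} \<upsilon>"
    unfolding \<upsilon>_def by (rule continuous_on_compose2[OF g(1)]) (use T in \<open>auto intro!: continuous_intros\<close>)
  have m\<upsilon>: "strict_mono_on {0..T} \<upsilon>"
    unfolding \<upsilon>_def by (rule strict_mono_onI) (use rng in \<open>auto intro!: strict_mono_onD[OF g(5)]\<close>)
  have \<upsilon>0: "\<upsilon> 0 = u1" "\<upsilon> T = u2" using g(4) uu by (auto simp: \<upsilon>_def T)
  have im: "\<upsilon> ` {0..T} \<subseteq> {u1..u2}" using g(2) rng by (auto simp: \<upsilon>_def)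
  have int: "\<upsilon> \<tau> \<in> {u1<..<u2}" if "\<tau> \<in> {0<..<T}" for \<tau>
    using strict_mono_onD[OF m\<upsilon>, of 0 \<tau>] strict_mono_onD[OF m\<upsilon>, of \<tau> T] that \<upsilon>0 by auto
  have d\<upsilon>: "(\<upsilon> has_real_derivative (a * k (q (\<upsilon> \<tau>)) - b * f (p (\<upsilon> \<tau>)))) (at \<tau>)" if \<tau>: "\<tau> \<in> {0<..<T}" for \<tau>
  proof -
    have d: "((\<lambda>u. \<theta> u - \<theta> u1) has_real_derivative 1 / (a * k (q (\<upsilon> \<tau>)) - b * f (p (\<upsilon> \<tau>)))) (at (\<upsilon> \<tau>))"
      using d\<theta>[OF int[OF \<tau>]] by (auto intro!: derivative_eq_intros)
    have "(\<upsilon> has_real_derivative inverse (1 / (a * k (q (\<upsilon> \<tau>)) - b * f (p (\<upsilon> \<tau>))))) (at \<tau>)"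
    proof (rule DERIV_inverse_function[where f = "\<lambda>u. \<theta> u - \<theta> u1" and g = \<upsilon> and x = \<tau> and a = 0 and b = T, OF d])
      show "1 / (a * k (q (\<upsilon> \<tau>)) - b * f (p (\<upsilon> \<tau>))) \<noteq> 0" using pos[OF int[OF \<tau>]] by simp
      show "0 < \<tau>" "\<tau> < T" using \<tau> by auto
      show "\<theta> (\<upsilon> y) - \<theta> u1 = y" if "0 < y" "y < T" for y
        using g(3) rng[of y] that by (auto simp: \<upsilon>_def)
      show "isCont \<upsilon> \<tau>" using continuous_on_interior_isCont[OF c\<upsilon> \<tau>] .
    qed
    then show ?thesis by simp
  qed
  have "smooth_sol k f T (\<lambda>\<tau>. p (\<upsilon> \<tau>)) (\<lambda>\<tau>. q (\<upsilon> \<tau>))"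
    unfolding smooth_sol_def
  proof (intro conjI ballI)
    show "0 \<le> T" by (rule T0)
    show "continuous_on {0..T} (\<lambda>\<tau>. p (\<upsilon> \<tau>))" "continuous_on {0..T} (\<lambda>\<tau>. q (\<upsilon> \<tau>))"
      using continuous_on_compose2[OF cp c\<upsilon> im] continuous_on_compose2[OF cq c\<upsilon> im] by auto
    fix \<tau> assume \<tau>: "\<tau> \<in> {0<..<T}"
    note u = int[OF \<tau>]
    let ?w = "a * k (q (\<upsilon> \<tau>)) - b * f (p (\<upsilon> \<tau>))"
    have ev: "\<forall>\<^sub>F v in at (\<upsilon> \<tau>). K (q v) + F (p v) = c \<and> a * p v + b * q v = v"
    proof -
      have "\<forall>\<^sub>F v in at (\<upsilon> \<tau>). v \<in> {u1<..<u2}"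
        using u by (intro eventually_at_in_open') auto
      then show ?thesis by eventually_elim (use lev par in auto)
    qed
    note L = level_curve_derivative[OF continuous_on_interior_isCont[OF cp u]
        continuous_on_interior_isCont[OF cq u] ev _ _ dK dF]
    have "((\<lambda>\<tau>. p (\<upsilon> \<tau>)) has_real_derivative k (q (\<upsilon> \<tau>)) / ?w * ?w) (at \<tau>)"
      by (rule DERIV_chain2[OF L(1) d\<upsilon>[OF \<tau>]]) (use u lev par pos[OF u] in auto)
    then show "((\<lambda>\<tau>. p (\<upsilon> \<tau>)) has_real_derivative k (q (\<upsilon> \<tau>))) (at \<tau>)"
      using pos[OF u] by simp
    have "((\<lambda>\<tau>. q (\<upsilon> \<tau>)) has_real_derivative - f (p (\<upsilon> \<tau>)) / ?w * ?w) (at \<tau>)"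
      by (rule DERIV_chain2[OF L(2) d\<upsilon>[OF \<tau>]]) (use u lev par pos[OF u] in auto)
    then show "((\<lambda>\<tau>. q (\<upsilon> \<tau>)) has_real_derivative - f (p (\<upsilon> \<tau>))) (at \<tau>)"
      using pos[OF u] by simp
  qed
  then show ?thesis using that c\<upsilon> m\<upsilon> \<upsilon>0 im int by blast
qed

text \<open>No integrability of \<open>\<rho>\<close> is assumed: it may be singular at the end points.\<close>

lemma smooth_sol_time:
  assumes sol: "smooth_sol k f T x y"
    and pos: "\<And>\<tau>. \<tau> \<in> {0<..<T} \<Longrightarrow> 0 < k (y \<tau>)" and cont_k: "continuous_on UNIV k"
    and \<rho>: "\<And>\<tau>. \<tau> \<in> {0<..<T} \<Longrightarrow> \<rho> (x \<tau>) = 1 / k (y \<tau>)"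
  shows "(LBINT \<xi>=x 0..x T. \<rho> \<xi>) = T"
proof (cases "T = 0")
  case True then show ?thesis by (simp add: interval_lebesgue_integral_def set_lebesgue_integral_def)
next
  case False
  then have T: "0 < T" using sol by (simp add: smooth_sol_def)
  have cx: "continuous_on {0..T} x" and cy: "continuous_on {0..T} y"
    and dx: "\<And>\<tau>. \<tau> \<in> {0<..<T} \<Longrightarrow> (x has_real_derivative k (y \<tau>)) (at \<tau>)"
    using sol by (auto simp: smooth_sol_def)
  have mono: "strict_mono_on {0..T} x"
  proof (rule strict_mono_onI)
    fix r s assume rs: "r \<in> {0..T}" "s \<in> {0..T}" "r < s"
    show "x r < x s"
    proof (rule DERIV_pos_imp_increasing_open[OF rs(3)])
      fix z assume "r < z" "z < s"
      then have "z \<in> {0<..<T}" using rs by auto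
      then show "\<exists>y. (x has_real_derivative y) (at z) \<and> 0 < y" using dx pos by blast
    next
      show "continuous_on {r..s} x" using rs by (intro continuous_on_subset[OF cx]) auto
    qed
  qed
  obtain g where g: "continuous_on {x 0..x T} g" "g ` {x 0..x T} \<subseteq> {0..T}"
    "\<And>t. t \<in> {x 0..x T} \<Longrightarrow> x (g t) = t" "\<And>u. u \<in> {0..T} \<Longrightarrow> g (x u) = u"
    "strict_mono_on {x 0..x T} g"
    using strict_mono_inverse_on_interval[OF _ cx mono] T by (metis less_imp_le)
  have iy: "isCont y \<tau>" and ix: "isCont x \<tau>" if "\<tau> \<in> {0<..<T}" for \<tau>
    using continuous_on_interior_isCont[OF cy that] continuous_on_interior_isCont[OF cx that] by auto
  have ik: "isCont (\<lambda>\<tau>. k (y \<tau>)) \<tau>" if "\<tau> \<in> {0<..<T}" for \<tau>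
    by (rule isCont_o2[OF iy[OF that]]) (use cont_k continuous_on_eq_continuous_at in blast)
  have xint: "x \<tau> \<in> {x 0<..<x T}" if "\<tau> \<in> {0<..<T}" for \<tau>
    using strict_mono_onD[OF mono, of 0 \<tau>] strict_mono_onD[OF mono, of \<tau> T] that by auto
  have gint: "g \<xi> \<in> {0<..<T}" if "\<xi> \<in> {x 0<..<x T}" for \<xi>
    using strict_mono_onD[OF g(5), of "x 0" \<xi>] strict_mono_onD[OF g(5), of \<xi> "x T"] that
      g(4)[of 0] g(4)[of T] T by auto
  \<comment> \<open>\<open>\<rho>\<close> is prescribed only along the orbit. Its continuity is read
    off from \<open>1 / k (y (g \<xi>))\<close>, with which it agrees near \<open>x \<tau>\<close>,
    \<open>g\<close> being the inverse of x.\<close>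
  have i\<rho>: "isCont \<rho> (x \<tau>)" if \<tau>: "\<tau> \<in> {0<..<T}" for \<tau>
  proof -
    have ig: "isCont g (x \<tau>)" using continuous_on_interior_isCont[OF g(1) xint[OF \<tau>]] .
    have "g (x \<tau>) = \<tau>" using g(4) \<tau> by auto
    then have "isCont (\<lambda>\<xi>. k (y (g \<xi>))) (x \<tau>)" using isCont_o2[OF ig, of "\<lambda>\<tau>. k (y \<tau>)"] ik[OF \<tau>] by simp
    then have 1: "isCont (\<lambda>\<xi>. 1 / k (y (g \<xi>))) (x \<tau>)"
      using pos[OF \<tau>] \<open>g (x \<tau>) = \<tau>\<close> by (intro continuous_intros) auto
    have "\<forall>\<^sub>F \<xi> in nhds (x \<tau>). \<xi> \<in> {x 0<..<x T}"
      using xint[OF \<tau>] by (intro eventually_nhds_in_open) auto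
    then have "\<forall>\<^sub>F \<xi> in nhds (x \<tau>). \<rho> \<xi> = 1 / k (y (g \<xi>))"
      by eventually_elim (use \<rho> gint g(3) in force)
    then show ?thesis using 1 isCont_cong by fastforce
  qed
  have lim0: "((ereal \<circ> x \<circ> real_of_ereal) \<longlongrightarrow> ereal (x 0)) (at_right (ereal 0))"
  proof -
    have "(x \<longlongrightarrow> x 0) (at_right 0)"
      using cx T by (metis at_within_Icc_at_right atLeastAtMost_iff continuous_on_def less_imp_le order_refl)
    then show ?thesis unfolding ereal_tendsto_simps by (simp add: o_def)
  qed
  have limT: "((ereal \<circ> x \<circ> real_of_ereal) \<longlongrightarrow> ereal (x T)) (at_left (ereal T))"
  proof -
    have "(x \<longlongrightarrow> x T) (at_left T)"
      using cx T by (metis at_within_Icc_at_left atLeastAtMost_iff continuous_on_def less_imp_le order_refl)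
    then show ?thesis unfolding ereal_tendsto_simps by (simp add: o_def)
  qed
  \<comment> \<open>The speed, set to 0 outside the open time interval: it is then nonnegative at
    the end points too, as the substitution rule demands, and the substituted integrand is the
    constant 1 inside.\<close>
  define w where "w \<tau> = (if \<tau> \<in> {0<..<T} then k (y \<tau>) else 0)" for \<tau>
  have one: "\<rho> (x \<tau>) * w \<tau> = 1" if "\<tau> \<in> {0<..<T}" for \<tau>
    using that \<rho> pos[OF that] by (auto simp: w_def)
  have "(LBINT \<xi>=ereal (x 0)..ereal (x T). \<rho> \<xi>) = (LBINT \<tau>=ereal 0..ereal T. \<rho> (x \<tau>) * w \<tau>)"
  proof (rule interval_integral_substitution_nonneg(2))
    show "ereal 0 < ereal T" using T by simp
    fix \<tau> assume a: "ereal 0 < ereal \<tau>" "ereal \<tau> < ereal T"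
    then have \<tau>: "\<tau> \<in> {0<..<T}" by auto
    show "(x has_real_derivative w \<tau>) (at \<tau>)" using dx[OF \<tau>] \<tau> by (simp add: w_def)
    show "isCont \<rho> (x \<tau>)" using i\<rho>[OF \<tau>] .
    have "\<forall>\<^sub>F \<xi> in nhds \<tau>. \<xi> \<in> {0<..<T}"
      using \<tau> by (intro eventually_nhds_in_open) auto
    then have "\<forall>\<^sub>F \<xi> in nhds \<tau>. w \<xi> = k (y \<xi>)"
      by eventually_elim (auto simp: w_def)
    then show "isCont w \<tau>" using ik[OF \<tau>] isCont_cong by fastforce
    show "0 \<le> \<rho> (x \<tau>)" using \<rho>[OF \<tau>] pos[OF \<tau>] by simp
  next
    fix \<tau> show "0 \<le> w \<tau>" using pos by (auto simp: w_def less_imp_le)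
  next
    have "set_integrable lborel (einterval (ereal 0) (ereal T)) (\<lambda>_. 1::real)"
      using T by (auto simp: set_integrable_def intro!: integrable_real_indicator)
    then show "set_integrable lborel (einterval (ereal 0) (ereal T)) (\<lambda>\<tau>. \<rho> (x \<tau>) * w \<tau>)"
      by (rule set_integrable_cong[THEN iffD1, rotated -1]) (use one in auto)
  qed (use lim0 limT in auto)
  also have "\<dots> = (LBINT \<tau>=ereal 0..ereal T. 1)"
    by (rule interval_integral_cong) (use T one in \<open>auto simp: einterval_iff\<close>)
  also have "\<dots> = T" using T by (simp add: interval_integral_const)
  finally show ?thesis by simp
qed

section \<open>Stretching in a rectangle\<close>

lemma integral_affine_unit_interval:
  fixes R :: "real \<Rightarrow> real"
  assumes "lo \<le> hi" "continuous_on {lo..hi} R"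
  shows "integral {lo..hi} R = (hi - lo) * integral {0..1} (\<lambda>r. R (lo + r * (hi - lo)))"
proof (cases "lo = hi")
  case True then show ?thesis by simp
next
  case False
  then have "lo < hi" using assms by simp
  have "(R has_integral integral {lo..hi} R) (cbox lo hi)"
    using integrable_continuous_real[OF assms(2)] by (simp add: has_integral_integral)
  from has_integral_affinity'[OF this, of "hi - lo" lo] \<open>lo < hi\<close>
  have "((\<lambda>r. R ((hi - lo) * r + lo)) has_integral (integral {lo..hi} R / (hi - lo))) {0..1}"
    by (simp add: divide_inverse mult.commute)
  then have "integral {0..1} (\<lambda>r. R (lo + r * (hi - lo))) = integral {lo..hi} R / (hi - lo)"
    by (simp add: integral_unique algebra_simps)
  then show ?thesis using \<open>lo < hi\<close> by simp
qed

text \<open>Rescaling to \<open>[0, 1]\<close> moves the variable limits into the integrand, so that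
  continuous dependence on a parameter over a fixed interval applies.\<close>

lemma continuous_on_integral_moving_interval:
  fixes R :: "'a::metric_space \<Rightarrow> real \<Rightarrow> real"
  assumes le: "\<And>s. s \<in> S \<Longrightarrow> lo s \<le> hi s"
    and clo: "continuous_on S lo" and chi: "continuous_on S hi"
    and cR: "\<And>s. s \<in> S \<Longrightarrow> continuous_on {lo s..hi s} (R s)"
    and c: "continuous_on (S \<times> {0..1}) (\<lambda>(s, r). R s (lo s + r * (hi s - lo s)))"
  shows "continuous_on S (\<lambda>s. integral {lo s..hi s} (R s))"
proof -
  have "continuous_on S (\<lambda>s. integral (cbox 0 1) (\<lambda>r. R s (lo s + r * (hi s - lo s))))"
    by (rule integral_continuous_on_param) (use c in simp)
  then have "continuous_on S (\<lambda>s. (hi s - lo s) * integral {0..1} (\<lambda>r. R s (lo s + r * (hi s - lo s))))"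
    using clo chi by (intro continuous_intros) auto
  then show ?thesis
    by (rule continuous_on_eq) (use integral_affine_unit_interval[OF le cR] in simp)
qed

text \<open>\<open>a'\<close> is the last point with \<open>\<phi> \<ge> 0\<close>, and
  \<open>b'\<close> the first point after it with \<open>\<psi> \<le> 0\<close>; since
  \<open>\<phi> < \<psi>\<close>, the second comes strictly later. In \<open>stretching\<close> the
  two functions are the travel times to the two ends of the target minus the prescribed time, and
  the band is where that time is attained strictly in between.\<close>

lemma crossing_band:
  fixes \<phi> \<psi> :: "real \<Rightarrow> real"
  assumes c\<phi>: "continuous_on {a..b} \<phi>" and c\<psi>: "continuous_on {a..b} \<psi>" and ab: "a \<le> b"
    and less: "\<And>s. s \<in> {a..b} \<Longrightarrow> \<phi> s < \<psi> s" and \<phi>a: "0 \<le> \<phi> a" and \<psi>b: "\<psi> b \<le> 0"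
  obtains a' b' where "a \<le> a'" "a' < b'" "b' \<le> b" "\<phi> a' = 0" "\<psi> b' = 0"
    "\<And>s. s \<in> {a'<..<b'} \<Longrightarrow> \<phi> s < 0 \<and> 0 < \<psi> s"
proof -
  define A where "A = {s \<in> {a..b}. 0 \<le> \<phi> s}"
  have A: "compact A" "A \<noteq> {}" "A \<subseteq> {a..b}"
  proof -
    have "closed A" unfolding A_def by (intro continuous_on_closed_Collect_le c\<phi> continuous_intros)
    moreover have "A = {a..b} \<inter> A" by (auto simp: A_def)
    ultimately show "compact A" by (metis compact_Int_closed[OF compact_Icc])
    show "A \<noteq> {}" "A \<subseteq> {a..b}" using ab \<phi>a by (auto simp: A_def)
  qed
  obtain a' where a': "a' \<in> A" "\<And>s. s \<in> A \<Longrightarrow> s \<le> a'" using compact_attains_sup[OF A(1,2)] by blast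
  have neg: "\<phi> s < 0" if "s \<in> {a'<..b}" for s
    using a'(2)[of s] a'(1) A(3) that by (force simp: A_def)
  have a'b: "a' < b" using less[of b] \<psi>b a' A(3) ab by (force simp: A_def)
  have \<phi>a': "\<phi> a' = 0"
  proof -
    have "0 \<le> \<phi> a'" using a' by (simp add: A_def)
    moreover have "\<not> 0 < \<phi> a'"
    proof
      assume p: "0 < \<phi> a'"
      have "continuous_on {a'..b} \<phi>" using a' A(3) by (intro continuous_on_subset[OF c\<phi>]) auto
      moreover have "\<phi> b < 0" using neg a'b by auto
      ultimately obtain s where "a' \<le> s" "s \<le> b" "\<phi> s = 0"
        using IVT2'[of \<phi> b 0 a'] p a'b by force
      then show False using neg[of s] p by (cases "s = a'") auto
    qed
    ultimately show ?thesis by simp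
  qed
  define B where "B = {s \<in> {a'..b}. \<psi> s \<le> 0}"
  have c\<psi>': "continuous_on {a'..b} \<psi>" using a' A(3) by (intro continuous_on_subset[OF c\<psi>]) auto
  have B: "compact B" "B \<noteq> {}"
  proof -
    have "closed B" unfolding B_def by (intro continuous_on_closed_Collect_le c\<psi>' continuous_intros)
    moreover have "B = {a'..b} \<inter> B" by (auto simp: B_def)
    ultimately show "compact B" by (metis compact_Int_closed[OF compact_Icc])
    show "B \<noteq> {}" using a'b \<psi>b by (auto simp: B_def)
  qed
  obtain b' where b': "b' \<in> B" "\<And>s. s \<in> B \<Longrightarrow> b' \<le> s" using compact_attains_inf[OF B] by blast
  have pos: "0 < \<psi> s" if "s \<in> {a'..<b'}" for s
    using b'(2)[of s] b'(1) that by (force simp: B_def)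
  have \<psi>a': "0 < \<psi> a'" using less[of a'] \<phi>a' a' A(3) by auto
  have a'b': "a' < b'" using \<psi>a' b' by (force simp: B_def)
  have \<psi>b': "\<psi> b' = 0"
  proof -
    have "\<psi> b' \<le> 0" using b' by (simp add: B_def)
    moreover have "\<not> \<psi> b' < 0"
    proof
      assume p: "\<psi> b' < 0"
      have "continuous_on {a'..b'} \<psi>" using b' by (intro continuous_on_subset[OF c\<psi>']) (auto simp: B_def)
      then obtain s where "a' \<le> s" "s \<le> b'" "\<psi> s = 0"
        using IVT2'[of \<psi> b' 0 a'] p a'b' \<psi>a' by force
      then show False using pos[of s] p by (cases "s = b'") auto
    qed
    ultimately show ?thesis by simp
  qed
  show ?thesis
  proof (rule that[of a' b'])
    show "a \<le> a'" "b' \<le> b" using a' A(3) b' by (auto simp: B_def)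
    show "\<phi> s < 0 \<and> 0 < \<psi> s" if "s \<in> {a'<..<b'}" for s
      using neg[of s] pos[of s] that b' by (auto simp: B_def)
  qed (use a'b' \<phi>a' \<psi>b' in auto)
qed

text \<open>The band of \<open>lo - E\<close> and \<open>hi - E\<close>: from the last passage
  through \<open>lo\<close> to the first passage through \<open>hi\<close> after it.\<close>

lemma crossing_between_levels:
  fixes E :: "real \<Rightarrow> real"
  assumes cE: "continuous_on {a..b} E" and "a \<le> b" and "E a \<le> lo" "lo < hi" "hi \<le> E b"
  obtains a' b' where "a \<le> a'" "a' < b'" "b' \<le> b" "E a' = lo" "E b' = hi"
    "\<And>s. s \<in> {a'<..<b'} \<Longrightarrow> lo < E s \<and> E s < hi"
proof (rule crossing_band[of a b "\<lambda>s. lo - E s" "\<lambda>s. hi - E s"])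
  fix a' b' assume *: "a \<le> a'" "a' < b'" "b' \<le> b" "lo - E a' = 0" "hi - E b' = 0"
    "\<And>s. s \<in> {a'<..<b'} \<Longrightarrow> lo - E s < 0 \<and> 0 < hi - E s"
  show thesis by (rule that[of a' b']) (use * in force)+
qed (use assms in \<open>auto intro!: continuous_intros\<close>)

text \<open>Monotonicity in v makes the level set \<open>f s v = \<tau>\<close> over a suitable band
  of s the graph of a function \<open>\<nu>0\<close>, which starts at \<open>v = 0\<close> and ends
  at \<open>v = 1\<close>. So the continuum that a topological crossing argument would produce is
  here an honest path, and paths can be handed on from one interval to the next.\<close>

lemma stretching:
  fixes f :: "real \<Rightarrow> real \<Rightarrow> real"
  assumes ab: "a \<le> b" and cf: "continuous_on ({a..b} \<times> {0..1}) (\<lambda>(s, v). f s v)"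
    and mono: "\<And>s. s \<in> {a..b} \<Longrightarrow> strict_mono_on {0..1} (f s)"
    and fa: "\<tau> \<le> f a 0" and fb: "f b 1 \<le> \<tau>"
  obtains \<omega> \<nu> :: "real \<Rightarrow> real" where "continuous_on {0..1} \<omega>" "continuous_on {0..1} \<nu>"
    "\<omega> ` {0..1} \<subseteq> {a..b}" "\<nu> ` {0..1} \<subseteq> {0..1}" "\<nu> 0 = 0" "\<nu> 1 = 1"
    "\<And>r. r \<in> {0..1} \<Longrightarrow> f (\<omega> r) (\<nu> r) = \<tau>"
proof -
  have c0: "continuous_on {a..b} (\<lambda>s. f s v - \<tau>)" if "v \<in> {0..1}" for v
  proof -
    have "continuous_on {a..b} (\<lambda>s. case (s, v) of (s, v) \<Rightarrow> f s v)"
      by (rule continuous_on_compose2[OF cf]) (use that in \<open>auto intro!: continuous_intros\<close>)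
    then show ?thesis by (auto intro!: continuous_intros)
  qed
  obtain a' b' where ab': "a \<le> a'" "a' < b'" "b' \<le> b" "f a' 0 - \<tau> = 0" "f b' 1 - \<tau> = 0"
    and band: "\<And>s. s \<in> {a'<..<b'} \<Longrightarrow> f s 0 - \<tau> < 0 \<and> 0 < f s 1 - \<tau>"
  proof (rule crossing_band[of a b "\<lambda>s. f s 0 - \<tau>" "\<lambda>s. f s 1 - \<tau>"])
    show "f s 0 - \<tau> < f s 1 - \<tau>" if "s \<in> {a..b}" for s
      using strict_mono_onD[OF mono[OF that], of 0 1] by simp
  qed (use c0 fa fb ab in auto)
  have band': "f s 0 \<le> \<tau>" "\<tau> \<le> f s 1" if "s \<in> {a'..b'}" for s
  proof -
    have "f s 0 < f s 1" using strict_mono_onD[OF mono, of s 0 1] that ab' by auto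
    moreover have "s \<in> {a'<..<b'} \<or> s = a' \<or> s = b'" using that by auto
    ultimately have "f s 0 \<le> \<tau> \<and> \<tau> \<le> f s 1"
      using band[of s] ab'(4,5) by (elim disjE) simp_all
    then show "f s 0 \<le> \<tau>" "\<tau> \<le> f s 1" by auto
  qed
  \<comment> \<open>The graph of the root is compact and projects injectively onto the s-axis; the
    inverse of this projection is therefore continuous, and with it \<open>\<nu>0\<close>.\<close>
  define Z where "Z = {z \<in> {a'..b'} \<times> {0..1}. (\<lambda>(s, v). f s v) z = \<tau>}"
  have cf': "continuous_on ({a'..b'} \<times> {0..1}) (\<lambda>(s, v). f s v)"
    using ab' by (intro continuous_on_subset[OF cf]) auto
  have "closed Z" unfolding Z_def
    by (intro continuous_closed_preimage_constant cf' closed_Times) auto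
  moreover have "Z = ({a'..b'} \<times> {0..1}) \<inter> Z" by (auto simp: Z_def)
  ultimately have cZ: "compact Z"
    using compact_Int_closed[OF compact_Times[OF compact_Icc compact_Icc], of Z a' b' 0 1] by simp
  have root: "\<exists>!v. v \<in> {0..1} \<and> f s v = \<tau>" if s: "s \<in> {a'..b'}" for s
  proof -
    have "continuous_on {0..1} (\<lambda>v. case (s, v) of (s, v) \<Rightarrow> f s v)"
      by (rule continuous_on_compose2[OF cf]) (use s ab' in \<open>auto intro!: continuous_intros\<close>)
    then have "\<exists>v. 0 \<le> v \<and> v \<le> 1 \<and> f s v = \<tau>"
      using IVT'[of "f s" 0 \<tau> 1] band'[OF s] by simp
    moreover have "inj_on (f s) {0..1}" using mono[of s] s ab' strict_mono_on_imp_inj_on by auto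
    ultimately show ?thesis by (metis atLeastAtMost_iff inj_onD)
  qed
  define \<nu>0 where "\<nu>0 s = (THE v. v \<in> {0..1} \<and> f s v = \<tau>)" for s
  have \<nu>0: "\<nu>0 s \<in> {0..1}" "f s (\<nu>0 s) = \<tau>" if "s \<in> {a'..b'}" for s
    using theI'[OF root[OF that]] by (auto simp: \<nu>0_def)
  have \<nu>0u: "\<nu>0 s = v" if "s \<in> {a'..b'}" "v \<in> {0..1}" "f s v = \<tau>" for s v
    using root[OF that(1)] \<nu>0[OF that(1)] that by blast
  have im: "fst ` Z = {a'..b'}"
  proof
    show "fst ` Z \<subseteq> {a'..b'}" by (auto simp: Z_def)
    show "{a'..b'} \<subseteq> fst ` Z"
    proof
      fix s assume s: "s \<in> {a'..b'}"
      then have "(s, \<nu>0 s) \<in> Z" using \<nu>0[OF s] by (simp add: Z_def)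
      then show "s \<in> fst ` Z" by (rule rev_image_eqI) simp
    qed
  qed
  have "continuous_on {a'..b'} (\<lambda>s. (s, \<nu>0 s))"
    unfolding im[symmetric] by (rule continuous_on_inv[OF _ cZ]) (auto simp: Z_def \<nu>0u intro!: continuous_intros)
  then have c\<nu>0: "continuous_on {a'..b'} \<nu>0" using continuous_on_snd by fastforce
  define \<omega> where "\<omega> r = a' + r * (b' - a')" for r
  have \<omega>: "\<omega> r \<in> {a'..b'}" if "r \<in> {0..1}" for r
  proof -
    have "r * (b' - a') \<le> 1 * (b' - a')" "0 \<le> r * (b' - a')"
      using that ab' by (intro mult_right_mono mult_nonneg_nonneg; simp)+
    then show ?thesis by (simp add: \<omega>_def)
  qed
  have c\<omega>: "continuous_on {0..1} \<omega>" unfolding \<omega>_def by (intro continuous_intros)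
  show ?thesis
  proof (rule that[of \<omega> "\<lambda>r. \<nu>0 (\<omega> r)"])
    show "continuous_on {0..1} (\<lambda>r. \<nu>0 (\<omega> r))"
      by (rule continuous_on_compose2[OF c\<nu>0 c\<omega>]) (use \<omega> in auto)
    show "\<omega> ` {0..1} \<subseteq> {a..b}" using \<omega> ab' by fastforce
    show "(\<lambda>r. \<nu>0 (\<omega> r)) ` {0..1} \<subseteq> {0..1}" using \<omega> \<nu>0 by blast
    show "\<nu>0 (\<omega> 0) = 0" by (rule \<nu>0u) (use ab' in \<open>auto simp: \<omega>_def\<close>)
    show "\<nu>0 (\<omega> 1) = 1" by (rule \<nu>0u) (use ab' in \<open>auto simp: \<omega>_def\<close>)
    show "f (\<omega> r) (\<nu>0 (\<omega> r)) = \<tau>" if "r \<in> {0..1}" for r using \<nu>0(2)[OF \<omega>[OF that]] .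
  qed (rule c\<omega>)
qed

section \<open>Hamiltonian orbits in one quadrant\<close>

text \<open>Only weak monotonicity is asked, because the function used later is \<open>h\<close>
  frozen outside a compact interval. The signs still make the primitive strictly monotone on each
  half-line, and monotonicity makes it unbounded.\<close>

definition restoring :: "(real \<Rightarrow> real) \<Rightarrow> bool" where
  "restoring k \<longleftrightarrow> continuous_on UNIV k \<and> mono k \<and> k 0 = 0 \<and> (\<forall>y>0. 0 < k y) \<and> (\<forall>y<0. k y < 0)"

lemma restoring_reflect: "restoring k \<Longrightarrow> restoring (\<lambda>y. - k (- y))"
  unfolding restoring_def mono_def
  by (auto intro!: continuous_intros continuous_on_compose2[of UNIV k])

text \<open>The half-plane \<open>y \<ge> 0\<close> of \<open>x' = k y\<close>,
  \<open>y' = - f x\<close>. The other quadrants, reversal of time and the exchange of the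
  coordinates are all brought to this case by changing the four functions. \<open>f\<close> has no
  prescribed sign: with \<open>lam < 0\<close> the force may point away from the origin close to
  it.\<close>

locale half_hamiltonian =
  fixes k K f F :: "real \<Rightarrow> real"
  assumes k: "restoring k" and dK: "\<And>y. (K has_real_derivative k y) (at y)" and K0: "K 0 = 0"
    and dF: "\<And>x. (F has_real_derivative f x) (at x)" and cf: "continuous_on UNIV f"
begin

lemma cont_k: "continuous_on UNIV k" and k_pos: "0 < y \<Longrightarrow> 0 < k y" and k_0: "k 0 = 0"
  using k by (auto simp: restoring_def)

lemma k_nonneg: "0 \<le> y \<Longrightarrow> 0 \<le> k y"
  using k_pos[of y] k_0 by (cases "y = 0") auto

lemma cont_K: "continuous_on S K" and cF: "continuous_on S F"
  using dK dF by (meson DERIV_isCont continuous_at_imp_continuous_on)+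

lemma K_strict_mono: "strict_mono_on {0..} K"
proof (rule strict_mono_onI)
  fix r s :: real assume "r \<in> {0..}" "s \<in> {0..}" "r < s"
  then show "K r < K s"
    by (intro DERIV_pos_imp_increasing_open[OF \<open>r < s\<close> _ cont_K]) (use dK k_pos in force)
qed

text \<open>Beyond 1 the slope of K is at least \<open>k 1\<close>, so K grows at least linearly.
  Hence \<open>Kinv\<close> is meaningful at every nonnegative energy, and no orbit formula has to
  worry about a bounded range.\<close>

lemma K_unbounded: obtains y where "0 \<le> y" "z \<le> K y"
proof -
  have k1: "0 < k 1" using k_pos by simp
  define y where "y = 1 + \<bar>z\<bar> / k 1"
  have y1: "1 \<le> y" using k1 by (simp add: y_def)
  have "K 1 - k 1 * 1 \<le> K y - k 1 * y"
  proof (rule DERIV_nonneg_imp_nondecreasing[OF y1])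
    fix x :: real assume "1 \<le> x"
    then have "k 1 \<le> k x" using k by (auto simp: restoring_def mono_def)
    moreover have "((\<lambda>y. K y - k 1 * y) has_real_derivative k x - k 1) (at x)"
      using dK by (auto intro!: derivative_eq_intros)
    ultimately show "\<exists>y. ((\<lambda>y. K y - k 1 * y) has_real_derivative y) (at x) \<and> 0 \<le> y" by (metis diff_ge_0_iff_ge)
  qed
  moreover have "K 0 < K 1" using strict_mono_onD[OF K_strict_mono, of 0 1] by simp
  ultimately have "k 1 * (y - 1) \<le> K y" using K0 by (simp add: algebra_simps)
  then have "z \<le> K y" using k1 by (simp add: y_def)
  then show ?thesis using that y1 by (meson order_trans zero_le_one)
qed

definition Kinv :: "real \<Rightarrow> real" where "Kinv = the_inv_into {0..} K"

lemma Kinv_K: "0 \<le> y \<Longrightarrow> Kinv (K y) = y"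
  unfolding Kinv_def using strict_mono_on_imp_inj_on[OF K_strict_mono] by (simp add: the_inv_into_f_f)

lemma Kinv: assumes "0 \<le> z" shows "0 \<le> Kinv z" "K (Kinv z) = z"
proof -
  obtain y where y: "0 \<le> y" "z \<le> K y" using K_unbounded .
  obtain w where "0 \<le> w" "w \<le> y" "K w = z" using IVT'[of K 0 z y] y K0 assms cont_K by auto
  then show "0 \<le> Kinv z" "K (Kinv z) = z" using Kinv_K by auto
qed

lemma Kinv_0: "Kinv 0 = 0" using Kinv_K[of 0] K0 by simp

lemma K_nonneg: "0 \<le> y \<Longrightarrow> 0 \<le> K y"
  using strict_mono_on_leD[OF K_strict_mono, of 0 y] K0 by simp

lemma Kinv_less: assumes "0 \<le> z" "z < z'" shows "Kinv z < Kinv z'"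
proof (rule ccontr)
  assume "\<not> Kinv z < Kinv z'"
  then have "K (Kinv z') \<le> K (Kinv z)"
    using strict_mono_on_leD[OF K_strict_mono, of "Kinv z'" "Kinv z"] Kinv(1) assms by auto
  then show False using Kinv(2) assms by auto
qed

lemma Kinv_pos: "0 < z \<Longrightarrow> 0 < Kinv z" using Kinv_less[of 0 z] Kinv_0 by simp

lemma continuous_on_Kinv: "continuous_on {0..} Kinv"
proof -
  \<comment> \<open>Composing with \<open>max 0 z\<close> turns the claim into continuity at each
    point of the whole line; near a given z the inverse of K on one compact interval is
    enough.\<close>
  have "isCont (\<lambda>z. Kinv (max 0 z)) z" for z
  proof -
    obtain y where y: "0 \<le> y" "max 0 z + 1 \<le> K y" using K_unbounded .
    have im: "K ` {0..y} = {0..K y}"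
    proof
      show "K ` {0..y} \<subseteq> {0..K y}"
        using strict_mono_on_leD[OF K_strict_mono] K_nonneg by auto
      show "{0..K y} \<subseteq> K ` {0..y}"
      proof
        fix w assume "w \<in> {0..K y}"
        then show "w \<in> K ` {0..y}"
          using IVT'[of K 0 w y] y K0 cont_K by (auto simp: image_iff)
      qed
    qed
    have "continuous_on {0..K y} Kinv"
      unfolding im[symmetric] by (rule continuous_on_inv[OF cont_K]) (auto simp: Kinv_K)
    then have "continuous_on {..<K y} (\<lambda>z. Kinv (max 0 z))"
      by (rule continuous_on_compose2) (use y in \<open>auto intro!: continuous_intros\<close>)
    then show ?thesis using y by (simp add: continuous_on_eq_continuous_at)
  qed
  then have "continuous_on {0..} (\<lambda>z. Kinv (max 0 z))" by (simp add: continuous_at_imp_continuous_on)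
  then show ?thesis by (rule continuous_on_eq) simp
qed

text \<open>The upper half of the level curve c, as a graph over x; it has this meaning only where
  \<open>F x \<le> c\<close>.\<close>

definition Y :: "real \<Rightarrow> real \<Rightarrow> real" where "Y c x = Kinv (c - F x)"

lemma Y: assumes "F x \<le> c" shows "0 \<le> Y c x" "K (Y c x) + F x = c"
  using Kinv[of "c - F x"] assms by (auto simp: Y_def)

lemma Y_eqI: "0 \<le> y \<Longrightarrow> K y + F x = c \<Longrightarrow> Y c x = y"
  using Kinv_K[of y] by (auto simp: Y_def algebra_simps)

lemma Y_pos: "F x < c \<Longrightarrow> 0 < Y c x" by (simp add: Y_def Kinv_pos)

lemma continuous_on_Y:
  assumes "continuous_on S C" "continuous_on S p" "\<And>s. s \<in> S \<Longrightarrow> F (p s) \<le> C s"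
  shows "continuous_on S (\<lambda>s. Y (C s) (p s))"
  unfolding Y_def
  by (rule continuous_on_compose2[OF continuous_on_Kinv])
     (use assms in \<open>auto intro!: continuous_intros continuous_on_compose2[OF cF]\<close>)

lemma Y_deriv:
  assumes "F x < c" shows "(Y c has_real_derivative - f x / k (Y c x)) (at x)"
proof -
  have op: "open {v. F v < c}" by (intro open_Collect_less cF continuous_intros)
  have ev: "\<forall>\<^sub>F v in nhds x. F v < c"
    using eventually_nhds_in_open[OF op, of x] assms by simp
  note op
  moreover have "continuous_on {v. F v < c} (Y c)"
    using continuous_on_Y[of "{v. F v < c}" "\<lambda>_. c" "\<lambda>v. v"] by (auto intro: continuous_intros)
  ultimately have iY: "isCont (Y c) x" using assms by (simp add: continuous_on_eq_continuous_at)
  have "(Y c has_real_derivative - f x / (1 * k (Y c x) - 0 * f x)) (at x)"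
  proof (rule level_curve_derivative(2)[where p = "\<lambda>v. v" and K = K and F = F and c = c])
    show "\<forall>\<^sub>F v in at x. K (Y c v) + F v = c \<and> 1 * v + 0 * Y c v = v"
    proof -
      have "\<forall>\<^sub>F v in at x. F v < c" using ev eventually_nhds_conv_at by fast
      then show ?thesis by eventually_elim (use Y(2) in auto)
    qed
  qed (use iY assms dK dF k_pos[OF Y_pos[OF assms]] in \<open>auto simp: Y\<close>)
  then show ?thesis by simp
qed

end

locale quadrant_annulus = half_hamiltonian +
  fixes c1 c2 :: real and X :: "real \<Rightarrow> real"
  assumes X_pos: "\<And>c. c \<in> {c1..c2} \<Longrightarrow> 0 < X c"
    and F_X: "\<And>c. c \<in> {c1..c2} \<Longrightarrow> F (X c) = c"
    and F_less: "\<And>c x. c \<in> {c1..c2} \<Longrightarrow> 0 \<le> x \<Longrightarrow> x < X c \<Longrightarrow> F x < c"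
    and f_X: "\<And>c. c \<in> {c1..c2} \<Longrightarrow> 0 < f (X c)"
begin

text \<open>F need not be monotone on \<open>[0, X c]\<close>, so X is not the inverse of F there. A
  level c' close to c still exceeds the maximum of F on an interval ending shortly before
  \<open>X c\<close>, which forces \<open>X c'\<close> beyond it; and as \<open>f (X c) > 0\<close>,
  F exceeds c' at some point shortly after \<open>X c\<close>, which by \<open>F_less\<close> the
  point \<open>X c'\<close> cannot pass.\<close>

lemma continuous_on_X: "continuous_on {c1..c2} X"
  unfolding continuous_on_iff
proof (intro ballI allI impI)
  fix c e :: real assume c: "c \<in> {c1..c2}" and e: "0 < e"
  define e' where "e' = min e (X c) / 2"
  have e': "0 < e'" "e' < e" "e' < X c" using e X_pos[OF c] by (auto simp: e'_def)
  define x1 where "x1 = X c - e'"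
  obtain z where z: "z \<in> {0..x1}" "\<And>w. w \<in> {0..x1} \<Longrightarrow> F w \<le> F z"
    using continuous_attains_sup[of "{0..x1}" F] cF e' by (auto simp: x1_def)
  have Fz: "F z < c" using F_less[OF c] z e' by (auto simp: x1_def)
  obtain d where d: "0 < d" "\<And>h. 0 < h \<Longrightarrow> h < d \<Longrightarrow> F (X c) < F (X c + h)"
    using DERIV_pos_inc_right[OF dF f_X[OF c]] by auto
  define h where "h = min d e' / 2"
  have h: "0 < h" "h < d" "h < e'" using d e' by (auto simp: h_def)
  have Fh: "c < F (X c + h)" using d(2)[OF h(1,2)] F_X[OF c] by simp
  show "\<exists>d>0. \<forall>c'\<in>{c1..c2}. dist c' c < d \<longrightarrow> dist (X c') (X c) < e"
  proof (intro exI conjI ballI impI)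
    show "0 < min (c - F z) (F (X c + h) - c)" using Fz Fh by simp
    fix c' assume c': "c' \<in> {c1..c2}" "dist c' c < min (c - F z) (F (X c + h) - c)"
    then have c'2: "F z < c'" "c' < F (X c + h)" by (auto simp: dist_real_def)
    have "x1 < X c'" using z(2)[of "X c'"] X_pos[OF c'(1)] F_X[OF c'(1)] c'2(1) by (rule_tac ccontr) simp
    moreover have "X c' \<le> X c + h"
      using F_less[OF c'(1), of "X c + h"] c'2(2) X_pos[OF c] h(1) by (rule_tac ccontr) simp
    ultimately show "dist (X c') (X c) < e" using h e' by (auto simp: dist_real_def x1_def)
  qed
qed

lemma F_lt: assumes "c \<in> {c1..c2}" "v \<in> {0..<1}" shows "F (v * X c) < c"
  using assms X_pos[OF assms(1)] by (intro F_less[OF assms(1)]) simp_all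

lemma F_le: assumes "c \<in> {c1..c2}" "v \<in> {0..1}" shows "F (v * X c) \<le> c"
proof (cases "v = 1")
  case True then show ?thesis using F_X[OF assms(1)] by simp
next
  case False then show ?thesis using F_lt[OF assms(1), of v] assms(2) by simp
qed

text \<open>The coordinates in the quadrant are the level c and the scaled abscissa
  \<open>v = x / X c\<close>, so that all orbits of the annulus are described over one rectangle,
  including the side \<open>v = 1\<close> where they cross the x-axis vertically.\<close>

lemma continuous_on_vX: "continuous_on ({c1..c2} \<times> {0..1}) (\<lambda>(c, v). v * X c)"
  by (auto simp: case_prod_beta intro!: continuous_intros continuous_on_compose2[OF continuous_on_X])

lemma continuous_on_YX: "continuous_on ({c1..c2} \<times> {0..1}) (\<lambda>(c, v). Y c (v * X c))"
proof -
  have "continuous_on ({c1..c2} \<times> {0..1}) (\<lambda>z. Y (fst z) (snd z * X (fst z)))"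
    by (rule continuous_on_Y) (use F_le in \<open>auto intro!: continuous_intros continuous_on_compose2[OF continuous_on_X]\<close>)
  then show ?thesis by (simp add: case_prod_beta)
qed

text \<open>Since \<open>f\<close> is positive where the orbits meet the \<open>x\<close>-axis, a large multiple of \<open>x\<close> minus \<open>y\<close>
  has positive derivative along the field on the whole quadrant; the time integral is not singular
  in this parameter.\<close>

lemma transversal_functional:
  obtains M where "\<And>c v. c \<in> {c1..c2} \<Longrightarrow> v \<in> {0..1} \<Longrightarrow> 0 < M * k (Y c (v * X c)) + f (v * X c)" "0 \<le> M"
proof -
  let ?R = "{c1..c2} \<times> {0..1::real}"
  define fX where "fX z = f (snd z * X (fst z))" for z
  define kY where "kY z = k (Y (fst z) (snd z * X (fst z)))" for z
  have cfX: "continuous_on ?R fX"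
    using continuous_on_compose2[OF cf continuous_on_vX] by (auto simp: case_prod_beta fX_def)
  have ckY: "continuous_on ?R kY"
    using continuous_on_compose2[OF cont_k continuous_on_YX] by (auto simp: case_prod_beta kY_def)
  have "bounded (fX ` ?R)"
    by (intro compact_imp_bounded compact_continuous_image cfX compact_Times compact_Icc)
  then obtain B where B0: "0 < B" and B': "\<forall>w\<in>fX ` ?R. norm w \<le> B" unfolding bounded_pos by blast
  have B: "- B \<le> fX z" if "z \<in> ?R" for z using bspec[OF B' imageI[OF that]] by simp
  \<comment> \<open>The multiple M has work to do only where f is not positive. This set is compact
    and misses \<open>v = 1\<close>, because \<open>f (X c) > 0\<close>; hence k along the orbit has
    a positive minimum on it.\<close>
  define N where "N = {z \<in> ?R. fX z \<le> 0}"
  have "closed N" unfolding N_def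
    by (intro continuous_on_closed_Collect_le cfX continuous_intros closed_Times closed_atLeastAtMost)
  moreover have "N = ?R \<inter> N" by (auto simp: N_def)
  ultimately have cN: "compact N"
    using compact_Int_closed[OF compact_Times[OF compact_Icc compact_Icc], of N c1 c2 0 1] by simp
  have Npos: "0 < kY z" if "z \<in> N" for z
  proof -
    have z: "fst z \<in> {c1..c2}" "snd z \<in> {0..1}" "fX z \<le> 0" using that by (auto simp: N_def)
    have "snd z \<noteq> 1"
    proof
      assume "snd z = 1"
      then show False using z(3) f_X[OF z(1)] by (simp add: fX_def)
    qed
    then have "snd z \<in> {0..<1}" using z(2) by simp
    then show ?thesis unfolding kY_def by (intro k_pos Y_pos F_lt z(1))
  qed
  have kge: "0 \<le> kY z" if "z \<in> ?R" for z
    unfolding kY_def by (rule k_nonneg, rule Y(1), rule F_le) (use that in auto)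
  have "\<exists>M\<ge>0. \<forall>z\<in>?R. 0 < M * kY z + fX z"
  proof (cases "N = {}")
    case True
    have "0 < 1 * kY z + fX z" if "z \<in> ?R" for z
    proof -
      have "z \<notin> N" using True by simp
      then have "0 < fX z" using that by (simp add: N_def)
      then show ?thesis using kge[OF that] by simp
    qed
    then show ?thesis by (intro exI[of _ 1]) auto
  next
    case False
    have "continuous_on N kY"
      by (rule continuous_on_subset[OF ckY]) (auto simp: N_def)
    then obtain z0 where z0: "z0 \<in> N" "\<forall>z\<in>N. kY z0 \<le> kY z"
      using continuous_attains_inf[OF cN False] by blast
    have \<delta>: "0 < kY z0" using Npos z0(1) .
    \<comment> \<open>With \<open>- B\<close> a lower bound of f and \<open>kY z0\<close> the
      minimum of k on N, this M gives \<open>M * k + f \<ge> 1\<close> on N.\<close>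
    define M where "M = (B + 1) / kY z0"
    have M: "0 \<le> M" using \<delta> B0 by (simp add: M_def)
    have "0 < M * kY z + fX z" if z: "z \<in> ?R" for z
    proof (cases "z \<in> N")
      case True
      have "M * kY z0 \<le> M * kY z" using bspec[OF z0(2) True] M by (rule mult_left_mono)
      moreover have "M * kY z0 = B + 1" using \<delta> by (simp add: M_def)
      ultimately show ?thesis using B[OF z] by linarith
    next
      case False
      then have "0 < fX z" using z by (simp add: N_def)
      moreover have "0 \<le> M * kY z" using M kge[OF z] by simp
      ultimately show ?thesis by simp
    qed
    then show ?thesis using M by blast
  qed
  then obtain M where M: "0 \<le> M" "\<forall>z\<in>?R. 0 < M * kY z + fX z" by blast
  have "0 < M * k (Y c (v * X c)) + f (v * X c)" if "c \<in> {c1..c2}" "v \<in> {0..1}" for c v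
    using bspec[OF M(2), of "(c, v)"] that by (simp add: kY_def fX_def)
  then show ?thesis using that M(1) by blast
qed

text \<open>\<open>el c v\<close> is the time from the y-axis to the abscissa \<open>v * X c\<close>
  on the level c. The integral clause admits every integrand with the right values strictly between
  the ends, so that integrals written with other formulas for the speed can be matched with it
  later.\<close>

definition elapsed_time :: "(real \<Rightarrow> real \<Rightarrow> real) \<Rightarrow> bool" where
  "elapsed_time el \<longleftrightarrow> continuous_on ({c1..c2} \<times> {0..1}) (\<lambda>(c, v). el c v) \<and>
     (\<forall>c\<in>{c1..c2}. el c 0 = 0 \<and> strict_mono_on {0..1} (el c) \<and>
        (\<forall>\<rho>. (\<forall>x\<in>{0<..<X c}. \<rho> x = 1 / k (Y c x)) \<longrightarrow> (LBINT x=0..X c. \<rho> x) = el c 1) \<and>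
        (\<forall>v v'. 0 \<le> v \<and> v \<le> v' \<and> v' \<le> 1 \<longrightarrow> (\<exists>x y. smooth_sol k f (el c v' - el c v) x y \<and>
           x 0 = v * X c \<and> x (el c v' - el c v) = v' * X c \<and>
           (\<forall>\<tau>\<in>{0..el c v' - el c v}. 0 \<le> x \<tau> \<and> x \<tau> \<le> X c \<and> y \<tau> = Y c (x \<tau>)) \<and>
           (\<forall>\<tau>\<in>{0<..<el c v' - el c v}. 0 < x \<tau> \<and> x \<tau> < X c))))"

text \<open>The parameter is \<open>U = M x - y\<close>, whose rate along the field,
  \<open>om\<close>, is positive up to and including the axes. Time is the integral of the
  continuous function \<open>1 / om\<close> over U, hence continuous in the level and the position
  together; \<open>W c\<close> recovers v from U. The singular integral over x comes back only at
  the end, through \<open>smooth_sol_time\<close>.\<close>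

lemma elapsed_time_exists: "\<exists>el. elapsed_time el"
proof -
  let ?R = "{c1..c2} \<times> {0..1::real}"
  obtain M where M: "\<And>c v. c \<in> {c1..c2} \<Longrightarrow> v \<in> {0..1} \<Longrightarrow> 0 < M * k (Y c (v * X c)) + f (v * X c)" "0 \<le> M"
    using transversal_functional by blast
  define U where "U c v = M * (v * X c) - Y c (v * X c)" for c v
  have cU: "continuous_on ?R (\<lambda>(c, v). U c v)"
    using continuous_on_diff[OF continuous_on_mult_left[OF continuous_on_vX, of M] continuous_on_YX]
    by (simp add: case_prod_beta U_def)
  have cU1: "continuous_on {0..1} (U c)" if "c \<in> {c1..c2}" for c
  proof -
    have "continuous_on {0..1} (\<lambda>v. case (c, v) of (c, v) \<Rightarrow> U c v)"
      by (rule continuous_on_compose2[OF cU]) (use that in \<open>auto intro!: continuous_intros\<close>)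
    then show ?thesis by simp
  qed
  \<comment> \<open>For \<open>v < 1\<close> the derivative of \<open>M x - Y c x\<close> is the
    positive rate divided by \<open>k (Y c x)\<close>. At \<open>v = 1\<close> the curve is vertical
    and only continuity is used.\<close>
  have mU: "strict_mono_on {0..1} (U c)" if c: "c \<in> {c1..c2}" for c
  proof (rule strict_mono_onI)
    fix r s :: real assume rs: "r \<in> {0..1}" "s \<in> {0..1}" "r < s"
    have X0: "0 < X c" using X_pos[OF c] .
    have "M * (r * X c) - Y c (r * X c) < M * (s * X c) - Y c (s * X c)"
    proof (rule DERIV_pos_imp_increasing_open[where f = "\<lambda>x. M * x - Y c x"])
      show "r * X c < s * X c" using rs X0 by simp
      fix x assume x: "r * X c < x" "x < s * X c"
      define v where "v = x / X c"
      have "r \<le> v" "v < s" using x X0 by (simp_all add: v_def pos_le_divide_eq pos_divide_less_eq less_imp_le)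
      then have "v \<in> {0..<1}" using rs by auto
      moreover have "x = v * X c" using X0 by (simp add: v_def)
      ultimately have v: "x = v * X c" "v \<in> {0..<1}" by auto
      have "((\<lambda>x. M * x - Y c x) has_real_derivative M - - f x / k (Y c x)) (at x)"
        using Y_deriv[of x c] F_lt[OF c v(2)] v(1) by (auto intro!: derivative_eq_intros)
      moreover have "0 < M - - f x / k (Y c x)"
        using M(1)[OF c, of v] v k_pos[OF Y_pos[OF F_lt[OF c v(2)]]] by (auto simp: field_simps)
      ultimately show "\<exists>y. ((\<lambda>x. M * x - Y c x) has_real_derivative y) (at x) \<and> 0 < y" by blast
    next
      have "F x \<le> c" if "x \<in> {r * X c..s * X c}" for x
      proof -
        have "r \<le> x / X c" "x / X c \<le> s" using that X0 by (simp_all add: pos_le_divide_eq pos_divide_le_eq)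
        then have "x / X c \<in> {0..1}" using order_trans[of 0 r "x / X c"] order_trans[of "x / X c" s 1] rs by simp
        moreover have "x = (x / X c) * X c" using X0 by simp
        ultimately have "x = (x / X c) * X c" "x / X c \<in> {0..1}" by auto
        then show ?thesis using F_le[OF c, of "x / X c"] by simp
      qed
      then show "continuous_on {r * X c..s * X c} (\<lambda>x. M * x - Y c x)"
        by (intro continuous_intros continuous_on_Y) auto
    qed
    then show "U c r < U c s" by (simp add: U_def)
  qed
  define P where "P c g \<longleftrightarrow> g ` {U c 0..U c 1} \<subseteq> {0..1} \<and> (\<forall>t\<in>{U c 0..U c 1}. U c (g t) = t) \<and>
     (\<forall>u\<in>{0..1}. g (U c u) = u) \<and> strict_mono_on {U c 0..U c 1} g \<and> continuous_on {U c 0..U c 1} g" for c g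
  have "\<exists>g. P c g" if c: "c \<in> {c1..c2}" for c
  proof -
    obtain g where "continuous_on {U c 0..U c 1} g" "g ` {U c 0..U c 1} \<subseteq> {0..1}"
      "\<And>t. t \<in> {U c 0..U c 1} \<Longrightarrow> U c (g t) = t" "\<And>u. u \<in> {0..1} \<Longrightarrow> g (U c u) = u"
      "strict_mono_on {U c 0..U c 1} g"
      using strict_mono_inverse_on_interval[OF zero_le_one cU1[OF c] mU[OF c]] by blast
    then show ?thesis unfolding P_def by blast
  qed
  then obtain W where "\<forall>c\<in>{c1..c2}. P c (W c)" using bchoice[of "{c1..c2}" P] by blast
  then have W: "W c ` {U c 0..U c 1} \<subseteq> {0..1}" "\<And>t. t \<in> {U c 0..U c 1} \<Longrightarrow> U c (W c t) = t"
    "\<And>v. v \<in> {0..1} \<Longrightarrow> W c (U c v) = v" "strict_mono_on {U c 0..U c 1} (W c)"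
    "continuous_on {U c 0..U c 1} (W c)" if "c \<in> {c1..c2}" for c
    using that by (simp_all add: P_def)
  have Urng: "U c v \<in> {U c 0..U c 1}" if "c \<in> {c1..c2}" "v \<in> {0..1}" for c v
    using strict_mono_on_leD[OF mU[OF that(1)]] that by auto
  have Wrng: "W c u \<in> {0..1}" if "c \<in> {c1..c2}" "u \<in> {U c 0..U c 1}" for c u
    using W(1)[OF that(1)] that(2) by blast
  \<comment> \<open>The map taking \<open>(c, v)\<close> to \<open>(c, U c v)\<close> is a
    continuous injection of a compact rectangle, so its inverse is continuous. This gives continuity
    of \<open>W\<close> in both variables jointly, whereas the inverses were chosen separately for
    each level.\<close>
  define D where "D = (\<lambda>(c, v). (c, U c v)) ` ?R"
  have D: "(c, u) \<in> D" if "c \<in> {c1..c2}" "u \<in> {U c 0..U c 1}" for c u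
    unfolding D_def by (rule image_eqI[where x = "(c, W c u)"]) (use that W(2) Wrng in auto)
  have cW: "continuous_on D (\<lambda>(c, u). W c u)"
  proof -
    have "continuous_on D (\<lambda>(c, u). (c, W c u))" unfolding D_def
    proof (rule continuous_on_inv)
      show "continuous_on ?R (\<lambda>(c, v). (c, U c v))"
        using cU by (auto simp: case_prod_beta intro!: continuous_intros)
    qed (use W(3) in \<open>auto intro!: compact_Times\<close>)
    from continuous_on_snd[OF this] show ?thesis by (simp add: case_prod_beta)
  qed
  define om where "om c v = M * k (Y c (v * X c)) + f (v * X c)" for c v
  have om: "0 < om c v" if "c \<in> {c1..c2}" "v \<in> {0..1}" for c v using M(1)[OF that] by (simp add: om_def)
  have com: "continuous_on ?R (\<lambda>(c, v). om c v)"
    using continuous_on_compose2[OF cont_k continuous_on_YX] continuous_on_compose2[OF cf continuous_on_vX]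
    unfolding om_def by (auto simp: case_prod_beta intro!: continuous_intros)
  have cr: "continuous_on D (\<lambda>(c, u). 1 / om c (W c u))"
  proof -
    have "continuous_on D (\<lambda>z. (\<lambda>(c, v). om c v) (fst z, (\<lambda>(c, u). W c u) z))"
    proof (rule continuous_on_compose2[OF com])
      show "continuous_on D (\<lambda>z. (fst z, (\<lambda>(c, u). W c u) z))" by (intro continuous_intros cW)
      show "(\<lambda>z. (fst z, (\<lambda>(c, u). W c u) z)) ` D \<subseteq> ?R"
      proof (rule image_subsetI)
        fix z assume "z \<in> D"
        then obtain c v where "c \<in> {c1..c2}" "v \<in> {0..1}" "z = (c, U c v)" unfolding D_def by auto
        then show "(fst z, (\<lambda>(c, u). W c u) z) \<in> ?R" using W(3) by simp
      qed
    qed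
    then have "continuous_on D (\<lambda>z. om (fst z) (W (fst z) (snd z)))" by (simp add: case_prod_beta)
    moreover have "om (fst z) (W (fst z) (snd z)) \<noteq> 0" if "z \<in> D" for z
    proof -
      obtain c v where cv: "c \<in> {c1..c2}" "v \<in> {0..1}" "z = (c, U c v)" using \<open>z \<in> D\<close> unfolding D_def by auto
      then show ?thesis using om[OF cv(1,2)] W(3)[OF cv(1,2)] by simp
    qed
    ultimately have "continuous_on D (\<lambda>z. 1 / om (fst z) (W (fst z) (snd z)))"
      by (intro continuous_intros) auto
    then show ?thesis by (simp add: case_prod_beta)
  qed
  define r where "r c u = 1 / om c (W c u)" for c u
  have cr1: "continuous_on {U c 0..U c 1} (r c)" if "c \<in> {c1..c2}" for c
  proof -
    have "continuous_on {U c 0..U c 1} (\<lambda>u. (\<lambda>(c, u). 1 / om c (W c u)) (c, u))"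
      by (rule continuous_on_compose2[OF cr]) (use that D in \<open>auto intro!: continuous_intros\<close>)
    then show ?thesis by (simp add: r_def)
  qed
  define \<theta> where "\<theta> c u = integral {U c 0..u} (r c)" for c u
  define el where "el c v = \<theta> c (U c v)" for c v
  have cel: "continuous_on ?R (\<lambda>(c, v). el c v)"
  proof -
    have "continuous_on ?R (\<lambda>z. integral {U (fst z) 0..U (fst z) (snd z)} (r (fst z)))"
    proof (rule continuous_on_integral_moving_interval)
      show "U (fst z) 0 \<le> U (fst z) (snd z)" if "z \<in> ?R" for z
        using that Urng[of "fst z" "snd z"] by auto
      show cU0: "continuous_on ?R (\<lambda>z. U (fst z) 0)"
      proof -
        have "continuous_on ?R (\<lambda>z. (\<lambda>(c, v). U c v) (fst z, 0))"
          by (rule continuous_on_compose2[OF cU]) (auto intro!: continuous_intros)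
        then show ?thesis by simp
      qed
      show cUz: "continuous_on ?R (\<lambda>z. U (fst z) (snd z))" using cU by (simp add: case_prod_beta)
      show "continuous_on {U (fst z) 0..U (fst z) (snd z)} (r (fst z))" if "z \<in> ?R" for z
        using that Urng[of "fst z" "snd z"] by (intro continuous_on_subset[OF cr1[of "fst z"]]) auto
      have "continuous_on (?R \<times> {0..1}) (\<lambda>w. (\<lambda>(c, u). 1 / om c (W c u)) (fst (fst w),
           U (fst (fst w)) 0 + snd w * (U (fst (fst w)) (snd (fst w)) - U (fst (fst w)) 0)))"
      proof (rule continuous_on_compose2[OF cr])
        have 1: "continuous_on (?R \<times> {0..1::real}) (\<lambda>w. U (fst (fst w)) 0)"
          by (rule continuous_on_compose2[OF cU0]) (auto intro!: continuous_intros)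
        have 2: "continuous_on (?R \<times> {0..1::real}) (\<lambda>w. U (fst (fst w)) (snd (fst w)))"
          by (rule continuous_on_compose2[OF cUz]) (auto intro!: continuous_intros)
        show "continuous_on (?R \<times> {0..1}) (\<lambda>w. (fst (fst w),
           U (fst (fst w)) 0 + snd w * (U (fst (fst w)) (snd (fst w)) - U (fst (fst w)) 0)))"
          by (intro continuous_intros 1 2)
        show "(\<lambda>w. (fst (fst w), U (fst (fst w)) 0 + snd w * (U (fst (fst w)) (snd (fst w)) - U (fst (fst w)) 0)))
           ` (?R \<times> {0..1}) \<subseteq> D"
        proof (rule image_subsetI)
          fix w :: "(real \<times> real) \<times> real" assume w: "w \<in> ?R \<times> {0..1}"
          obtain c v s where [simp]: "w = ((c, v), s)" by (metis surj_pair)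
          have cv: "c \<in> {c1..c2}" "v \<in> {0..1}" "s \<in> {0..1}" using w by auto
          have "s * (U c v - U c 0) \<le> 1 * (U c v - U c 0)" "0 \<le> s * (U c v - U c 0)"
            using cv Urng[OF cv(1,2)] by (intro mult_right_mono mult_nonneg_nonneg; simp)+
          then show "(fst (fst w), U (fst (fst w)) 0 + snd w * (U (fst (fst w)) (snd (fst w)) - U (fst (fst w)) 0)) \<in> D"
            using Urng[OF cv(1,2)] by (auto intro!: D[OF cv(1)])
        qed
      qed
      then show "continuous_on (?R \<times> {0..1}) (\<lambda>(z, s). r (fst z) (U (fst z) 0 + s * (U (fst z) (snd z) - U (fst z) 0)))"
        by (simp add: case_prod_beta r_def)
    qed
    then show ?thesis by (simp add: el_def \<theta>_def case_prod_beta)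
  qed
  have d\<theta>: "(\<theta> c has_real_derivative r c u) (at u)" if c: "c \<in> {c1..c2}" and u: "u \<in> {U c 0<..<U c 1}" for c u
  proof -
    have "(\<theta> c has_real_derivative r c u) (at u within {U c 0..U c 1})"
      unfolding \<theta>_def using u by (intro integral_has_real_derivative cr1 c) auto
    moreover have "at u within {U c 0..U c 1} = at u"
      using u by (intro at_within_interior) auto
    ultimately show ?thesis by simp
  qed
  have c\<theta>: "continuous_on {U c 0..U c 1} (\<theta> c)" if c: "c \<in> {c1..c2}" for c
    unfolding \<theta>_def by (intro indefinite_integral_continuous_1 integrable_continuous_real cr1 c)
  have m\<theta>: "strict_mono_on {U c 0..U c 1} (\<theta> c)" if c: "c \<in> {c1..c2}" for c
  proof (rule strict_mono_onI)
    fix p q assume pq: "p \<in> {U c 0..U c 1}" "q \<in> {U c 0..U c 1}" "p < q"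
    show "\<theta> c p < \<theta> c q"
    proof (rule DERIV_pos_imp_increasing_open[OF pq(3)])
      fix u assume "p < u" "u < q"
      then have "u \<in> {U c 0<..<U c 1}" using pq by auto
      then show "\<exists>y. (\<theta> c has_real_derivative y) (at u) \<and> 0 < y"
        using d\<theta>[OF c, of u] om[OF c Wrng[OF c, of u]] by (auto simp: r_def)
    next
      show "continuous_on {p..q} (\<theta> c)" using pq by (intro continuous_on_subset[OF c\<theta>[OF c]]) auto
    qed
  qed
  have mel: "strict_mono_on {0..1} (el c)" if c: "c \<in> {c1..c2}" for c
    by (rule strict_mono_onI)
       (auto simp: el_def intro!: strict_mono_onD[OF m\<theta>[OF c]] Urng[OF c, simplified] strict_mono_onD[OF mU[OF c]])
  have el0: "el c 0 = 0" for c by (simp add: el_def \<theta>_def)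
  have sol: "\<exists>x y. smooth_sol k f (el c v' - el c v) x y \<and>
           x 0 = v * X c \<and> x (el c v' - el c v) = v' * X c \<and>
           (\<forall>\<tau>\<in>{0..el c v' - el c v}. 0 \<le> x \<tau> \<and> x \<tau> \<le> X c \<and> y \<tau> = Y c (x \<tau>)) \<and>
           (\<forall>\<tau>\<in>{0<..<el c v' - el c v}. 0 < x \<tau> \<and> x \<tau> < X c)"
    if c: "c \<in> {c1..c2}" and v: "0 \<le> v" "v \<le> v'" "v' \<le> 1" for c v v'
  proof -
    have vv: "v \<in> {0..1}" "v' \<in> {0..1}" using v by auto
    have le: "U c v \<le> U c v'" using strict_mono_on_leD[OF mU[OF c] vv] v by simp
    have sub: "{U c v..U c v'} \<subseteq> {U c 0..U c 1}" using Urng[OF c vv(1)] Urng[OF c vv(2)] by auto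
    define p where "p u = W c u * X c" for u
    have cp: "continuous_on {U c v..U c v'} p"
      unfolding p_def by (intro continuous_intros continuous_on_subset[OF W(5)[OF c] sub])
    have Fp: "F (p u) \<le> c" if "u \<in> {U c v..U c v'}" for u
      unfolding p_def using F_le[OF c] Wrng[OF c] that sub by blast
    have omp: "M * k (Y c (p u)) - - 1 * f (p u) = om c (W c u)" for u
      by (simp add: om_def p_def)
    obtain \<upsilon> where \<upsilon>: "\<upsilon> 0 = U c v" "\<upsilon> (el c v' - el c v) = U c v'"
      "\<upsilon> ` {0..el c v' - el c v} \<subseteq> {U c v..U c v'}"
      "\<And>\<tau>. \<tau> \<in> {0<..<el c v' - el c v} \<Longrightarrow> \<upsilon> \<tau> \<in> {U c v<..<U c v'}"
      "smooth_sol k f (el c v' - el c v) (\<lambda>\<tau>. p (\<upsilon> \<tau>)) (\<lambda>\<tau>. Y c (p (\<upsilon> \<tau>)))"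
    proof (rule smooth_sol_along_curve[of "U c v" "U c v'" p "\<lambda>u. Y c (p u)" "\<theta> c" K F c M "-1" k f])
      show "continuous_on {U c v..U c v'} (\<lambda>u. Y c (p u))"
        by (intro continuous_on_Y continuous_intros cp Fp)
      show "continuous_on {U c v..U c v'} (\<theta> c)" by (rule continuous_on_subset[OF c\<theta>[OF c] sub])
      show "K (Y c (p u)) + F (p u) = c" if "u \<in> {U c v..U c v'}" for u using Y(2)[OF Fp[OF that]] .
      show "M * p u + - 1 * Y c (p u) = u" if "u \<in> {U c v..U c v'}" for u
        using W(2)[OF c, of u] that sub by (auto simp: U_def p_def)
      show "0 < M * k (Y c (p u)) - - 1 * f (p u)" if "u \<in> {U c v<..<U c v'}" for u
        unfolding omp using om[OF c Wrng[OF c]] that sub by auto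
      show "(\<theta> c has_real_derivative 1 / (M * k (Y c (p u)) - - 1 * f (p u))) (at u)"
        if "u \<in> {U c v<..<U c v'}" for u
        unfolding omp using d\<theta>[OF c, of u] that Urng[OF c vv(1)] Urng[OF c vv(2)] by (auto simp: r_def)
      show "el c v' - el c v = \<theta> c (U c v') - \<theta> c (U c v)" by (simp add: el_def)
    qed (use le cp dK dF in auto)
    have X0: "0 < X c" using X_pos[OF c] .
    have prng: "0 \<le> p u \<and> p u \<le> X c" if "u \<in> {U c v..U c v'}" for u
      using Wrng[OF c, of u] that sub X0 by (auto simp: p_def)
    have pint: "0 < p u \<and> p u < X c" if "u \<in> {U c v<..<U c v'}" for u
    proof -
      have u: "U c 0 < u" "u < U c 1" using that Urng[OF c vv(1)] Urng[OF c vv(2)] by auto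
      have "0 < W c u" using strict_mono_onD[OF W(4)[OF c], of "U c 0" u] u W(3)[OF c, of 0] by auto
      moreover have "W c u < 1" using strict_mono_onD[OF W(4)[OF c], of u "U c 1"] u W(3)[OF c, of 1] by auto
      ultimately show ?thesis using X0 by (simp add: p_def)
    qed
    show ?thesis
    proof (intro exI conjI ballI)
      show "smooth_sol k f (el c v' - el c v) (\<lambda>\<tau>. p (\<upsilon> \<tau>)) (\<lambda>\<tau>. Y c (p (\<upsilon> \<tau>)))" by (rule \<upsilon>(5))
      show "p (\<upsilon> 0) = v * X c" "p (\<upsilon> (el c v' - el c v)) = v' * X c"
        using W(3)[OF c vv(1)] W(3)[OF c vv(2)] \<upsilon>(1,2) by (auto simp: p_def)
      fix \<tau>
      show "0 \<le> p (\<upsilon> \<tau>)" "p (\<upsilon> \<tau>) \<le> X c" if "\<tau> \<in> {0..el c v' - el c v}"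
        using prng \<upsilon>(3) that by blast+
      show "0 < p (\<upsilon> \<tau>)" "p (\<upsilon> \<tau>) < X c" if "\<tau> \<in> {0<..<el c v' - el c v}"
        using pint[OF \<upsilon>(4)[OF that]] by auto
    qed simp
  qed
  have time: "(LBINT x=0..X c. \<rho> x) = el c 1"
    if c: "c \<in> {c1..c2}" and \<rho>: "\<forall>x\<in>{0<..<X c}. \<rho> x = 1 / k (Y c x)" for c \<rho>
  proof -
    obtain x y where xy: "smooth_sol k f (el c 1) x y" "x 0 = 0" "x (el c 1) = X c"
      "\<forall>\<tau>\<in>{0..el c 1}. y \<tau> = Y c (x \<tau>)" "\<forall>\<tau>\<in>{0<..<el c 1}. 0 < x \<tau> \<and> x \<tau> < X c"
      using sol[OF c, of 0 1] el0 by auto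
    have "(LBINT \<xi>=x 0..x (el c 1). \<rho> \<xi>) = el c 1"
    proof (rule smooth_sol_time[OF xy(1) _ cont_k])
      fix \<tau> assume \<tau>: "\<tau> \<in> {0<..<el c 1}"
      have "F (x \<tau>) < c" using F_less[OF c, of "x \<tau>"] bspec[OF xy(5) \<tau>] by simp
      then show "0 < k (y \<tau>)" using xy(4) \<tau> by (auto intro!: k_pos Y_pos)
      show "\<rho> (x \<tau>) = 1 / k (y \<tau>)" using \<rho> xy(4,5) \<tau> by auto
    qed
    then show ?thesis using xy(2,3) by (simp add: zero_ereal_def)
  qed
  show ?thesis unfolding elapsed_time_def
    by (intro exI[of _ el] conjI ballI cel el0 mel allI impI time sol) auto
qed

end

section \<open>Travel times of arcs away from the x-axis\<close>

context half_hamiltonian begin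

definition slowness :: "real \<Rightarrow> real \<Rightarrow> real" where "slowness E x = 1 / k (Y E x)"

lemma slowness_pos: "F x < E \<Longrightarrow> 0 < slowness E x"
  by (simp add: slowness_def k_pos Y_pos)

lemma continuous_on_slowness:
  assumes "continuous_on S C" "continuous_on S p" "\<And>s. s \<in> S \<Longrightarrow> F (p s) < C s"
  shows "continuous_on S (\<lambda>s. slowness (C s) (p s))"
proof -
  have "continuous_on S (\<lambda>s. k (Y (C s) (p s)))"
    using continuous_on_compose2[OF cont_k continuous_on_Y[OF assms(1,2)]] assms(3) by (simp add: less_imp_le)
  moreover have "k (Y (C s) (p s)) \<noteq> 0" if "s \<in> S" for s
    using k_pos[OF Y_pos[OF assms(3)[OF that]]] by simp
  ultimately show ?thesis unfolding slowness_def by (intro continuous_intros) auto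
qed

lemma continuous_on_slowness1:
  "(\<And>x. x \<in> S \<Longrightarrow> F x < E) \<Longrightarrow> continuous_on S (slowness E)"
  using continuous_on_slowness[of S "\<lambda>_. E" "\<lambda>x. x"] by (simp add: continuous_intros)

text \<open>As the arc stays off the x-axis, x itself is an admissible parameter
  (\<open>a = 1\<close>, \<open>b = 0\<close>), and the travel time is a plain integral of the
  continuous slowness.\<close>

lemma traversal:
  assumes ab: "a \<le> b" and less: "\<And>x. x \<in> {a..b} \<Longrightarrow> F x < E"
    and T: "T = integral {a..b} (slowness E)"
  obtains x where "smooth_sol k f T x (\<lambda>\<tau>. Y E (x \<tau>))" "x 0 = a" "x T = b"
    "strict_mono_on {0..T} x" "x ` {0..T} \<subseteq> {a..b}"
proof -
  define \<theta> where "\<theta> u = integral {a..u} (slowness E)" for u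
  have cs: "continuous_on {a..b} (slowness E)" by (rule continuous_on_slowness1[OF less])
  have d\<theta>: "(\<theta> has_real_derivative slowness E u) (at u)" if u: "u \<in> {a<..<b}" for u
  proof -
    have "(\<theta> has_real_derivative slowness E u) (at u within {a..b})"
      unfolding \<theta>_def using u by (intro integral_has_real_derivative cs) auto
    moreover have "at u within {a..b} = at u" using u by (intro at_within_interior) auto
    ultimately show ?thesis by simp
  qed
  obtain \<upsilon> where \<upsilon>: "\<upsilon> 0 = a" "\<upsilon> T = b" "strict_mono_on {0..T} \<upsilon>" "\<upsilon> ` {0..T} \<subseteq> {a..b}"
    "smooth_sol k f T (\<lambda>\<tau>. \<upsilon> \<tau>) (\<lambda>\<tau>. Y E (\<upsilon> \<tau>))"
  proof (rule smooth_sol_along_curve[of a b "\<lambda>u. u" "Y E" \<theta> K F E 1 0 k f T])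
    show "continuous_on {a..b} (Y E)"
      using continuous_on_Y[of "{a..b}" "\<lambda>_. E" "\<lambda>u. u"] less by (simp add: continuous_intros less_imp_le)
    show "continuous_on {a..b} \<theta>"
      unfolding \<theta>_def by (intro indefinite_integral_continuous_1 integrable_continuous_real cs)
    show "K (Y E u) + F u = E" if "u \<in> {a..b}" for u using Y(2) less[OF that] by simp
    show "0 < 1 * k (Y E u) - 0 * f u" if "u \<in> {a<..<b}" for u
      using k_pos[OF Y_pos[OF less[of u]]] that by simp
    show "(\<theta> has_real_derivative 1 / (1 * k (Y E u) - 0 * f u)) (at u)" if "u \<in> {a<..<b}" for u
      using d\<theta>[OF that] by (simp add: slowness_def)
    show "T = \<theta> b - \<theta> a" by (simp add: T \<theta>_def)
  qed (use ab dK dF in \<open>auto intro!: continuous_intros\<close>)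
  then show ?thesis using that by blast
qed

lemma slowness_integral_mono:
  assumes "a' \<le> a" "b \<le> b'" and "\<And>x. x \<in> {a'..b'} \<Longrightarrow> F x < E"
  shows "integral {a..b} (slowness E) \<le> integral {a'..b'} (slowness E)"
proof (rule integral_subset_le)
  have c: "continuous_on {a'..b'} (slowness E)" by (rule continuous_on_slowness1[OF assms(3)])
  show "slowness E integrable_on {a'..b'}" using c by (rule integrable_continuous_real)
  show "slowness E integrable_on {a..b}"
    using assms(1,2) by (intro integrable_continuous_real continuous_on_subset[OF c]) auto
qed (use assms slowness_pos in \<open>auto intro!: less_imp_le\<close>)

lemma slowness_integral_strict_mono:
  assumes "a \<le> b" "b < b'" and less: "\<And>x. x \<in> {a..b'} \<Longrightarrow> F x < E"
  shows "integral {a..b} (slowness E) < integral {a..b'} (slowness E)"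
proof -
  have "0 < integral {b..b'} (slowness E)"
  proof -
    \<comment> \<open>A vanishing integral would let \<open>traversal\<close> join two different
      abscissae in time 0.\<close>
    obtain x where x: "smooth_sol k f (integral {b..b'} (slowness E)) x (\<lambda>\<tau>. Y E (x \<tau>))" "x 0 = b"
      "x (integral {b..b'} (slowness E)) = b'"
      by (rule traversal[of b b' E, OF _ _ refl]) (use assms in auto)
    then have "0 \<le> integral {b..b'} (slowness E)" "integral {b..b'} (slowness E) \<noteq> 0"
      using assms(2) by (auto simp: smooth_sol_def)
    then show ?thesis by simp
  qed
  moreover have "integral {a..b} (slowness E) + integral {b..b'} (slowness E) = integral {a..b'} (slowness E)"
    using assms by (intro Henstock_Kurzweil_Integration.integral_combine integrable_continuous_real
        continuous_on_slowness1) auto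
  ultimately show ?thesis by simp
qed

end

section \<open>Passage near a saddle\<close>

locale saddle = half_hamiltonian +
  fixes \<delta>0 :: real
  assumes F_0: "F 0 = 0" and F_neg: "\<And>x. x \<noteq> 0 \<Longrightarrow> F x < 0" and \<delta>0: "0 < \<delta>0"
    and no_arrival: "\<And>T x y. smooth_sol k f T x y \<Longrightarrow> x 0 < 0 \<Longrightarrow> - \<delta>0 \<le> x 0 \<Longrightarrow> x T = 0 \<Longrightarrow> y T = 0 \<Longrightarrow>
      (\<And>\<tau>. \<tau> \<in> {0..T} \<Longrightarrow> x 0 \<le> x \<tau> \<and> x \<tau> \<le> 0 \<and> 0 \<le> y \<tau> \<and> K (y \<tau>) + F (x \<tau>) = 0) \<Longrightarrow> False"
begin

lemma F_nonpos: "F x \<le> 0" using F_0 F_neg[of x] by (cases "x = 0") auto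

text \<open>A finite limit of the travel times along the stable manifold would produce a solution that
  reaches the equilibrium in finite time.\<close>

lemma stable_manifold_time_unbounded:
  assumes \<delta>: "0 < \<delta>" "\<delta> \<le> \<delta>0"
  obtains \<epsilon> where "0 < \<epsilon>" "\<epsilon> < \<delta>" "M < integral {-\<delta>..-\<epsilon>} (slowness 0)"
proof (rule ccontr)
  assume no: "\<not> thesis"
  note main = that
  define \<theta> where "\<theta> u = integral {-\<delta>..u} (slowness 0)" for u
  have bnd: "\<theta> u \<le> max M 0" if "u \<in> {-\<delta>..<0}" for u
  proof (cases "u = -\<delta>")
    case True then show ?thesis by (simp add: \<theta>_def)
  next
    case False
    then have "0 < -u" "-u < \<delta>" using that by auto
    then have "\<not> M < integral {-\<delta>..-(-u)} (slowness 0)" using main[of "-u"] no by blast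
    then show ?thesis by (simp add: \<theta>_def)
  qed
  have mono: "\<theta> u \<le> \<theta> u'" if "u \<le> u'" "u' < 0" for u u'
    unfolding \<theta>_def using that F_neg by (intro slowness_integral_mono) auto
  have bdd: "bdd_above (\<theta> ` {-\<delta>..<0})" using bnd by (intro bdd_aboveI2)
  define \<theta>0 where "\<theta>0 = (SUP u\<in>{-\<delta>..<0}. \<theta> u)"
  have up: "\<theta> u \<le> \<theta>0" if "u \<in> {-\<delta>..<0}" for u unfolding \<theta>0_def by (rule cSUP_upper[OF that bdd])
  \<comment> \<open>The clock, extended to the equilibrium by its supremum. Monotonicity makes this
    extension continuous at 0, which is all that \<open>smooth_sol_along_curve\<close> asks of a
    clock at an end.\<close>
  define \<phi> where "\<phi> u = (if u < 0 then \<theta> u else \<theta>0)" for u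
  have cs: "continuous_on {-\<delta>..<0} (slowness 0)" by (rule continuous_on_slowness1) (simp add: F_neg)
  have d\<theta>: "(\<theta> has_real_derivative slowness 0 u) (at u within {-\<delta>..u'})" if "u \<in> {-\<delta>..u'}" "u' < 0" for u u'
    unfolding \<theta>_def using that by (intro integral_has_real_derivative continuous_on_subset[OF cs]) auto
  have c\<phi>: "continuous_on {-\<delta>..0} \<phi>"
    unfolding continuous_on_def
  proof
    fix u assume u: "u \<in> {-\<delta>..0}"
    show "(\<phi> \<longlongrightarrow> \<phi> u) (at u within {-\<delta>..0})"
    proof (cases "u < 0")
      case True
      have "continuous (at u within {-\<delta>..u/2}) \<theta>"
        by (rule DERIV_continuous[OF d\<theta>]) (use u True in auto)
      then have t: "(\<theta> \<longlongrightarrow> \<theta> u) (at u within {-\<delta>..u/2})" by (simp add: continuous_within)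
      have "at u within {-\<delta>..u/2} = at u within {-\<delta>..0}"
        by (rule at_within_nhd[of u "{..<u/2}"]) (use True in auto)
      with t have t: "(\<theta> \<longlongrightarrow> \<phi> u) (at u within {-\<delta>..0})" using True by (simp add: \<phi>_def)
      have "\<forall>\<^sub>F v in at u within {-\<delta>..0}. v \<in> {..<0}"
        by (rule filter_leD[OF at_le[OF subset_UNIV] eventually_at_in_open']) (use True in simp_all)
      then have "\<forall>\<^sub>F v in at u within {-\<delta>..0}. \<theta> v = \<phi> v"
        by eventually_elim (simp add: \<phi>_def)
      then show ?thesis by (rule Lim_transform_eventually[OF t])
    next
      case False
      then have u0: "u = 0" using u by auto
      show ?thesis unfolding u0
      proof (rule order_tendstoI)
        fix l assume "l < \<phi> 0"
        then have "l < \<theta>0" by (simp add: \<phi>_def)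
        then obtain v where v: "v \<in> {-\<delta>..<0}" "l < \<theta> v"
          unfolding \<theta>0_def using less_cSUP_iff[OF _ bdd] \<delta> by auto
        have "\<forall>\<^sub>F w in at 0 within {-\<delta>..0}. w \<in> {v<..}"
          by (rule filter_leD[OF at_le[OF subset_UNIV] eventually_at_in_open']) (use v in simp_all)
        moreover have "\<forall>\<^sub>F w in at 0 within {-\<delta>..0}. w \<in> {-\<delta>..0}" by (simp add: eventually_at_filter)
        ultimately show "\<forall>\<^sub>F w in at 0 within {-\<delta>..0}. l < \<phi> w"
        proof eventually_elim
          case (elim w)
          then show ?case using mono[of v w] v up[OF v(1)] by (auto simp: \<phi>_def)
        qed
      next
        fix l assume "\<phi> 0 < l"
        then have l: "\<theta>0 < l" by (simp add: \<phi>_def)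
        have "\<forall>\<^sub>F w in at 0 within {-\<delta>..0}. w \<in> {-\<delta>..0}" by (simp add: eventually_at_filter)
        then show "\<forall>\<^sub>F w in at 0 within {-\<delta>..0}. \<phi> w < l"
        proof eventually_elim
          case (elim w)
          then show ?case using up[of w] l by (auto simp: \<phi>_def)
        qed
      qed
    qed
  qed
  have d\<phi>: "(\<phi> has_real_derivative 1 / (1 * k (Y 0 u) - 0 * f u)) (at u)" if u: "u \<in> {-\<delta><..<0}" for u
  proof -
    have "at u within {-\<delta>..u/2} = at u" using u by (intro at_within_interior) auto
    then have "(\<theta> has_real_derivative slowness 0 u) (at u)" using d\<theta>[of u "u/2"] u by auto
    then have "(\<phi> has_real_derivative slowness 0 u) (at u)"
      by (rule has_field_derivative_transform_within_open[of _ _ _ "{..<0}"]) (use u in \<open>auto simp: \<phi>_def\<close>)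
    then show ?thesis by (simp add: slowness_def)
  qed
  obtain \<upsilon> where \<upsilon>: "\<upsilon> 0 = -\<delta>" "\<upsilon> (\<phi> 0 - \<phi> (-\<delta>)) = 0" "\<upsilon> ` {0..\<phi> 0 - \<phi> (-\<delta>)} \<subseteq> {-\<delta>..0}"
    "smooth_sol k f (\<phi> 0 - \<phi> (-\<delta>)) (\<lambda>\<tau>. \<upsilon> \<tau>) (\<lambda>\<tau>. Y 0 (\<upsilon> \<tau>))"
  proof (rule smooth_sol_along_curve[of "-\<delta>" 0 "\<lambda>u. u" "Y 0" \<phi> K F 0 1 0 k f "\<phi> 0 - \<phi> (-\<delta>)"])
    show "continuous_on {-\<delta>..0} (Y 0)"
      using continuous_on_Y[of "{-\<delta>..0}" "\<lambda>_. 0" "\<lambda>u. u"] F_nonpos by (simp add: continuous_intros)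
    show "0 < 1 * k (Y 0 u) - 0 * f u" if "u \<in> {-\<delta><..<0}" for u
      using k_pos[OF Y_pos[OF F_neg[of u]]] that by simp
  qed (use \<delta> c\<phi> d\<phi> dK dF Y(2)[OF F_nonpos] in \<open>auto intro!: continuous_intros\<close>)
  show False
  proof (rule no_arrival[OF \<upsilon>(4)])
    show "Y 0 (\<upsilon> (\<phi> 0 - \<phi> (-\<delta>))) = 0" using \<upsilon>(2) F_0 Kinv_0 by (simp add: Y_def)
    show "\<upsilon> 0 \<le> \<upsilon> \<tau> \<and> \<upsilon> \<tau> \<le> 0 \<and> 0 \<le> Y 0 (\<upsilon> \<tau>) \<and> K (Y 0 (\<upsilon> \<tau>)) + F (\<upsilon> \<tau>) = 0"
      if "\<tau> \<in> {0..\<phi> 0 - \<phi> (-\<delta>)}" for \<tau>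
    proof -
      have "\<upsilon> \<tau> \<in> {-\<delta>..0}" using \<upsilon>(3) that by blast
      then show ?thesis using \<upsilon>(1) Y[OF F_nonpos] by auto
    qed
  qed (use \<upsilon>(1,2) \<delta> in auto)
qed

text \<open>\<open>X s\<close> and \<open>E s\<close> are abscissa and energy along the path of
  starts; \<open>X2 e v\<close> is the place where the orbit of energy e meets the v-th level of the
  next annulus. The travel time \<open>T s v\<close> is too long for starts with energy near 0, even
  to the nearest target \<open>v = 0\<close>, and short enough for energy \<open>E1\<close>, even to
  the farthest target \<open>v = 1\<close>; \<open>Xl\<close> bounds the way to the axis there. So
  \<open>stretching\<close> applies to \<open>T\<close>.\<close>

lemma passage:
  fixes X E :: "real \<Rightarrow> real" and X2 :: "real \<Rightarrow> real \<Rightarrow> real"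
  assumes cX: "continuous_on {0..1} X" and cE: "continuous_on {0..1} E"
    and X_le: "\<And>s. s \<in> {0..1} \<Longrightarrow> X s \<le> 0" and E0: "E 0 \<le> 0" and E1: "E1 \<le> E 1" and E1_pos: "0 < E1"
    and X_neg: "\<And>s. s \<in> {0..1} \<Longrightarrow> E s = 0 \<Longrightarrow> X s < 0"
    and cX2: "continuous_on ({0..E1} \<times> {0..1}) (\<lambda>(e, v). X2 e v)"
    and X2_ge: "\<And>e v. e \<in> {0..E1} \<Longrightarrow> v \<in> {0..1} \<Longrightarrow> 0 \<le> X2 e v"
    and X2_mono: "\<And>e. e \<in> {0..E1} \<Longrightarrow> strict_mono_on {0..1} (X2 e)"
    and Xl: "\<And>s. s \<in> {0..1} \<Longrightarrow> E s = E1 \<Longrightarrow> Xl \<le> X s"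
    and time: "integral {Xl..X2 E1 1} (slowness E1) \<le> \<sigma>"
  obtains \<omega> \<nu> :: "real \<Rightarrow> real" where "continuous_on {0..1} \<omega>" "continuous_on {0..1} \<nu>"
    "\<omega> ` {0..1} \<subseteq> {0..1}" "\<nu> ` {0..1} \<subseteq> {0..1}" "\<nu> 0 = 0" "\<nu> 1 = 1"
    "\<And>r. r \<in> {0..1} \<Longrightarrow> 0 < E (\<omega> r) \<and> E (\<omega> r) \<le> E1"
    "\<And>r. r \<in> {0..1} \<Longrightarrow> \<exists>x. smooth_sol k f \<sigma> x (\<lambda>\<tau>. Y (E (\<omega> r)) (x \<tau>)) \<and> x 0 = X (\<omega> r) \<and>
       x \<sigma> = X2 (E (\<omega> r)) (\<nu> r) \<and> strict_mono_on {0..\<sigma>} x \<and> x ` {0..\<sigma>} \<subseteq> {X (\<omega> r)..X2 (E (\<omega> r)) (\<nu> r)}"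
proof -
  obtain a b where ab: "0 \<le> a" "a < b" "b \<le> 1" "E a = 0" "E b = E1"
    and band: "\<And>s. s \<in> {a<..<b} \<Longrightarrow> 0 < E s \<and> E s < E1"
    using crossing_between_levels[OF cE _ E0 E1_pos E1] by auto
  have Xa: "X a < 0" using X_neg ab by auto
  define \<delta> where "\<delta> = min \<delta>0 (- X a / 2)"
  have \<delta>: "0 < \<delta>" "\<delta> \<le> \<delta>0" "X a < - \<delta>" using \<delta>0 Xa by (auto simp: \<delta>_def min_def)
  \<comment> \<open>On the stable manifold the segment from \<open>- \<delta>\<close> to
    \<open>- \<epsilon>\<close> alone takes longer than \<sigma>. The slowness is not singular over
    this compact segment, so the estimate persists for small positive energies.\<close>
  obtain \<epsilon> where \<epsilon>: "0 < \<epsilon>" "\<epsilon> < \<delta>" "\<sigma> < integral {-\<delta>..-\<epsilon>} (slowness 0)"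
    by (rule stable_manifold_time_unbounded[OF \<delta>(1,2), of \<sigma>])
  have less: "F x < e" if "0 < e" for x e using F_nonpos[of x] that by simp
  have cI: "continuous_on {0..E1} (\<lambda>e. integral (cbox (-\<delta>) (-\<epsilon>)) (slowness e))"
  proof (rule integral_continuous_on_param)
    have "continuous_on ({0..E1} \<times> cbox (-\<delta>) (-\<epsilon>)) (\<lambda>z. slowness (fst z) (snd z))"
    proof (rule continuous_on_slowness)
      fix z :: "real \<times> real" assume "z \<in> {0..E1} \<times> cbox (-\<delta>) (-\<epsilon>)"
      then have "snd z \<noteq> 0" "0 \<le> fst z" using \<epsilon> by auto
      then show "F (snd z) < fst z" using F_neg[of "snd z"] by simp
    qed (intro continuous_intros)+
    then show "continuous_on ({0..E1} \<times> cbox (-\<delta>) (-\<epsilon>)) (\<lambda>(e, x). slowness e x)" by (simp add: case_prod_beta)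
  qed
  have sub: "{a..b} \<subseteq> {0..1}" using ab by auto
  have E_rng: "E s \<in> {0..E1}" if "s \<in> {a..b}" for s
  proof -
    have "s = a \<or> s = b \<or> s \<in> {a<..<b}" using that by auto
    then show ?thesis using band[of s] ab E1_pos by (elim disjE) auto
  qed
  \<comment> \<open>The path cannot be used from \<open>a\<close> on: there the energy is 0 and the
    slowness is singular at the origin. It is cut at some \<open>a'' > a\<close> where the energy is
    positive, the start is still left of \<open>- \<delta>\<close>, and crossing the segment still
    takes longer than \<sigma>.\<close>
  obtain a'' where a'': "a < a''" "a'' \<le> b" "X a'' \<le> - \<delta>" "\<sigma> < integral {-\<delta>..-\<epsilon>} (slowness (E a''))"
  proof -
    have "continuous_on {a..b} (\<lambda>s. integral (cbox (-\<delta>) (-\<epsilon>)) (slowness (E s)))"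
      by (rule continuous_on_compose2[OF cI continuous_on_subset[OF cE sub]]) (use E_rng in blast)
    then have "((\<lambda>s. integral (cbox (-\<delta>) (-\<epsilon>)) (slowness (E s))) \<longlongrightarrow> integral (cbox (-\<delta>) (-\<epsilon>)) (slowness (E a))) (at a within {a..b})"
      unfolding continuous_on_def by (rule bspec) (use ab in simp)
    then have 1: "\<forall>\<^sub>F s in at a within {a..b}. \<sigma> < integral (cbox (-\<delta>) (-\<epsilon>)) (slowness (E s))"
      using \<epsilon>(3) ab by (intro order_tendstoD) auto
    have "(X \<longlongrightarrow> X a) (at a within {a..b})"
      using continuous_on_subset[OF cX sub] ab by (auto simp: continuous_on_def)
    then have 2: "\<forall>\<^sub>F s in at a within {a..b}. X s < - \<delta>" using \<delta>(3) by (intro order_tendstoD)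
    have 3: "\<forall>\<^sub>F s in at a within {a..b}. s \<in> {a..b} \<and> s \<noteq> a" by (simp add: eventually_at_filter)
    have "at a within {a..b} \<noteq> bot" using ab by (simp add: at_within_Icc_at_right)
    then have "\<exists>s. \<sigma> < integral (cbox (-\<delta>) (-\<epsilon>)) (slowness (E s)) \<and> X s < - \<delta> \<and> s \<in> {a..b} \<and> s \<noteq> a"
      using eventually_happens[OF eventually_conj[OF 1 eventually_conj[OF 2 3]]] by blast
    then show ?thesis using that by (auto simp: less_eq_real_def)
  qed
  have E_pos: "0 < E s" if "s \<in> {a''..b}" for s
  proof -
    have "s = b \<or> s \<in> {a<..<b}" using that a'' by auto
    then show ?thesis using band[of s] ab E1_pos by auto
  qed
  have sub': "{a''..b} \<subseteq> {0..1}" "{a''..b} \<subseteq> {a..b}" using ab a'' by auto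
  define T where "T s v = integral {X s..X2 (E s) v} (slowness (E s))" for s v
  have le: "X s \<le> X2 (E s) v" if "s \<in> {a''..b}" "v \<in> {0..1}" for s v
    using order_trans[OF X_le[of s] X2_ge[of "E s" v]] E_rng[of s] that sub' by auto
  let ?R = "{a''..b} \<times> {0..1::real}"
  have cT: "continuous_on ?R (\<lambda>(s, v). T s v)"
  proof -
    have cX': "continuous_on ?R (\<lambda>z. X (fst z))"
      by (rule continuous_on_compose2[OF cX]) (use sub' in \<open>auto intro!: continuous_intros\<close>)
    have cE': "continuous_on ?R (\<lambda>z. E (fst z))"
      by (rule continuous_on_compose2[OF cE]) (use sub' in \<open>auto intro!: continuous_intros\<close>)
    have cX2': "continuous_on ?R (\<lambda>z. X2 (E (fst z)) (snd z))"
    proof -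
      have "continuous_on ?R (\<lambda>z. (\<lambda>(e, v). X2 e v) (E (fst z), snd z))"
      proof (rule continuous_on_compose2[OF cX2])
        show "continuous_on ?R (\<lambda>z. (E (fst z), snd z))" by (intro continuous_intros cE')
        show "(\<lambda>z. (E (fst z), snd z)) ` ?R \<subseteq> {0..E1} \<times> {0..1}" using E_rng sub' by force
      qed
      then show ?thesis by simp
    qed
    have "continuous_on ?R (\<lambda>z. integral {X (fst z)..X2 (E (fst z)) (snd z)} (slowness (E (fst z))))"
    proof (rule continuous_on_integral_moving_interval[OF _ cX' cX2'])
      show "continuous_on {X (fst z)..X2 (E (fst z)) (snd z)} (slowness (E (fst z)))" if "z \<in> ?R" for z
        using that E_pos by (intro continuous_on_slowness1 less) auto
      have "continuous_on (?R \<times> {0..1::real}) (\<lambda>w. slowness (E (fst (fst w)))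
          (X (fst (fst w)) + snd w * (X2 (E (fst (fst w))) (snd (fst w)) - X (fst (fst w)))))"
      proof (rule continuous_on_slowness)
        have f: "continuous_on (?R \<times> {0..1::real}) (\<lambda>w. g (fst w))" if "continuous_on ?R g" for g :: "real \<times> real \<Rightarrow> real"
          by (rule continuous_on_compose2[OF that]) (auto intro!: continuous_intros)
        show "continuous_on (?R \<times> {0..1::real}) (\<lambda>w. E (fst (fst w)))" by (rule f[OF cE'])
        show "continuous_on (?R \<times> {0..1::real}) (\<lambda>w. X (fst (fst w)) + snd w * (X2 (E (fst (fst w))) (snd (fst w)) - X (fst (fst w))))"
          by (intro continuous_intros f[OF cX'] f[OF cX2'])
      qed (use E_pos less in auto)
      then show "continuous_on (?R \<times> {0..1}) (\<lambda>(z, r). slowness (E (fst z)) (X (fst z) + r * (X2 (E (fst z)) (snd z) - X (fst z))))"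
        by (simp add: case_prod_beta)
    qed (use le in auto)
    then show ?thesis by (simp add: T_def case_prod_beta)
  qed
  have mT: "strict_mono_on {0..1} (T s)" if s: "s \<in> {a''..b}" for s
  proof (rule strict_mono_onI)
    fix v v' :: real assume v: "v \<in> {0..1}" "v' \<in> {0..1}" "v < v'"
    have "X2 (E s) v < X2 (E s) v'" using strict_mono_onD[OF X2_mono v] E_rng[of s] s sub' by blast
    then show "T s v < T s v'"
      unfolding T_def using le[OF s v(1)] less[OF E_pos[OF s]] by (intro slowness_integral_strict_mono)
  qed
  have T0: "\<sigma> \<le> T a'' 0"
  proof -
    have "integral {-\<delta>..-\<epsilon>} (slowness (E a'')) \<le> T a'' 0"
      unfolding T_def
    proof (rule slowness_integral_mono)
      have "0 \<le> X2 (E a'') 0" using X2_ge E_rng[of a''] a'' by auto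
      then show "- \<epsilon> \<le> X2 (E a'') 0" using \<epsilon> by simp
    qed (use a'' less E_pos in auto)
    then show ?thesis using a'' by simp
  qed
  have T1: "T b 1 \<le> \<sigma>"
  proof -
    have "T b 1 \<le> integral {Xl..X2 E1 1} (slowness E1)"
      unfolding T_def ab(5) using Xl ab less E1_pos by (intro slowness_integral_mono) auto
    then show ?thesis using time by simp
  qed
  obtain \<omega> \<nu> :: "real \<Rightarrow> real" where st: "continuous_on {0..1} \<omega>" "continuous_on {0..1} \<nu>"
    "\<omega> ` {0..1} \<subseteq> {a''..b}" "\<nu> ` {0..1} \<subseteq> {0..1}" "\<nu> 0 = 0" "\<nu> 1 = 1"
    "\<And>r. r \<in> {0..1} \<Longrightarrow> T (\<omega> r) (\<nu> r) = \<sigma>"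
    using stretching[OF a''(2) cT mT T0 T1] by blast
  show ?thesis
  proof (rule that[OF st(1,2) _ st(4,5,6)])
    show "\<omega> ` {0..1} \<subseteq> {0..1}" using st(3) sub' by blast
    fix r :: real assume r: "r \<in> {0..1}"
    have \<omega>r: "\<omega> r \<in> {a''..b}" and \<nu>r: "\<nu> r \<in> {0..1}" using st r by blast+
    show "0 < E (\<omega> r) \<and> E (\<omega> r) \<le> E1" using E_pos[OF \<omega>r] E_rng[of "\<omega> r"] \<omega>r sub' by auto
    obtain x where "smooth_sol k f \<sigma> x (\<lambda>\<tau>. Y (E (\<omega> r)) (x \<tau>))" "x 0 = X (\<omega> r)"
       "x \<sigma> = X2 (E (\<omega> r)) (\<nu> r)" "strict_mono_on {0..\<sigma>} x" "x ` {0..\<sigma>} \<subseteq> {X (\<omega> r)..X2 (E (\<omega> r)) (\<nu> r)}"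
      using traversal[OF le[OF \<omega>r \<nu>r] less[OF E_pos[OF \<omega>r]], of \<sigma>] st(7)[OF r] by (auto simp: T_def)
    then show "\<exists>x. smooth_sol k f \<sigma> x (\<lambda>\<tau>. Y (E (\<omega> r)) (x \<tau>)) \<and> x 0 = X (\<omega> r) \<and>
       x \<sigma> = X2 (E (\<omega> r)) (\<nu> r) \<and> strict_mono_on {0..\<sigma>} x \<and> x ` {0..\<sigma>} \<subseteq> {X (\<omega> r)..X2 (E (\<omega> r)) (\<nu> r)}"
      by blast
  qed
qed

end

section \<open>Symmetries, concatenation and zeros\<close>

text \<open>For equal signs \<sigma>, \<rho> this is the identity or the half turn, which respect
  the direction of time. Opposite signs mean a reflection in an axis, which reverses time; that case
  is \<open>smooth_sol_reverse\<close>.\<close>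

lemma smooth_sol_rotate:
  assumes "smooth_sol (\<lambda>y. \<rho> * h (\<rho> * y)) (\<lambda>x. \<sigma> * f (\<sigma> * x)) T x y" "\<sigma> * \<rho> = 1"
  shows "smooth_sol h f T (\<lambda>\<tau>. \<sigma> * x \<tau>) (\<lambda>\<tau>. \<rho> * y \<tau>)"
  unfolding smooth_sol_def
proof (intro conjI ballI)
  show "0 \<le> T" "continuous_on {0..T} (\<lambda>\<tau>. \<sigma> * x \<tau>)" "continuous_on {0..T} (\<lambda>\<tau>. \<rho> * y \<tau>)"
    using assms(1) by (auto simp: smooth_sol_def intro!: continuous_intros)
  fix \<tau> assume "\<tau> \<in> {0<..<T}"
  then have d: "(x has_real_derivative \<rho> * h (\<rho> * y \<tau>)) (at \<tau>)" "(y has_real_derivative - (\<sigma> * f (\<sigma> * x \<tau>))) (at \<tau>)"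
    using assms(1) by (auto simp: smooth_sol_def)
  have "((\<lambda>\<tau>. \<sigma> * x \<tau>) has_real_derivative (\<sigma> * \<rho>) * h (\<rho> * y \<tau>)) (at \<tau>)"
    using DERIV_cmult[OF d(1), of \<sigma>] by (simp add: mult.assoc)
  then show "((\<lambda>\<tau>. \<sigma> * x \<tau>) has_real_derivative h (\<rho> * y \<tau>)) (at \<tau>)" using assms(2) by simp
  have "((\<lambda>\<tau>. \<rho> * y \<tau>) has_real_derivative - ((\<sigma> * \<rho>) * f (\<sigma> * x \<tau>))) (at \<tau>)"
    using DERIV_cmult[OF d(2), of \<rho>] by (simp add: ac_simps)
  then show "((\<lambda>\<tau>. \<rho> * y \<tau>) has_real_derivative - f (\<sigma> * x \<tau>)) (at \<tau>)" using assms(2) by simp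
qed

lemma smooth_sol_reverse:
  assumes "smooth_sol (\<lambda>y. \<rho> * h (\<rho> * y)) (\<lambda>x. \<sigma> * f (\<sigma> * x)) T x y" "\<sigma> * \<rho> = - 1"
  shows "smooth_sol h f T (\<lambda>\<tau>. \<sigma> * x (T - \<tau>)) (\<lambda>\<tau>. \<rho> * y (T - \<tau>))"
  unfolding smooth_sol_def
proof (intro conjI ballI)
  have c: "continuous_on {0..T} x" "continuous_on {0..T} y" using assms(1) by (auto simp: smooth_sol_def)
  show "0 \<le> T" using assms(1) by (simp add: smooth_sol_def)
  show "continuous_on {0..T} (\<lambda>\<tau>. \<sigma> * x (T - \<tau>))"
    by (intro continuous_intros continuous_on_compose2[OF c(1)]) auto
  show "continuous_on {0..T} (\<lambda>\<tau>. \<rho> * y (T - \<tau>))"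
    by (intro continuous_intros continuous_on_compose2[OF c(2)]) auto
  fix \<tau> assume "\<tau> \<in> {0<..<T}"
  then have d: "(x has_real_derivative \<rho> * h (\<rho> * y (T - \<tau>))) (at (T - \<tau>))"
    "(y has_real_derivative - (\<sigma> * f (\<sigma> * x (T - \<tau>)))) (at (T - \<tau>))"
    using assms(1) by (auto simp: smooth_sol_def)
  have r: "((\<lambda>\<tau>. T - \<tau>) has_real_derivative - 1) (at \<tau>)" by (auto intro!: derivative_eq_intros)
  have "((\<lambda>\<tau>. \<sigma> * x (T - \<tau>)) has_real_derivative - (\<sigma> * \<rho>) * h (\<rho> * y (T - \<tau>))) (at \<tau>)"
    using DERIV_cmult[OF DERIV_chain2[OF d(1) r], of \<sigma>] by (simp add: mult.assoc)
  then show "((\<lambda>\<tau>. \<sigma> * x (T - \<tau>)) has_real_derivative h (\<rho> * y (T - \<tau>))) (at \<tau>)" using assms(2) by simp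
  have "((\<lambda>\<tau>. \<rho> * y (T - \<tau>)) has_real_derivative (\<sigma> * \<rho>) * f (\<sigma> * x (T - \<tau>))) (at \<tau>)"
    using DERIV_cmult[OF DERIV_chain2[OF d(2) r], of \<rho>] by (simp add: ac_simps)
  then show "((\<lambda>\<tau>. \<rho> * y (T - \<tau>)) has_real_derivative - f (\<sigma> * x (T - \<tau>))) (at \<tau>)" using assms(2) by simp
qed

lemma has_exactly_zeros_cong:
  "(\<And>\<tau>. \<tau> \<in> A \<Longrightarrow> u \<tau> = v \<tau>) \<Longrightarrow> has_exactly_zeros u A n \<longleftrightarrow> has_exactly_zeros v A n"
proof -
  assume "\<And>\<tau>. \<tau> \<in> A \<Longrightarrow> u \<tau> = v \<tau>"
  then have "{\<tau> \<in> A. u \<tau> = 0} = {\<tau> \<in> A. v \<tau> = 0}" by auto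
  then show ?thesis by (simp add: has_exactly_zeros_def)
qed

lemma has_exactly_zeros_Un:
  assumes "has_exactly_zeros u A n" "has_exactly_zeros u B m" "A \<inter> B = {}"
  shows "has_exactly_zeros u (A \<union> B) (n + m)"
proof -
  have "{\<tau> \<in> A \<union> B. u \<tau> = 0} = {\<tau> \<in> A. u \<tau> = 0} \<union> {\<tau> \<in> B. u \<tau> = 0}" by auto
  moreover have "{\<tau> \<in> A. u \<tau> = 0} \<inter> {\<tau> \<in> B. u \<tau> = 0} = {}" using assms(3) by auto
  ultimately show ?thesis using assms(1,2) by (simp add: has_exactly_zeros_def card_Un_disjoint)
qed

lemma has_exactly_zeros_shift:
  fixes u :: "real \<Rightarrow> real"
  shows "has_exactly_zeros u ((+) d ` A) n \<longleftrightarrow> has_exactly_zeros (\<lambda>\<tau>. u (d + \<tau>)) A n"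
proof -
  have "{\<tau> \<in> (+) d ` A. u \<tau> = 0} = (+) d ` {\<tau> \<in> A. u (d + \<tau>) = 0}" by auto
  then show ?thesis by (simp add: has_exactly_zeros_def card_image finite_image_iff)
qed

lemma has_exactly_zeros_empty: "has_exactly_zeros u {} 0"
  by (simp add: has_exactly_zeros_def)

lemma has_exactly_zeros_singleton:
  "has_exactly_zeros u {\<tau>} (if u \<tau> = 0 then 1 else 0)"
proof -
  have "{\<tau>' \<in> {\<tau>}. u \<tau>' = 0} = (if u \<tau> = 0 then {\<tau>} else {})" by auto
  then show ?thesis by (simp add: has_exactly_zeros_def)
qed

lemma has_exactly_zeros_none: "(\<And>\<tau>. \<tau> \<in> A \<Longrightarrow> u \<tau> \<noteq> 0) \<Longrightarrow> has_exactly_zeros u A 0"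
proof -
  assume "\<And>\<tau>. \<tau> \<in> A \<Longrightarrow> u \<tau> \<noteq> 0"
  then have e: "{\<tau> \<in> A. u \<tau> = 0} = {}" by auto
  show ?thesis unfolding has_exactly_zeros_def e by simp
qed

text \<open>The exceptional set collects the joints of concatenated pieces; at the ends of a gap
  \<open>y'\<close> really jumps with the weight. The right-hand side \<open>w\<close> depends on
  time for the same reason.\<close>

definition piecewise_sol ::
  "(real \<Rightarrow> real) \<Rightarrow> (real \<Rightarrow> real \<Rightarrow> real) \<Rightarrow> real \<Rightarrow> real \<Rightarrow> (real \<Rightarrow> real) \<Rightarrow> (real \<Rightarrow> real) \<Rightarrow> bool" where
  "piecewise_sol h w a b x y \<longleftrightarrow> a \<le> b \<and> continuous_on {a..b} x \<and> continuous_on {a..b} y \<and>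
     (\<exists>N. finite N \<and> (\<forall>\<tau>\<in>{a<..<b} - N. (x has_real_derivative h (y \<tau>)) (at \<tau>) \<and>
        (y has_real_derivative w \<tau> (x \<tau>)) (at \<tau>)))"

lemma piecewise_sol_of_smooth: "smooth_sol h f T x y \<Longrightarrow> piecewise_sol h (\<lambda>_ x. - f x) 0 T x y"
  unfolding smooth_sol_def piecewise_sol_def by (intro conjI exI[of _ "{}"]) simp_all

lemma piecewise_sol_cong:
  assumes sol: "piecewise_sol h w a b x y"
    and eq: "\<And>\<tau>. \<tau> \<in> {a..b} \<Longrightarrow> x' \<tau> = x \<tau> \<and> y' \<tau> = y \<tau>"
    and w: "\<And>\<tau>. \<tau> \<in> {a<..<b} \<Longrightarrow> w' \<tau> = w \<tau>"
  shows "piecewise_sol h w' a b x' y'"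
proof -
  obtain N where N: "finite N" "\<And>\<tau>. \<tau> \<in> {a<..<b} - N \<Longrightarrow> (x has_real_derivative h (y \<tau>)) (at \<tau>) \<and>
        (y has_real_derivative w \<tau> (x \<tau>)) (at \<tau>)"
    using sol unfolding piecewise_sol_def by blast
  have "(x' has_real_derivative h (y' \<tau>)) (at \<tau>) \<and> (y' has_real_derivative w' \<tau> (x' \<tau>)) (at \<tau>)"
    if \<tau>: "\<tau> \<in> {a<..<b} - N" for \<tau>
  proof -
    have i: "\<tau> \<in> {a<..<b}" using \<tau> by simp
    have "(x' has_real_derivative h (y \<tau>)) (at \<tau>)" "(y' has_real_derivative w \<tau> (x \<tau>)) (at \<tau>)"
      using N(2)[OF \<tau>] eq by (auto intro: has_field_derivative_transform_within_open[OF _ open_greaterThanLessThan i])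
    then show ?thesis using eq[of \<tau>] w[OF i] i by auto
  qed
  moreover have "continuous_on {a..b} x'" "continuous_on {a..b} y'"
    using sol eq continuous_on_eq[of "{a..b}" x x'] continuous_on_eq[of "{a..b}" y y']
    by (simp_all add: piecewise_sol_def)
  moreover have "a \<le> b" using sol by (simp add: piecewise_sol_def)
  ultimately show ?thesis using N(1) unfolding piecewise_sol_def by (intro conjI exI[of _ N] ballI) simp_all
qed

lemma piecewise_sol_join:
  assumes "piecewise_sol h w a b x y" "piecewise_sol h w b c x y"
  shows "piecewise_sol h w a c x y"
proof -
  obtain N M where N: "finite N" "finite M" "\<And>\<tau>. \<tau> \<in> {a<..<b} - N \<Longrightarrow> (x has_real_derivative h (y \<tau>)) (at \<tau>) \<and>
        (y has_real_derivative w \<tau> (x \<tau>)) (at \<tau>)"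
     "\<And>\<tau>. \<tau> \<in> {b<..<c} - M \<Longrightarrow> (x has_real_derivative h (y \<tau>)) (at \<tau>) \<and>
        (y has_real_derivative w \<tau> (x \<tau>)) (at \<tau>)"
    using assms unfolding piecewise_sol_def by blast
  have ac: "a \<le> b" "b \<le> c" using assms by (auto simp: piecewise_sol_def)
  then have U: "{a..c} = {a..b} \<union> {b..c}" by auto
  have "continuous_on {a..c} x" "continuous_on {a..c} y"
    unfolding U using assms by (auto simp: piecewise_sol_def intro!: continuous_on_closed_Un)
  moreover have "(x has_real_derivative h (y \<tau>)) (at \<tau>) \<and> (y has_real_derivative w \<tau> (x \<tau>)) (at \<tau>)"
    if "\<tau> \<in> {a<..<c} - (N \<union> M \<union> {b})" for \<tau>
    using N(3)[of \<tau>] N(4)[of \<tau>] that by (cases "\<tau> < b") auto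
  ultimately show ?thesis using ac N(1,2) unfolding piecewise_sol_def
    by (intro conjI exI[of _ "N \<union> M \<union> {b}"] ballI) simp_all
qed

lemma piecewise_sol_shift:
  assumes "piecewise_sol h w a b x y"
  shows "piecewise_sol h (\<lambda>\<tau>. w (\<tau> - d)) (a + d) (b + d) (\<lambda>\<tau>. x (\<tau> - d)) (\<lambda>\<tau>. y (\<tau> - d))"
proof -
  obtain N where N: "finite N" "\<And>\<tau>. \<tau> \<in> {a<..<b} - N \<Longrightarrow> (x has_real_derivative h (y \<tau>)) (at \<tau>) \<and>
        (y has_real_derivative w \<tau> (x \<tau>)) (at \<tau>)"
    using assms unfolding piecewise_sol_def by blast
  have c: "continuous_on {a..b} x" "continuous_on {a..b} y" "a \<le> b" using assms by (auto simp: piecewise_sol_def)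
  have "((\<lambda>\<tau>. x (\<tau> - d)) has_real_derivative h (y (\<tau> - d))) (at \<tau>) \<and>
        ((\<lambda>\<tau>. y (\<tau> - d)) has_real_derivative w (\<tau> - d) (x (\<tau> - d))) (at \<tau>)"
    if "\<tau> \<in> {a + d<..<b + d} - (+) d ` N" for \<tau>
  proof -
    have "\<tau> - d \<in> {a<..<b} - N" using that by (auto simp: image_iff)
    note D = N(2)[OF this]
    have r: "((\<lambda>\<tau>. \<tau> - d) has_real_derivative 1) (at \<tau>)" by (auto intro!: derivative_eq_intros)
    show ?thesis using DERIV_chain2[OF conjunct1[OF D] r] DERIV_chain2[OF conjunct2[OF D] r] by simp
  qed
  moreover have "continuous_on {a + d..b + d} (\<lambda>\<tau>. x (\<tau> - d))" "continuous_on {a + d..b + d} (\<lambda>\<tau>. y (\<tau> - d))"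
    by (auto intro!: continuous_intros continuous_on_compose2[OF c(1)] continuous_on_compose2[OF c(2)])
  ultimately show ?thesis using c(3) N(1) unfolding piecewise_sol_def
    by (intro conjI exI[of _ "(+) d ` N"] ballI) simp_all
qed

fun xsign :: "quadrant \<Rightarrow> real" where
  "xsign QI = 1" | "xsign QII = - 1" | "xsign QIII = - 1" | "xsign QIV = 1"

fun ysign :: "quadrant \<Rightarrow> real" where
  "ysign QI = 1" | "ysign QII = 1" | "ysign QIII = - 1" | "ysign QIV = - 1"

lemma sign_cases: "xsign q = 1 \<or> xsign q = - 1" "ysign q = 1 \<or> ysign q = - 1" by (cases q; simp)+

section \<open>The twist of an annulus\<close>

locale annulus_flow =
  fixes h H f F :: "real \<Rightarrow> real" and c1 c2 :: real and xm xp :: "real \<Rightarrow> real"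
  assumes h: "restoring h" and dH: "\<And>y. (H has_real_derivative h y) (at y)" and H0: "H 0 = 0"
    and dF: "\<And>x. (F has_real_derivative f x) (at x)" and cf: "continuous_on UNIV f"
    and c12: "c1 < c2"
    and xm_neg: "\<And>c. c \<in> {c1..c2} \<Longrightarrow> xm c < 0" and xp_pos: "\<And>c. c \<in> {c1..c2} \<Longrightarrow> 0 < xp c"
    and F_xm: "\<And>c. c \<in> {c1..c2} \<Longrightarrow> F (xm c) = c" and F_xp: "\<And>c. c \<in> {c1..c2} \<Longrightarrow> F (xp c) = c"
    and F_less: "\<And>c x. c \<in> {c1..c2} \<Longrightarrow> x \<in> {xm c<..<xp c} \<Longrightarrow> F x < c"
    and f_xm: "\<And>c. c \<in> {c1..c2} \<Longrightarrow> f (xm c) < 0" and f_xp: "\<And>c. c \<in> {c1..c2} \<Longrightarrow> 0 < f (xp c)"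
begin

definition X :: "quadrant \<Rightarrow> real \<Rightarrow> real" where
  "X q c = (if xsign q = 1 then xp c else - xm c)"

text \<open>Multiplying each coordinate by its sign in q maps the quadrant onto the first one and
  conjugates \<open>h\<close> and \<open>f\<close> with these signs, so a single analysis serves for
  all four quadrants.\<close>

lemma quadrant_annulus_refl:
  "quadrant_annulus (\<lambda>y. ysign q * h (ysign q * y)) (\<lambda>y. H (ysign q * y))
     (\<lambda>x. xsign q * f (xsign q * x)) (\<lambda>x. F (xsign q * x)) c1 c2 (X q)"
proof unfold_locales
  show "restoring (\<lambda>y. ysign q * h (ysign q * y))"
    using h restoring_reflect[OF h] sign_cases(2)[of q] by auto
  show "((\<lambda>y. H (ysign q * y)) has_real_derivative ysign q * h (ysign q * y)) (at y)" for y
  proof -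
    have "((\<lambda>y. ysign q * y) has_real_derivative ysign q) (at y)" by (auto intro!: derivative_eq_intros)
    from DERIV_chain2[OF dH this] show ?thesis by (simp add: mult.commute)
  qed
  show "((\<lambda>x. F (xsign q * x)) has_real_derivative xsign q * f (xsign q * x)) (at x)" for x
  proof -
    have "((\<lambda>x. xsign q * x) has_real_derivative xsign q) (at x)" by (auto intro!: derivative_eq_intros)
    from DERIV_chain2[OF dF this] show ?thesis by (simp add: mult.commute)
  qed
  show "continuous_on UNIV (\<lambda>x. xsign q * f (xsign q * x))"
    by (intro continuous_intros continuous_on_compose2[OF cf]) auto
  show "H (ysign q * 0) = 0" by (simp add: H0)
  fix c assume c: "c \<in> {c1..c2}"
  show "0 < X q c" "F (xsign q * X q c) = c" "0 < xsign q * f (xsign q * X q c)"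
    using xm_neg[OF c] xp_pos[OF c] F_xm[OF c] F_xp[OF c] f_xm[OF c] f_xp[OF c] sign_cases(1)[of q]
    by (auto simp: X_def)
  show "F (xsign q * x) < c" if "0 \<le> x" "x < X q c" for x
    using F_less[OF c, of "xsign q * x"] that xm_neg[OF c] xp_pos[OF c] sign_cases(1)[of q] by (auto simp: X_def)
qed

text \<open>\<open>pos q c v\<close>, \<open>v\<close> from 0 to 1, runs clockwise through the part of the orbit \<open>c\<close> in the
  quadrant \<open>q\<close>; in quadrants I and III this is away from the \<open>y\<close>-axis.\<close>

definition param :: "quadrant \<Rightarrow> real \<Rightarrow> real" where
  "param q v = (if xsign q = ysign q then v else 1 - v)"

definition pos :: "quadrant \<Rightarrow> real \<Rightarrow> real \<Rightarrow> real \<times> real" where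
  "pos q c v = (xsign q * (param q v * X q c),
     ysign q * half_hamiltonian.Y (\<lambda>y. H (ysign q * y)) (\<lambda>x. F (xsign q * x)) c (param q v * X q c))"

definition arc_time :: "quadrant \<Rightarrow> (real \<Rightarrow> real \<Rightarrow> real) \<Rightarrow> bool" where
  "arc_time q T \<longleftrightarrow> continuous_on ({c1..c2} \<times> {0..1}) (\<lambda>(c, v). T c v) \<and>
     (\<forall>c\<in>{c1..c2}. T c 0 = 0 \<and> strict_mono_on {0..1} (T c) \<and>
        (\<forall>\<rho>. (\<forall>x y. xm c < x \<and> x < xp c \<and> 0 < xsign q * x \<and> 0 < ysign q * y \<and> H y + F x = c \<longrightarrow>
                \<rho> x = 1 / (ysign q * h y)) \<longrightarrow>
              (if xsign q = 1 then LBINT x=0..xp c. \<rho> x else LBINT x=xm c..0. \<rho> x) = T c 1) \<and>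
        (\<forall>v v'. 0 \<le> v \<and> v \<le> v' \<and> v' \<le> 1 \<longrightarrow> (\<exists>x y. smooth_sol h f (T c v' - T c v) x y \<and>
           (x 0, y 0) = pos q c v \<and> (x (T c v' - T c v), y (T c v' - T c v)) = pos q c v' \<and>
           (\<forall>\<tau>\<in>{0..T c v' - T c v}. H (y \<tau>) + F (x \<tau>) = c \<and> x \<tau> \<in> {xm c..xp c}) \<and>
           (\<forall>\<tau>\<in>{0<..<T c v' - T c v}. 0 < xsign q * x \<tau> \<and> 0 < ysign q * y \<tau>))))"

lemma arc_time_exists: "\<exists>T. arc_time q T"
proof -
  let ?\<sigma> = "xsign q" and ?\<rho> = "ysign q"
  interpret Q: quadrant_annulus "\<lambda>y. ?\<rho> * h (?\<rho> * y)" "\<lambda>y. H (?\<rho> * y)"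
     "\<lambda>x. ?\<sigma> * f (?\<sigma> * x)" "\<lambda>x. F (?\<sigma> * x)" c1 c2 "X q"
    by (rule quadrant_annulus_refl)
  obtain el where el: "Q.elapsed_time el" using Q.elapsed_time_exists by blast
  have cel: "continuous_on ({c1..c2} \<times> {0..1}) (\<lambda>(c, v). el c v)" using el by (simp add: Q.elapsed_time_def)
  have el0: "el c 0 = 0" and mel: "strict_mono_on {0..1} (el c)" if "c \<in> {c1..c2}" for c
    using el that by (auto simp: Q.elapsed_time_def)
  have time: "(LBINT x=0..X q c. \<rho> x) = el c 1"
    if "c \<in> {c1..c2}" "\<And>x. x \<in> {0<..<X q c} \<Longrightarrow> \<rho> x = 1 / (?\<rho> * h (?\<rho> * Q.Y c x))" for c \<rho>
    using el that by (simp add: Q.elapsed_time_def)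
  have sol: "\<exists>x y. smooth_sol (\<lambda>y. ?\<rho> * h (?\<rho> * y)) (\<lambda>x. ?\<sigma> * f (?\<sigma> * x)) (el c v' - el c v) x y \<and>
           x 0 = v * X q c \<and> x (el c v' - el c v) = v' * X q c \<and>
           (\<forall>\<tau>\<in>{0..el c v' - el c v}. 0 \<le> x \<tau> \<and> x \<tau> \<le> X q c \<and> y \<tau> = Q.Y c (x \<tau>)) \<and>
           (\<forall>\<tau>\<in>{0<..<el c v' - el c v}. 0 < x \<tau> \<and> x \<tau> < X q c)"
    if "c \<in> {c1..c2}" "0 \<le> v" "v \<le> v'" "v' \<le> 1" for c v v'
    using el that unfolding Q.elapsed_time_def by blast
  have sg: "?\<sigma> * ?\<sigma> = 1" "?\<rho> * ?\<rho> = 1" using sign_cases[of q] by auto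
  have Fle: "F (?\<sigma> * x) \<le> c" if "c \<in> {c1..c2}" "0 \<le> x" "x \<le> X q c" for c x
    using Q.F_less[OF that(1,2)] Q.F_X[OF that(1)] that(3) by (cases "x = X q c") auto
  have rng: "?\<sigma> * x \<in> {xm c..xp c}" if "c \<in> {c1..c2}" "0 \<le> x" "x \<le> X q c" for c x
    using that xm_neg[of c] xp_pos[of c] sign_cases(1)[of q] by (auto simp: X_def)
  have state: "H (?\<rho> * Q.Y c x) + F (?\<sigma> * x) = c" if "c \<in> {c1..c2}" "0 \<le> x" "x \<le> X q c" for c x
    using Q.Y(2)[OF Fle[OF that]] .
  have ypos: "0 < Q.Y c x" if "c \<in> {c1..c2}" "0 < x" "x < X q c" for c x
    using Q.Y_pos[OF Q.F_less[OF that(1)]] that by auto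
  \<comment> \<open>In quadrants II and IV the clockwise motion runs towards the y-axis, opposite to
    that of the first quadrant onto which they are reflected; there the time is measured backwards
    from the end.\<close>
  define T where "T c v = (if ?\<sigma> = ?\<rho> then el c v else el c 1 - el c (1 - v))" for c v
  have "continuous_on ({c1..c2} \<times> {0..1}) (\<lambda>(c, v). T c v)"
  proof (cases "?\<sigma> = ?\<rho>")
    case True then show ?thesis using cel by (simp add: T_def)
  next
    case False
    have "continuous_on ({c1..c2} \<times> {0..1}) (\<lambda>z. (\<lambda>(c, v). el c v) (fst z, 1) - (\<lambda>(c, v). el c v) (fst z, 1 - snd z))"
      by (intro continuous_on_diff continuous_on_compose2[OF cel]) (auto intro!: continuous_intros)
    then show ?thesis using False by (simp add: T_def case_prod_beta)
  qed
  moreover have "T c 0 = 0" if "c \<in> {c1..c2}" for c using el0[OF that] by (simp add: T_def)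
  moreover have "strict_mono_on {0..1} (T c)" if "c \<in> {c1..c2}" for c
    using mel[OF that] by (auto simp: T_def strict_mono_on_def)
  moreover have "(if ?\<sigma> = 1 then LBINT x=0..xp c. \<rho> x else LBINT x=xm c..0. \<rho> x) = T c 1"
    if c: "c \<in> {c1..c2}" and \<rho>: "\<forall>x y. xm c < x \<and> x < xp c \<and> 0 < ?\<sigma> * x \<and> 0 < ?\<rho> * y \<and> H y + F x = c \<longrightarrow>
                \<rho> x = 1 / (?\<rho> * h y)" for c \<rho>
  proof -
    have T1: "T c 1 = el c 1" using el0[OF c] by (simp add: T_def)
    have "(LBINT x=0..X q c. \<rho> (?\<sigma> * x)) = el c 1"
    proof (rule time[OF c])
      fix x assume x: "x \<in> {0<..<X q c}"
      have s: "H (?\<rho> * Q.Y c x) + F (?\<sigma> * x) = c" using state[OF c] x by auto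
      have "xm c < ?\<sigma> * x" "?\<sigma> * x < xp c" using x xm_neg[OF c] xp_pos[OF c] sign_cases(1)[of q] by (auto simp: X_def)
      moreover have "0 < ?\<sigma> * (?\<sigma> * x)" "0 < ?\<rho> * (?\<rho> * Q.Y c x)"
        using x ypos[OF c, of x] sg by (simp_all add: mult.assoc[symmetric])
      ultimately show "\<rho> (?\<sigma> * x) = 1 / (?\<rho> * h (?\<rho> * Q.Y c x))" using \<rho> s by blast
    qed
    moreover have "(LBINT x=0..X q c. \<rho> (?\<sigma> * x)) = (if ?\<sigma> = 1 then LBINT x=0..xp c. \<rho> x else LBINT x=xm c..0. \<rho> x)"
    proof (cases "?\<sigma> = 1")
      case True then show ?thesis by (simp add: X_def)
    next
      case False
      then have "?\<sigma> = - 1" using sign_cases(1)[of q] by auto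
      then show ?thesis using interval_integral_reflect[of "ereal (xm c)" 0 \<rho>] by (simp add: X_def)
    qed
    ultimately show ?thesis using T1 by simp
  qed
  moreover have "\<exists>x y. smooth_sol h f (T c v' - T c v) x y \<and>
           (x 0, y 0) = pos q c v \<and> (x (T c v' - T c v), y (T c v' - T c v)) = pos q c v' \<and>
           (\<forall>\<tau>\<in>{0..T c v' - T c v}. H (y \<tau>) + F (x \<tau>) = c \<and> x \<tau> \<in> {xm c..xp c}) \<and>
           (\<forall>\<tau>\<in>{0<..<T c v' - T c v}. 0 < ?\<sigma> * x \<tau> \<and> 0 < ?\<rho> * y \<tau>)"
    if c: "c \<in> {c1..c2}" and v: "0 \<le> v \<and> v \<le> v' \<and> v' \<le> 1" for c v v'
  proof (cases "?\<sigma> = ?\<rho>")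
    case True
    obtain x y where xy: "smooth_sol (\<lambda>y. ?\<rho> * h (?\<rho> * y)) (\<lambda>x. ?\<sigma> * f (?\<sigma> * x)) (el c v' - el c v) x y"
      "x 0 = v * X q c" "x (el c v' - el c v) = v' * X q c"
      "\<And>\<tau>. \<tau> \<in> {0..el c v' - el c v} \<Longrightarrow> 0 \<le> x \<tau> \<and> x \<tau> \<le> X q c \<and> y \<tau> = Q.Y c (x \<tau>)"
      "\<And>\<tau>. \<tau> \<in> {0<..<el c v' - el c v} \<Longrightarrow> 0 < x \<tau> \<and> x \<tau> < X q c"
      using sol[OF c, of v v'] v by blast
    have T: "T c v' - T c v = el c v' - el c v" using True by (simp add: T_def)
    have nn: "0 \<le> el c v' - el c v" using xy(1) by (simp add: smooth_sol_def)
    show ?thesis unfolding T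
    proof (intro exI conjI ballI)
      show "smooth_sol h f (el c v' - el c v) (\<lambda>\<tau>. ?\<sigma> * x \<tau>) (\<lambda>\<tau>. ?\<rho> * y \<tau>)"
        by (rule smooth_sol_rotate[OF xy(1)]) (use True sg in simp)
      show "(?\<sigma> * x 0, ?\<rho> * y 0) = pos q c v"
        using xy(2) xy(4)[of 0] nn True by (simp add: pos_def param_def)
      show "(?\<sigma> * x (el c v' - el c v), ?\<rho> * y (el c v' - el c v)) = pos q c v'"
        using xy(3) xy(4)[of "el c v' - el c v"] nn True by (simp add: pos_def param_def)
      fix \<tau>
      show "H (?\<rho> * y \<tau>) + F (?\<sigma> * x \<tau>) = c" "?\<sigma> * x \<tau> \<in> {xm c..xp c}" if "\<tau> \<in> {0..el c v' - el c v}"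
        using state[OF c, of "x \<tau>"] rng[OF c, of "x \<tau>"] xy(4)[OF that] by auto
      show "0 < ?\<sigma> * (?\<sigma> * x \<tau>)" "0 < ?\<rho> * (?\<rho> * y \<tau>)" if "\<tau> \<in> {0<..<el c v' - el c v}"
        using xy(4)[of \<tau>] xy(5)[OF that] ypos[OF c, of "x \<tau>"] sg that by (simp_all add: mult.assoc[symmetric])
    qed
  next
    case False
    define D where "D = el c (1 - v) - el c (1 - v')"
    obtain x y where xy: "smooth_sol (\<lambda>y. ?\<rho> * h (?\<rho> * y)) (\<lambda>x. ?\<sigma> * f (?\<sigma> * x)) D x y"
      "x 0 = (1 - v') * X q c" "x D = (1 - v) * X q c"
      "\<And>\<tau>. \<tau> \<in> {0..D} \<Longrightarrow> 0 \<le> x \<tau> \<and> x \<tau> \<le> X q c \<and> y \<tau> = Q.Y c (x \<tau>)"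
      "\<And>\<tau>. \<tau> \<in> {0<..<D} \<Longrightarrow> 0 < x \<tau> \<and> x \<tau> < X q c"
      using sol[OF c, of "1 - v'" "1 - v"] v unfolding D_def[symmetric] by auto
    have T: "T c v' - T c v = D" using False by (simp add: T_def D_def)
    have nn: "0 \<le> D" using xy(1) by (simp add: smooth_sol_def)
    show ?thesis unfolding T
    proof (intro exI conjI ballI)
      show "smooth_sol h f D (\<lambda>\<tau>. ?\<sigma> * x (D - \<tau>)) (\<lambda>\<tau>. ?\<rho> * y (D - \<tau>))"
        by (rule smooth_sol_reverse[OF xy(1)]) (use False sign_cases[of q] in auto)
      show "(?\<sigma> * x (D - 0), ?\<rho> * y (D - 0)) = pos q c v"
        using xy(3) xy(4)[of D] nn False by (simp add: pos_def param_def)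
      show "(?\<sigma> * x (D - D), ?\<rho> * y (D - D)) = pos q c v'"
        using xy(2) xy(4)[of 0] nn False by (simp add: pos_def param_def)
      fix \<tau>
      show "H (?\<rho> * y (D - \<tau>)) + F (?\<sigma> * x (D - \<tau>)) = c" "?\<sigma> * x (D - \<tau>) \<in> {xm c..xp c}" if "\<tau> \<in> {0..D}"
        using state[OF c, of "x (D - \<tau>)"] rng[OF c, of "x (D - \<tau>)"] xy(4)[of "D - \<tau>"] that by auto
      show "0 < ?\<sigma> * (?\<sigma> * x (D - \<tau>))" "0 < ?\<rho> * (?\<rho> * y (D - \<tau>))" if "\<tau> \<in> {0<..<D}"
        using xy(4)[of "D - \<tau>"] xy(5)[of "D - \<tau>"] ypos[OF c, of "x (D - \<tau>)"] sg that
        by (simp_all add: mult.assoc[symmetric])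
    qed
  qed
  ultimately have "arc_time q T" unfolding arc_time_def by (intro conjI ballI allI impI) blast+
  then show ?thesis by blast
qed

text \<open>Consecutive quadrants share a half-axis. If it lies on the x-axis, both heights vanish
  and \<open>X\<close> agrees because \<open>xsign\<close> does; if on the y-axis, the height
  depends on \<open>ysign\<close> alone, which agrees.\<close>

lemma pos_1_eq_pos_0:
  assumes c: "c \<in> {c1..c2}" shows "pos q c 1 = pos (qsucc q) c 0"
proof -
  have z: "half_hamiltonian.Y (\<lambda>y. H (ysign p * y)) (\<lambda>x. F (xsign p * x)) c (X p c) = 0" for p
  proof -
    interpret Q: quadrant_annulus "\<lambda>y. ysign p * h (ysign p * y)" "\<lambda>y. H (ysign p * y)"
     "\<lambda>x. xsign p * f (xsign p * x)" "\<lambda>x. F (xsign p * x)" c1 c2 "X p"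
      by (rule quadrant_annulus_refl)
    show ?thesis using Q.F_X[OF c] Q.Kinv_0 by (simp add: Q.Y_def)
  qed
  have y0: "half_hamiltonian.Y (\<lambda>y. H (ysign p * y)) (\<lambda>x. F (xsign p * x)) c 0
     = half_hamiltonian.Kinv (\<lambda>y. H (ysign p * y)) (c - F 0)" for p
  proof -
    interpret Q: quadrant_annulus "\<lambda>y. ysign p * h (ysign p * y)" "\<lambda>y. H (ysign p * y)"
     "\<lambda>x. xsign p * f (xsign p * x)" "\<lambda>x. F (xsign p * x)" c1 c2 "X p"
      by (rule quadrant_annulus_refl)
    show ?thesis by (simp add: Q.Y_def)
  qed
  show ?thesis
    using z[of q] z[of "qsucc q"] y0[of q] y0[of "qsucc q"] by (cases q) (auto simp: pos_def param_def X_def)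
qed

lemma pos_state:
  assumes c: "c \<in> {c1..c2}" and v: "v \<in> {0..1}"
  shows "H (snd (pos q c v)) + F (fst (pos q c v)) = c" "fst (pos q c v) \<in> {xm c..xp c}"
    "0 \<le> xsign q * fst (pos q c v)" "0 \<le> ysign q * snd (pos q c v)"
    "fst (pos q c v) = 0 \<longleftrightarrow> param q v = 0" "snd (pos q c v) = 0 \<longleftrightarrow> param q v = 1"
proof -
  interpret Q: quadrant_annulus "\<lambda>y. ysign q * h (ysign q * y)" "\<lambda>y. H (ysign q * y)"
     "\<lambda>x. xsign q * f (xsign q * x)" "\<lambda>x. F (xsign q * x)" c1 c2 "X q"
    by (rule quadrant_annulus_refl)
  have p: "param q v \<in> {0..1}" using v by (auto simp: param_def)
  have X0: "0 < X q c" by (rule Q.X_pos[OF c])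
  have le: "F (xsign q * (param q v * X q c)) \<le> c" using Q.F_le[OF c p] .
  show "H (snd (pos q c v)) + F (fst (pos q c v)) = c" using Q.Y(2)[OF le] by (simp add: pos_def)
  have m: "0 \<le> param q v * X q c" "param q v * X q c \<le> 1 * X q c"
    using p X0 by (intro mult_nonneg_nonneg mult_right_mono; simp)+
  then show "fst (pos q c v) \<in> {xm c..xp c}"
    using xm_neg[OF c] xp_pos[OF c] sign_cases(1)[of q] by (auto simp: pos_def X_def)
  show "0 \<le> xsign q * fst (pos q c v)" "0 \<le> ysign q * snd (pos q c v)"
    using m Q.Y(1)[OF le] sign_cases[of q] by (auto simp: pos_def)
  show "fst (pos q c v) = 0 \<longleftrightarrow> param q v = 0" using X0 sign_cases(1)[of q] by (auto simp: pos_def)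
  have "Q.Y c (param q v * X q c) = 0 \<longleftrightarrow> param q v = 1"
  proof
    assume "Q.Y c (param q v * X q c) = 0"
    then have "\<not> F (xsign q * (param q v * X q c)) < c" using Q.Y_pos by force
    then show "param q v = 1" using Q.F_lt[OF c, of "param q v"] p by force
  next
    assume "param q v = 1"
    then show "Q.Y c (param q v * X q c) = 0" using Q.F_X[OF c] Q.Kinv_0 by (simp add: Q.Y_def)
  qed
  then show "snd (pos q c v) = 0 \<longleftrightarrow> param q v = 1" using sign_cases(2)[of q] by (auto simp: pos_def)
qed

text \<open>The converse of \<open>pos_state\<close>: every state of the orbit in the closed
  quadrant has a coordinate. Since \<open>param q\<close> is its own inverse, it also turns the
  scaled abscissa back into v.\<close>

lemma pos_eqI:
  assumes c: "c \<in> {c1..c2}" and e: "H y + F x = c" and x: "x \<in> {xm c..xp c}"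
    and s: "0 \<le> xsign q * x" "0 \<le> ysign q * y"
  shows "param q (xsign q * x / X q c) \<in> {0..1}" "pos q c (param q (xsign q * x / X q c)) = (x, y)"
proof -
  interpret Q: quadrant_annulus "\<lambda>y. ysign q * h (ysign q * y)" "\<lambda>y. H (ysign q * y)"
     "\<lambda>x. xsign q * f (xsign q * x)" "\<lambda>x. F (xsign q * x)" c1 c2 "X q"
    by (rule quadrant_annulus_refl)
  have X0: "0 < X q c" by (rule Q.X_pos[OF c])
  have le: "xsign q * x \<le> X q c" using x s(1) sign_cases(1)[of q] by (auto simp: X_def)
  then have "xsign q * x / X q c \<in> {0..1}" using s(1) X0 by auto
  then show "param q (xsign q * x / X q c) \<in> {0..1}" by (auto simp: param_def)
  have pp: "param q (param q w) = w" for w by (simp add: param_def)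
  have sg: "xsign q * (xsign q * x) = x" "ysign q * (ysign q * y) = y" using sign_cases[of q] by auto
  have "Q.Y c (xsign q * x) = ysign q * y" by (rule Q.Y_eqI) (simp_all only: s(2) e sg)
  then show "pos q c (param q (xsign q * x / X q c)) = (x, y)"
    using X0 sg by (simp add: pos_def pp)
qed

lemma continuous_on_X: "continuous_on {c1..c2} (X q)"
proof -
  interpret Q: quadrant_annulus "\<lambda>y. ysign q * h (ysign q * y)" "\<lambda>y. H (ysign q * y)"
     "\<lambda>x. xsign q * f (xsign q * x)" "\<lambda>x. F (xsign q * x)" c1 c2 "X q"
    by (rule quadrant_annulus_refl)
  show ?thesis by (rule Q.continuous_on_X)
qed

lemma X_pos: "c \<in> {c1..c2} \<Longrightarrow> 0 < X q c"
  using xm_neg[of c] xp_pos[of c] by (auto simp: X_def)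

lemma continuous_on_pos:
  assumes "continuous_on {0..1::real} C" "continuous_on {0..1} V" "C ` {0..1} \<subseteq> {c1..c2}" "V ` {0..1} \<subseteq> {0..1}"
  shows "continuous_on {0..1} (\<lambda>s. pos q (C s) (V s))"
proof -
  interpret Q: quadrant_annulus "\<lambda>y. ysign q * h (ysign q * y)" "\<lambda>y. H (ysign q * y)"
     "\<lambda>x. xsign q * f (xsign q * x)" "\<lambda>x. F (xsign q * x)" c1 c2 "X q"
    by (rule quadrant_annulus_refl)
  have cp: "continuous_on {0..1} (\<lambda>s. param q (V s))"
    unfolding param_def using assms(2) by (cases "xsign q = ysign q") (auto intro!: continuous_intros)
  have cx: "continuous_on {0..1} (\<lambda>s. param q (V s) * X q (C s))"
    by (intro continuous_intros cp continuous_on_compose2[OF continuous_on_X assms(1,3)])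
  have "F (xsign q * (param q (V s) * X q (C s))) \<le> C s" if "s \<in> {0..1}" for s
  proof (rule Q.F_le)
    show "C s \<in> {c1..c2}" using assms(3) that by blast
    have "V s \<in> {0..1}" using assms(4) that by blast
    then show "param q (V s) \<in> {0..1}" by (auto simp: param_def)
  qed
  then have "continuous_on {0..1} (\<lambda>s. Q.Y (C s) (param q (V s) * X q (C s)))"
    by (rule Q.continuous_on_Y[OF assms(1) cx])
  then show ?thesis unfolding pos_def by (intro continuous_intros cx)
qed

text \<open>The half-open intervals make the counts additive: at a joint a zero of x belongs to the
  earlier piece and a zero of y to the later one. In particular a start on the y-axis is not counted
  for x, as the theorem wants for the open interval, while a start on the x-axis is counted for
  y.\<close>

definition leg :: "real \<Rightarrow> real \<Rightarrow> real \<times> real \<Rightarrow> real \<times> real \<Rightarrow> nat \<Rightarrow> nat \<Rightarrow> bool" where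
  "leg c T P Q nx ny \<longleftrightarrow> (\<exists>x y. piecewise_sol h (\<lambda>_ x. - f x) 0 T x y \<and> (x 0, y 0) = P \<and> (x T, y T) = Q \<and>
     (\<forall>\<tau>\<in>{0..T}. H (y \<tau>) + F (x \<tau>) = c \<and> x \<tau> \<in> {xm c..xp c}) \<and>
     has_exactly_zeros x {0<..T} nx \<and> has_exactly_zeros y {0..<T} ny)"

lemma leg_join:
  assumes "leg c S P Q nx ny" "leg c T Q R nx' ny'"
  shows "leg c (S + T) P R (nx + nx') (ny + ny')"
proof -
  obtain x y where xy: "piecewise_sol h (\<lambda>_ x. - f x) 0 S x y" "(x 0, y 0) = P" "(x S, y S) = Q"
    "\<forall>\<tau>\<in>{0..S}. H (y \<tau>) + F (x \<tau>) = c \<and> x \<tau> \<in> {xm c..xp c}"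
    "has_exactly_zeros x {0<..S} nx" "has_exactly_zeros y {0..<S} ny"
    using assms(1) unfolding leg_def by blast
  obtain u v where uv: "piecewise_sol h (\<lambda>_ x. - f x) 0 T u v" "(u 0, v 0) = Q" "(u T, v T) = R"
    "\<forall>\<tau>\<in>{0..T}. H (v \<tau>) + F (u \<tau>) = c \<and> u \<tau> \<in> {xm c..xp c}"
    "has_exactly_zeros u {0<..T} nx'" "has_exactly_zeros v {0..<T} ny'"
    using assms(2) unfolding leg_def by blast
  have ST: "0 \<le> S" "0 \<le> T" using xy(1) uv(1) by (auto simp: piecewise_sol_def)
  define X' Y' where "X' \<tau> = (if \<tau> \<le> S then x \<tau> else u (\<tau> - S))" and "Y' \<tau> = (if \<tau> \<le> S then y \<tau> else v (\<tau> - S))" for \<tau>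
  have match: "x S = u 0" "y S = v 0" using xy(3) uv(2) by auto
  have r: "X' \<tau> = u (\<tau> - S) \<and> Y' \<tau> = v (\<tau> - S)" if "S \<le> \<tau>" for \<tau>
    using that match by (cases "\<tau> = S") (auto simp: X'_def Y'_def)
  have 1: "piecewise_sol h (\<lambda>_ x. - f x) 0 S X' Y'"
    by (rule piecewise_sol_cong[OF xy(1)]) (auto simp: X'_def Y'_def)
  have 2: "piecewise_sol h (\<lambda>_ x. - f x) S (S + T) X' Y'"
    by (rule piecewise_sol_cong[OF piecewise_sol_shift[OF uv(1), of S, simplified, unfolded add.commute[of T]]])
       (use r in auto)
  have en: "H (Y' \<tau>) + F (X' \<tau>) = c \<and> X' \<tau> \<in> {xm c..xp c}" if "\<tau> \<in> {0..S + T}" for \<tau>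
    using bspec[OF xy(4), of \<tau>] bspec[OF uv(4), of "\<tau> - S"] that by (auto simp: X'_def Y'_def)
  have zx: "has_exactly_zeros X' ({0<..S} \<union> (+) S ` {0<..T}) (nx + nx')"
  proof (rule has_exactly_zeros_Un)
    show "has_exactly_zeros X' {0<..S} nx"
      by (rule has_exactly_zeros_cong[THEN iffD1, OF _ xy(5)]) (auto simp: X'_def)
    show "has_exactly_zeros X' ((+) S ` {0<..T}) nx'"
      unfolding has_exactly_zeros_shift
      by (rule has_exactly_zeros_cong[THEN iffD1, OF _ uv(5)]) (use r in auto)
  qed auto
  have zy: "has_exactly_zeros Y' ({0..<S} \<union> (+) S ` {0..<T}) (ny + ny')"
  proof (rule has_exactly_zeros_Un)
    show "has_exactly_zeros Y' {0..<S} ny"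
      by (rule has_exactly_zeros_cong[THEN iffD1, OF _ xy(6)]) (auto simp: Y'_def)
    show "has_exactly_zeros Y' ((+) S ` {0..<T}) ny'"
      unfolding has_exactly_zeros_shift
      by (rule has_exactly_zeros_cong[THEN iffD1, OF _ uv(6)]) (use r in auto)
  qed auto
  have "{0<..S} \<union> (+) S ` {0<..T} = {0<..S + T}" "{0..<S} \<union> (+) S ` {0..<T} = {0..<S + T}"
    unfolding image_add_greaterThanAtMost image_add_atLeastLessThan using ST by auto
  then show ?thesis
    unfolding leg_def
    using piecewise_sol_join[OF 1 2] en zx zy xy(2) uv(3) ST r[of "S + T"]
    by (intro exI[of _ X'] exI[of _ Y']) (auto simp: X'_def Y'_def)
qed

end

lemma has_exactly_zeros_remove:
  assumes "has_exactly_zeros u (insert a A) (n + (if u a = 0 then 1 else 0))" "a \<notin> A"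
  shows "has_exactly_zeros u A n"
proof -
  have e: "{\<tau> \<in> insert a A. u \<tau> = 0} = (if u a = 0 then insert a {\<tau> \<in> A. u \<tau> = 0} else {\<tau> \<in> A. u \<tau> = 0})"
    by auto
  show ?thesis using assms unfolding has_exactly_zeros_def e by (auto split: if_splits)
qed

context annulus_flow begin

text \<open>Inside a quadrant neither coordinate vanishes, so zeros occur at the ends only. For
  \<open>v = v'\<close> the arc takes no time and its half-open time intervals are empty; hence the
  condition \<open>v < v'\<close> in the counts.\<close>

lemma leg_arc:
  assumes T: "arc_time q T" and c: "c \<in> {c1..c2}" and v: "0 \<le> v" "v \<le> v'" "v' \<le> 1"
  shows "leg c (T c v' - T c v) (pos q c v) (pos q c v')
    (if v < v' \<and> param q v' = 0 then 1 else 0) (if v < v' \<and> param q v = 1 then 1 else 0)"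
proof -
  define D where "D = T c v' - T c v"
  obtain x y where xy: "smooth_sol h f D x y" "(x 0, y 0) = pos q c v" "(x D, y D) = pos q c v'"
    "\<forall>\<tau>\<in>{0..D}. H (y \<tau>) + F (x \<tau>) = c \<and> x \<tau> \<in> {xm c..xp c}"
    "\<And>\<tau>. \<tau> \<in> {0<..<D} \<Longrightarrow> 0 < xsign q * x \<tau> \<and> 0 < ysign q * y \<tau>"
    using T c v unfolding arc_time_def D_def[symmetric] by (metis D_def)
  have mT: "strict_mono_on {0..1} (T c)" using T c by (simp add: arc_time_def)
  have zx: "has_exactly_zeros x {0<..D} (if v < v' \<and> param q v' = 0 then 1 else 0)
    \<and> has_exactly_zeros y {0..<D} (if v < v' \<and> param q v = 1 then 1 else 0)"
  proof (cases "v < v'")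
    case False
    then have "D = 0" using v by (simp add: D_def)
    then show ?thesis using False has_exactly_zeros_empty by simp
  next
    case True
    then have D: "0 < D" using strict_mono_onD[OF mT, of v v'] v by (simp add: D_def)
    have "has_exactly_zeros x ({0<..<D} \<union> {D}) (0 + (if x D = 0 then 1 else 0))"
    proof (intro has_exactly_zeros_Un has_exactly_zeros_singleton has_exactly_zeros_none)
      show "x \<tau> \<noteq> 0" if "\<tau> \<in> {0<..<D}" for \<tau> using xy(5)[OF that] by auto
    qed auto
    moreover have "{0<..<D} \<union> {D} = {0<..D}" using D by auto
    moreover have "x D = 0 \<longleftrightarrow> param q v' = 0"
      using pos_state(5)[OF c, of v' q] xy(3) v by (metis atLeastAtMost_iff fst_conv order_trans)
    moreover have "has_exactly_zeros y ({0} \<union> {0<..<D}) ((if y 0 = 0 then 1 else 0) + 0)"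
    proof (intro has_exactly_zeros_Un has_exactly_zeros_singleton has_exactly_zeros_none)
      show "y \<tau> \<noteq> 0" if "\<tau> \<in> {0<..<D}" for \<tau> using xy(5)[OF that] by auto
    qed auto
    moreover have "{0} \<union> {0<..<D} = {0..<D}" using D by auto
    moreover have "y 0 = 0 \<longleftrightarrow> param q v = 1"
      using pos_state(6)[OF c, of v q] xy(2) v by (metis atLeastAtMost_iff snd_conv order_trans)
    ultimately show ?thesis using True by simp
  qed
  show ?thesis
    unfolding leg_def D_def[symmetric]
    using piecewise_sol_of_smooth[OF xy(1)] xy(2-4) zx by blast
qed

lemma leg_to_end:
  assumes "arc_time q T" "c \<in> {c1..c2}" "v \<in> {0..1}" "q \<in> {QI, QIII}"
  shows "leg c (T c 1 - T c v) (pos q c v) (pos (qsucc q) c 0) 0 0"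
  using leg_arc[OF assms(1,2), of v 1] assms(3,4) pos_1_eq_pos_0[OF assms(2), of q]
  by (auto simp: param_def split: if_splits)

lemma leg_from_start:
  assumes T: "arc_time q T" and c: "c \<in> {c1..c2}" and "v \<in> {0..1}" "q \<in> {QII, QIV}"
  shows "leg c (T c v) (pos q c 0) (pos q c v) (if v = 1 then 1 else 0) (if v = 0 then 0 else 1)"
proof -
  have "T c 0 = 0" using T c by (simp add: arc_time_def)
  then show ?thesis using leg_arc[OF T c, of 0 v] assms(3,4) by (auto simp: param_def split: if_splits)
qed

lemma leg_forward:
  assumes T: "arc_time q T" and c: "c \<in> {c1..c2}" and q: "q \<in> {QI, QIII}"
  shows "leg c (T c 1) (pos q c 0) (pos (qsucc q) c 0) 0 0"
proof -
  have "T c 0 = 0" using T c by (simp add: arc_time_def)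
  then show ?thesis using leg_to_end[OF T c _ q, of 0] by simp
qed

lemma leg_backward:
  assumes "arc_time q T" "c \<in> {c1..c2}" "q \<in> {QII, QIV}"
  shows "leg c (T c 1) (pos q c 0) (pos (qsucc q) c 0) 1 1"
  using leg_from_start[OF assms(1,2) _ assms(3), of 1] pos_1_eq_pos_0[OF assms(2), of q] by simp

definition per :: "(quadrant \<Rightarrow> real \<Rightarrow> real \<Rightarrow> real) \<Rightarrow> real \<Rightarrow> real" where
  "per T c = T QI c 1 + T QII c 1 + T QIII c 1 + T QIV c 1"

lemma leg_turns:
  assumes T: "\<And>q. arc_time q (T q)" and c: "c \<in> {c1..c2}" and q: "q \<in> {QII, QIV}"
  shows "leg c (real n * per T c) (pos q c 0) (pos q c 0) (2 * n) (2 * n)"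
proof (induction n)
  case 0
  show ?case using leg_arc[OF T[of q] c, of 0 0] by simp
next
  case (Suc n)
  have "leg c (T q c 1 + T (qsucc q) c 1 + T (qsucc (qsucc q)) c 1 + T (qsucc (qsucc (qsucc q))) c 1)
     (pos q c 0) (pos (qsucc (qsucc (qsucc (qsucc q)))) c 0) (1 + 0 + 1 + 0) (1 + 0 + 1 + 0)"
    by (rule leg_join[OF leg_join[OF leg_join[OF leg_backward[OF T c] leg_forward[OF T c]] leg_backward[OF T c]]
          leg_forward[OF T c]]) (use q in auto)
  moreover have "qsucc (qsucc (qsucc (qsucc q))) = q" by (cases q) auto
  moreover have "T q c 1 + T (qsucc q) c 1 + T (qsucc (qsucc q)) c 1 + T (qsucc (qsucc (qsucc q))) c 1 = per T c"
    by (cases q) (auto simp: per_def)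
  ultimately have "leg c (per T c) (pos q c 0) (pos q c 0) 2 2" by (simp add: numeral_2_eq_2)
  from leg_join[OF Suc this] show ?case by (simp add: algebra_simps)
qed

definition crosses :: "real \<Rightarrow> real \<times> real \<Rightarrow> real \<times> real \<Rightarrow> nat \<Rightarrow> nat \<Rightarrow> bool" where
  "crosses S P Q nx ny \<longleftrightarrow> (\<exists>x y. piecewise_sol h (\<lambda>_ x. - f x) 0 S x y \<and> (x 0, y 0) = P \<and> (x S, y S) = Q \<and>
     (\<forall>\<tau>\<in>{0..S}. \<exists>c\<in>{c1..c2}. H (y \<tau>) + F (x \<tau>) = c \<and> x \<tau> \<in> {xm c..xp c}) \<and>
     has_exactly_zeros x {0<..<S} nx \<and> has_exactly_zeros y {0..S} ny)"

text \<open>Passage from the half-open counts to the open interval for x and the closed one for y. A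
  zero of x at the end (\<open>w = 1\<close>) is dropped. For y, either the last zero lay on
  entering q and is already counted, or it is the end itself (\<open>w = 0\<close>) and is added
  now; both give \<open>ny + 1\<close>.\<close>

lemma crosses_of_leg:
  assumes leg: "leg c S P (pos q c w) (nx + (if w = 1 then 1 else 0)) (ny + (if w = 0 then 0 else 1))"
    and c: "c \<in> {c1..c2}" and w: "w \<in> {0..1}" and q: "q \<in> {QII, QIV}" and S: "0 < S"
  shows "crosses S P (pos q c w) nx (ny + 1)"
proof -
  obtain x y where xy: "piecewise_sol h (\<lambda>_ x. - f x) 0 S x y" "(x 0, y 0) = P" "(x S, y S) = pos q c w"
     "\<forall>\<tau>\<in>{0..S}. H (y \<tau>) + F (x \<tau>) = c \<and> x \<tau> \<in> {xm c..xp c}"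
     "has_exactly_zeros x {0<..S} (nx + (if w = 1 then 1 else 0))"
     "has_exactly_zeros y {0..<S} (ny + (if w = 0 then 0 else 1))"
    using leg unfolding leg_def by blast
  have p: "param q w = 1 - w" using q by (auto simp: param_def)
  have x0: "x S = 0 \<longleftrightarrow> w = 1" using pos_state(5)[OF c w, of q] p by (simp add: xy(3)[symmetric]) 
  have y0: "y S = 0 \<longleftrightarrow> w = 0" using pos_state(6)[OF c w, of q] p by (simp add: xy(3)[symmetric])
  have "has_exactly_zeros x {0<..<S} nx"
  proof (rule has_exactly_zeros_remove[where a = S])
    have "insert S {0<..<S} = {0<..S}" using S by auto
    then show "has_exactly_zeros x (insert S {0<..<S}) (nx + (if x S = 0 then 1 else 0))" using xy(5) x0 by simp
  qed simp
  moreover have "has_exactly_zeros y {0..S} (ny + 1)"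
  proof -
    have "has_exactly_zeros y ({0..<S} \<union> {S}) ((ny + (if w = 0 then 0 else 1)) + (if y S = 0 then 1 else 0))"
      by (intro has_exactly_zeros_Un xy(6) has_exactly_zeros_singleton) auto
    moreover have "{0..<S} \<union> {S} = {0..S}" using S by auto
    ultimately show ?thesis using y0 by (auto split: if_splits)
  qed
  ultimately show ?thesis unfolding crosses_def using xy(1-4) c by blast
qed

text \<open>\<open>total c v w\<close> is the time from position v of the quadrant \<kappa> to
  position w of q with a prescribed number of turns. On the level d it exceeds S already for
  \<open>w = 0\<close>, and on the level e it is below S even for \<open>w = 1\<close>, in both
  cases whatever v is. So the shape of the given path between the two circles does not matter, and
  \<open>stretching\<close> yields a path from one side of q to the other.\<close>

lemma twist:
  fixes C V :: "real \<Rightarrow> real"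
  assumes T: "\<And>q. arc_time q (T q)" and \<kappa>: "\<kappa> \<in> {QI, QIII}" and q: "q \<in> {QII, QIV}" and S: "0 < S"
    and de: "d \<in> {c1, c2}" "e \<in> {c1, c2}" "d \<noteq> e" and j: "1 \<le> j" "j \<le> \<beta> - \<alpha>"
    and slow: "S < T (qsucc \<kappa>) d 1 + T (qsucc (qsucc \<kappa>)) d 1 + real \<alpha> * per T d"
    and fast: "T \<kappa> e 1 + T (qsucc \<kappa>) e 1 + real \<beta> * per T e < S"
    and C: "continuous_on {0..1} C" "C ` {0..1} \<subseteq> {c1..c2}" "C 0 = c1" "C 1 = c2"
    and V: "continuous_on {0..1} V" "V ` {0..1} \<subseteq> {0..1}"
  obtains C' V' :: "real \<Rightarrow> real" where "continuous_on {0..1} C'" "C' ` {0..1} \<subseteq> {c1..c2}"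
    "continuous_on {0..1} V'" "V' ` {0..1} \<subseteq> {0..1}" "V' 0 = 0" "V' 1 = 1"
    "\<And>r. r \<in> {0..1} \<Longrightarrow> \<exists>s\<in>{0..1}. crosses S (pos \<kappa> (C s) (V s)) (pos q (C' r) (V' r))
       (if q = qsucc \<kappa> then 2 * (\<alpha> + j) else 2 * (\<alpha> + j) - 1)
       (if q = qsucc \<kappa> then 2 * (\<alpha> + j) + 1 else 2 * (\<alpha> + j))"
proof -
  let ?q1 = "qsucc \<kappa>" let ?q2 = "qsucc (qsucc \<kappa>)" let ?q3 = "qsucc (qsucc (qsucc \<kappa>))"
  have qc: "?q1 \<in> {QII, QIV}" "?q2 \<in> {QI, QIII}" "q = ?q1 \<or> q = ?q3" "?q1 \<noteq> ?q3" using \<kappa> q by auto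
  have T0: "T p c 0 = 0" and Tmono: "strict_mono_on {0..1} (T p c)" if "c \<in> {c1..c2}" for p c
    using T[of p] that by (auto simp: arc_time_def)
  have Tnn: "0 \<le> T p c v" if "c \<in> {c1..c2}" "v \<in> {0..1}" for p c v
    using strict_mono_on_leD[OF Tmono[OF that(1)], of 0 v p] T0[OF that(1)] that(2) by auto
  have Tle: "T p c v \<le> T p c 1" if "c \<in> {c1..c2}" "v \<in> {0..1}" for p c v
    using strict_mono_on_leD[OF Tmono[OF that(1)], of v 1 p] that(2) by auto
  have per_eq: "T \<kappa> c 1 + T ?q1 c 1 + T ?q2 c 1 + T ?q3 c 1 = per T c" for c
    by (cases \<kappa>) (auto simp: per_def)
  have per_nn: "0 \<le> per T c" if "c \<in> {c1..c2}" for c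
    unfolding per_eq[symmetric] using Tnn[OF that, of 1] by (intro add_nonneg_nonneg) auto
  \<comment> \<open>Full turns are counted from the first arrival at \<open>?q1\<close>. The target
    q is \<open>?q1\<close> itself or \<open>?q3\<close>; in the second case the quadrants
    \<open>?q1\<close> and \<open>?q2\<close> have to be crossed once more, in the time
    \<open>ex\<close>. Lowering n by one there makes the same j stand for the neighbouring zero
    counts \<open>2 * (\<alpha> + j)\<close> and \<open>2 * (\<alpha> + j) - 1\<close> of x.\<close>
  define n where "n = (if q = ?q1 then \<alpha> + j else \<alpha> + j - 1)"
  define ex where "ex c = (if q = ?q1 then 0 else T ?q1 c 1 + T ?q2 c 1)" for c
  define total where "total c v w = (T \<kappa> c 1 - T \<kappa> c v) + real n * per T c + ex c + T q c w" for c v w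
  have crossing: "crosses S (pos \<kappa> c v) (pos q c w)
       (if q = ?q1 then 2 * (\<alpha> + j) else 2 * (\<alpha> + j) - 1) (if q = ?q1 then 2 * (\<alpha> + j) + 1 else 2 * (\<alpha> + j))"
    if c: "c \<in> {c1..c2}" and v: "v \<in> {0..1}" and w: "w \<in> {0..1}" and t: "total c v w = S" for c v w
  proof -
    have a: "leg c ((T \<kappa> c 1 - T \<kappa> c v) + real n * per T c) (pos \<kappa> c v) (pos ?q1 c 0) (0 + 2 * n) (0 + 2 * n)"
      by (intro leg_join[OF leg_to_end leg_turns] T c v \<kappa> qc)
    show ?thesis
    proof (cases "q = ?q1")
      case True
      have "leg c ((T \<kappa> c 1 - T \<kappa> c v) + real n * per T c + T q c w) (pos \<kappa> c v) (pos q c w)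
        (0 + 2 * n + (if w = 1 then 1 else 0)) (0 + 2 * n + (if w = 0 then 0 else 1))"
        by (rule leg_join[OF a[folded True] leg_from_start[OF T c w q]])
      then have "crosses S (pos \<kappa> c v) (pos q c w) (2 * n) (2 * n + 1)"
        using t True by (intro crosses_of_leg c w q S) (simp add: total_def ex_def)
      then show ?thesis using True by (simp add: n_def)
    next
      case False
      then have q3: "q = ?q3" using qc by auto
      have "leg c (((T \<kappa> c 1 - T \<kappa> c v) + real n * per T c) + T ?q1 c 1 + T ?q2 c 1) (pos \<kappa> c v) (pos q c 0)
         (0 + 2 * n + 1 + 0) (0 + 2 * n + 1 + 0)"
        unfolding q3 by (rule leg_join[OF leg_join[OF a leg_backward[OF T c qc(1)]] leg_forward[OF T c qc(2)]])
      from leg_join[OF this leg_from_start[OF T c w q]]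
      have "crosses S (pos \<kappa> c v) (pos q c w) (2 * n + 1) (2 * n + 1 + 1)"
        using t False by (intro crosses_of_leg c w q S) (simp add: total_def ex_def algebra_simps)
      moreover have "2 * n + 1 = 2 * (\<alpha> + j) - 1" "2 * n + 1 + 1 = 2 * (\<alpha> + j)" using j(1) False by (auto simp: n_def)
      ultimately show ?thesis using False by simp
    qed
  qed
  \<comment> \<open>\<open>g\<close> orients the path from the slow level d to the fast level e,
    whichever of the two is the inner circle.\<close>
  define g where "g s = (if d = c1 then s else 1 - s)" for s :: real
  have g: "g s \<in> {0..1}" if "s \<in> {0..1}" for s using that by (auto simp: g_def)
  have cg: "continuous_on {0..1} g" unfolding g_def by (cases "d = c1") (auto intro!: continuous_intros)
  have Cg: "C (g 0) = d" "C (g 1) = e" using de C(3,4) by (auto simp: g_def)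
  have Crng: "C s \<in> {c1..c2}" "V s \<in> {0..1}" if "s \<in> {0..1}" for s using C(2) V(2) that by blast+
  have dc: "d \<in> {c1..c2}" "e \<in> {c1..c2}" using de c12 by auto
  have cTT: "continuous_on ({c1..c2} \<times> {0..1}) (\<lambda>(c, v). T p c v)" for p using T[of p] by (simp add: arc_time_def)
  have cgz: "continuous_on ({0..1} \<times> {0..1::real}) (\<lambda>z. g (fst z))"
    by (rule continuous_on_compose2[OF cg continuous_on_fst[OF continuous_on_id]]) auto
  have gz: "(\<lambda>z. g (fst z)) ` ({0..1} \<times> {0..1::real}) \<subseteq> {0..1}"
    by (rule image_subsetI, rule g) (simp add: mem_Times_iff)
  have cT: "continuous_on ({0..1} \<times> {0..1}) (\<lambda>z. T p (C (g (fst z))) (v z))"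
    if "continuous_on ({0..1} \<times> {0..1}) v" "\<And>z. z \<in> {0..1} \<times> {0..1} \<Longrightarrow> v z \<in> {0..1}" for p and v :: "real \<times> real \<Rightarrow> real"
  proof -
    have 1: "continuous_on ({0..1} \<times> {0..1::real}) (\<lambda>z. C (g (fst z)))"
      by (rule continuous_on_compose2[OF C(1) cgz gz])
    have "continuous_on ({0..1} \<times> {0..1}) (\<lambda>z. (\<lambda>(c, v). T p c v) (C (g (fst z)), v z))"
    proof (rule continuous_on_compose2[OF cTT])
      show "continuous_on ({0..1} \<times> {0..1}) (\<lambda>z. (C (g (fst z)), v z))" by (intro continuous_intros 1 that(1))
      show "(\<lambda>z. (C (g (fst z)), v z)) ` ({0..1} \<times> {0..1}) \<subseteq> {c1..c2} \<times> {0..1}"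
      proof (rule image_subsetI)
        fix z :: "real \<times> real" assume "z \<in> {0..1} \<times> {0..1}"
        then show "(C (g (fst z)), v z) \<in> {c1..c2} \<times> {0..1}" using Crng(1)[OF g] that(2) by (simp add: mem_Times_iff)
      qed
    qed
    then show ?thesis by simp
  qed
  define fT where "fT s w = total (C (g s)) (V (g s)) w" for s w
  have cf: "continuous_on ({0..1} \<times> {0..1}) (\<lambda>(s, w). fT s w)"
  proof -
    have cV: "continuous_on ({0..1} \<times> {0..1::real}) (\<lambda>z. V (g (fst z)))"
      by (rule continuous_on_compose2[OF V(1) cgz gz])
    have c1: "continuous_on ({0..1} \<times> {0..1::real}) (\<lambda>z. T p (C (g (fst z))) 1)" for p
      by (rule cT) auto
    have cex: "continuous_on ({0..1} \<times> {0..1::real}) (\<lambda>z. ex (C (g (fst z))))"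
      unfolding ex_def by (cases "q = ?q1") (auto intro!: continuous_intros c1)
    have c2: "continuous_on ({0..1} \<times> {0..1::real}) (\<lambda>z. T \<kappa> (C (g (fst z))) (V (g (fst z))))"
      by (rule cT[OF cV], rule Crng(2), rule g) (simp add: mem_Times_iff)
    have c3: "continuous_on ({0..1} \<times> {0..1}) (\<lambda>z. T q (C (g (fst z))) (snd z))"
      by (rule cT[OF continuous_on_snd[OF continuous_on_id]]) (simp add: mem_Times_iff)
    have "continuous_on ({0..1} \<times> {0..1}) (\<lambda>z. fT (fst z) (snd z))"
      unfolding fT_def total_def per_def
      by (intro continuous_on_add continuous_on_diff continuous_on_mult_left c1 c2 c3 cex)
    then show ?thesis by (simp add: case_prod_beta)
  qed
  \<comment> \<open>For \<open>q = ?q1\<close>, n runs from \<open>\<alpha> + 1\<close> to \<beta>,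
    and the turn beyond \<alpha> covers the two quadrants in \<open>slow\<close>. Otherwise n runs
    from \<alpha> to \<open>\<beta> - 1\<close>: the quadrants in \<open>ex\<close> are then those
    of \<open>slow\<close>, and together with \<kappa> and q they make up one more turn, still
    within the \<beta> turns of \<open>fast\<close>.\<close>
  have n_ge: "real \<alpha> \<le> real n" and n_ge': "q = ?q1 \<Longrightarrow> real \<alpha> + 1 \<le> real n"
    and n_le: "real n \<le> real \<beta>" and n_le': "q \<noteq> ?q1 \<Longrightarrow> real n + 1 \<le> real \<beta>"
    using j by (auto simp: n_def)
  have "\<exists>\<omega> \<nu>. continuous_on {0..1} \<omega> \<and> continuous_on {0..1} \<nu> \<and> \<omega> ` {0..1} \<subseteq> {0..1::real} \<and> \<nu> ` {0..1} \<subseteq> {0..1} \<and>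
      \<nu> (0::real) = 0 \<and> \<nu> 1 = 1 \<and> (\<forall>r\<in>{0..1::real}. fT (\<omega> r) (\<nu> r) = S)"
  proof (rule stretching[of 0 1 fT S])
    show "strict_mono_on {0..1} (fT s)" if "s \<in> {0..1}" for s
      using Tmono[OF Crng(1)[OF g[OF that]], of q] by (auto simp: fT_def total_def strict_mono_on_def)
    show "S \<le> fT 0 0"
    proof -
      have v: "V (g 0) \<in> {0..1}" using Crng(2)[OF g[of 0]] by simp
      have 1: "0 \<le> T \<kappa> d 1 - T \<kappa> d (V (g 0))" using Tle[OF dc(1) v] by simp
      have 2: "T ?q1 d 1 + T ?q2 d 1 + real \<alpha> * per T d \<le> real n * per T d + ex d"
      proof (cases "q = ?q1")
        case True
        have "(real \<alpha> + 1) * per T d \<le> real n * per T d"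
          using n_ge'[OF True] per_nn[OF dc(1)] by (rule mult_right_mono)
        moreover have "T ?q1 d 1 + T ?q2 d 1 \<le> per T d"
          unfolding per_eq[symmetric] using Tnn[OF dc(1), of 1 \<kappa>] Tnn[OF dc(1), of 1 ?q3] by simp
        ultimately show ?thesis using True by (simp add: ex_def algebra_simps)
      next
        case False
        have "real \<alpha> * per T d \<le> real n * per T d" using n_ge per_nn[OF dc(1)] by (rule mult_right_mono)
        then show ?thesis using False by (simp add: ex_def)
      qed
      show ?thesis using slow 1 2 T0[OF dc(1)] by (simp add: fT_def total_def Cg)
    qed
    show "fT 1 1 \<le> S"
    proof -
      have v: "V (g 1) \<in> {0..1}" using Crng(2)[OF g[of 1]] by simp
      have 1: "T \<kappa> e 1 - T \<kappa> e (V (g 1)) \<le> T \<kappa> e 1" using Tnn[OF dc(2) v] by simp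
      have 2: "T \<kappa> e 1 + real n * per T e + ex e + T q e 1 \<le> T \<kappa> e 1 + T ?q1 e 1 + real \<beta> * per T e"
      proof (cases "q = ?q1")
        case True
        have "real n * per T e \<le> real \<beta> * per T e" using n_le per_nn[OF dc(2)] by (rule mult_right_mono)
        then show ?thesis using True by (simp add: ex_def)
      next
        case False
        then have q3: "q = ?q3" using qc by auto
        have "(real n + 1) * per T e \<le> real \<beta> * per T e"
          using n_le'[OF False] per_nn[OF dc(2)] by (rule mult_right_mono)
        then have "real n * per T e + per T e \<le> real \<beta> * per T e" by (simp add: algebra_simps)
        moreover have "ex e + T \<kappa> e 1 + T q e 1 = per T e"
          unfolding per_eq[symmetric] using False q3 by (simp add: ex_def)
        ultimately show ?thesis using Tnn[OF dc(2), of 1 \<kappa>] Tnn[OF dc(2), of 1 ?q1] by simp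
      qed
      show ?thesis using fast 1 2 by (simp add: fT_def total_def Cg)
    qed
  qed (rule zero_le_one | rule cf | blast)+
  then obtain \<omega> \<nu> :: "real \<Rightarrow> real" where st: "continuous_on {0..1} \<omega>" "continuous_on {0..1} \<nu>"
    "\<omega> ` {0..1} \<subseteq> {0..1}" "\<nu> ` {0..1} \<subseteq> {0..1}" "\<nu> 0 = 0" "\<nu> 1 = 1"
    "\<forall>r\<in>{0..1}. fT (\<omega> r) (\<nu> r) = S" by blast
  have \<omega>r: "\<omega> r \<in> {0..1}" and \<nu>r: "\<nu> r \<in> {0..1}" if "r \<in> {0..1}" for r using st(3,4) that by blast+
  show ?thesis
  proof (rule that[of "\<lambda>r. C (g (\<omega> r))" \<nu>])
    show "continuous_on {0..1} (\<lambda>r. C (g (\<omega> r)))"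
      by (rule continuous_on_compose2[OF C(1) continuous_on_compose2[OF cg st(1,3)]]) (use \<omega>r g in blast)
    show "(\<lambda>r. C (g (\<omega> r))) ` {0..1} \<subseteq> {c1..c2}" using Crng(1) g \<omega>r by blast
    fix r :: real assume r: "r \<in> {0..1}"
    show "\<exists>s\<in>{0..1}. crosses S (pos \<kappa> (C s) (V s)) (pos q (C (g (\<omega> r))) (\<nu> r))
       (if q = qsucc \<kappa> then 2 * (\<alpha> + j) else 2 * (\<alpha> + j) - 1)
       (if q = qsucc \<kappa> then 2 * (\<alpha> + j) + 1 else 2 * (\<alpha> + j))"
    proof (rule bexI[of _ "g (\<omega> r)"])
      show "crosses S (pos \<kappa> (C (g (\<omega> r))) (V (g (\<omega> r)))) (pos q (C (g (\<omega> r))) (\<nu> r))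
       (if q = qsucc \<kappa> then 2 * (\<alpha> + j) else 2 * (\<alpha> + j) - 1)
       (if q = qsucc \<kappa> then 2 * (\<alpha> + j) + 1 else 2 * (\<alpha> + j))"
        by (rule crossing[OF Crng(1)[OF g[OF \<omega>r[OF r]]] Crng(2)[OF g[OF \<omega>r[OF r]]] \<nu>r[OF r]])
           (use bspec[OF st(7) r] in \<open>simp add: fT_def\<close>)
    qed (rule g[OF \<omega>r[OF r]])
  qed (use st in auto)
qed

end

section \<open>Transition between two annuli\<close>

text \<open>Identifies the integral used for the continuity arguments with the Lebesgue integral of
  the transition times, by evaluating both as the duration of one and the same solution.\<close>

lemma (in half_hamiltonian) traversal_time:
  assumes ab: "a \<le> b" and less: "\<And>x. x \<in> {a..b} \<Longrightarrow> F x < E"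
    and \<rho>: "\<And>x. x \<in> {a..b} \<Longrightarrow> \<rho> x = 1 / k (Y E x)"
  shows "integral {a..b} (slowness E) = (LBINT x=a..b. \<rho> x)"
proof -
  obtain x where x: "smooth_sol k f (integral {a..b} (slowness E)) x (\<lambda>\<tau>. Y E (x \<tau>))" "x 0 = a"
    "x (integral {a..b} (slowness E)) = b" "x ` {0..integral {a..b} (slowness E)} \<subseteq> {a..b}"
    by (rule traversal[OF ab less refl])
  have "(LBINT \<xi>=x 0..x (integral {a..b} (slowness E)). \<rho> \<xi>) = integral {a..b} (slowness E)"
  proof (rule smooth_sol_time[OF x(1) _ cont_k])
    fix \<tau> assume "\<tau> \<in> {0<..<integral {a..b} (slowness E)}"
    then have "x \<tau> \<in> {a..b}" using x(4) by (simp add: image_subset_iff)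
    then show "0 < k (Y E (x \<tau>))" "\<rho> (x \<tau>) = 1 / k (Y E (x \<tau>))" using \<rho> k_pos[OF Y_pos[OF less]] by auto
  qed
  then show ?thesis using x(2,3) by simp
qed

lemma strict_mono_one_zero:
  fixes u :: "real \<Rightarrow> real"
  assumes "strict_mono_on {0..S} u" "continuous_on {0..S} u" "0 \<le> S" "u 0 \<le> 0" "0 \<le> u S"
  shows "has_exactly_zeros u {0..S} 1"
proof -
  obtain z where z: "0 \<le> z" "z \<le> S" "u z = 0" using IVT'[of u 0 0 S] assms by auto
  have inj: "inj_on u {0..S}" using assms(1) strict_mono_on_imp_inj_on by blast
  have "{\<tau> \<in> {0..S}. u \<tau> = 0} = {z}"
  proof (intro set_eqI iffI)
    fix w assume "w \<in> {\<tau> \<in> {0..S}. u \<tau> = 0}"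
    then have "w = z" using inj_onD[OF inj, of w z] z by auto
    then show "w \<in> {z}" by simp
  qed (use z in auto)
  then show ?thesis by (simp add: has_exactly_zeros_def)
qed

text \<open>For \<open>lam < 0\<close> the function \<open>- lam * y\<close> is restoring, so the
  two coordinates can change roles; the minus signs preserve the direction of time.\<close>

lemma smooth_sol_swap:
  assumes "smooth_sol (\<lambda>y. - lam * y) (\<lambda>x. h (- x)) T u v"
  shows "smooth_sol h (\<lambda>x. lam * x) T (\<lambda>\<tau>. - v \<tau>) (\<lambda>\<tau>. - u \<tau>)"
  using assms unfolding smooth_sol_def by (auto intro!: continuous_intros derivative_eq_intros)

text \<open>The digits 1 and 2 in front of annulus data refer to the annulus that is left and the
  one that is entered. Starts are in quadrant II, so of the first annulus only the left half occurs;
  starts in IV are reduced to these by a half turn. The origin is assumed to be out of reach for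
  solutions with \<open>0 \<le> y \<le> yb\<close>, since uniqueness is available in the
  strip.\<close>

locale gap =
  fixes h H G :: "real \<Rightarrow> real" and lam \<mu>1 \<mu>2 c11 c21 c12 c22 :: real
    and xm1 xm2 xp2 :: "real \<Rightarrow> real" and yb :: real
  assumes h: "restoring h" and dH: "\<And>y. (H has_real_derivative h y) (at y)" and H0: "H 0 = 0"
    and lam: "lam < 0" and cG: "continuous_on UNIV G" and G0: "G 0 = 0"
    and G_mono: "strict_mono_on {0..} G" and G_anti: "\<And>x y. x < y \<Longrightarrow> y \<le> 0 \<Longrightarrow> G y < G x"
    and \<mu>: "0 < \<mu>1" "0 < \<mu>2" and c1: "0 < c11" "c11 < c21" and c2: "0 < c12" "c12 < c22"
    and xm1: "\<And>c. c \<in> {c11..c21} \<Longrightarrow> xm1 c < 0"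
      "\<And>c x. c \<in> {c11..c21} \<Longrightarrow> xm1 c < x \<Longrightarrow> x \<le> 0 \<Longrightarrow> lam / 2 * x\<^sup>2 + \<mu>1 * G x < c"
    and xm2: "\<And>c. c \<in> {c12..c22} \<Longrightarrow> xm2 c < 0"
      "\<And>c. c \<in> {c12..c22} \<Longrightarrow> lam / 2 * (xm2 c)\<^sup>2 + \<mu>2 * G (xm2 c) = c"
      "\<And>c x. c \<in> {c12..c22} \<Longrightarrow> xm2 c < x \<Longrightarrow> x \<le> 0 \<Longrightarrow> lam / 2 * x\<^sup>2 + \<mu>2 * G x < c"
    and xp2: "\<And>c. c \<in> {c12..c22} \<Longrightarrow> 0 < xp2 c"
      "\<And>c. c \<in> {c12..c22} \<Longrightarrow> lam / 2 * (xp2 c)\<^sup>2 + \<mu>2 * G (xp2 c) = c"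
    and yb: "0 < yb"
    and no_arrival: "\<And>T x y. smooth_sol h (\<lambda>x. lam * x) T x y \<Longrightarrow> x 0 < 0 \<Longrightarrow> x T = 0 \<Longrightarrow> y T = 0 \<Longrightarrow>
      (\<And>\<tau>. \<tau> \<in> {0..T} \<Longrightarrow> x \<tau> \<le> 0 \<and> 0 \<le> y \<tau> \<and> y \<tau> \<le> yb) \<Longrightarrow> False"
begin

lemma H_pos: "y \<noteq> 0 \<Longrightarrow> 0 < H y"
proof -
  interpret P: half_hamiltonian h H "\<lambda>_. 0" "\<lambda>_. 0"
    by unfold_locales (use h dH H0 in auto)
  have r: "((\<lambda>y. - y) has_real_derivative - 1) (at y)" for y :: real by (auto intro!: derivative_eq_intros)
  interpret M: half_hamiltonian "\<lambda>y. - h (- y)" "\<lambda>y. H (- y)" "\<lambda>_. 0" "\<lambda>_. 0"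
    by unfold_locales (use restoring_reflect[OF h] DERIV_chain2[OF dH r] H0 in auto)
  assume "y \<noteq> 0"
  then consider "0 < y" | "0 < - y" by linarith
  then show "0 < H y"
    using strict_mono_onD[OF P.K_strict_mono, of 0 y] strict_mono_onD[OF M.K_strict_mono, of 0 "- y"] H0
    by cases auto
qed

lemma H_mono: "0 \<le> y \<Longrightarrow> y < y' \<Longrightarrow> H y < H y'"
proof -
  interpret P: half_hamiltonian h H "\<lambda>_. 0" "\<lambda>_. 0"
    by unfold_locales (use h dH H0 in auto)
  show "0 \<le> y \<Longrightarrow> y < y' \<Longrightarrow> H y < H y'" using strict_mono_onD[OF P.K_strict_mono, of y y'] by auto
qed

text \<open>On the level 0 one has \<open>H y = - lam / 2 * x^2\<close>, so \<open>\<delta>0\<close>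
  is the distance from the y-axis at which the stable manifold reaches the height \<open>yb\<close>;
  nearer to the origin it stays below.\<close>

sublocale A: saddle h H "\<lambda>x. lam * x" "\<lambda>x. lam / 2 * x\<^sup>2" "sqrt (2 * H yb / - lam)"
proof unfold_locales
  have Hyb: "0 < H yb" using H_pos yb by simp
  show "0 < sqrt (2 * H yb / - lam)" using Hyb lam by (simp add: divide_pos_neg)
  fix T and x y :: "real \<Rightarrow> real"
  assume s: "smooth_sol h (\<lambda>x. lam * x) T x y" "x 0 < 0" "- sqrt (2 * H yb / - lam) \<le> x 0" "x T = 0" "y T = 0"
    and e: "\<And>\<tau>. \<tau> \<in> {0..T} \<Longrightarrow> x 0 \<le> x \<tau> \<and> x \<tau> \<le> 0 \<and> 0 \<le> y \<tau> \<and> H (y \<tau>) + lam / 2 * (x \<tau>)\<^sup>2 = 0"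
  show False
  proof (rule no_arrival[OF s(1,2,4,5)])
    fix \<tau> assume t: "\<tau> \<in> {0..T}"
    have "\<bar>x \<tau>\<bar> \<le> sqrt (2 * H yb / - lam)" using e[OF t] s(3) by linarith
    then have "\<bar>x \<tau>\<bar>\<^sup>2 \<le> (sqrt (2 * H yb / - lam))\<^sup>2" by (rule power_mono) simp
    moreover have "0 \<le> 2 * H yb / - lam" using Hyb lam by (simp add: divide_nonneg_neg)
    ultimately have "(x \<tau>)\<^sup>2 \<le> 2 * H yb / - lam" by simp
    then have "- lam / 2 * (x \<tau>)\<^sup>2 \<le> H yb" using lam by (simp add: field_simps)
    then have "H (y \<tau>) \<le> H yb" using e[OF t] by linarith
    then have "y \<tau> \<le> yb" using H_mono[of yb "y \<tau>"] yb by force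
    then show "x \<tau> \<le> 0 \<and> 0 \<le> y \<tau> \<and> y \<tau> \<le> yb" using e[OF t] by simp
  qed
qed (use h dH H0 lam in \<open>auto intro!: derivative_eq_intros continuous_intros simp: mult_neg_pos\<close>)

text \<open>The saddle in the coordinates \<open>(-y, -x)\<close>, in which the passage II to III is that from II to I.\<close>

sublocale B: saddle "\<lambda>y. - lam * y" "\<lambda>y. - lam / 2 * y\<^sup>2" "\<lambda>x. h (- x)" "\<lambda>x. - H (- x)" yb
proof unfold_locales
  show "restoring (\<lambda>y. - lam * y)" using lam
    by (auto simp: restoring_def mono_def mult_neg_pos mult_neg_neg intro!: continuous_intros)
  show "continuous_on UNIV (\<lambda>x. h (- x))"
    by (rule continuous_on_compose2[of UNIV h]) (use h in \<open>auto simp: restoring_def intro!: continuous_intros\<close>)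
  have r: "((\<lambda>y. - y) has_real_derivative - 1) (at y)" for y :: real by (auto intro!: derivative_eq_intros)
  show "((\<lambda>x. - H (- x)) has_real_derivative h (- x)) (at x)" for x
    using DERIV_minus[OF DERIV_chain2[OF dH r]] by simp
  fix T and u v :: "real \<Rightarrow> real"
  assume s: "smooth_sol (\<lambda>y. - lam * y) (\<lambda>x. h (- x)) T u v" "u 0 < 0" "- yb \<le> u 0" "u T = 0" "v T = 0"
    and e: "\<And>\<tau>. \<tau> \<in> {0..T} \<Longrightarrow> u 0 \<le> u \<tau> \<and> u \<tau> \<le> 0 \<and> 0 \<le> v \<tau> \<and> - lam / 2 * (v \<tau>)\<^sup>2 + - H (- u \<tau>) = 0"
  show False
  proof (rule no_arrival[OF smooth_sol_swap[OF s(1)]])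
    have "0 \<le> T" using s(1) by (simp add: smooth_sol_def)
    then have "0 \<le> v 0" "- lam / 2 * (v 0)\<^sup>2 = H (- u 0)" using e[of 0] by auto
    moreover have "0 < H (- u 0)" using H_pos s(2) by simp
    ultimately show "- v 0 < 0" by (cases "v 0 = 0") auto
    show "- v \<tau> \<le> 0 \<and> 0 \<le> - u \<tau> \<and> - u \<tau> \<le> yb" if "\<tau> \<in> {0..T}" for \<tau> using e[OF that] s(3) by linarith
  qed (use s in auto)
qed (use lam H_pos H0 yb in \<open>auto intro!: derivative_eq_intros\<close>)

text \<open>The bounds on y by its values at the ends are recorded because both ends lie in annuli:
  this is how the whole gap orbit is later seen to stay in the strip.\<close>

definition reaches :: "real \<Rightarrow> real \<times> real \<Rightarrow> real \<times> real \<Rightarrow> nat \<Rightarrow> nat \<Rightarrow> bool" where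
  "reaches S P Q nx ny \<longleftrightarrow> (\<exists>x y. smooth_sol h (\<lambda>x. lam * x) S x y \<and> (x 0, y 0) = P \<and> (x S, y S) = Q \<and>
     (\<forall>\<tau>\<in>{0..S}. min 0 (snd Q) \<le> y \<tau> \<and> y \<tau> \<le> max (snd P) (snd Q)) \<and>
     has_exactly_zeros x {0..S} nx \<and> has_exactly_zeros y {0..S} ny)"

text \<open>The gap energy of the start is \<open>lam / 2 * x^2 \<le> 0\<close> where the path
  leaves the x-axis and equals the level, hence is at least \<open>E1\<close>, where it reaches the
  y-axis. The orbit of energy e meets the level \<open>c v\<close> of the new annulus where
  \<open>\<mu>2 * G x = c v - e\<close>. The limits \<open>xl\<close> and \<open>xr\<close> are the
  places where the orbit of energy \<open>E1\<close> meets the outer circles of the old and the new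
  annulus.\<close>

lemma passage_II_I:
  fixes xs ys :: "real \<Rightarrow> real"
  assumes cx: "continuous_on {0..1} xs" and cy: "continuous_on {0..1} ys"
    and sg: "\<And>s. s \<in> {0..1} \<Longrightarrow> xs s \<le> 0 \<and> 0 \<le> ys s"
    and en: "\<And>s. s \<in> {0..1} \<Longrightarrow> H (ys s) + (lam / 2 * (xs s)\<^sup>2 + \<mu>1 * G (xs s)) \<in> {c11..c21}"
    and ends: "ys 0 = 0" "xs 1 = 0"
    and E1: "E1 = min c11 c12" and xl: "xl \<le> 0" "\<mu>1 * G xl = c21 - E1" and xr: "0 \<le> xr" "\<mu>2 * G xr = c22 - E1"
    and \<rho>: "\<And>x y. x \<in> {xl..xr} \<Longrightarrow> 0 < y \<Longrightarrow> H y + lam / 2 * x\<^sup>2 = E1 \<Longrightarrow> \<rho> x = 1 / h y"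
    and time: "(LBINT x=xl..xr. \<rho> x) \<le> S"
  obtains x2 y2 C :: "real \<Rightarrow> real" where "continuous_on {0..1} x2" "continuous_on {0..1} y2" "continuous_on {0..1} C"
    "C 0 = c12" "C 1 = c22"
    "\<And>r. r \<in> {0..1} \<Longrightarrow> C r \<in> {c12..c22} \<and> 0 \<le> x2 r \<and> x2 r \<le> xp2 (C r) \<and> 0 \<le> y2 r \<and>
       H (y2 r) + (lam / 2 * (x2 r)\<^sup>2 + \<mu>2 * G (x2 r)) = C r"
    "\<And>r. r \<in> {0..1} \<Longrightarrow> \<exists>s\<in>{0..1}. reaches S (xs s, ys s) (x2 r, y2 r) 1 0"
proof -
  have E1p: "0 < E1" "E1 \<le> c11" "E1 \<le> c12" using E1 c1 c2 by auto
  \<comment> \<open>As \<open>lam < 0\<close>, \<open>\<mu>2 * G b\<close> is at least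
    \<open>c22\<close>, so G takes all required values already on \<open>[0, b]\<close>; it may well
    be bounded on the half-line.\<close>
  define b where "b = xp2 c22"
  have b: "0 < b" "lam / 2 * b\<^sup>2 + \<mu>2 * G b = c22" using xp2[of c22] c2 by (auto simp: b_def)
  have Gle: "G x \<le> G y \<Longrightarrow> x \<le> y" if "0 \<le> x" "0 \<le> y" for x y
    using strict_mono_onD[OF G_mono, of y x] that by force
  have lam2: "lam / 2 * x\<^sup>2 \<le> 0" for x using lam by (simp add: mult_nonpos_nonneg)
  have Gb: "c22 \<le> \<mu>2 * G b" using b(2) lam2[of b] by linarith
  have G0b: "0 \<le> G b" using strict_mono_onD[OF G_mono, of 0 b] b G0 by simp
  obtain g where g: "continuous_on {G 0..G b} g" "g ` {G 0..G b} \<subseteq> {0..b}"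
    "\<And>t. t \<in> {G 0..G b} \<Longrightarrow> G (g t) = t" "\<And>u. u \<in> {0..b} \<Longrightarrow> g (G u) = u" "strict_mono_on {G 0..G b} g"
  proof (rule strict_mono_inverse_on_interval[of 0 b G])
    show "continuous_on {0..b} G" by (rule continuous_on_subset[OF cG]) simp
    show "strict_mono_on {0..b} G" using G_mono by (simp add: strict_mono_on_def)
  qed (use b in auto)
  define c where "c v = c12 + v * (c22 - c12)" for v
  have c: "c v \<in> {c12..c22}" if "v \<in> {0..1}" for v
  proof -
    have "0 \<le> v * (c22 - c12)" "v * (c22 - c12) \<le> 1 * (c22 - c12)"
      using that c2 by (intro mult_nonneg_nonneg mult_right_mono; simp)+
    then show ?thesis by (simp add: c_def)
  qed
  define X2 where "X2 e v = g ((c v - e) / \<mu>2)" for e v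
  have arg: "(c v - e) / \<mu>2 \<in> {G 0..G b}" if "e \<in> {0..E1}" "v \<in> {0..1}" for e v
  proof -
    have "0 \<le> c v - e" "c v - e \<le> \<mu>2 * G b" using c[OF that(2)] that(1) E1p Gb by auto
    then show ?thesis using \<mu> G0 by (simp add: field_simps)
  qed
  have X2: "0 \<le> X2 e v" "X2 e v \<le> b" "\<mu>2 * G (X2 e v) = c v - e" if "e \<in> {0..E1}" "v \<in> {0..1}" for e v
  proof -
    have "g ((c v - e) / \<mu>2) \<in> {0..b}" using g(2) arg[OF that] by blast
    then show "0 \<le> X2 e v" "X2 e v \<le> b" by (auto simp: X2_def)
    show "\<mu>2 * G (X2 e v) = c v - e" using g(3)[OF arg[OF that]] \<mu> by (simp add: X2_def)
  qed
  define E where "E s = H (ys s) + lam / 2 * (xs s)\<^sup>2" for s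
  have en': "E s + \<mu>1 * G (xs s) \<in> {c11..c21}" if "s \<in> {0..1}" for s using en[OF that] by (simp add: E_def add.assoc)
  have cE: "continuous_on {0..1} E"
    unfolding E_def by (intro continuous_intros cx continuous_on_compose2[OF A.cont_K[of UNIV] cy]) auto
  have XE1: "X2 E1 1 = xr"
  proof -
    have "\<mu>2 * G xr \<le> \<mu>2 * G b" using xr Gb E1p by linarith
    then have "G xr \<le> G b" using \<mu> by simp
    then have "xr \<le> b" by (rule Gle[OF xr(1) less_imp_le[OF b(1)]])
    moreover have "(c 1 - E1) / \<mu>2 = G xr" using xr(2)[symmetric] \<mu> by (simp add: c_def)
    ultimately show ?thesis using g(4)[of xr] xr by (simp add: X2_def)
  qed
  have less: "lam / 2 * x\<^sup>2 < e" if "0 < e" for x e using lam2[of x] that by simp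
  obtain \<omega> \<nu> :: "real \<Rightarrow> real" where p: "continuous_on {0..1} \<omega>" "continuous_on {0..1} \<nu>"
    "\<omega> ` {0..1} \<subseteq> {0..1}" "\<nu> ` {0..1} \<subseteq> {0..1}" "\<nu> 0 = 0" "\<nu> 1 = 1"
    "\<And>r. r \<in> {0..1} \<Longrightarrow> 0 < E (\<omega> r) \<and> E (\<omega> r) \<le> E1"
    "\<And>r. r \<in> {0..1} \<Longrightarrow> \<exists>x. smooth_sol h (\<lambda>x. lam * x) S x (\<lambda>\<tau>. A.Y (E (\<omega> r)) (x \<tau>)) \<and> x 0 = xs (\<omega> r) \<and>
       x S = X2 (E (\<omega> r)) (\<nu> r) \<and> strict_mono_on {0..S} x \<and> x ` {0..S} \<subseteq> {xs (\<omega> r)..X2 (E (\<omega> r)) (\<nu> r)}"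
  proof (rule A.passage[of xs E E1 X2 xl S])
    show "E 0 \<le> 0" using lam2[of "xs 0"] by (simp add: E_def ends H0)
    show "E1 \<le> E 1" using en'[of 1] E1p by (simp add: ends G0)
    \<comment> \<open>A start on the y-axis with gap energy 0 would have the level 0, below
      \<open>c11\<close>.\<close>
    show "xs s < 0" if "s \<in> {0..1}" "E s = 0" for s
    proof (rule ccontr)
      assume "\<not> xs s < 0"
      then have "xs s = 0" using sg[OF that(1)] by simp
      then show False using en'[OF that(1)] that(2) G0 c1 by simp
    qed
    have "continuous_on ({0..E1} \<times> {0..1}) (\<lambda>z. g ((c (snd z) - fst z) / \<mu>2))"
    proof (rule continuous_on_compose2[OF g(1)])
      show "continuous_on ({0..E1} \<times> {0..1::real}) (\<lambda>z. (c (snd z) - fst z) / \<mu>2)"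
        unfolding c_def using \<mu> by (intro continuous_intros) auto
      show "(\<lambda>z. (c (snd z) - fst z) / \<mu>2) ` ({0..E1} \<times> {0..1}) \<subseteq> {G 0..G b}"
        by (rule image_subsetI, rule arg) (simp_all add: mem_Times_iff)
    qed
    then show "continuous_on ({0..E1} \<times> {0..1}) (\<lambda>(e, v). X2 e v)" by (simp add: X2_def case_prod_beta)
    show "strict_mono_on {0..1} (X2 e)" if "e \<in> {0..E1}" for e
    proof (rule strict_mono_onI)
      fix v w :: real assume vw: "v \<in> {0..1}" "w \<in> {0..1}" "v < w"
      have "(c v - e) / \<mu>2 < (c w - e) / \<mu>2"
        using vw c2 \<mu> by (intro divide_strict_right_mono) (auto simp: c_def)
      then show "X2 e v < X2 e w"
        unfolding X2_def using strict_mono_onD[OF g(5)] arg[OF that] vw by blast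
    qed
    \<comment> \<open>Among the starts with gap energy \<open>E1\<close>, the one on the outer
      circle is farthest from the y-axis.\<close>
    show "xl \<le> xs s" if "s \<in> {0..1}" "E s = E1" for s
    proof (rule ccontr)
      assume "\<not> xl \<le> xs s"
      then have "G xl < G (xs s)" using G_anti xl by simp
      then have "\<mu>1 * G xl < \<mu>1 * G (xs s)" using \<mu> by simp
      then show False using en'[OF that(1)] that(2) xl by simp
    qed
    have "integral {xl..xr} (A.slowness E1) = (LBINT x=xl..xr. \<rho> x)"
    proof (rule A.traversal_time)
      fix x assume x: "x \<in> {xl..xr}"
      show "\<rho> x = 1 / h (A.Y E1 x)"
        by (rule \<rho>[OF x A.Y_pos[OF less[OF E1p(1)]] A.Y(2)]) (use less[OF E1p(1), of x] in simp)
    qed (use xl xr less E1p in auto)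
    then show "integral {xl..X2 E1 1} (A.slowness E1) \<le> S" using time XE1 by simp
  qed (use cx cE sg E1p X2 in auto)
  define x2 where "x2 r = X2 (E (\<omega> r)) (\<nu> r)" for r
  define y2 where "y2 r = A.Y (E (\<omega> r)) (x2 r)" for r
  have \<omega>r: "\<omega> r \<in> {0..1}" and \<nu>r: "\<nu> r \<in> {0..1}" if "r \<in> {0..1}" for r using p(3,4) that by blast+
  have Er: "E (\<omega> r) \<in> {0..E1}" if "r \<in> {0..1}" for r using p(7)[OF that] by auto
  have cE\<omega>: "continuous_on {0..1} (\<lambda>r. E (\<omega> r))" by (rule continuous_on_compose2[OF cE p(1,3)])
  have cx2: "continuous_on {0..1} x2"
    unfolding x2_def X2_def
  proof (rule continuous_on_compose2[OF g(1)])
    show "continuous_on {0..1} (\<lambda>r. (c (\<nu> r) - E (\<omega> r)) / \<mu>2)"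
      unfolding c_def using \<mu> by (intro continuous_intros cE\<omega> p(2)) auto
    show "(\<lambda>r. (c (\<nu> r) - E (\<omega> r)) / \<mu>2) ` {0..1} \<subseteq> {G 0..G b}"
      by (rule image_subsetI, rule arg) (simp_all only: Er \<nu>r)
  qed
  have y2: "0 < y2 r" "H (y2 r) + lam / 2 * (x2 r)\<^sup>2 = E (\<omega> r)" if "r \<in> {0..1}" for r
    using A.Y_pos[OF less] A.Y(2)[OF less_imp_le[OF less]] p(7)[OF that] by (auto simp: y2_def)
  show ?thesis
  proof (rule that[of x2 y2 "\<lambda>r. c (\<nu> r)"])
    show "continuous_on {0..1} y2"
      unfolding y2_def by (rule A.continuous_on_Y[OF cE\<omega> cx2]) (use less p(7) in \<open>auto intro: less_imp_le\<close>)
    show "continuous_on {0..1} (\<lambda>r. c (\<nu> r))" unfolding c_def by (intro continuous_intros p(2))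
    show "c (\<nu> 0) = c12" "c (\<nu> 1) = c22" by (simp_all add: p c_def)
    fix r :: real assume r: "r \<in> {0..1}"
    note X2r = X2[OF Er[OF r] \<nu>r[OF r], folded x2_def]
    have "G (x2 r) \<le> G (xp2 (c (\<nu> r)))"
    proof -
      have "\<mu>2 * G (x2 r) \<le> \<mu>2 * G (xp2 (c (\<nu> r)))"
        using X2r(3) xp2(2)[OF c[OF \<nu>r[OF r]]] lam2[of "xp2 (c (\<nu> r))"] Er[OF r] by auto
      then show ?thesis using \<mu> by simp
    qed
    then have "x2 r \<le> xp2 (c (\<nu> r))" by (rule Gle[OF X2r(1) less_imp_le[OF xp2(1)[OF c[OF \<nu>r[OF r]]]]])
    then show "c (\<nu> r) \<in> {c12..c22} \<and> 0 \<le> x2 r \<and> x2 r \<le> xp2 (c (\<nu> r)) \<and> 0 \<le> y2 r \<and>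
       H (y2 r) + (lam / 2 * (x2 r)\<^sup>2 + \<mu>2 * G (x2 r)) = c (\<nu> r)"
      using c[OF \<nu>r[OF r]] X2r y2[OF r] by auto
    obtain x where x: "smooth_sol h (\<lambda>x. lam * x) S x (\<lambda>\<tau>. A.Y (E (\<omega> r)) (x \<tau>))" "x 0 = xs (\<omega> r)"
       "x S = x2 r" "strict_mono_on {0..S} x" "x ` {0..S} \<subseteq> {xs (\<omega> r)..x2 r}"
      using p(8)[OF r] by (auto simp: x2_def)
    have S: "0 \<le> S" "continuous_on {0..S} x" using x(1) by (auto simp: smooth_sol_def)
    have Ep: "0 < E (\<omega> r)" using p(7)[OF r] by simp
    have ys: "A.Y (E (\<omega> r)) (xs (\<omega> r)) = ys (\<omega> r)"
      by (rule A.Y_eqI) (use sg[OF \<omega>r[OF r]] in \<open>auto simp: E_def\<close>)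
    show "\<exists>s\<in>{0..1}. reaches S (xs s, ys s) (x2 r, y2 r) 1 0"
    proof (rule bexI[OF _ \<omega>r[OF r]])
      show "reaches S (xs (\<omega> r), ys (\<omega> r)) (x2 r, y2 r) 1 0"
        unfolding reaches_def
      proof (rule exI[of _ x], rule exI[of _ "\<lambda>\<tau>. A.Y (E (\<omega> r)) (x \<tau>)"], intro conjI ballI x(1))
        show "(x 0, A.Y (E (\<omega> r)) (x 0)) = (xs (\<omega> r), ys (\<omega> r))" using x(2) ys by simp
        show "(x S, A.Y (E (\<omega> r)) (x S)) = (x2 r, y2 r)" using x(3) by (simp add: y2_def)
        show "has_exactly_zeros x {0..S} 1"
          by (rule strict_mono_one_zero[OF x(4) S(2,1)]) (use x(2,3) sg[OF \<omega>r[OF r]] X2r(1) in simp_all)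
        show "has_exactly_zeros (\<lambda>\<tau>. A.Y (E (\<omega> r)) (x \<tau>)) {0..S} 0"
          by (rule has_exactly_zeros_none) (metis A.Y_pos[OF less[OF Ep]] less_irrefl)
        fix \<tau> assume t: "\<tau> \<in> {0..S}"
        have yt: "0 < A.Y (E (\<omega> r)) (x \<tau>)" "H (A.Y (E (\<omega> r)) (x \<tau>)) + lam / 2 * (x \<tau>)\<^sup>2 = E (\<omega> r)"
          using A.Y_pos[OF less[OF Ep]] A.Y(2)[OF less_imp_le[OF less[OF Ep]]] by auto
        show "min 0 (snd (x2 r, y2 r)) \<le> A.Y (E (\<omega> r)) (x \<tau>)" using yt by simp
        have xt: "xs (\<omega> r) \<le> x \<tau>" "x \<tau> \<le> x2 r" using subsetD[OF x(5) imageI[OF t]] by auto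
        \<comment> \<open>On a gap orbit \<open>H y = E - lam / 2 * x^2\<close> grows with the
          distance from the y-axis, so y is largest at one of the two ends.\<close>
        have "A.Y (E (\<omega> r)) (x \<tau>) \<le> ys (\<omega> r) \<or> A.Y (E (\<omega> r)) (x \<tau>) \<le> y2 r"
        proof (rule ccontr)
          assume "\<not> ?thesis"
          then have n: "ys (\<omega> r) < A.Y (E (\<omega> r)) (x \<tau>)" "y2 r < A.Y (E (\<omega> r)) (x \<tau>)" by auto
          have "H (ys (\<omega> r)) < H (A.Y (E (\<omega> r)) (x \<tau>))" "H (y2 r) < H (A.Y (E (\<omega> r)) (x \<tau>))"
            using n sg[OF \<omega>r[OF r]] y2(1)[OF r] by (auto intro!: H_mono)
          then have "lam / 2 * (x \<tau>)\<^sup>2 < lam / 2 * (xs (\<omega> r))\<^sup>2" "lam / 2 * (x \<tau>)\<^sup>2 < lam / 2 * (x2 r)\<^sup>2"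
            using yt(2) y2(2)[OF r] unfolding E_def by linarith+
          then have "(xs (\<omega> r))\<^sup>2 < (x \<tau>)\<^sup>2" "(x2 r)\<^sup>2 < (x \<tau>)\<^sup>2" using lam by (auto simp: mult_less_cancel_left)
          then have "\<bar>xs (\<omega> r)\<bar> < \<bar>x \<tau>\<bar>" "\<bar>x2 r\<bar> < \<bar>x \<tau>\<bar>" 
            using abs_le_square_iff[of "x \<tau>" "xs (\<omega> r)"] abs_le_square_iff[of "x \<tau>" "x2 r"] by linarith+
          then show False using xt by linarith
        qed
        then show "A.Y (E (\<omega> r)) (x \<tau>) \<le> max (snd (xs (\<omega> r), ys (\<omega> r))) (snd (x2 r, y2 r))" by auto
      qed
    qed
  qed (rule cx2)
qed

text \<open>Orbits of negative gap energy turn back at a vertex on the x-axis. In the exchanged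
  coordinates the energy changes its sign, and the height takes the place of the abscissa.
  \<open>E1\<close> belongs to the orbit with vertex \<open>x0\<close>, the inner-circle point
  nearer to the origin; \<open>yl\<close> and \<open>yr\<close> are its heights over
  \<open>xl1\<close> and \<open>xl2\<close>. The path now starts on the y-axis, where the exchanged
  energy is not positive.\<close>

lemma passage_II_III:
  fixes xs ys :: "real \<Rightarrow> real"
  assumes cx: "continuous_on {0..1} xs" and cy: "continuous_on {0..1} ys"
    and sg: "\<And>s. s \<in> {0..1} \<Longrightarrow> xs s \<le> 0 \<and> 0 \<le> ys s"
    and en: "\<And>s. s \<in> {0..1} \<Longrightarrow> H (ys s) + (lam / 2 * (xs s)\<^sup>2 + \<mu>1 * G (xs s)) \<in> {c11..c21}"
    and ends: "ys 1 = 0" "xs 0 = 0"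
    and x0: "x0 = max (xm1 c11) (xm2 c12)" and E1: "E1 = - lam / 2 * x0\<^sup>2"
    and xl: "xl1 \<le> 0" "\<mu>1 * G xl1 = c21 + E1" and yl: "0 \<le> yl" "H yl + lam / 2 * xl1\<^sup>2 = - E1"
    and xr: "xl2 \<le> 0" "\<mu>2 * G xl2 = c22 + E1" and yr: "yr \<le> 0" "H yr + lam / 2 * xl2\<^sup>2 = - E1"
    and \<rho>1: "\<And>x y. x \<le> 0 \<Longrightarrow> 0 < y \<Longrightarrow> y \<le> yl \<Longrightarrow> H y + lam / 2 * x\<^sup>2 = - E1 \<Longrightarrow> \<rho>1 x = 1 / h y"
    and \<rho>2: "\<And>x y. x \<le> 0 \<Longrightarrow> yr \<le> y \<Longrightarrow> y < 0 \<Longrightarrow> H y + lam / 2 * x\<^sup>2 = - E1 \<Longrightarrow> \<rho>2 x = 1 / - h y"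
    and time: "(LBINT x=xl1..x0. \<rho>1 x) + (LBINT x=xl2..x0. \<rho>2 x) \<le> S"
  obtains x2 y2 C :: "real \<Rightarrow> real" where "continuous_on {0..1} x2" "continuous_on {0..1} y2" "continuous_on {0..1} C"
    "C 0 = c12" "C 1 = c22"
    "\<And>r. r \<in> {0..1} \<Longrightarrow> C r \<in> {c12..c22} \<and> xm2 (C r) \<le> x2 r \<and> x2 r \<le> 0 \<and> y2 r \<le> 0 \<and>
       H (y2 r) + (lam / 2 * (x2 r)\<^sup>2 + \<mu>2 * G (x2 r)) = C r"
    "\<And>r. r \<in> {0..1} \<Longrightarrow> \<exists>s\<in>{0..1}. reaches S (xs s, ys s) (x2 r, y2 r) 0 1"
proof -
  have rf: "((\<lambda>y. - y) has_real_derivative - 1) (at y)" for y :: real by (auto intro!: derivative_eq_intros)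
  interpret M: half_hamiltonian "\<lambda>y. - h (- y)" "\<lambda>y. H (- y)" "\<lambda>_. 0" "\<lambda>_. 0"
    by unfold_locales (use restoring_reflect[OF h] DERIV_chain2[OF dH rf] H0 in auto)
  have x0n: "x0 < 0" "xm1 c11 \<le> x0" "xm2 c12 \<le> x0" using xm1(1)[of c11] xm2(1)[of c12] c1 c2 by (auto simp: x0)
  have E1p: "0 < E1" unfolding E1 using x0n lam by (intro mult_pos_pos) auto
  have G_le: "y \<le> x" if "x \<le> 0" "y \<le> 0" "G x \<le> G y" for x y
    using G_anti[of x y] that by (cases "x < y") auto
  have sq_le: "y\<^sup>2 \<le> x\<^sup>2" if "x \<le> y" "y \<le> 0" for x y :: real
    using that abs_le_square_iff[of y x] by simp
  have xm2_le: "xm2 c \<le> xm2 c12" if "c \<in> {c12..c22}" for c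
  proof (rule ccontr)
    assume n: "\<not> xm2 c \<le> xm2 c12"
    have "c12 \<in> {c12..c22}" using c2 by simp
    then have "lam / 2 * (xm2 c)\<^sup>2 + \<mu>2 * G (xm2 c) < c12" using n xm2(1)[OF that] by (intro xm2(3)) auto
    then show False using xm2(2)[OF that] that by simp
  qed
  have key: "- lam / 2 * (xm2 c)\<^sup>2 \<ge> E1" if "c \<in> {c12..c22}" for c
  proof -
    have "x0\<^sup>2 \<le> (xm2 c)\<^sup>2" using xm2_le[OF that] x0n by (intro sq_le) auto
    then show ?thesis using lam by (simp add: E1)
  qed
  define b where "b = - xm2 c22"
  have c22: "c22 \<in> {c12..c22}" using c2 by simp
  have b: "0 < b" "lam / 2 * b\<^sup>2 + \<mu>2 * G (- b) = c22" using xm2(1,2)[OF c22] by (auto simp: b_def)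
  have Gb: "c22 + E1 \<le> \<mu>2 * G (- b)" using b(2) key[OF c22] by (simp add: b_def)
  obtain g where g: "continuous_on {G (- 0)..G (- b)} g" "g ` {G (- 0)..G (- b)} \<subseteq> {0..b}"
    "\<And>t. t \<in> {G (- 0)..G (- b)} \<Longrightarrow> G (- g t) = t" "\<And>u. u \<in> {0..b} \<Longrightarrow> g (G (- u)) = u"
    "strict_mono_on {G (- 0)..G (- b)} g"
  proof (rule strict_mono_inverse_on_interval[of 0 b "\<lambda>x. G (- x)"])
    show "continuous_on {0..b} (\<lambda>x. G (- x))" by (rule continuous_on_compose2[OF cG]) (auto intro!: continuous_intros)
    show "strict_mono_on {0..b} (\<lambda>x. G (- x))" by (rule strict_mono_onI) (auto intro!: G_anti)
  qed (use b in auto)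
  define c where "c v = c12 + v * (c22 - c12)" for v
  have c: "c v \<in> {c12..c22}" if "v \<in> {0..1}" for v
  proof -
    have "0 \<le> v * (c22 - c12)" "v * (c22 - c12) \<le> 1 * (c22 - c12)"
      using that c2 by (intro mult_nonneg_nonneg mult_right_mono; simp)+
    then show ?thesis by (simp add: c_def)
  qed
  \<comment> \<open>The abscissa at which the orbit meets the level \<open>c v\<close>; because the
    energy has changed its sign, the equation is now \<open>\<mu>2 * G x = c v + e\<close>. The
    coordinate needed by \<open>passage\<close> is the depth \<open>X2\<close> of this point below
    the x-axis.\<close>
  define Xt where "Xt e v = - g ((c v + e) / \<mu>2)" for e v
  have arg: "(c v + e) / \<mu>2 \<in> {G (- 0)..G (- b)}" if "e \<in> {0..E1}" "v \<in> {0..1}" for e v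
  proof -
    have "0 \<le> c v + e" "c v + e \<le> \<mu>2 * G (- b)" using c[OF that(2)] that(1) c2 Gb by auto
    then show ?thesis using \<mu> G0 by (simp add: field_simps)
  qed
  have Xt: "Xt e v \<le> 0" "\<mu>2 * G (Xt e v) = c v + e" if "e \<in> {0..E1}" "v \<in> {0..1}" for e v
  proof -
    have "g ((c v + e) / \<mu>2) \<in> {0..b}" using g(2) arg[OF that] by blast
    then show "Xt e v \<le> 0" by (auto simp: Xt_def)
    show "\<mu>2 * G (Xt e v) = c v + e" using g(3)[OF arg[OF that]] \<mu> by (simp add: Xt_def)
  qed
  have Xt_ge: "xm2 (c v) \<le> Xt e v" if "e \<in> {0..E1}" "v \<in> {0..1}" for e v
  proof -
    note cv = c[OF that(2)]
    have "\<mu>2 * G (Xt e v) \<le> \<mu>2 * G (xm2 (c v))"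
      using Xt(2)[OF that] xm2(2)[OF cv] key[OF cv] that(1) by auto
    then have "G (Xt e v) \<le> G (xm2 (c v))" using \<mu> by simp
    then show ?thesis by (rule G_le[OF Xt(1)[OF that] less_imp_le[OF xm2(1)[OF cv]]])
  qed
  \<comment> \<open>\<open>w\<close> is the vertex of the orbit of energy e. As
    \<open>x0 \<le> w\<close>, it lies inside the new annulus's inner circle or on it, so its level
    in the new annulus is at most \<open>c v\<close>. The orbit therefore meets the level
    \<open>c v\<close> at the vertex or to the left of it, and the depth there is well
    defined.\<close>
  have Xt_E: "e \<le> - lam / 2 * (Xt e v)\<^sup>2" if "e \<in> {0..E1}" "v \<in> {0..1}" for e v
  proof -
    define w where "w = - sqrt (2 * e / - lam)"
    have nn: "0 \<le> 2 * e / - lam" using that(1) lam by (intro divide_nonneg_pos) auto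
    have w: "w \<le> 0" "- lam / 2 * w\<^sup>2 = e" using nn lam by (simp_all add: w_def)
    have "- lam / 2 * w\<^sup>2 \<le> - lam / 2 * x0\<^sup>2" using w that(1) by (simp add: E1)
    then have "w\<^sup>2 \<le> x0\<^sup>2" using lam by (simp add: mult_le_cancel_left)
    then have "x0 \<le> w" using abs_le_square_iff[of w x0] x0n w by linarith
    have "lam / 2 * w\<^sup>2 + \<mu>2 * G w \<le> c v"
    proof (cases "xm2 c12 < w")
      case True
      then show ?thesis using xm2(3)[of c12 w] w c2 c[OF that(2)] by simp
    next
      case False
      then have "w = xm2 c12" using \<open>x0 \<le> w\<close> x0n by simp
      then show ?thesis using xm2(2)[of c12] c2 c[OF that(2)] by simp
    qed
    then have "\<mu>2 * G w \<le> \<mu>2 * G (Xt e v)" using Xt(2)[OF that] w(2) by linarith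
    then have "G w \<le> G (Xt e v)" using \<mu> by simp
    then have "Xt e v \<le> w" by (rule G_le[OF w(1) Xt(1)[OF that]])
    then have "w\<^sup>2 \<le> (Xt e v)\<^sup>2" by (rule sq_le[OF _ w(1)])
    then have "- lam / 2 * w\<^sup>2 \<le> - lam / 2 * (Xt e v)\<^sup>2" using lam by (intro mult_left_mono) auto
    then show ?thesis using w(2) by simp
  qed
  define X2 where "X2 e v = M.Kinv (- lam / 2 * (Xt e v)\<^sup>2 - e)" for e v
  have X2: "0 \<le> X2 e v" "H (- X2 e v) = - lam / 2 * (Xt e v)\<^sup>2 - e" if "e \<in> {0..E1}" "v \<in> {0..1}" for e v
    using M.Kinv[of "- lam / 2 * (Xt e v)\<^sup>2 - e"] Xt_E[OF that] by (auto simp: X2_def)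
  have M_unique: "z = M.Kinv w" if "0 \<le> z" "H (- z) = w" for z w using M.Kinv_K[of z] that by simp
  define X where "X s = - ys s" for s
  define E where "E s = - lam / 2 * (xs s)\<^sup>2 - H (ys s)" for s
  have en': "\<mu>1 * G (xs s) - E s \<in> {c11..c21}" if "s \<in> {0..1}" for s using en[OF that] by (simp add: E_def)
  have cE: "continuous_on {0..1} E"
    unfolding E_def by (intro continuous_intros cx continuous_on_compose2[OF A.cont_K[of UNIV] cy]) auto
  have XtE1: "Xt E1 1 = xl2"
  proof -
    have "\<mu>2 * G xl2 \<le> \<mu>2 * G (- b)" using xr Gb by simp
    then have "G xl2 \<le> G (- b)" using \<mu> by simp
    then have "- b \<le> xl2" using b by (intro G_le[OF xr(1)]) simp_all
    moreover have "(c 1 + E1) / \<mu>2 = G (- (- xl2))" using xr(2)[symmetric] \<mu> by (simp add: c_def)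
    ultimately show ?thesis using g(4)[of "- xl2"] xr(1) by (simp add: Xt_def)
  qed
  have X2E1: "X2 E1 1 = - yr"
    unfolding X2_def by (rule M_unique[symmetric]) (use yr XtE1 in auto)
  have less: "- H (- x) < e" if "0 < e" for x e using H_pos[of "- x"] H0 that by (cases "x = 0") auto
  have BY: "0 < B.Y e x" "- lam / 2 * (B.Y e x)\<^sup>2 - H (- x) = e" if "0 < e" for e x
    using B.Y_pos[OF less[OF that]] B.Y(2)[OF less_imp_le[OF less[OF that]]] by auto
  have BY_eq: "B.Y e x = y" if "0 \<le> y" "- lam / 2 * y\<^sup>2 - H (- x) = e" for e x y
    by (rule B.Y_eqI) (use that in auto)
  \<comment> \<open>The integral over the height is split at the vertex. Each part is the duration
    of an arc that is a graph over x, hence one of the two integrals of the transition time.\<close>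
  have total_time: "integral {- yl..- yr} (B.slowness E1) \<le> S"
  proof -
    have less': "- H (- x) < E1" for x by (rule less[OF E1p])
    define T1 where "T1 = integral {- yl..0} (B.slowness E1)"
    define T2 where "T2 = integral {0..- yr} (B.slowness E1)"
    have "T1 + T2 = integral {- yl..- yr} (B.slowness E1)"
      unfolding T1_def T2_def using yl yr
      by (intro Henstock_Kurzweil_Integration.integral_combine integrable_continuous_real B.continuous_on_slowness1 less') auto
    moreover have "(LBINT x=xl1..x0. \<rho>1 x) = T1"
    proof -
      obtain u where u: "smooth_sol (\<lambda>y. - lam * y) (\<lambda>x. h (- x)) T1 u (\<lambda>\<tau>. B.Y E1 (u \<tau>))" "u 0 = - yl" "u T1 = 0"
        "strict_mono_on {0..T1} u"
        by (rule B.traversal[of "- yl" 0 E1 T1, OF _ less' T1_def]) (use yl in auto)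
      have y: "0 < - u \<tau>" "- u \<tau> \<le> yl" if "\<tau> \<in> {0<..<T1}" for \<tau>
        using strict_mono_onD[OF u(4), of \<tau> T1] strict_mono_onD[OF u(4), of 0 \<tau>] that u(2,3) by auto
      have "(LBINT \<xi>=- B.Y E1 (u 0)..- B.Y E1 (u T1). \<rho>1 \<xi>) = T1"
      proof (rule smooth_sol_time[OF smooth_sol_swap[OF u(1)] _ A.cont_k])
        fix \<tau> assume t: "\<tau> \<in> {0<..<T1}"
        show "0 < h (- u \<tau>)" using y[OF t] by (intro A.k_pos)
        show "\<rho>1 (- B.Y E1 (u \<tau>)) = 1 / h (- u \<tau>)"
          by (rule \<rho>1) (use y[OF t] BY[OF E1p, of "u \<tau>"] in auto)
      qed
      moreover have "B.Y E1 (- yl) = - xl1" by (rule BY_eq) (use yl xl in auto)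
      moreover have "B.Y E1 0 = - x0" by (rule BY_eq) (use x0n H0 in \<open>auto simp: E1\<close>)
      ultimately show ?thesis using u(2,3) by simp
    qed
    moreover have "(LBINT x=xl2..x0. \<rho>2 x) = T2"
    proof -
      obtain u where u: "smooth_sol (\<lambda>y. - lam * y) (\<lambda>x. h (- x)) T2 u (\<lambda>\<tau>. B.Y E1 (u \<tau>))" "u 0 = 0" "u T2 = - yr"
        "strict_mono_on {0..T2} u"
        by (rule B.traversal[of 0 "- yr" E1 T2, OF _ less' T2_def]) (use yr in auto)
      have y: "0 < u \<tau>" "u \<tau> \<le> - yr" if "\<tau> \<in> {0<..<T2}" for \<tau>
        using strict_mono_onD[OF u(4), of \<tau> T2] strict_mono_onD[OF u(4), of 0 \<tau>] that u(2,3) by auto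
      \<comment> \<open>After the vertex x decreases. Reflected in the x-axis and run backwards, the
        arc has x increasing towards \<open>x0\<close>, as \<open>smooth_sol_time\<close> and the
        orientation of the second integral require.\<close>
      have rev: "smooth_sol (\<lambda>y. - h (- y)) (\<lambda>x. lam * x) T2 (\<lambda>\<tau>. - B.Y E1 (u (T2 - \<tau>))) (\<lambda>\<tau>. u (T2 - \<tau>))"
        using smooth_sol_reverse[where \<rho> = "- 1" and \<sigma> = 1 and h = "\<lambda>y. - h (- y)" and f = "\<lambda>x. lam * x",
            of T2 "\<lambda>\<tau>. - B.Y E1 (u \<tau>)" "\<lambda>\<tau>. - u \<tau>"] smooth_sol_swap[OF u(1)] by simp
      have "(LBINT \<xi>=- B.Y E1 (u (T2 - 0))..- B.Y E1 (u (T2 - T2)). \<rho>2 \<xi>) = T2"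
      proof (rule smooth_sol_time[OF rev _ M.cont_k])
        fix \<tau> assume "\<tau> \<in> {0<..<T2}"
        then have t: "T2 - \<tau> \<in> {0<..<T2}" by auto
        show "0 < - h (- u (T2 - \<tau>))" using y[OF t] M.k_pos by simp
        show "\<rho>2 (- B.Y E1 (u (T2 - \<tau>))) = 1 / - h (- u (T2 - \<tau>))"
          by (rule \<rho>2) (use y[OF t] BY[OF E1p, of "u (T2 - \<tau>)"] in auto)
      qed
      moreover have "B.Y E1 (- yr) = - xl2" by (rule BY_eq) (use yr xr in auto)
      moreover have "B.Y E1 0 = - x0" by (rule BY_eq) (use x0n H0 in \<open>auto simp: E1\<close>)
      ultimately show ?thesis using u(2,3) by simp
    qed
    ultimately show ?thesis using time by simp
  qed
  obtain \<omega> \<nu> :: "real \<Rightarrow> real" where p: "continuous_on {0..1} \<omega>" "continuous_on {0..1} \<nu>"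
    "\<omega> ` {0..1} \<subseteq> {0..1}" "\<nu> ` {0..1} \<subseteq> {0..1}" "\<nu> 0 = 0" "\<nu> 1 = 1"
    "\<And>r. r \<in> {0..1} \<Longrightarrow> 0 < E (\<omega> r) \<and> E (\<omega> r) \<le> E1"
    "\<And>r. r \<in> {0..1} \<Longrightarrow> \<exists>x. smooth_sol (\<lambda>y. - lam * y) (\<lambda>x. h (- x)) S x (\<lambda>\<tau>. B.Y (E (\<omega> r)) (x \<tau>)) \<and> x 0 = X (\<omega> r) \<and>
       x S = X2 (E (\<omega> r)) (\<nu> r) \<and> strict_mono_on {0..S} x \<and> x ` {0..S} \<subseteq> {X (\<omega> r)..X2 (E (\<omega> r)) (\<nu> r)}"
  proof (rule B.passage[of X E E1 X2 "- yl" S])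
    show "continuous_on {0..1} X" unfolding X_def by (intro continuous_intros cy)
    show "X s \<le> 0" if "s \<in> {0..1}" for s using sg[OF that] by (simp add: X_def)
    show "E 0 \<le> 0" using H_pos[of "ys 0"] H0 by (cases "ys 0 = 0") (auto simp: E_def ends)
    \<comment> \<open>On the x-axis a state of the old annulus lies at or left of
      \<open>xm1 c11\<close>, hence of \<open>x0\<close>, and the energy there grows with the
      distance from the origin.\<close>
    show "E1 \<le> E 1"
    proof -
      have "\<not> xm1 c11 < xs 1"
      proof
        assume "xm1 c11 < xs 1"
        then have "lam / 2 * (xs 1)\<^sup>2 + \<mu>1 * G (xs 1) < c11" using sg[of 1] c1 by (intro xm1(2)) auto
        then show False using en[of 1] ends H0 by simp
      qed
      then have "x0\<^sup>2 \<le> (xs 1)\<^sup>2" using x0n by (intro sq_le) auto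
      then have "- lam / 2 * x0\<^sup>2 \<le> - lam / 2 * (xs 1)\<^sup>2" using lam by (intro mult_left_mono) auto
      then show ?thesis by (simp add: E_def E1 ends H0)
    qed
    show "X s < 0" if "s \<in> {0..1}" "E s = 0" for s
    proof (rule ccontr)
      assume "\<not> X s < 0"
      then have "ys s = 0" using sg[OF that(1)] by (simp add: X_def)
      then have "xs s = 0" using that(2) lam H0 by (simp add: E_def)
      then show False using en'[OF that(1)] that(2) G0 c1 by simp
    qed
    have cg: "continuous_on ({0..E1} \<times> {0..1}) (\<lambda>z. g ((c (snd z) + fst z) / \<mu>2))"
    proof (rule continuous_on_compose2[OF g(1)])
      show "continuous_on ({0..E1} \<times> {0..1::real}) (\<lambda>z. (c (snd z) + fst z) / \<mu>2)"
        unfolding c_def using \<mu> by (intro continuous_intros) auto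
      show "(\<lambda>z. (c (snd z) + fst z) / \<mu>2) ` ({0..E1} \<times> {0..1}) \<subseteq> {G (- 0)..G (- b)}"
        by (rule image_subsetI, rule arg) (simp_all add: mem_Times_iff)
    qed
    have "continuous_on ({0..E1} \<times> {0..1}) (\<lambda>z. M.Kinv (- lam / 2 * (- g ((c (snd z) + fst z) / \<mu>2))\<^sup>2 - fst z))"
    proof (rule continuous_on_compose2[OF M.continuous_on_Kinv])
      show "continuous_on ({0..E1} \<times> {0..1}) (\<lambda>z. - lam / 2 * (- g ((c (snd z) + fst z) / \<mu>2))\<^sup>2 - fst z)"
        by (intro continuous_intros cg)
      show "(\<lambda>z. - lam / 2 * (- g ((c (snd z) + fst z) / \<mu>2))\<^sup>2 - fst z) ` ({0..E1} \<times> {0..1}) \<subseteq> {0..}"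
      proof (rule image_subsetI)
        fix z :: "real \<times> real" assume "z \<in> {0..E1} \<times> {0..1}"
        then show "- lam / 2 * (- g ((c (snd z) + fst z) / \<mu>2))\<^sup>2 - fst z \<in> {0..}"
          using Xt_E[of "fst z" "snd z"] by (simp add: Xt_def mem_Times_iff)
      qed
    qed
    then show "continuous_on ({0..E1} \<times> {0..1}) (\<lambda>(e, v). X2 e v)" by (simp add: X2_def Xt_def case_prod_beta)
    show "strict_mono_on {0..1} (X2 e)" if e: "e \<in> {0..E1}" for e
    proof (rule strict_mono_onI)
      fix v w :: real assume vw: "v \<in> {0..1}" "w \<in> {0..1}" "v < w"
      have "(c v + e) / \<mu>2 < (c w + e) / \<mu>2"
        using vw c2 \<mu> by (intro divide_strict_right_mono) (auto simp: c_def)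
      then have "g ((c v + e) / \<mu>2) < g ((c w + e) / \<mu>2)"
        using strict_mono_onD[OF g(5)] arg[OF e] vw by blast
      moreover have "0 \<le> g ((c v + e) / \<mu>2)" using Xt(1)[OF e vw(1)] by (simp add: Xt_def)
      ultimately have "(Xt e v)\<^sup>2 < (Xt e w)\<^sup>2" unfolding Xt_def power2_minus by (rule power_strict_mono) simp
      then have "- lam / 2 * (Xt e v)\<^sup>2 < - lam / 2 * (Xt e w)\<^sup>2" using lam by (intro mult_strict_left_mono) auto
      then show "X2 e v < X2 e w" unfolding X2_def using Xt_E[OF e vw(1)] by (intro M.Kinv_less) auto
    qed
    show "- yl \<le> X s" if "s \<in> {0..1}" "E s = E1" for s
    proof (rule ccontr)
      assume "\<not> - yl \<le> X s"
      then have "H yl < H (ys s)" using yl by (intro H_mono) (auto simp: X_def)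
      then have "- lam / 2 * xl1\<^sup>2 < - lam / 2 * (xs s)\<^sup>2" using yl that(2) by (simp add: E_def)
      then have "xl1\<^sup>2 < (xs s)\<^sup>2" using lam by (simp add: mult_less_cancel_left)
      then have "xs s < xl1" using sq_le[of xl1 "xs s"] sg[OF that(1)] by (cases "xl1 \<le> xs s") auto
      then have "G xl1 < G (xs s)" using xl(1) by (rule G_anti)
      then have "\<mu>1 * G xl1 < \<mu>1 * G (xs s)" using \<mu> by simp
      then show False using en'[OF that(1)] that(2) xl by simp
    qed
    show "integral {- yl..X2 E1 1} (B.slowness E1) \<le> S" using total_time X2E1 by simp
    show "0 \<le> X2 e v" if "e \<in> {0..E1}" "v \<in> {0..1}" for e v by (rule X2(1)[OF that])
  qed (rule cE E1p | (rule that; assumption))+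
  define x2 where "x2 r = Xt (E (\<omega> r)) (\<nu> r)" for r
  define y2 where "y2 r = - X2 (E (\<omega> r)) (\<nu> r)" for r
  have \<omega>r: "\<omega> r \<in> {0..1}" and \<nu>r: "\<nu> r \<in> {0..1}" if "r \<in> {0..1}" for r using p(3,4) that by blast+
  have Er: "E (\<omega> r) \<in> {0..E1}" if "r \<in> {0..1}" for r using p(7)[OF that] by auto
  have cE\<omega>: "continuous_on {0..1} (\<lambda>r. E (\<omega> r))" by (rule continuous_on_compose2[OF cE p(1,3)])
  have cx2: "continuous_on {0..1} x2"
    unfolding x2_def Xt_def
  proof (intro continuous_on_minus continuous_on_compose2[OF g(1)])
    show "continuous_on {0..1} (\<lambda>r. (c (\<nu> r) + E (\<omega> r)) / \<mu>2)"
      unfolding c_def using \<mu> by (intro continuous_intros cE\<omega> p(2)) auto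
    show "(\<lambda>r. (c (\<nu> r) + E (\<omega> r)) / \<mu>2) ` {0..1} \<subseteq> {G (- 0)..G (- b)}"
      by (rule image_subsetI, rule arg) (simp_all only: Er \<nu>r)
  qed
  have x2E: "E (\<omega> r) \<le> - lam / 2 * (x2 r)\<^sup>2" if "r \<in> {0..1}" for r
    unfolding x2_def by (rule Xt_E[OF Er[OF that] \<nu>r[OF that]])
  have Hy2: "H (y2 r) = - lam / 2 * (x2 r)\<^sup>2 - E (\<omega> r)" if "r \<in> {0..1}" for r
    unfolding x2_def y2_def by (rule X2(2)[OF Er[OF that] \<nu>r[OF that]])
  show ?thesis
  proof (rule that[of x2 y2 "\<lambda>r. c (\<nu> r)"])
    have "continuous_on {0..1} (\<lambda>r. M.Kinv (- lam / 2 * (x2 r)\<^sup>2 - E (\<omega> r)))"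
    proof (rule continuous_on_compose2[OF M.continuous_on_Kinv])
      show "continuous_on {0..1} (\<lambda>r. - lam / 2 * (x2 r)\<^sup>2 - E (\<omega> r))" by (intro continuous_intros cx2 cE\<omega>)
    qed (use x2E in auto)
    then show "continuous_on {0..1} y2" unfolding y2_def X2_def x2_def by (intro continuous_intros)
    show "continuous_on {0..1} (\<lambda>r. c (\<nu> r))" unfolding c_def by (intro continuous_intros p(2))
    show "c (\<nu> 0) = c12" "c (\<nu> 1) = c22" by (simp_all add: p c_def)
    fix r :: real assume r: "r \<in> {0..1}"
    note Xr = Xt[OF Er[OF r] \<nu>r[OF r], folded x2_def] Xt_ge[OF Er[OF r] \<nu>r[OF r], folded x2_def]
    have y2n: "y2 r \<le> 0" using X2(1)[OF Er[OF r] \<nu>r[OF r]] by (simp add: y2_def)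
    show "c (\<nu> r) \<in> {c12..c22} \<and> xm2 (c (\<nu> r)) \<le> x2 r \<and> x2 r \<le> 0 \<and> y2 r \<le> 0 \<and>
       H (y2 r) + (lam / 2 * (x2 r)\<^sup>2 + \<mu>2 * G (x2 r)) = c (\<nu> r)"
      using c[OF \<nu>r[OF r]] Xr y2n Hy2[OF r] by auto
    obtain u where u: "smooth_sol (\<lambda>y. - lam * y) (\<lambda>x. h (- x)) S u (\<lambda>\<tau>. B.Y (E (\<omega> r)) (u \<tau>))" "u 0 = - ys (\<omega> r)"
       "u S = - y2 r" "strict_mono_on {0..S} u" "u ` {0..S} \<subseteq> {- ys (\<omega> r)..- y2 r}"
      using p(8)[OF r] by (auto simp: y2_def X_def)
    have S: "0 \<le> S" "continuous_on {0..S} u" using u(1) by (auto simp: smooth_sol_def)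
    have Ep: "0 < E (\<omega> r)" using p(7)[OF r] by simp
    have z: "has_exactly_zeros u {0..S} 1"
      by (rule strict_mono_one_zero[OF u(4) S(2,1)]) (use u(2,3) sg[OF \<omega>r[OF r]] y2n in simp_all)
    show "\<exists>s\<in>{0..1}. reaches S (xs s, ys s) (x2 r, y2 r) 0 1"
    proof (rule bexI[OF _ \<omega>r[OF r]])
      show "reaches S (xs (\<omega> r), ys (\<omega> r)) (x2 r, y2 r) 0 1"
        unfolding reaches_def
      proof (rule exI[of _ "\<lambda>\<tau>. - B.Y (E (\<omega> r)) (u \<tau>)"], rule exI[of _ "\<lambda>\<tau>. - u \<tau>"],
          intro conjI ballI smooth_sol_swap[OF u(1)])
        have "B.Y (E (\<omega> r)) (u 0) = - xs (\<omega> r)"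
          by (rule BY_eq) (use sg[OF \<omega>r[OF r]] u(2) in \<open>simp_all add: E_def\<close>)
        then show "(- B.Y (E (\<omega> r)) (u 0), - u 0) = (xs (\<omega> r), ys (\<omega> r))" using u(2) by simp
        have "B.Y (E (\<omega> r)) (u S) = - x2 r"
          by (rule BY_eq) (use Xr(1) u(3) Hy2[OF r] in simp_all)
        then show "(- B.Y (E (\<omega> r)) (u S), - u S) = (x2 r, y2 r)" using u(3) by simp
        show "has_exactly_zeros (\<lambda>\<tau>. - B.Y (E (\<omega> r)) (u \<tau>)) {0..S} 0"
          by (rule has_exactly_zeros_none) (metis BY(1)[OF Ep] less_irrefl neg_equal_0_iff_equal)
        show "has_exactly_zeros (\<lambda>\<tau>. - u \<tau>) {0..S} 1" using z by (simp add: has_exactly_zeros_def)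
        fix \<tau> assume t: "\<tau> \<in> {0..S}"
        have "- ys (\<omega> r) \<le> u \<tau>" "u \<tau> \<le> - y2 r" using subsetD[OF u(5) imageI[OF t]] by auto
        then show "min 0 (snd (x2 r, y2 r)) \<le> - u \<tau>" "- u \<tau> \<le> max (snd (xs (\<omega> r), ys (\<omega> r))) (snd (x2 r, y2 r))"
          by auto
      qed
    qed
  qed (rule cx2)
qed

end

section \<open>Reduction of the boundary value problem to bounded strips\<close>

lemma primitive0_0: "primitive0 f 0 = 0"
  by (simp add: primitive0_def zero_ereal_def interval_lebesgue_integral_def set_lebesgue_integral_def)

lemma primitive0_deriv:
  fixes f :: "real \<Rightarrow> real"
  assumes "continuous_on {a..b} f" "0 \<in> {a..b}" "x \<in> {a<..<b}"
  shows "(primitive0 f has_real_derivative f x) (at x)"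
proof -
  have "((\<lambda>u. LBINT y=0..u. f y) has_vector_derivative f x) (at x within {a..b})"
    using interval_integral_FTC2[of a 0 b f x] assms by (simp add: zero_ereal_def)
  moreover have "at x within {a..b} = at x" using assms(3) by (intro at_within_interior) auto
  ultimately show ?thesis
    unfolding has_real_derivative_iff_has_vector_derivative primitive0_def[abs_def] by simp
qed

lemma primitive0_deriv_UNIV:
  "continuous_on UNIV f \<Longrightarrow> (primitive0 f has_real_derivative f x) (at x)"
  by (rule primitive0_deriv[of "min 0 x - 1" "max 0 x + 1"]) (auto intro: continuous_on_subset)

text \<open>Absolute continuity of the solutions is obtained from a Lipschitz bound: the derivatives
  are bounded on the compact time interval, and the fundamental theorem tolerates the finitely many
  joints.\<close>

lemma lipschitz_of_bounded_derivative:
  fixes u u' :: "real \<Rightarrow> real"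
  assumes cu: "continuous_on {a..b} u" and N: "finite N"
    and du: "\<And>\<tau>. \<tau> \<in> {a<..<b} - N \<Longrightarrow> (u has_real_derivative u' \<tau>) (at \<tau>)"
    and B: "\<And>\<tau>. \<tau> \<in> {a..b} \<Longrightarrow> \<bar>u' \<tau>\<bar> \<le> B" and rs: "r \<in> {a..b}" "s \<in> {a..b}" "r \<le> s"
  shows "\<bar>u s - u r\<bar> \<le> B * (s - r)"
proof -
  have "(u' has_integral (u s - u r)) {r..s}"
  proof (rule fundamental_theorem_of_calculus_interior_strong[OF N rs(3)])
    show "(u has_vector_derivative u' x) (at x)" if "x \<in> {r<..<s} - N" for x
      using du[of x] that rs by (auto simp: has_real_derivative_iff_has_vector_derivative)
    show "continuous_on {r..s} u" using rs by (intro continuous_on_subset[OF cu]) auto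
  qed
  then have "norm (u s - u r) \<le> B * measure lborel {r..s}"
    using order_trans[OF abs_ge_zero B[OF rs(1)]] B rs by (intro has_integral_bound_real[where S = "{}" and f = u']) auto
  then show ?thesis using rs(3) by simp
qed

lemma abs_continuous_of_lipschitz:
  assumes L: "\<And>r s. r \<in> {a..b} \<Longrightarrow> s \<in> {a..b} \<Longrightarrow> r \<le> s \<Longrightarrow> \<bar>u s - u r\<bar> \<le> B * (s - r)" and B: "0 \<le> B"
  shows "abs_continuous_on_interval a b u"
  unfolding abs_continuous_on_interval_def
proof (intro allI impI)
  fix \<epsilon> :: real assume \<epsilon>: "0 < \<epsilon>"
  show "\<exists>\<delta>>0. \<forall>\<D> S. \<D> division_of S \<and> S \<subseteq> {a..b} \<and> (\<Sum>K\<in>\<D>. Sup K - Inf K) < \<delta>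
        \<longrightarrow> (\<Sum>K\<in>\<D>. \<bar>u (Sup K) - u (Inf K)\<bar>) < \<epsilon>"
  proof (intro exI[of _ "\<epsilon> / (B + 1)"] conjI allI impI)
    show "0 < \<epsilon> / (B + 1)" using \<epsilon> B by simp
    fix \<D> :: "real set set" and S assume D: "\<D> division_of S \<and> S \<subseteq> {a..b} \<and> (\<Sum>K\<in>\<D>. Sup K - Inf K) < \<epsilon> / (B + 1)"
    have K: "Inf K \<in> {a..b} \<and> Sup K \<in> {a..b} \<and> Inf K \<le> Sup K" if "K \<in> \<D>" for K
    proof -
      obtain p q where pq: "K = cbox p q" using division_ofD(4)[OF conjunct1[OF D] \<open>K \<in> \<D>\<close>] by blast
      have ne: "K \<noteq> {}" "K \<subseteq> {a..b}" using division_ofD(2,3)[OF conjunct1[OF D] that] D by auto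
      then show ?thesis using pq by auto
    qed
    have "(\<Sum>K\<in>\<D>. \<bar>u (Sup K) - u (Inf K)\<bar>) \<le> (\<Sum>K\<in>\<D>. B * (Sup K - Inf K))"
      using K L by (intro sum_mono) auto
    also have "\<dots> = B * (\<Sum>K\<in>\<D>. Sup K - Inf K)" by (simp add: sum_distrib_left)
    also have "\<dots> \<le> B * (\<epsilon> / (B + 1))" using D B by (intro mult_left_mono) auto
    also have "\<dots> < \<epsilon>" using \<epsilon> B by (simp add: field_simps)
    finally show "(\<Sum>K\<in>\<D>. \<bar>u (Sup K) - u (Inf K)\<bar>) < \<epsilon>" .
  qed
qed

section \<open>Monotonicity of the given functions and a common strip\<close>

context annular_system begin

lemma h_cont: "continuous_on (einterval rm rp) h" and h_less: "y \<in> einterval rm rp \<Longrightarrow> y' \<in> einterval rm rp \<Longrightarrow> y < y' \<Longrightarrow> h y < h y'"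
proof -
  obtain jm jp \<phi> where \<phi>: "strict_mono_on (einterval jm jp) \<phi>"
    and ho: "homeomorphism (einterval jm jp) (einterval rm rp) \<phi> h"
    using h_inverse_homeo by blast
  show "continuous_on (einterval rm rp) h" using ho by (simp add: homeomorphism_def)
  assume y: "y \<in> einterval rm rp" "y' \<in> einterval rm rp" "y < y'"
  have i: "h y \<in> einterval jm jp" "h y' \<in> einterval jm jp" "\<phi> (h y) = y" "\<phi> (h y') = y'"
    using ho y by (auto simp: homeomorphism_def)
  show "h y < h y'"
  proof (rule ccontr)
    assume "\<not> h y < h y'"
    then have "\<phi> (h y') \<le> \<phi> (h y)" using strict_mono_on_leD[OF \<phi> i(2,1)] by simp
    then show False using i y by simp
  qed
qed

lemma strip_0: "0 \<in> einterval rm rp"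
  using rm_neg rp_pos by (simp add: einterval_iff zero_ereal_def)

lemma strip_between:
  assumes "rm < ereal y" "ereal y' < rp" "y \<le> z" "z \<le> y'" shows "z \<in> einterval rm rp"
  using less_le_trans[of rm "ereal y" "ereal z"] le_less_trans[of "ereal z" "ereal y'" rp] assms
  by (simp add: einterval_iff)

lemma strip_convex: "y \<in> einterval rm rp \<Longrightarrow> y' \<in> einterval rm rp \<Longrightarrow> {y..y'} \<subseteq> einterval rm rp"
  by (auto intro: strip_between simp: einterval_iff)

lemma H_deriv:
  assumes y: "y \<in> einterval rm rp" shows "(H has_real_derivative h y) (at y)"
proof -
  have "rm < ereal (min 0 y)" "ereal (max 0 y) < rp" using y rm_neg rp_pos
    by (auto simp: einterval_iff min_def max_def zero_ereal_def)
  then obtain p q where p: "rm < ereal p" "ereal p < ereal (min 0 y)" and q: "ereal (max 0 y) < ereal q" "ereal q < rp"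
    using ereal_dense2 by metis
  have "ereal p < rp" "rm < ereal q"
    using p q rm_neg rp_pos by (auto simp: zero_ereal_def) (metis less_trans ereal_less(2) less_ereal.simps(1) max_less_iff_conj min_less_iff_conj)+
  then have "p \<in> einterval rm rp" "q \<in> einterval rm rp" using p q by (auto simp: einterval_iff)
  then show ?thesis
    by (intro primitive0_deriv[of p q] continuous_on_subset[OF h_cont strip_convex]) (use p q in auto)
qed

lemma G_deriv: "(G has_real_derivative g x) (at x)" by (rule primitive0_deriv_UNIV[OF g_cont])

lemma F_deriv: "(F i has_real_derivative lam * x + \<mu> i * g x) (at x)"
  unfolding potential_def by (auto intro!: derivative_eq_intros G_deriv)

lemma deriv_F: "deriv (F i) x = lam * x + \<mu> i * g x" by (rule DERIV_imp_deriv[OF F_deriv])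

lemma cont_F: "continuous_on S (F i)"
  using F_deriv by (meson DERIV_isCont continuous_at_imp_continuous_on)

lemma cont_G: "continuous_on S G"
  using G_deriv by (meson DERIV_isCont continuous_at_imp_continuous_on)

lemma h_pos: "y \<in> einterval rm rp \<Longrightarrow> 0 < y \<Longrightarrow> 0 < h y" using h_less[OF strip_0, of y] h_0 by simp

lemma h_neg: "y \<in> einterval rm rp \<Longrightarrow> y < 0 \<Longrightarrow> h y < 0" using h_less[of y 0] strip_0 h_0 by simp

lemma H_less_pos:
  assumes "0 \<le> y" "y < y'" "ereal y' < rp" shows "H y < H y'"
proof (rule DERIV_pos_imp_increasing_open[OF assms(2)])
  have i: "z \<in> einterval rm rp" if "0 \<le> z" "z \<le> y'" for z
    using strip_between[OF _ assms(3) that] rm_neg by (simp add: zero_ereal_def)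
  show "\<exists>d. (H has_real_derivative d) (at z) \<and> 0 < d" if "y < z" "z < y'" for z
    using that assms(1) H_deriv[OF i, of z] h_pos[OF i, of z] by auto
  show "continuous_on {y..y'} H"
    using assms(1) by (intro continuous_at_imp_continuous_on ballI DERIV_isCont[OF H_deriv[OF i]]) auto
qed

lemma H_less_neg:
  assumes "y \<le> 0" "y' < y" "rm < ereal y'" shows "H y < H y'"
proof -
  have i: "z \<in> einterval rm rp" if "z \<le> 0" "y' \<le> z" for z
    using strip_between[OF assms(3) _ that(2,1)] rp_pos by (simp add: zero_ereal_def)
  have "- H y' < - H y"
  proof (rule DERIV_pos_imp_increasing_open[where f = "\<lambda>z. - H z", OF assms(2)])
    show "\<exists>d. ((\<lambda>z. - H z) has_real_derivative d) (at z) \<and> 0 < d" if "y' < z" "z < y" for z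
      using that assms(1) DERIV_minus[OF H_deriv[OF i, of z]] h_neg[OF i, of z] by (intro exI[of _ "- h z"]) auto
    show "continuous_on {y'..y} (\<lambda>z. - H z)"
      using assms(1) by (intro continuous_intros continuous_at_imp_continuous_on ballI DERIV_isCont[OF H_deriv[OF i]]) auto
  qed
  then show ?thesis by simp
qed

lemma Hp_inv_H: "0 \<le> y \<Longrightarrow> ereal y < rp \<Longrightarrow> Hp_inv (H y) = y"
  unfolding H_plus_inv_def
proof (rule the_inv_into_f_f)
  show "inj_on H {y. 0 \<le> y \<and> ereal y < rp}"
  proof (rule linorder_inj_onI)
    fix y z assume "y < z" "y \<in> {y. 0 \<le> y \<and> ereal y < rp}" "z \<in> {y. 0 \<le> y \<and> ereal y < rp}"
    then show "H y \<noteq> H z" using H_less_pos[of y z] by auto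
  qed auto
qed auto

lemma Hm_inv_H: "y \<le> 0 \<Longrightarrow> rm < ereal y \<Longrightarrow> Hm_inv (H y) = y"
  unfolding H_minus_inv_def
proof (rule the_inv_into_f_f)
  show "inj_on H {y. rm < ereal y \<and> y \<le> 0}"
  proof (rule linorder_inj_onI)
    fix y z assume "y < z" "y \<in> {y. rm < ereal y \<and> y \<le> 0}" "z \<in> {y. rm < ereal y \<and> y \<le> 0}"
    then show "H y \<noteq> H z" using H_less_neg[of z y] by auto
  qed auto
qed auto

lemma G_0: "G 0 = 0" by (rule primitive0_0)

lemma G_strict_mono: "strict_mono_on {0..} G"
proof (rule strict_mono_onI)
  fix x y :: real assume "x \<in> {0..}" "y \<in> {0..}" "x < y"
  then show "G x < G y"
    by (intro DERIV_pos_imp_increasing_open[OF \<open>x < y\<close> _ cont_G])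
       (use G_deriv g_sign in \<open>metis atLeast_iff less_eq_real_def less_irrefl less_trans zero_less_mult_pos2\<close>)
qed

lemma G_anti: assumes "x < y" "y \<le> 0" shows "G y < G x"
proof -
  have "- G x < - G y"
  proof (rule DERIV_pos_imp_increasing_open[where f = "\<lambda>z. - G z", OF assms(1)])
    fix z assume "x < z" "z < y"
    then have "z < 0" "0 < g z * z" using assms g_sign[of z] by auto
    then have "g z < 0" by (simp add: zero_less_mult_iff)
    then show "\<exists>d. ((\<lambda>z. - G z) has_real_derivative d) (at z) \<and> 0 < d"
      using DERIV_minus[OF G_deriv[of z]] by (intro exI[of _ "- g z"]) auto
  qed (intro continuous_intros cont_G)
  then show ?thesis by simp
qed

lemma Gp_inv_eqI: "0 \<le> x \<Longrightarrow> G x = z \<Longrightarrow> Gp_inv z = x"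
  unfolding G_plus_inv_def using strict_mono_on_imp_inj_on[OF G_strict_mono] by (auto intro: the_inv_into_f_f)

lemma Gm_inv_eqI: "x \<le> 0 \<Longrightarrow> G x = z \<Longrightarrow> Gm_inv z = x"
proof -
  have "inj_on G {..0}" by (rule linorder_inj_onI) (use G_anti in force)+
  then show "x \<le> 0 \<Longrightarrow> G x = z \<Longrightarrow> Gm_inv z = x"
    unfolding G_minus_inv_def by (auto intro: the_inv_into_f_f)
qed

lemma c2_mem: "i \<le> m \<Longrightarrow> c2 i \<in> {c1 i..c2 i}" and c1_mem: "i \<le> m \<Longrightarrow> c1 i \<in> {c1 i..c2 i}"
  using c1_less_c2[of i] by auto

lemma xp_mono: assumes i: "i \<le> m" and c: "c \<in> {c1 i..c2 i}" "c' \<in> {c1 i..c2 i}" "c \<le> c'" shows "xp i c \<le> xp i c'"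
proof (rule ccontr)
  assume "\<not> xp i c \<le> xp i c'"
  then have "F i (xp i c') < c" using xp_pos[OF i c(2)] xm_neg[OF i c(1)] by (intro F_less[OF i c(1)]) auto
  then show False using F_xp[OF i c(2)] c(3) by simp
qed

lemma xm_mono: assumes i: "i \<le> m" and c: "c \<in> {c1 i..c2 i}" "c' \<in> {c1 i..c2 i}" "c \<le> c'" shows "xm i c' \<le> xm i c"
proof (rule ccontr)
  assume "\<not> xm i c' \<le> xm i c"
  then have "F i (xm i c') < c" using xp_pos[OF i c(1)] xm_neg[OF i c(2)] by (intro F_less[OF i c(1)]) auto
  then show False using F_xm[OF i c(2)] c(3) by simp
qed

text \<open>All annuli lie in one compact strip, outside of which \<open>h\<close> can be modified.\<close>

lemma common_strip:
  obtains ym yp where "rm < ereal ym" "ym < 0" "0 < yp" "ereal yp < rp"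
    "\<And>i c x. i \<le> m \<Longrightarrow> c \<in> {c1 i..c2 i} \<Longrightarrow> x \<in> {xm i c..xp i c} \<Longrightarrow> c - F i x \<le> H yp \<and> c - F i x \<le> H ym"
proof -
  define Q where "Q i y z \<longleftrightarrow> 0 < y \<and> ereal y < rp \<and> z < 0 \<and> rm < ereal z \<and>
      (\<forall>c x. c \<in> {c1 i..c2 i} \<longrightarrow> x \<in> {xm i c..xp i c} \<longrightarrow> c - F i x \<le> H y \<and> c - F i x \<le> H z)" for i y z
  have "\<exists>y z. Q i y z" if i: "i \<le> m" for i
  proof -
    have ne: "xm i (c2 i) \<le> xp i (c2 i)" using xm_neg[OF i c2_mem[OF i]] xp_pos[OF i c2_mem[OF i]] by simp
    \<comment> \<open>The intervals of the smaller levels are nested in that of \<open>c2 i\<close>,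
      so \<open>c2 i - F i w\<close> bounds every \<open>c - F i x\<close> of this annulus. The arcs
      of the outer orbit over \<open>w\<close> supply points of the strip at which H attains the
      bound.\<close>
    obtain w where w: "w \<in> {xm i (c2 i)..xp i (c2 i)}" "\<And>x. x \<in> {xm i (c2 i)..xp i (c2 i)} \<Longrightarrow> F i w \<le> F i x"
      using continuous_attains_inf[of "{xm i (c2 i)..xp i (c2 i)}" "F i"] ne cont_F by auto
    obtain y where y: "0 \<le> y" "ereal y < rp" "H y + F i w = c2 i" using annulus_strip_upper[OF i c2_mem[OF i] w(1)] by auto
    obtain z where z: "z \<le> 0" "rm < ereal z" "H z + F i w = c2 i" using annulus_strip_lower[OF i c2_mem[OF i] w(1)] by auto
    have "F i w \<le> F i 0" using xm_neg[OF i c2_mem[OF i]] xp_pos[OF i c2_mem[OF i]] by (intro w(2)) auto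
    then have "H y \<noteq> 0" "H z \<noteq> 0" using y z c1_pos[OF i] c1_less_c2[OF i] by (auto simp: potential_def G_0)
    then have "y \<noteq> 0" "z \<noteq> 0" using primitive0_0 by auto
    moreover have "c - F i x \<le> c2 i - F i w" if c: "c \<in> {c1 i..c2 i}" and x: "x \<in> {xm i c..xp i c}" for c x
    proof -
      have "x \<in> {xm i (c2 i)..xp i (c2 i)}"
        using x xp_mono[OF i c c2_mem[OF i]] xm_mono[OF i c c2_mem[OF i]] c by auto
      then show ?thesis using w(2)[of x] c by auto
    qed
    moreover have "H y = c2 i - F i w" "H z = c2 i - F i w" using y(3) z(3) by linarith+
    ultimately have "Q i y z" using y(1,2) z(1,2) by (simp add: Q_def)
    then show ?thesis by blast
  qed
  then obtain Y Z where "\<And>i. i \<le> m \<Longrightarrow> Q i (Y i) (Z i)" by metis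
  then have YZ: "\<And>i. i \<le> m \<Longrightarrow> 0 < Y i" "\<And>i. i \<le> m \<Longrightarrow> ereal (Y i) < rp"
    "\<And>i. i \<le> m \<Longrightarrow> Z i < 0" "\<And>i. i \<le> m \<Longrightarrow> rm < ereal (Z i)"
    "\<And>i c x. i \<le> m \<Longrightarrow> c \<in> {c1 i..c2 i} \<Longrightarrow> x \<in> {xm i c..xp i c} \<Longrightarrow> c - F i x \<le> H (Y i) \<and> c - F i x \<le> H (Z i)"
    by (auto simp: Q_def)
  \<comment> \<open>There are finitely many annuli, so the extreme heights still belong to the open
    strip.\<close>
  define yp where "yp = Max (Y ` {..m})"
  define ym where "ym = Min (Z ` {..m})"
  have "yp \<in> Y ` {..m}" "ym \<in> Z ` {..m}" unfolding yp_def ym_def by (auto intro!: Max_in Min_in)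
  then have b: "0 < yp" "ereal yp < rp" "ym < 0" "rm < ereal ym" using YZ by auto
  show ?thesis
  proof (rule that[OF b(4,3,1,2)])
    fix i c x assume i: "i \<le> m" and cx: "c \<in> {c1 i..c2 i}" "x \<in> {xm i c..xp i c}"
    have "Y i \<le> yp" "ym \<le> Z i" unfolding yp_def ym_def using i by auto
    then have "H (Y i) \<le> H yp" "H (Z i) \<le> H ym"
      using H_less_pos[of "Y i" yp] H_less_neg[of "Z i" ym] YZ(1,3)[OF i] b by (force simp: less_eq_real_def)+
    then show "c - F i x \<le> H yp \<and> c - F i x \<le> H ym" using YZ(5)[OF i cx] by auto
  qed
qed

end

section \<open>The system with \<open>h\<close> frozen outside a compact strip\<close>

locale clamped_system = annular_system +
  fixes ym yp :: real
  assumes ym: "rm < ereal ym" "ym < 0" and yp: "0 < yp" "ereal yp < rp" and lam_neg: "lam < 0"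
    and strip: "\<And>i c x. i \<le> m \<Longrightarrow> c \<in> {c1 i..c2 i} \<Longrightarrow> x \<in> {xm i c..xp i c} \<Longrightarrow> c - F i x \<le> H yp \<and> c - F i x \<le> H ym"
begin

text \<open>Freezing keeps \<open>h\<close> continuous and monotone and makes it total. The
  primitive becomes unbounded on both half-lines, so that the half-plane analysis applies, and a
  solution with values in \<open>[ym, yp]\<close> solves the original system.\<close>

definition hb :: "real \<Rightarrow> real" where "hb y = h (max ym (min yp y))"
definition Hb :: "real \<Rightarrow> real" where "Hb = primitive0 hb"

lemma strip_mem: "y \<in> {ym..yp} \<Longrightarrow> y \<in> einterval rm rp"
  using strip_between[OF ym(1) yp(2)] by auto

lemma hb_eq: "y \<in> {ym..yp} \<Longrightarrow> hb y = h y" by (simp add: hb_def)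

lemma cont_hb: "continuous_on UNIV hb"
  unfolding hb_def
  by (rule continuous_on_compose2[OF continuous_on_subset[OF h_cont, of "{ym..yp}"]])
     (use ym yp strip_mem in \<open>auto intro!: continuous_intros\<close>)

lemma restoring_hb: "restoring hb"
  unfolding restoring_def
proof (intro conjI allI impI cont_hb)
  show "mono hb"
  proof (rule monoI)
    fix x y :: real assume "x \<le> y"
    then have le: "max ym (min yp x) \<le> max ym (min yp y)" by auto
    have "max ym (min yp x) \<in> {ym..yp}" "max ym (min yp y) \<in> {ym..yp}" using ym yp by auto
    then show "hb x \<le> hb y" unfolding hb_def
      using h_less[OF strip_mem strip_mem] le by (metis less_eq_real_def)
  qed
  show "hb 0 = 0" using ym yp h_0 by (simp add: hb_def)
  show "0 < hb y" if "0 < y" for y unfolding hb_def using ym yp that by (intro h_pos strip_mem) auto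
  show "hb y < 0" if "y < 0" for y unfolding hb_def using ym yp that by (intro h_neg strip_mem) auto
qed

lemma Hb_deriv: "(Hb has_real_derivative hb y) (at y)"
  unfolding Hb_def by (rule primitive0_deriv_UNIV[OF cont_hb])

lemma Hb_0: "Hb 0 = 0" unfolding Hb_def by (rule primitive0_0)

lemma Hb_eq: assumes y: "y \<in> {ym..yp}" shows "Hb y = H y"
  unfolding Hb_def primitive0_def
proof (rule interval_integral_cong)
  fix x assume "x \<in> einterval (min 0 (ereal y)) (max 0 (ereal y))"
  then have "x \<in> {ym..yp}" using y ym yp by (auto simp: einterval_iff zero_ereal_def min_def max_def split: if_splits)
  then show "hb x = h x" by (rule hb_eq)
qed

lemma half_hb: "half_hamiltonian hb Hb (\<lambda>_. 0) (\<lambda>_. 0)"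
  by unfold_locales (use restoring_hb Hb_deriv Hb_0 in auto)

lemma half_hb_reflected: "half_hamiltonian (\<lambda>y. - hb (- y)) (\<lambda>y. Hb (- y)) (\<lambda>_. 0) (\<lambda>_. 0)"
proof -
  have rf: "((\<lambda>y. - y) has_real_derivative - 1) (at y)" for y :: real by (auto intro!: derivative_eq_intros)
  show ?thesis
    by unfold_locales (use restoring_reflect[OF restoring_hb] DERIV_chain2[OF Hb_deriv rf] Hb_0 in auto)
qed

lemma Hb_le_D: assumes "Hb y \<le> H yp" "Hb y \<le> H ym" shows "y \<in> {ym..yp}"
proof (rule ccontr)
  interpret P: half_hamiltonian hb Hb "\<lambda>_. 0" "\<lambda>_. 0" by (rule half_hb)
  interpret M: half_hamiltonian "\<lambda>y. - hb (- y)" "\<lambda>y. Hb (- y)" "\<lambda>_. 0" "\<lambda>_. 0" by (rule half_hb_reflected)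
  assume "y \<notin> {ym..yp}"
  then consider "yp < y" | "y < ym" by fastforce
  then show False
  proof cases
    case 1
    then have "Hb yp < Hb y" using yp by (intro strict_mono_onD[OF P.K_strict_mono]) auto
    then show False using assms Hb_eq[of yp] ym yp by simp
  next
    case 2
    then have "Hb (- (- ym)) < Hb (- (- y))" using ym by (intro strict_mono_onD[OF M.K_strict_mono]) auto
    then show False using assms Hb_eq[of ym] ym yp by simp
  qed
qed

lemma H_le_D: assumes "y \<in> einterval rm rp" "H y \<le> H yp" "H y \<le> H ym" shows "y \<in> {ym..yp}"
proof (rule ccontr)
  assume "y \<notin> {ym..yp}"
  then consider "yp < y" | "y < ym" by fastforce
  then show False
    by cases (use assms H_less_pos[of yp y] H_less_neg[of ym y] ym yp in \<open>auto simp: einterval_iff\<close>)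
qed

abbreviation "field i \<equiv> (\<lambda>x. lam * x + \<mu> i * g x)"

lemma flow: assumes i: "i \<le> m" shows "annulus_flow hb Hb (field i) (F i) (c1 i) (c2 i) (xm i) (xp i)"
proof unfold_locales
  show "continuous_on UNIV (field i)" by (intro continuous_intros g_cont)
  show "field i (xm i c) < 0" "0 < field i (xp i c)" if "c \<in> {c1 i..c2 i}" for c
    using F'_xm[OF i that] F'_xp[OF i that] by (simp_all add: deriv_F)
qed (use restoring_hb Hb_deriv Hb_0 F_deriv c1_less_c2[OF i] xm_neg[OF i] xp_pos[OF i] F_xm[OF i] F_xp[OF i] F_less[OF i] in auto)

abbreviation "P i \<equiv> annulus_flow.pos Hb (F i) (xm i) (xp i)"

lemma orbit_y: assumes "i \<le> m" "c \<in> {c1 i..c2 i}" "x \<in> {xm i c..xp i c}" "Hb y + F i x = c"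
  shows "y \<in> {ym..yp}"
proof (rule Hb_le_D)
  show "Hb y \<le> H yp" "Hb y \<le> H ym" using strip[OF assms(1-3)] assms(4) by linarith+
qed

lemma mem_quadrant_set: "(x, y) \<in> quadrant_set q \<longleftrightarrow> 0 \<le> xsign q * x \<and> 0 \<le> ysign q * y"
  by (cases q) auto

lemma mem_annulus_quadrant:
  assumes i: "i \<le> m"
  shows "(x, y) \<in> annulus_quadrant i q \<longleftrightarrow> (\<exists>c\<in>{c1 i..c2 i}. x \<in> {xm i c..xp i c} \<and> Hb y + F i x = c) \<and>
    0 \<le> xsign q * x \<and> 0 \<le> ysign q * y"
proof -
  have "(x, y) \<in> orbit i c \<longleftrightarrow> x \<in> {xm i c..xp i c} \<and> Hb y + F i x = c" if c: "c \<in> {c1 i..c2 i}" for c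
  proof
    assume "(x, y) \<in> orbit i c"
    then have o: "x \<in> {xm i c..xp i c}" "y \<in> einterval rm rp" "H y + F i x = c" by (auto simp: orbit_def)
    have "y \<in> {ym..yp}" using strip[OF i c o(1)] o(3) by (intro H_le_D[OF o(2)]) linarith+
    then show "x \<in> {xm i c..xp i c} \<and> Hb y + F i x = c" using o by (simp add: Hb_eq)
  next
    assume o: "x \<in> {xm i c..xp i c} \<and> Hb y + F i x = c"
    then have "y \<in> {ym..yp}" using orbit_y[OF i c] by blast
    then show "(x, y) \<in> orbit i c" using o by (simp add: orbit_def Hb_eq strip_mem)
  qed
  then show ?thesis by (auto simp: annulus_quadrant_def annulus_def mem_quadrant_set)
qed

lemma P_mem: assumes i: "i \<le> m" and cv: "c \<in> {c1 i..c2 i}" "v \<in> {0..1}" shows "P i q c v \<in> annulus_quadrant i q"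
proof -
  interpret A: annulus_flow hb Hb "field i" "F i" "c1 i" "c2 i" "xm i" "xp i" by (rule flow[OF i])
  obtain x y where xy: "P i q c v = (x, y)" by (metis surj_pair)
  show ?thesis unfolding xy mem_annulus_quadrant[OF i] using A.pos_state(1-4)[OF cv, of q] cv unfolding xy by auto
qed

text \<open>The angle is an explicit expression in x and the level, continuous because
  \<open>X\<close> is continuous and positive; no inverse of the chart \<open>pos\<close> has to be
  shown continuous.\<close>

lemma coordinates:
  fixes x y C :: "real \<Rightarrow> real"
  assumes i: "i \<le> m" and c: "continuous_on {0..1} x" "continuous_on {0..1} C"
    and st: "\<And>s. s \<in> {0..1} \<Longrightarrow> C s \<in> {c1 i..c2 i} \<and> x s \<in> {xm i (C s)..xp i (C s)} \<and> Hb (y s) + F i (x s) = C s \<and>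
      0 \<le> xsign q * x s \<and> 0 \<le> ysign q * y s"
  obtains V where "continuous_on {0..1} V" "V ` {0..1} \<subseteq> {0..1}" "\<And>s. s \<in> {0..1} \<Longrightarrow> P i q (C s) (V s) = (x s, y s)"
proof -
  interpret A: annulus_flow hb Hb "field i" "F i" "c1 i" "c2 i" "xm i" "xp i" by (rule flow[OF i])
  define V where "V s = A.param q (xsign q * x s / A.X q (C s))" for s
  have st': "C s \<in> {c1 i..c2 i}" "Hb (y s) + F i (x s) = C s" "x s \<in> {xm i (C s)..xp i (C s)}"
      "0 \<le> xsign q * x s" "0 \<le> ysign q * y s" if "s \<in> {0..1}" for s using st[OF that] by auto
  have cX: "continuous_on {0..1} (\<lambda>s. A.X q (C s))"
    by (rule continuous_on_compose2[OF A.continuous_on_X c(2)]) (use st'(1) in auto)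
  have nz: "A.X q (C s) \<noteq> 0" if "s \<in> {0..1}" for s using A.X_pos[OF st'(1)[OF that], of q] by simp
  have c0: "continuous_on {0..1} (\<lambda>s. xsign q * x s / A.X q (C s))"
    by (intro continuous_intros c cX ballI nz)
  have "continuous_on {0..1} V"
    unfolding V_def A.param_def using c0 by (cases "xsign q = ysign q") (auto intro!: continuous_intros)
  moreover have "V ` {0..1} \<subseteq> {0..1}"
    unfolding V_def by (rule image_subsetI, rule A.pos_eqI(1)) (use st' in auto)
  moreover have "P i q (C s) (V s) = (x s, y s)" if "s \<in> {0..1}" for s
    unfolding V_def by (rule A.pos_eqI(2)) (use st'[OF that] in auto)
  ultimately show ?thesis using that by blast
qed

lemma arc_coordinates:
  assumes i: "i \<le> m" and r: "connecting_arc i r" "r \<subseteq> annulus_quadrant i q"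
  obtains C V :: "real \<Rightarrow> real" where "continuous_on {0..1} C" "C ` {0..1} \<subseteq> {c1 i..c2 i}" "C 0 = c1 i" "C 1 = c2 i"
    "continuous_on {0..1} V" "V ` {0..1} \<subseteq> {0..1}" "\<And>s. s \<in> {0..1} \<Longrightarrow> P i q (C s) (V s) \<in> r"
proof -
  obtain \<gamma> where \<gamma>: "arc \<gamma>" "path_image \<gamma> = r" "pathstart \<gamma> \<in> orbit i (c1 i)" "pathfinish \<gamma> \<in> orbit i (c2 i)"
    using r(1) unfolding connecting_arc_def by blast
  define x y where "x s = fst (\<gamma> s)" and "y s = snd (\<gamma> s)" for s
  have c\<gamma>: "continuous_on {0..1} \<gamma>" using \<gamma>(1) by (simp add: arc_def path_def)
  have cx: "continuous_on {0..1} x" "continuous_on {0..1} y"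
    unfolding x_def y_def using c\<gamma> by (auto intro!: continuous_intros)
  have in_r: "(x s, y s) \<in> r" if "s \<in> {0..1}" for s using \<gamma>(2) that by (auto simp: path_image_def x_def y_def)
  have st: "(\<exists>c\<in>{c1 i..c2 i}. x s \<in> {xm i c..xp i c} \<and> Hb (y s) + F i (x s) = c) \<and>
    0 \<le> xsign q * x s \<and> 0 \<le> ysign q * y s" if "s \<in> {0..1}" for s
    using in_r[OF that] r(2) mem_annulus_quadrant[OF i] by blast
  have yst: "y s \<in> {ym..yp}" if "s \<in> {0..1}" for s using st[OF that] orbit_y[OF i] by blast
  define C where "C s = Hb (y s) + F i (x s)" for s
  have cC: "continuous_on {0..1} C"
    unfolding C_def
    by (intro continuous_intros continuous_on_compose2[OF half_hamiltonian.cont_K[OF half_hb, of UNIV] cx(2)]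
        continuous_on_compose2[OF cont_F[of UNIV] cx(1)]) auto
  obtain V where V: "continuous_on {0..1} V" "V ` {0..1} \<subseteq> {0..1}" "\<And>s. s \<in> {0..1} \<Longrightarrow> P i q (C s) (V s) = (x s, y s)"
    by (rule coordinates[OF i cx(1) cC, of y q]) (use st in \<open>auto simp: C_def\<close>)
  show ?thesis
  proof (rule that[OF cC _ _ _ V(1,2)])
    show "C ` {0..1} \<subseteq> {c1 i..c2 i}" using st by (force simp: C_def)
    have "C 0 = H (y 0) + F i (x 0)" "C 1 = H (y 1) + F i (x 1)" using yst by (auto simp: C_def Hb_eq)
    then show "C 0 = c1 i" "C 1 = c2 i"
      using \<gamma>(3,4) by (auto simp: pathstart_def pathfinish_def orbit_def x_def y_def)
    show "P i q (C s) (V s) \<in> r" if "s \<in> {0..1}" for s using V(3)[OF that] in_r[OF that] by simp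
  qed
qed

text \<open>At a point of the orbit, \<open>Hp_inv\<close> or \<open>Hm_inv\<close> applied to
  \<open>c - F i x\<close> returns y itself. This is the form in which \<open>arc_time\<close>
  recognises an admissible integrand.\<close>

lemma quadrant_time_eq:
  assumes i: "i \<le> m" and T: "annulus_flow.arc_time hb Hb (field i) (F i) (c1 i) (c2 i) (xm i) (xp i) q T"
    and c: "c \<in> {c1 i..c2 i}"
  shows "quadrant_time i q c = T c 1"
proof -
  interpret A: annulus_flow hb Hb "field i" "F i" "c1 i" "c2 i" "xm i" "xp i" by (rule flow[OF i])
  have time: "(if xsign q = 1 then LBINT x=0..xp i c. \<rho> x else LBINT x=xm i c..0. \<rho> x) = T c 1"
    if "\<And>x y. xm i c < x \<Longrightarrow> x < xp i c \<Longrightarrow> 0 < xsign q * x \<Longrightarrow> 0 < ysign q * y \<Longrightarrow> Hb y + F i x = c \<Longrightarrow>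
        \<rho> x = 1 / (ysign q * hb y)" for \<rho>
    using T c that unfolding A.arc_time_def by blast
  have y: "y \<in> {ym..yp}" "c - F i x = H y" if "xm i c < x" "x < xp i c" "Hb y + F i x = c" for x y
  proof -
    show 1: "y \<in> {ym..yp}" by (rule orbit_y[OF i c _ that(3)]) (use that in auto)
    show "c - F i x = H y" using that(3) Hb_eq[OF 1] by simp
  qed
  have up: "1 / h (Hp_inv (c - F i x)) = 1 / hb y" if "xm i c < x" "x < xp i c" "0 < y" "Hb y + F i x = c" for x y
  proof -
    note yy = y[OF that(1,2,4)]
    have "Hp_inv (H y) = y" using strip_mem[OF yy(1)] that(3) by (intro Hp_inv_H) (auto simp: einterval_iff)
    then show ?thesis using yy by (simp add: hb_eq)
  qed
  have dn: "1 / - h (Hm_inv (c - F i x)) = 1 / - hb y" if "xm i c < x" "x < xp i c" "y < 0" "Hb y + F i x = c" for x y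
  proof -
    note yy = y[OF that(1,2,4)]
    have "Hm_inv (H y) = y" using strip_mem[OF yy(1)] that(3) by (intro Hm_inv_H) (auto simp: einterval_iff)
    then show ?thesis using yy by (simp add: hb_eq)
  qed
  show ?thesis
  proof (cases "ysign q = 1")
    case True
    have "(if xsign q = 1 then LBINT x=0..xp i c. 1 / h (Hp_inv (c - F i x)) else LBINT x=xm i c..0. 1 / h (Hp_inv (c - F i x))) = T c 1"
      by (rule time) (use up True in auto)
    then show ?thesis using True by (cases q) auto
  next
    case False
    then have "ysign q = - 1" using sign_cases(2)[of q] by auto
    have "(if xsign q = 1 then LBINT x=0..xp i c. 1 / - h (Hm_inv (c - F i x)) else LBINT x=xm i c..0. 1 / - h (Hm_inv (c - F i x))) = T c 1"
      by (rule time) (use dn \<open>ysign q = - 1\<close> in auto)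
    then show ?thesis using False by (cases q) auto
  qed
qed

text \<open>Derivatives that exist off a finite set and are bounded give a Lipschitz bound, hence
  absolute continuity; the finite set and the two ends are null. As y stays in
  \<open>[ym, yp]\<close>, \<open>hb\<close> may be read as \<open>h\<close>.\<close>

lemma caratheodory_of_piecewise:
  assumes sol: "piecewise_sol hb w p q x y" and y: "\<And>\<tau>. \<tau> \<in> {p..q} \<Longrightarrow> y \<tau> \<in> {ym..yp}"
    and B: "\<And>\<tau>. \<tau> \<in> {p..q} \<Longrightarrow> \<bar>w \<tau> (x \<tau>)\<bar> \<le> B"
  shows "caratheodory_solution rm rp h w p q x y"
proof -
  obtain N where N: "finite N" "\<And>\<tau>. \<tau> \<in> {p<..<q} - N \<Longrightarrow> (x has_real_derivative hb (y \<tau>)) (at \<tau>) \<and>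
        (y has_real_derivative w \<tau> (x \<tau>)) (at \<tau>)"
    using sol unfolding piecewise_sol_def by blast
  have c: "continuous_on {p..q} x" "continuous_on {p..q} y" "p \<le> q" using sol by (auto simp: piecewise_sol_def)
  have "bounded ((\<lambda>\<tau>. hb (y \<tau>)) ` {p..q})"
    by (intro compact_imp_bounded compact_continuous_image compact_Icc continuous_on_compose2[OF cont_hb c(2)]) auto
  then obtain B' where "\<forall>z\<in>(\<lambda>\<tau>. hb (y \<tau>)) ` {p..q}. norm z \<le> B'" unfolding bounded_iff by blast
  then have B': "\<bar>hb (y \<tau>)\<bar> \<le> B'" if "\<tau> \<in> {p..q}" for \<tau> using that by auto
  have nn: "0 \<le> B" "0 \<le> B'" using B[of p] B'[of p] c(3) by auto
  have "abs_continuous_on_interval p q x"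
    by (rule abs_continuous_of_lipschitz[OF lipschitz_of_bounded_derivative[OF c(1) N(1) _ B']]) (use N(2) nn in auto)
  moreover have "abs_continuous_on_interval p q y"
    by (rule abs_continuous_of_lipschitz[OF lipschitz_of_bounded_derivative[OF c(2) N(1) _ B]]) (use N(2) nn in auto)
  moreover have "AE \<tau> in lebesgue. \<tau> \<in> {p..q} \<longrightarrow>
       (x has_real_derivative h (y \<tau>)) (at \<tau> within {p..q}) \<and> (y has_real_derivative w \<tau> (x \<tau>)) (at \<tau> within {p..q})"
  proof -
    have "AE \<tau> in lebesgue. \<tau> \<notin> N \<union> {p, q}"
      by (intro AE_not_in null_sets_completionI finite_imp_null_set_lborel) (use N(1) in auto)
    then show ?thesis
    proof eventually_elim
      case (elim \<tau>)
      show ?case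
      proof
        assume t: "\<tau> \<in> {p..q}"
        then have "\<tau> \<in> {p<..<q} - N" using elim by auto
        then show "(x has_real_derivative h (y \<tau>)) (at \<tau> within {p..q}) \<and> (y has_real_derivative w \<tau> (x \<tau>)) (at \<tau> within {p..q})"
          using N(2) hb_eq[OF y[OF t]] by (metis has_field_derivative_at_within)
      qed
    qed
  qed
  ultimately show ?thesis
    unfolding caratheodory_solution_def using y strip_mem by blast
qed

text \<open>Uniqueness for the gap system makes the origin unreachable in finite time.\<close>

lemma origin_unreachable:
  assumes sol: "smooth_sol hb (\<lambda>x. lam * x) T x y" and end0: "x T = 0" "y T = 0"
    and y: "\<And>\<tau>. \<tau> \<in> {0..T} \<Longrightarrow> y \<tau> \<in> {ym..yp}"
  shows "x 0 = 0"
proof -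
  have T: "0 \<le> T" "continuous_on {0..T} x" using sol by (auto simp: smooth_sol_def)
  have "bounded (x ` {0..T})" by (intro compact_imp_bounded compact_continuous_image compact_Icc T(2))
  then obtain B where "\<forall>z\<in>x ` {0..T}. norm z \<le> B" unfolding bounded_iff by blast
  then have B: "\<bar>- (lam * x \<tau>)\<bar> \<le> \<bar>lam\<bar> * B" if "\<tau> \<in> {0..T}" for \<tau>
    using that by (auto simp: abs_mult intro!: mult_left_mono)
  have 1: "caratheodory_solution rm rp h (\<lambda>_ x. - (lam * x)) 0 T x y"
    by (rule caratheodory_of_piecewise[OF piecewise_sol_of_smooth[OF sol] y B])
  have "piecewise_sol hb (\<lambda>_ x. - (lam * x)) 0 T (\<lambda>_. 0) (\<lambda>_. 0)"
    using T(1) restoring_hb by (auto simp: piecewise_sol_def restoring_def)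
  then have 2: "caratheodory_solution rm rp h (\<lambda>_ x. - (lam * x)) 0 T (\<lambda>_. 0) (\<lambda>_. 0)"
    by (rule caratheodory_of_piecewise[where B = 0]) (use ym yp in auto)
  have eq: "(\<lambda>x. - lam * x) = (\<lambda>x. - (lam * x))" by auto
  have "\<forall>\<tau>\<in>{0..T}. x \<tau> = 0 \<and> y \<tau> = 0"
    using unique_L[unfolded eq unique_ivp_solutions_def, rule_format, of T 0 T x y "\<lambda>_. 0" "\<lambda>_. 0"] 1 2 T(1) end0
    by simp
  then show ?thesis using T(1) by simp
qed

end

locale bounded_gap = gap +
  fixes zb :: real
  assumes zb: "0 < zb"
    and F1_xm1: "\<And>c. c \<in> {c11..c21} \<Longrightarrow> lam / 2 * (xm1 c)\<^sup>2 + \<mu>1 * G (xm1 c) = c"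
    and bound1: "\<And>c x. c \<in> {c11..c21} \<Longrightarrow> xm1 c \<le> x \<Longrightarrow> x \<le> 0 \<Longrightarrow> c - (lam / 2 * x\<^sup>2 + \<mu>1 * G x) \<le> H yb"
    and bound2: "\<And>c x. c \<in> {c12..c22} \<Longrightarrow> xm2 c \<le> x \<Longrightarrow> x \<le> xp2 c \<Longrightarrow>
      c - (lam / 2 * x\<^sup>2 + \<mu>2 * G x) \<le> H yb \<and> c - (lam / 2 * x\<^sup>2 + \<mu>2 * G x) \<le> H (- zb)"
begin

lemma lam_sq_nonpos: "lam / 2 * x\<^sup>2 \<le> 0"
  using lam by (simp add: mult_nonpos_nonneg)

lemma lam_sq_mono: "\<bar>x\<bar> \<le> \<bar>y\<bar> \<Longrightarrow> lam / 2 * y\<^sup>2 \<le> lam / 2 * x\<^sup>2"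
  using lam abs_le_square_iff[of x y] by (simp add: mult_le_cancel_left)

text \<open>The root is sought in \<open>[b, 0]\<close> and not on the half-line, on which G may be
  bounded. With b the end of the outer orbit this also puts the root inside the annulus.\<close>

lemma G_root_neg:
  assumes "b \<le> 0" "0 \<le> z" "z \<le> \<mu> * G b" "0 < \<mu>"
  obtains x where "b \<le> x" "x \<le> 0" "\<mu> * G x = z"
proof -
  have "G 0 \<le> z / \<mu>" "z / \<mu> \<le> G b" using assms G0 by (simp_all add: pos_divide_le_eq mult.commute)
  then obtain x where "b \<le> x" "x \<le> 0" "G x = z / \<mu>"
    using IVT2'[of G 0 "z / \<mu>" b] assms(1) continuous_on_subset[OF cG] by auto
  then show ?thesis using that assms(4) by simp
qed

lemma G_root_pos:
  assumes "0 \<le> b" "0 \<le> z" "z \<le> \<mu> * G b" "0 < \<mu>"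
  obtains x where "0 \<le> x" "x \<le> b" "\<mu> * G x = z"
proof -
  have "G 0 \<le> z / \<mu>" "z / \<mu> \<le> G b" using assms G0 by (simp_all add: pos_divide_le_eq mult.commute)
  then obtain x where "0 \<le> x" "x \<le> b" "G x = z / \<mu>"
    using IVT'[of G 0 "z / \<mu>" b] assms(1) continuous_on_subset[OF cG] by auto
  then show ?thesis using that assms(4) by simp
qed

lemma H_le_D: "H y \<le> H yb \<Longrightarrow> y \<le> yb"
  using H_mono[of yb y] yb by force

text \<open>Supplies the limits and strip bounds that \<open>passage_II_I\<close> presupposes.
  \<open>time\<close> speaks of all limits satisfying the defining equations, so that the caller can
  identify them with values of the inverses of G.\<close>

lemma crossing_II_I:
  fixes xs ys :: "real \<Rightarrow> real"
  assumes path: "continuous_on {0..1} xs" "continuous_on {0..1} ys"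
    "\<And>s. s \<in> {0..1} \<Longrightarrow> xs s \<le> 0 \<and> 0 \<le> ys s"
    "\<And>s. s \<in> {0..1} \<Longrightarrow> H (ys s) + (lam / 2 * (xs s)\<^sup>2 + \<mu>1 * G (xs s)) \<in> {c11..c21}"
    "ys 0 = 0" "xs 1 = 0"
    and \<rho>: "\<And>x y. 0 < y \<Longrightarrow> y \<le> yb \<Longrightarrow> H y + lam / 2 * x\<^sup>2 = min c11 c12 \<Longrightarrow> \<rho> x = 1 / h y"
    and time: "\<And>xl xr. xl \<le> 0 \<Longrightarrow> \<mu>1 * G xl = c21 - min c11 c12 \<Longrightarrow> 0 \<le> xr \<Longrightarrow> \<mu>2 * G xr = c22 - min c11 c12 \<Longrightarrow>
      (LBINT x=xl..xr. \<rho> x) \<le> S"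
  obtains x2 y2 C :: "real \<Rightarrow> real" where "continuous_on {0..1} x2" "continuous_on {0..1} y2" "continuous_on {0..1} C"
    "C 0 = c12" "C 1 = c22"
    "\<And>r. r \<in> {0..1} \<Longrightarrow> C r \<in> {c12..c22} \<and> 0 \<le> x2 r \<and> x2 r \<le> xp2 (C r) \<and> 0 \<le> y2 r \<and>
       H (y2 r) + (lam / 2 * (x2 r)\<^sup>2 + \<mu>2 * G (x2 r)) = C r"
    "\<And>r. r \<in> {0..1} \<Longrightarrow> \<exists>s\<in>{0..1}. reaches S (xs s, ys s) (x2 r, y2 r) 1 0"
proof -
  let ?E = "min c11 c12"
  have c21: "c21 \<in> {c11..c21}" and c22: "c22 \<in> {c12..c22}" using c1 c2 by auto
  obtain xl where xl: "xm1 c21 \<le> xl" "xl \<le> 0" "\<mu>1 * G xl = c21 - ?E"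
  proof (rule G_root_neg[of "xm1 c21" "c21 - ?E" \<mu>1])
    show "c21 - ?E \<le> \<mu>1 * G (xm1 c21)" using F1_xm1[OF c21] lam_sq_nonpos[of "xm1 c21"] c1 c2 by linarith
  qed (use xm1(1)[OF c21] c1 \<mu> in auto)
  obtain xr where xr: "0 \<le> xr" "xr \<le> xp2 c22" "\<mu>2 * G xr = c22 - ?E"
  proof (rule G_root_pos[of "xp2 c22" "c22 - ?E" \<mu>2])
    show "c22 - ?E \<le> \<mu>2 * G (xp2 c22)" using xp2(2)[OF c22] lam_sq_nonpos[of "xp2 c22"] c1 c2 by linarith
  qed (use xp2(1)[OF c22] c2 \<mu> in auto)
  show ?thesis
  proof (rule passage_II_I[OF path refl xl(2,3) xr(1,3) _ time[OF xl(2,3) xr(1,3)]])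
    fix x y assume x: "x \<in> {xl..xr}" and y: "0 < y" "H y + lam / 2 * x\<^sup>2 = ?E"
    \<comment> \<open>At fixed gap energy the height grows with the distance from the y-axis, so it
      is enough to compare with the ends \<open>xl\<close> and \<open>xr\<close>, which belong to
      the outer orbits of the two annuli.\<close>
    have "H y \<le> H yb"
    proof (cases "x \<le> 0")
      case True
      then have "lam / 2 * xl\<^sup>2 \<le> lam / 2 * x\<^sup>2" using x by (intro lam_sq_mono) auto
      then show ?thesis using bound1[OF c21 xl(1,2)] xl(3) y(2) by linarith
    next
      case False
      then have "lam / 2 * xr\<^sup>2 \<le> lam / 2 * x\<^sup>2" using x by (intro lam_sq_mono) auto
      moreover have "xm2 c22 \<le> xr" using xm2(1)[OF c22] xr by simp
      ultimately show ?thesis using bound2[OF c22 _ xr(2)] xr(3) y(2) by force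
    qed
    then show "\<rho> x = 1 / h y" by (intro \<rho> y H_le_D)
  qed (assumption | (rule that; assumption))+
qed

text \<open>The analogue for the passage over the x-axis, with one integrand before and one after
  the vertex. The arc before it rises to at most \<open>yb\<close>, and the arc after it goes down
  to at least \<open>- zb\<close>.\<close>

lemma crossing_II_III:
  fixes xs ys :: "real \<Rightarrow> real"
  assumes path: "continuous_on {0..1} xs" "continuous_on {0..1} ys"
    "\<And>s. s \<in> {0..1} \<Longrightarrow> xs s \<le> 0 \<and> 0 \<le> ys s"
    "\<And>s. s \<in> {0..1} \<Longrightarrow> H (ys s) + (lam / 2 * (xs s)\<^sup>2 + \<mu>1 * G (xs s)) \<in> {c11..c21}"
    "ys 0 = 0" "xs 1 = 0"
    and x0: "x0 = max (xm1 c11) (xm2 c12)"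
    and \<rho>1: "\<And>x y. 0 < y \<Longrightarrow> y \<le> yb \<Longrightarrow> H y = lam / 2 * (x0\<^sup>2 - x\<^sup>2) \<Longrightarrow> \<rho>1 x = 1 / h y"
    and \<rho>2: "\<And>x y. - zb \<le> y \<Longrightarrow> y < 0 \<Longrightarrow> H y = lam / 2 * (x0\<^sup>2 - x\<^sup>2) \<Longrightarrow> \<rho>2 x = 1 / - h y"
    and time: "\<And>xl1 xl2. xl1 \<le> 0 \<Longrightarrow> \<mu>1 * G xl1 = c21 - lam / 2 * x0\<^sup>2 \<Longrightarrow> xl2 \<le> 0 \<Longrightarrow>
      \<mu>2 * G xl2 = c22 - lam / 2 * x0\<^sup>2 \<Longrightarrow> (LBINT x=xl1..x0. \<rho>1 x) + (LBINT x=xl2..x0. \<rho>2 x) \<le> S"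
  obtains x2 y2 C :: "real \<Rightarrow> real" where "continuous_on {0..1} x2" "continuous_on {0..1} y2" "continuous_on {0..1} C"
    "C 0 = c12" "C 1 = c22"
    "\<And>r. r \<in> {0..1} \<Longrightarrow> C r \<in> {c12..c22} \<and> xm2 (C r) \<le> x2 r \<and> x2 r \<le> 0 \<and> y2 r \<le> 0 \<and>
       H (y2 r) + (lam / 2 * (x2 r)\<^sup>2 + \<mu>2 * G (x2 r)) = C r"
    "\<And>r. r \<in> {0..1} \<Longrightarrow> \<exists>s\<in>{0..1}. reaches S (xs s, ys s) (x2 r, y2 r) 0 1"
proof -
  define E1 where "E1 = - lam / 2 * x0\<^sup>2"
  have cc: "c11 \<in> {c11..c21}" "c21 \<in> {c11..c21}" "c12 \<in> {c12..c22}" "c22 \<in> {c12..c22}" using c1 c2 by auto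
  have x0n: "x0 < 0" "xm1 c11 \<le> x0" "xm2 c12 \<le> x0" using xm1(1)[OF cc(1)] xm2(1)[OF cc(3)] by (auto simp: x0)
  have E1: "0 < E1" unfolding E1_def using lam x0n by (intro mult_pos_pos) auto
  \<comment> \<open>Outer orbits reach at least as far left as inner ones, hence as the vertex
    \<open>x0\<close>. This makes \<open>- lam / 2 * x^2\<close> large enough at their ends for the
    roots \<open>xl1\<close> and \<open>xl2\<close> to exist inside the annuli.\<close>
  have le1: "xm1 c21 \<le> x0"
  proof (rule ccontr)
    assume "\<not> xm1 c21 \<le> x0"
    then have "lam / 2 * (xm1 c21)\<^sup>2 + \<mu>1 * G (xm1 c21) < c11" using xm1(1)[OF cc(2)] x0n by (intro xm1(2)[OF cc(1)]) auto
    then show False using F1_xm1[OF cc(2)] c1 by simp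
  qed
  have le2: "xm2 c22 \<le> x0"
  proof (rule ccontr)
    assume "\<not> xm2 c22 \<le> x0"
    then have "lam / 2 * (xm2 c22)\<^sup>2 + \<mu>2 * G (xm2 c22) < c12" using xm2(1)[OF cc(4)] x0n by (intro xm2(3)[OF cc(3)]) auto
    then show False using xm2(2)[OF cc(4)] c2 by simp
  qed
  obtain xl1 where xl1: "xm1 c21 \<le> xl1" "xl1 \<le> 0" "\<mu>1 * G xl1 = c21 + E1"
  proof (rule G_root_neg[of "xm1 c21" "c21 + E1" \<mu>1])
    have "lam / 2 * (xm1 c21)\<^sup>2 \<le> lam / 2 * x0\<^sup>2" using le1 x0n by (intro lam_sq_mono) auto
    then show "c21 + E1 \<le> \<mu>1 * G (xm1 c21)" using F1_xm1[OF cc(2)] by (simp add: E1_def)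
  qed (use xm1(1)[OF cc(2)] c1 \<mu> E1 in auto)
  obtain xl2 where xl2: "xm2 c22 \<le> xl2" "xl2 \<le> 0" "\<mu>2 * G xl2 = c22 + E1"
  proof (rule G_root_neg[of "xm2 c22" "c22 + E1" \<mu>2])
    have "lam / 2 * (xm2 c22)\<^sup>2 \<le> lam / 2 * x0\<^sup>2" using le2 x0n by (intro lam_sq_mono) auto
    then show "c22 + E1 \<le> \<mu>2 * G (xm2 c22)" using xm2(2)[OF cc(4)] by (simp add: E1_def)
  qed (use xm2(1)[OF cc(4)] c2 \<mu> E1 in auto)
  have rf: "((\<lambda>y. - y) has_real_derivative - 1) (at y)" for y :: real by (auto intro!: derivative_eq_intros)
  interpret M: half_hamiltonian "\<lambda>y. - h (- y)" "\<lambda>y. H (- y)" "\<lambda>_. 0" "\<lambda>_. 0"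
    by unfold_locales (use restoring_reflect[OF h] DERIV_chain2[OF dH rf] H0 in auto)
  have nn1: "0 \<le> - E1 - lam / 2 * xl1\<^sup>2"
  proof -
    have "lam / 2 * xl1\<^sup>2 + \<mu>1 * G xl1 \<le> c21"
      using xm1(2)[OF cc(2), of xl1] F1_xm1[OF cc(2)] xl1(1,2) by (cases "xl1 = xm1 c21") auto
    then show ?thesis using xl1(3) by linarith
  qed
  have nn2: "0 \<le> - E1 - lam / 2 * xl2\<^sup>2"
  proof -
    have "lam / 2 * xl2\<^sup>2 + \<mu>2 * G xl2 \<le> c22"
      using xm2(3)[OF cc(4), of xl2] xm2(2)[OF cc(4)] xl2(1,2) by (cases "xl2 = xm2 c22") auto
    then show ?thesis using xl2(3) by linarith
  qed
  \<comment> \<open>The heights, above and below the axis, at which the orbit with vertex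
    \<open>x0\<close> meets the outer circles of the two annuli.\<close>
  define yl where "yl = A.Kinv (- E1 - lam / 2 * xl1\<^sup>2)"
  define yr where "yr = - M.Kinv (- E1 - lam / 2 * xl2\<^sup>2)"
  have yl: "0 \<le> yl" "H yl + lam / 2 * xl1\<^sup>2 = - E1" using A.Kinv[OF nn1] by (auto simp: yl_def)
  have yr: "yr \<le> 0" "H yr + lam / 2 * xl2\<^sup>2 = - E1" using M.Kinv[OF nn2] by (auto simp: yr_def)
  have ylb: "yl \<le> yb" using bound1[OF cc(2) xl1(1,2)] yl(2) xl1(3) by (intro H_le_D) linarith
  have yrb: "- zb \<le> yr"
  proof (rule ccontr)
    assume "\<not> - zb \<le> yr"
    then have "H (- zb) < H (- (- yr))" using zb by (intro strict_mono_onD[OF M.K_strict_mono]) auto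
    moreover have "xl2 \<le> xp2 c22" using xp2(1)[OF cc(4)] xl2(2) by simp
    ultimately show False using bound2[OF cc(4) xl2(1)] yr(2) xl2(3) by force
  qed
  \<comment> \<open>\<open>passage_II_III\<close> expects a path that starts on the y-axis, whereas
    the given one starts on the x-axis; it is run backwards.\<close>
  have cont: "continuous_on {0..1} (\<lambda>s::real. 1 - s)" "(\<lambda>s. 1 - s) ` {0..1::real} \<subseteq> {0..1}"
    by (auto intro!: continuous_intros)
  show ?thesis
  proof (rule passage_II_III[of "\<lambda>s. xs (1 - s)" "\<lambda>s. ys (1 - s)" x0 E1 xl1 yl xl2 yr \<rho>1 \<rho>2 S])
    show "continuous_on {0..1} (\<lambda>s. xs (1 - s))" "continuous_on {0..1} (\<lambda>s. ys (1 - s))"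
      using continuous_on_compose2[OF path(1) cont] continuous_on_compose2[OF path(2) cont] by auto
    show "xs (1 - s) \<le> 0 \<and> 0 \<le> ys (1 - s)" if "s \<in> {0..1}" for s using path(3)[of "1 - s"] that by auto
    show "H (ys (1 - s)) + (lam / 2 * (xs (1 - s))\<^sup>2 + \<mu>1 * G (xs (1 - s))) \<in> {c11..c21}" if "s \<in> {0..1}" for s
      using path(4)[of "1 - s"] that by auto
    show "\<rho>1 x = 1 / h y" if "0 < y" "y \<le> yl" "H y + lam / 2 * x\<^sup>2 = - E1" for x y
      by (rule \<rho>1[OF that(1)]) (use that ylb in \<open>auto simp: E1_def algebra_simps\<close>)
    show "\<rho>2 x = 1 / - h y" if "yr \<le> y" "y < 0" "H y + lam / 2 * x\<^sup>2 = - E1" for x y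
      by (rule \<rho>2) (use that yrb in \<open>auto simp: E1_def algebra_simps\<close>)
    show "(LBINT x=xl1..x0. \<rho>1 x) + (LBINT x=xl2..x0. \<rho>2 x) \<le> S"
      by (rule time) (use xl1 xl2 in \<open>auto simp: E1_def\<close>)
    fix x2 y2 C :: "real \<Rightarrow> real"
    assume o: "continuous_on {0..1} x2" "continuous_on {0..1} y2" "continuous_on {0..1} C"
    "C 0 = c12" "C 1 = c22"
    "\<And>r. r \<in> {0..1} \<Longrightarrow> C r \<in> {c12..c22} \<and> xm2 (C r) \<le> x2 r \<and> x2 r \<le> 0 \<and> y2 r \<le> 0 \<and>
       H (y2 r) + (lam / 2 * (x2 r)\<^sup>2 + \<mu>2 * G (x2 r)) = C r"
    "\<And>r. r \<in> {0..1} \<Longrightarrow> \<exists>s\<in>{0..1}. reaches S (xs (1 - s), ys (1 - s)) (x2 r, y2 r) 0 1"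
    show thesis
    proof (rule that[OF o(1-6)])
      fix r :: real assume "r \<in> {0..1}"
      then obtain s where "s \<in> {0..1}" "reaches S (xs (1 - s), ys (1 - s)) (x2 r, y2 r) 0 1" using o(7) by blast
      then show "\<exists>s\<in>{0..1}. reaches S (xs s, ys s) (x2 r, y2 r) 0 1" by (intro bexI[of _ "1 - s"]) auto
    qed
  qed (use path(5,6) x0 E1_def xl1 xl2 yl yr in auto)
qed

end

section \<open>The four transitions between consecutive annuli\<close>

context clamped_system begin

lemma F_eq: "F i x = lam / 2 * x\<^sup>2 + \<mu> i * G x" by (simp add: potential_def)

lemma F_0: "F i 0 = 0" by (simp add: F_eq G_0)

lemma cG_UNIV: "continuous_on UNIV G" by (rule cont_G)

lemma gap_standard:
  assumes i: "i < m"
  shows "bounded_gap hb Hb G lam (\<mu> i) (\<mu> (Suc i)) (c1 i) (c2 i) (c1 (Suc i)) (c2 (Suc i))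
     (xm i) (xm (Suc i)) (xp (Suc i)) yp (- ym)"
proof -
  have i': "i \<le> m" "Suc i \<le> m" using i by auto
  show ?thesis
  proof unfold_locales
    show "lam / 2 * x\<^sup>2 + \<mu> i * G x < c" if "c \<in> {c1 i..c2 i}" "xm i c < x" "x \<le> 0" for c x
      using F_less[OF i'(1) that(1), of x] xp_pos[OF i'(1) that(1)] that by (simp add: F_eq)
    show "lam / 2 * x\<^sup>2 + \<mu> (Suc i) * G x < c" if "c \<in> {c1 (Suc i)..c2 (Suc i)}" "xm (Suc i) c < x" "x \<le> 0" for c x
      using F_less[OF i'(2) that(1), of x] xp_pos[OF i'(2) that(1)] that by (simp add: F_eq)
    show "False" if "smooth_sol hb (\<lambda>x. lam * x) T x y" "x 0 < 0" "x T = 0" "y T = 0"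
      "\<And>\<tau>. \<tau> \<in> {0..T} \<Longrightarrow> x \<tau> \<le> 0 \<and> 0 \<le> y \<tau> \<and> y \<tau> \<le> yp" for T x y
      using origin_unreachable[OF that(1,3,4)] that(2,5) ym by force
    show "c - (lam / 2 * x\<^sup>2 + \<mu> i * G x) \<le> Hb yp" if "c \<in> {c1 i..c2 i}" "xm i c \<le> x" "x \<le> 0" for c x
      using strip[OF i'(1) that(1), of x] xp_pos[OF i'(1) that(1)] that ym yp by (simp add: F_eq Hb_eq)
    show "c - (lam / 2 * x\<^sup>2 + \<mu> (Suc i) * G x) \<le> Hb yp \<and> c - (lam / 2 * x\<^sup>2 + \<mu> (Suc i) * G x) \<le> Hb (- (- ym))"
      if "c \<in> {c1 (Suc i)..c2 (Suc i)}" "xm (Suc i) c \<le> x" "x \<le> xp (Suc i) c" for c x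
      using strip[OF i'(2) that(1), of x] that ym yp by (simp add: F_eq Hb_eq)
  qed (use restoring_hb Hb_deriv Hb_0 lam_neg cG_UNIV G_0 G_strict_mono G_anti \<mu>_pos i' c1_pos c1_less_c2 xm_neg xp_pos
      F_xm[unfolded F_eq] F_xp[unfolded F_eq] yp ym in auto)
qed

text \<open>A half turn carries a start in quadrant IV to one in quadrant II. It exchanges
  \<open>xm\<close> with \<open>xp\<close> and \<open>ym\<close> with \<open>yp\<close> up to sign
  and leaves the linear force as it is, so the two crossings from II also yield those from
  IV.\<close>

lemma gap_rotated:
  assumes i: "i < m"
  shows "bounded_gap (\<lambda>y. - hb (- y)) (\<lambda>y. Hb (- y)) (\<lambda>x. G (- x)) lam (\<mu> i) (\<mu> (Suc i)) (c1 i) (c2 i) (c1 (Suc i)) (c2 (Suc i))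
     (\<lambda>c. - xp i c) (\<lambda>c. - xp (Suc i) c) (\<lambda>c. - xm (Suc i) c) (- ym) yp"
proof -
  have i': "i \<le> m" "Suc i \<le> m" using i by auto
  show ?thesis
  proof unfold_locales
    show "restoring (\<lambda>y. - hb (- y))" by (rule restoring_reflect[OF restoring_hb])
    show "((\<lambda>y. Hb (- y)) has_real_derivative - hb (- y)) (at y)" for y
      using half_hamiltonian.dK[OF half_hb_reflected] .
    show "continuous_on UNIV (\<lambda>x. G (- x))"
      by (rule continuous_on_compose2[OF cG_UNIV]) (auto intro!: continuous_intros)
    show "strict_mono_on {0..} (\<lambda>x. G (- x))" by (rule strict_mono_onI) (auto intro!: G_anti)
    show "G (- y) < G (- x)" if "x < y" "y \<le> 0" for x y
      using strict_mono_onD[OF G_strict_mono, of "- y" "- x"] that by auto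
    show "lam / 2 * x\<^sup>2 + \<mu> i * G (- x) < c" if "c \<in> {c1 i..c2 i}" "- xp i c < x" "x \<le> 0" for c x
      using F_less[OF i'(1) that(1), of "- x"] xm_neg[OF i'(1) that(1)] that by (simp add: F_eq)
    show "lam / 2 * x\<^sup>2 + \<mu> (Suc i) * G (- x) < c" if "c \<in> {c1 (Suc i)..c2 (Suc i)}" "- xp (Suc i) c < x" "x \<le> 0" for c x
      using F_less[OF i'(2) that(1), of "- x"] xm_neg[OF i'(2) that(1)] that by (simp add: F_eq)
    show "False" if s: "smooth_sol (\<lambda>y. - hb (- y)) (\<lambda>x. lam * x) T x y" "x 0 < 0" "x T = 0" "y T = 0"
      "\<And>\<tau>. \<tau> \<in> {0..T} \<Longrightarrow> x \<tau> \<le> 0 \<and> 0 \<le> y \<tau> \<and> y \<tau> \<le> - ym" for T x y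
    proof -
      have "smooth_sol hb (\<lambda>x. lam * x) T (\<lambda>\<tau>. - x \<tau>) (\<lambda>\<tau>. - y \<tau>)"
        using smooth_sol_rotate[where \<sigma> = "- 1" and \<rho> = "- 1" and h = hb and f = "\<lambda>x. lam * x", of T x y] s(1) by simp
      then have "- x 0 = 0" by (rule origin_unreachable) (use s(3-5) yp in force)+
      then show False using s(2) by simp
    qed
    show "c - (lam / 2 * x\<^sup>2 + \<mu> i * G (- x)) \<le> Hb (- (- ym))" if "c \<in> {c1 i..c2 i}" "- xp i c \<le> x" "x \<le> 0" for c x
      using strip[OF i'(1) that(1), of "- x"] xm_neg[OF i'(1) that(1)] that ym yp by (simp add: F_eq Hb_eq)
    show "c - (lam / 2 * x\<^sup>2 + \<mu> (Suc i) * G (- x)) \<le> Hb (- (- ym)) \<and> c - (lam / 2 * x\<^sup>2 + \<mu> (Suc i) * G (- x)) \<le> Hb (- (- yp))"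
      if "c \<in> {c1 (Suc i)..c2 (Suc i)}" "- xp (Suc i) c \<le> x" "x \<le> - xm (Suc i) c" for c x
      using strip[OF i'(2) that(1), of "- x"] that ym yp by (simp add: F_eq Hb_eq)
  qed (use Hb_0 lam_neg G_0 \<mu>_pos i' c1_pos c1_less_c2 xm_neg xp_pos F_xm[unfolded F_eq] F_xp[unfolded F_eq] yp ym in auto)
qed

text \<open>Over \<open>x = 0\<close> the potential vanishes, so the points of the inner orbit there
  have \<open>H y = c1 i\<close>. They are the preimages at which the inverses of H have their
  intended value.\<close>

lemma H_inv_c1:
  assumes i: "i \<le> m"
  shows "0 \<le> Hp_inv (c1 i)" "ereal (Hp_inv (c1 i)) < rp" "H (Hp_inv (c1 i)) = c1 i"
    "Hm_inv (c1 i) \<le> 0" "rm < ereal (Hm_inv (c1 i))" "H (Hm_inv (c1 i)) = c1 i"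
proof -
  have x: "0 \<in> {xm i (c1 i)..xp i (c1 i)}" using xm_neg[OF i c1_mem[OF i]] xp_pos[OF i c1_mem[OF i]] by simp
  obtain y where y: "0 \<le> y" "ereal y < rp" "H y = c1 i"
    using annulus_strip_upper[OF i c1_mem[OF i] x] F_0 by auto
  obtain z where z: "z \<le> 0" "rm < ereal z" "H z = c1 i"
    using annulus_strip_lower[OF i c1_mem[OF i] x] F_0 by auto
  have "Hp_inv (c1 i) = y" using Hp_inv_H[OF y(1,2)] y(3) by simp
  then show "0 \<le> Hp_inv (c1 i)" "ereal (Hp_inv (c1 i)) < rp" "H (Hp_inv (c1 i)) = c1 i" using y by auto
  have "Hm_inv (c1 i) = z" using Hm_inv_H[OF z(1,2)] z(3) by simp
  then show "Hm_inv (c1 i) \<le> 0" "rm < ereal (Hm_inv (c1 i))" "H (Hm_inv (c1 i)) = c1 i" using z by auto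
qed

text \<open>H increases on the upper half of the strip, so the lower of the two points has the
  smaller energy. As H decreases on the lower half, \<open>y_minus\<close> has the same energy: both
  transitions over the y-axis use the value \<open>E1\<close> of
  \<open>passage_II_I\<close>.\<close>

lemma H_y_plus: assumes i: "i < m" shows "H (y_plus i) = min (c1 i) (c1 (Suc i))"
proof -
  let ?a = "Hp_inv (c1 i)" and ?b = "Hp_inv (c1 (Suc i))"
  have i': "i \<le> m" "Suc i \<le> m" using i by auto
  note a = H_inv_c1(1-3)[OF i'(1)] and b = H_inv_c1(1-3)[OF i'(2)]
  show ?thesis
  proof (cases "?a \<le> ?b")
    case True
    then have "H ?a \<le> H ?b" using H_less_pos[OF a(1) _ b(2)] by (cases "?a = ?b") simp_all
    then show ?thesis unfolding y_plus_def using True a(3) b(3) by (simp add: min_absorb1)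
  next
    case False
    then have "H ?b \<le> H ?a" using H_less_pos[OF b(1) _ a(2)] by simp
    then show ?thesis unfolding y_plus_def using False a(3) b(3) by (simp add: min_absorb2)
  qed
qed

lemma H_y_minus: assumes i: "i < m" shows "H (y_minus i) = min (c1 i) (c1 (Suc i))"
proof -
  let ?a = "Hm_inv (c1 i)" and ?b = "Hm_inv (c1 (Suc i))"
  have i': "i \<le> m" "Suc i \<le> m" using i by auto
  note a = H_inv_c1(4-6)[OF i'(1)] and b = H_inv_c1(4-6)[OF i'(2)]
  show ?thesis
  proof (cases "?b \<le> ?a")
    case True
    then have "H ?a \<le> H ?b" using H_less_neg[OF a(1) _ b(2)] by (cases "?a = ?b") simp_all
    then show ?thesis unfolding y_minus_def using True a(3) b(3) by (simp add: min_absorb1 max_absorb1)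
  next
    case False
    then have "H ?b \<le> H ?a" using H_less_neg[OF b(1) _ a(2)] by simp
    then show ?thesis unfolding y_minus_def using False a(3) b(3) by (simp add: min_absorb2 max_absorb2)
  qed
qed

lemma Hp_inv_Hb: "0 < y \<Longrightarrow> y \<le> yp \<Longrightarrow> Hb y = z \<Longrightarrow> h (Hp_inv z) = hb y"
proof -
  assume y: "0 < y" "y \<le> yp" "Hb y = z"
  then have m: "y \<in> {ym..yp}" using ym by auto
  then have "H y = z" using Hb_eq y(3) by simp
  then have "Hp_inv z = y" using Hp_inv_H[of y] strip_mem[OF m] y(1) by (auto simp: einterval_iff)
  then show ?thesis using hb_eq[OF m] by simp
qed

lemma Hm_inv_Hb: "y < 0 \<Longrightarrow> ym \<le> y \<Longrightarrow> Hb y = z \<Longrightarrow> h (Hm_inv z) = hb y"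
proof -
  assume y: "y < 0" "ym \<le> y" "Hb y = z"
  then have m: "y \<in> {ym..yp}" using yp by auto
  then have "H y = z" using Hb_eq y(3) by simp
  then have "Hm_inv z = y" using Hm_inv_H[of y] strip_mem[OF m] y(1) by (auto simp: einterval_iff)
  then show ?thesis using hb_eq[OF m] by simp
qed

definition gap_sol :: "nat \<Rightarrow> real \<times> real \<Rightarrow> real \<times> real \<Rightarrow> nat \<Rightarrow> nat \<Rightarrow> bool" where
  "gap_sol i Q Z nx ny \<longleftrightarrow> (\<exists>x y. smooth_sol hb (\<lambda>x. lam * x) (t (Suc i) - s i) x y \<and>
     (x 0, y 0) = Q \<and> (x (t (Suc i) - s i), y (t (Suc i) - s i)) = Z \<and>
     (\<forall>\<tau>\<in>{0..t (Suc i) - s i}. y \<tau> \<in> {ym..yp}) \<and>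
     has_exactly_zeros x {0..t (Suc i) - s i} nx \<and> has_exactly_zeros y {0..t (Suc i) - s i} ny)"

lemma gap_sol_of_reaches:
  assumes i: "i < m" and r: "gap.reaches hb lam (t (Suc i) - s i) (x0, y0) (x1, y1) nx ny"
    and y: "y0 \<in> {ym..yp}" "y1 \<in> {ym..yp}"
  shows "gap_sol i (x0, y0) (x1, y1) nx ny"
proof -
  interpret gp: bounded_gap hb Hb G lam "\<mu> i" "\<mu> (Suc i)" "c1 i" "c2 i" "c1 (Suc i)" "c2 (Suc i)"
     "xm i" "xm (Suc i)" "xp (Suc i)" yp "- ym" by (rule gap_standard[OF i])
  obtain x y where xy: "smooth_sol hb (\<lambda>x. lam * x) (t (Suc i) - s i) x y" "(x 0, y 0) = (x0, y0)"
     "(x (t (Suc i) - s i), y (t (Suc i) - s i)) = (x1, y1)"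
     "\<forall>\<tau>\<in>{0..t (Suc i) - s i}. min 0 (snd (x1, y1)) \<le> y \<tau> \<and> y \<tau> \<le> max (snd (x0, y0)) (snd (x1, y1))"
     "has_exactly_zeros x {0..t (Suc i) - s i} nx" "has_exactly_zeros y {0..t (Suc i) - s i} ny"
    using r unfolding gp.reaches_def by blast
  have "y \<tau> \<in> {ym..yp}" if "\<tau> \<in> {0..t (Suc i) - s i}" for \<tau>
    using bspec[OF xy(4) that] y assms(3) ym by auto
  then show ?thesis unfolding gap_sol_def using xy(1-3,5,6) by blast
qed

lemma gap_sol_of_reaches_rotated:
  assumes i: "i < m" and r: "gap.reaches (\<lambda>y. - hb (- y)) lam (t (Suc i) - s i) (- x0, - y0) (- x1, - y1) nx ny"
    and y: "y0 \<in> {ym..yp}" "y1 \<in> {ym..yp}"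
  shows "gap_sol i (x0, y0) (x1, y1) nx ny"
proof -
  interpret gp: bounded_gap "\<lambda>y. - hb (- y)" "\<lambda>y. Hb (- y)" "\<lambda>x. G (- x)" lam "\<mu> i" "\<mu> (Suc i)" "c1 i" "c2 i" "c1 (Suc i)" "c2 (Suc i)"
     "\<lambda>c. - xp i c" "\<lambda>c. - xp (Suc i) c" "\<lambda>c. - xm (Suc i) c" "- ym" yp by (rule gap_rotated[OF i])
  obtain x y where xy: "smooth_sol (\<lambda>y. - hb (- y)) (\<lambda>x. lam * x) (t (Suc i) - s i) x y" "x 0 = - x0" "y 0 = - y0"
     "x (t (Suc i) - s i) = - x1" "y (t (Suc i) - s i) = - y1"
     "\<forall>\<tau>\<in>{0..t (Suc i) - s i}. min 0 (- y1) \<le> y \<tau> \<and> y \<tau> \<le> max (- y0) (- y1)"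
     "has_exactly_zeros x {0..t (Suc i) - s i} nx" "has_exactly_zeros y {0..t (Suc i) - s i} ny"
    using r unfolding gp.reaches_def by auto
  have 1: "- y \<tau> \<in> {ym..yp}" if "\<tau> \<in> {0..t (Suc i) - s i}" for \<tau>
    using bspec[OF xy(6) that] y assms(3) yp by auto
  have 2: "smooth_sol hb (\<lambda>x. lam * x) (t (Suc i) - s i) (\<lambda>\<tau>. - x \<tau>) (\<lambda>\<tau>. - y \<tau>)"
    using smooth_sol_rotate[where \<sigma> = "- 1" and \<rho> = "- 1" and h = hb and f = "\<lambda>x. lam * x", of _ x y] xy(1) by simp
  have 3: "has_exactly_zeros (\<lambda>\<tau>. - x \<tau>) {0..t (Suc i) - s i} nx" "has_exactly_zeros (\<lambda>\<tau>. - y \<tau>) {0..t (Suc i) - s i} ny"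
    using xy(7,8) by (simp_all add: has_exactly_zeros_def)
  show ?thesis unfolding gap_sol_def
    by (rule exI[of _ "\<lambda>\<tau>. - x \<tau>"], rule exI[of _ "\<lambda>\<tau>. - y \<tau>"]) (use 1 2 3 xy(2-5) in simp)
qed

text \<open>The orientation is that of the clockwise angle in quadrants II and IV: from the x-axis
  to the y-axis.\<close>

definition axis_path :: "nat \<Rightarrow> quadrant \<Rightarrow> (real \<Rightarrow> real) \<Rightarrow> (real \<Rightarrow> real) \<Rightarrow> bool" where
  "axis_path i q xs ys \<longleftrightarrow> continuous_on {0..1} xs \<and> continuous_on {0..1} ys \<and> ys 0 = 0 \<and> xs 1 = 0 \<and>
     (\<forall>s\<in>{0..1}. Hb (ys s) + F i (xs s) \<in> {c1 i..c2 i} \<and> 0 \<le> xsign q * xs s \<and> 0 \<le> ysign q * ys s \<and> ys s \<in> {ym..yp})"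

text \<open>The common outcome of the four transitions. \<open>C\<close> is the level in the new
  annulus, so its end values say that the path of arrivals joins the two boundary circles.\<close>

definition stretched :: "nat \<Rightarrow> quadrant \<Rightarrow> (real \<Rightarrow> real) \<Rightarrow> (real \<Rightarrow> real) \<Rightarrow> nat \<Rightarrow> nat \<Rightarrow> bool" where
  "stretched i \<kappa> xs ys nx ny \<longleftrightarrow> (\<exists>x2 y2 C :: real \<Rightarrow> real. continuous_on {0..1} x2 \<and> continuous_on {0..1} y2 \<and>
     continuous_on {0..1} C \<and> C 0 = c1 (Suc i) \<and> C 1 = c2 (Suc i) \<and>
     (\<forall>r\<in>{0..1}. C r \<in> {c1 (Suc i)..c2 (Suc i)} \<and> x2 r \<in> {xm (Suc i) (C r)..xp (Suc i) (C r)} \<and>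
        Hb (y2 r) + F (Suc i) (x2 r) = C r \<and> 0 \<le> xsign \<kappa> * x2 r \<and> 0 \<le> ysign \<kappa> * y2 r \<and>
        (\<exists>s\<in>{0..1}. gap_sol i (xs s, ys s) (x2 r, y2 r) nx ny)))"

lemma stretched_QII_QI:
  assumes i: "i < m" and p: "axis_path i QII xs ys" and S: "S_II_I i \<le> t (Suc i) - s i"
  shows "stretched i QI xs ys 1 0"
proof -
  have i': "i \<le> m" "Suc i \<le> m" using i by auto
  interpret gp: bounded_gap hb Hb G lam "\<mu> i" "\<mu> (Suc i)" "c1 i" "c2 i" "c1 (Suc i)" "c2 (Suc i)"
     "xm i" "xm (Suc i)" "xp (Suc i)" yp "- ym" by (rule gap_standard[OF i])
  let ?E = "min (c1 i) (c1 (Suc i))"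
  obtain x2 y2 C :: "real \<Rightarrow> real" where o: "continuous_on {0..1} x2" "continuous_on {0..1} y2" "continuous_on {0..1} C"
    "C 0 = c1 (Suc i)" "C 1 = c2 (Suc i)"
    "\<And>r. r \<in> {0..1} \<Longrightarrow> C r \<in> {c1 (Suc i)..c2 (Suc i)} \<and> 0 \<le> x2 r \<and> x2 r \<le> xp (Suc i) (C r) \<and> 0 \<le> y2 r \<and>
       Hb (y2 r) + (lam / 2 * (x2 r)\<^sup>2 + \<mu> (Suc i) * G (x2 r)) = C r"
    "\<And>r. r \<in> {0..1} \<Longrightarrow> \<exists>u\<in>{0..1}. gp.reaches (t (Suc i) - s i) (xs u, ys u) (x2 r, y2 r) 1 0"
  proof (rule gp.crossing_II_I[of xs ys "\<lambda>x. 1 / h (Hp_inv (H (y_plus i) - lam / 2 * x\<^sup>2))" "t (Suc i) - s i"])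
    show "1 / h (Hp_inv (H (y_plus i) - lam / 2 * x\<^sup>2)) = 1 / hb y" if "0 < y" "y \<le> yp" "Hb y + lam / 2 * x\<^sup>2 = ?E" for x y
      using Hp_inv_Hb[OF that(1,2), of "H (y_plus i) - lam / 2 * x\<^sup>2"] that(3) by (simp add: H_y_plus[OF i] eq_diff_eq)
    show "(LBINT x=ereal a..ereal b. 1 / h (Hp_inv (H (y_plus i) - lam / 2 * x\<^sup>2))) \<le> t (Suc i) - s i"
      if "a \<le> 0" "\<mu> i * G a = c2 i - ?E" "0 \<le> b" "\<mu> (Suc i) * G b = c2 (Suc i) - ?E" for a b
    proof -
      \<comment> \<open>Since \<open>H (y_plus i)\<close> is the minimum of the two inner levels,
        the equation and the sign of a characterise it as this value of the inverse of G; the same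
        pattern serves for all limits below.\<close>
      have "xl i = a" unfolding xl_def H_y_plus[OF i] by (rule Gm_inv_eqI) (use that(1,2) \<mu>_pos[OF i'(1)] in \<open>simp_all add: eq_divide_eq mult.commute\<close>)
      moreover have "xr i = b" unfolding xr_def H_y_plus[OF i] by (rule Gp_inv_eqI) (use that(3,4) \<mu>_pos[OF i'(2)] in \<open>simp_all add: eq_divide_eq mult.commute\<close>)
      ultimately show ?thesis using S by (simp add: S_II_I_def)
    qed
  qed (use p in \<open>auto simp: axis_path_def F_eq\<close>)
  have y2: "y2 r \<in> {ym..yp}" if "r \<in> {0..1}" for r
    using o(6)[OF that] xm_neg[OF i'(2), of "C r"] by (intro orbit_y[OF i'(2), of "C r" "x2 r"]) (auto simp: F_eq)
  show ?thesis unfolding stretched_def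
  proof (rule exI[of _ x2], rule exI[of _ y2], rule exI[of _ C], intro conjI ballI)
    fix r :: real assume r: "r \<in> {0..1}"
    obtain u where u: "u \<in> {0..1}" "gp.reaches (t (Suc i) - s i) (xs u, ys u) (x2 r, y2 r) 1 0" using o(7)[OF r] by blast
    have "ys u \<in> {ym..yp}" using p u(1) by (auto simp: axis_path_def)
    then show "\<exists>u\<in>{0..1}. gap_sol i (xs u, ys u) (x2 r, y2 r) 1 0"
      using gap_sol_of_reaches[OF i u(2) _ y2[OF r]] u(1) by blast
    show "C r \<in> {c1 (Suc i)..c2 (Suc i)}" "x2 r \<in> {xm (Suc i) (C r)..xp (Suc i) (C r)}" "Hb (y2 r) + F (Suc i) (x2 r) = C r"
      "0 \<le> xsign QI * x2 r" "0 \<le> ysign QI * y2 r"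
      using o(6)[OF r] xm_neg[OF i'(2), of "C r"] by (auto simp: F_eq)
  qed (rule o)+
qed

lemma stretched_QIV_QIII:
  assumes i: "i < m" and p: "axis_path i QIV xs ys" and S: "S_IV_III i \<le> t (Suc i) - s i"
  shows "stretched i QIII xs ys 1 0"
proof -
  have i': "i \<le> m" "Suc i \<le> m" using i by auto
  interpret gp: bounded_gap "\<lambda>y. - hb (- y)" "\<lambda>y. Hb (- y)" "\<lambda>x. G (- x)" lam "\<mu> i" "\<mu> (Suc i)" "c1 i" "c2 i" "c1 (Suc i)" "c2 (Suc i)"
     "\<lambda>c. - xp i c" "\<lambda>c. - xp (Suc i) c" "\<lambda>c. - xm (Suc i) c" "- ym" yp by (rule gap_rotated[OF i])
  let ?E = "min (c1 i) (c1 (Suc i))"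
  let ?\<rho> = "\<lambda>x. 1 / - h (Hm_inv (H (y_minus i) - lam / 2 * x\<^sup>2))"
  obtain x2 y2 C :: "real \<Rightarrow> real" where o: "continuous_on {0..1} x2" "continuous_on {0..1} y2" "continuous_on {0..1} C"
    "C 0 = c1 (Suc i)" "C 1 = c2 (Suc i)"
    "\<And>r. r \<in> {0..1} \<Longrightarrow> C r \<in> {c1 (Suc i)..c2 (Suc i)} \<and> 0 \<le> x2 r \<and> x2 r \<le> - xm (Suc i) (C r) \<and> 0 \<le> y2 r \<and>
       Hb (- y2 r) + (lam / 2 * (x2 r)\<^sup>2 + \<mu> (Suc i) * G (- x2 r)) = C r"
    "\<And>r. r \<in> {0..1} \<Longrightarrow> \<exists>u\<in>{0..1}. gp.reaches (t (Suc i) - s i) (- xs u, - ys u) (x2 r, y2 r) 1 0"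
  proof (rule gp.crossing_II_I[of "\<lambda>s. - xs s" "\<lambda>s. - ys s" ?\<rho> "t (Suc i) - s i"])
    show "?\<rho> x = 1 / - hb (- y)" if "0 < y" "y \<le> - ym" "Hb (- y) + lam / 2 * x\<^sup>2 = ?E" for x y
      using Hm_inv_Hb[of "- y" "H (y_minus i) - lam / 2 * x\<^sup>2"] that by (simp add: H_y_minus[OF i] eq_diff_eq)
    show "(LBINT x=ereal a..ereal b. ?\<rho> x) \<le> t (Suc i) - s i"
      if "a \<le> 0" "\<mu> i * G (- a) = c2 i - ?E" "0 \<le> b" "\<mu> (Suc i) * G (- b) = c2 (Suc i) - ?E" for a b
    proof -
      have "xr' i = - a" unfolding xr'_def H_y_minus[OF i] by (rule Gp_inv_eqI) (use that(1,2) \<mu>_pos[OF i'(1)] in \<open>simp_all add: eq_divide_eq mult.commute\<close>)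
      moreover have "xl' i = - b" unfolding xl'_def H_y_minus[OF i] by (rule Gm_inv_eqI) (use that(3,4) \<mu>_pos[OF i'(2)] in \<open>simp_all add: eq_divide_eq mult.commute\<close>)
      ultimately show ?thesis using S interval_integral_reflect[of "ereal a" "ereal b" ?\<rho>] by (simp add: S_IV_III_def)
    qed
  qed (use p in \<open>auto simp: axis_path_def F_eq intro!: continuous_intros\<close>)
  have y2: "- y2 r \<in> {ym..yp}" if "r \<in> {0..1}" for r
    using o(6)[OF that] xp_pos[OF i'(2), of "C r"] by (intro orbit_y[OF i'(2), of "C r" "- x2 r"]) (auto simp: F_eq)
  show ?thesis unfolding stretched_def
  proof (rule exI[of _ "\<lambda>r. - x2 r"], rule exI[of _ "\<lambda>r. - y2 r"], rule exI[of _ C], intro conjI ballI)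
    fix r :: real assume r: "r \<in> {0..1}"
    obtain u where u: "u \<in> {0..1}" "gp.reaches (t (Suc i) - s i) (- xs u, - ys u) (x2 r, y2 r) 1 0" using o(7)[OF r] by blast
    have "ys u \<in> {ym..yp}" using p u(1) by (auto simp: axis_path_def)
    then have "gap_sol i (xs u, ys u) (- x2 r, - y2 r) 1 0"
      using gap_sol_of_reaches_rotated[OF i, of "xs u" "ys u" "- x2 r" "- y2 r"] u(2) y2[OF r] by simp
    then show "\<exists>u\<in>{0..1}. gap_sol i (xs u, ys u) (- x2 r, - y2 r) 1 0" using u(1) by blast
    show "C r \<in> {c1 (Suc i)..c2 (Suc i)}" "- x2 r \<in> {xm (Suc i) (C r)..xp (Suc i) (C r)}"
      "Hb (- y2 r) + F (Suc i) (- x2 r) = C r" "0 \<le> xsign QIII * (- x2 r)" "0 \<le> ysign QIII * (- y2 r)"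
      using o(6)[OF r] xp_pos[OF i'(2), of "C r"] by (auto simp: F_eq)
  qed (use o in \<open>auto intro!: continuous_intros\<close>)
qed

lemma stretched_QII_QIII:
  assumes i: "i < m" and p: "axis_path i QII xs ys" and S: "S_II_III i \<le> t (Suc i) - s i"
  shows "stretched i QIII xs ys 0 1"
proof -
  have i': "i \<le> m" "Suc i \<le> m" using i by auto
  interpret gp: bounded_gap hb Hb G lam "\<mu> i" "\<mu> (Suc i)" "c1 i" "c2 i" "c1 (Suc i)" "c2 (Suc i)"
     "xm i" "xm (Suc i)" "xp (Suc i)" yp "- ym" by (rule gap_standard[OF i])
  let ?\<rho>1 = "\<lambda>x. 1 / h (Hp_inv (lam / 2 * ((x_minus i)\<^sup>2 - x\<^sup>2)))"
  let ?\<rho>2 = "\<lambda>x. 1 / - h (Hm_inv (lam / 2 * ((x_minus i)\<^sup>2 - x\<^sup>2)))"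
  \<comment> \<open>The limits of the x-axis transitions are stated through the outer end point x.
    Inserting \<open>F j x = c2 j\<close> eliminates \<open>G x\<close> and leaves the right-hand
    side of the equation in \<open>crossing_II_III\<close>.\<close>
  have Ginv_arg: "G x + lam / (2 * \<mu> j) * (x\<^sup>2 - z\<^sup>2) = (c2 j - lam / 2 * z\<^sup>2) / \<mu> j"
    if "j \<le> m" "F j x = c2 j" for j x z
    using that \<mu>_pos[OF that(1)] by (simp add: F_eq field_simps)
  obtain x2 y2 C :: "real \<Rightarrow> real" where o: "continuous_on {0..1} x2" "continuous_on {0..1} y2" "continuous_on {0..1} C"
    "C 0 = c1 (Suc i)" "C 1 = c2 (Suc i)"
    "\<And>r. r \<in> {0..1} \<Longrightarrow> C r \<in> {c1 (Suc i)..c2 (Suc i)} \<and> xm (Suc i) (C r) \<le> x2 r \<and> x2 r \<le> 0 \<and> y2 r \<le> 0 \<and>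
       Hb (y2 r) + (lam / 2 * (x2 r)\<^sup>2 + \<mu> (Suc i) * G (x2 r)) = C r"
    "\<And>r. r \<in> {0..1} \<Longrightarrow> \<exists>u\<in>{0..1}. gp.reaches (t (Suc i) - s i) (xs u, ys u) (x2 r, y2 r) 0 1"
  proof (rule gp.crossing_II_III[of xs ys "x_minus i" ?\<rho>1 ?\<rho>2 "t (Suc i) - s i"])
    show "?\<rho>1 x = 1 / hb y" if "0 < y" "y \<le> yp" "Hb y = lam / 2 * ((x_minus i)\<^sup>2 - x\<^sup>2)" for x y
      using Hp_inv_Hb[OF that] by simp
    show "?\<rho>2 x = 1 / - hb y" if "- (- ym) \<le> y" "y < 0" "Hb y = lam / 2 * ((x_minus i)\<^sup>2 - x\<^sup>2)" for x y
      using Hm_inv_Hb[OF that(2) _ that(3)] that(1) by simp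
    show "(LBINT x=ereal a..ereal (x_minus i). ?\<rho>1 x) + (LBINT x=ereal b..ereal (x_minus i). ?\<rho>2 x) \<le> t (Suc i) - s i"
      if "a \<le> 0" "\<mu> i * G a = c2 i - lam / 2 * (x_minus i)\<^sup>2" "b \<le> 0" "\<mu> (Suc i) * G b = c2 (Suc i) - lam / 2 * (x_minus i)\<^sup>2" for a b
    proof -
      have "xl1 i = a"
        unfolding xl1_def Ginv_arg[OF i'(1) F_xm[OF i'(1) c2_mem[OF i'(1)]]]
        by (rule Gm_inv_eqI) (use that(1,2) \<mu>_pos[OF i'(1)] in \<open>simp_all add: eq_divide_eq mult.commute\<close>)
      moreover have "xl2 i = b"
        unfolding xl2_def Ginv_arg[OF i'(2) F_xm[OF i'(2) c2_mem[OF i'(2)]]]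
        by (rule Gm_inv_eqI) (use that(3,4) \<mu>_pos[OF i'(2)] in \<open>simp_all add: eq_divide_eq mult.commute\<close>)
      ultimately show ?thesis using S by (simp add: S_II_III_def)
    qed
    show "x_minus i = max (xm i (c1 i)) (xm (Suc i) (c1 (Suc i)))" by (rule x_minus_def)
  qed (use p in \<open>auto simp: axis_path_def F_eq\<close>)
  have y2: "y2 r \<in> {ym..yp}" if "r \<in> {0..1}" for r
    using o(6)[OF that] xp_pos[OF i'(2), of "C r"] by (intro orbit_y[OF i'(2), of "C r" "x2 r"]) (auto simp: F_eq)
  show ?thesis unfolding stretched_def
  proof (rule exI[of _ x2], rule exI[of _ y2], rule exI[of _ C], intro conjI ballI)
    fix r :: real assume r: "r \<in> {0..1}"
    obtain u where u: "u \<in> {0..1}" "gp.reaches (t (Suc i) - s i) (xs u, ys u) (x2 r, y2 r) 0 1" using o(7)[OF r] by blast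
    have "ys u \<in> {ym..yp}" using p u(1) by (auto simp: axis_path_def)
    then show "\<exists>u\<in>{0..1}. gap_sol i (xs u, ys u) (x2 r, y2 r) 0 1"
      using gap_sol_of_reaches[OF i u(2) _ y2[OF r]] u(1) by blast
    show "C r \<in> {c1 (Suc i)..c2 (Suc i)}" "x2 r \<in> {xm (Suc i) (C r)..xp (Suc i) (C r)}" "Hb (y2 r) + F (Suc i) (x2 r) = C r"
      "0 \<le> xsign QIII * x2 r" "0 \<le> ysign QIII * y2 r"
      using o(6)[OF r] xp_pos[OF i'(2), of "C r"] by (auto simp: F_eq)
  qed (rule o)+
qed

lemma stretched_QIV_QI:
  assumes i: "i < m" and p: "axis_path i QIV xs ys" and S: "S_IV_I i \<le> t (Suc i) - s i"
  shows "stretched i QI xs ys 0 1"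
proof -
  have i': "i \<le> m" "Suc i \<le> m" using i by auto
  interpret gp: bounded_gap "\<lambda>y. - hb (- y)" "\<lambda>y. Hb (- y)" "\<lambda>x. G (- x)" lam "\<mu> i" "\<mu> (Suc i)" "c1 i" "c2 i" "c1 (Suc i)" "c2 (Suc i)"
     "\<lambda>c. - xp i c" "\<lambda>c. - xp (Suc i) c" "\<lambda>c. - xm (Suc i) c" "- ym" yp by (rule gap_rotated[OF i])
  \<comment> \<open>The arc before the vertex lies in quadrant IV, so after the half turn the
    lower-branch integrand comes first; in \<open>S_IV_I\<close> it is the second summand.\<close>
  let ?\<rho>1 = "\<lambda>x. 1 / - h (Hm_inv (lam / 2 * ((x_plus i)\<^sup>2 - x\<^sup>2)))"
  let ?\<rho>2 = "\<lambda>x. 1 / h (Hp_inv (lam / 2 * ((x_plus i)\<^sup>2 - x\<^sup>2)))"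
  have Ginv_arg: "G x + lam / (2 * \<mu> j) * (x\<^sup>2 - z\<^sup>2) = (c2 j - lam / 2 * z\<^sup>2) / \<mu> j"
    if "j \<le> m" "F j x = c2 j" for j x z
    using that \<mu>_pos[OF that(1)] by (simp add: F_eq field_simps)
  obtain x2 y2 C :: "real \<Rightarrow> real" where o: "continuous_on {0..1} x2" "continuous_on {0..1} y2" "continuous_on {0..1} C"
    "C 0 = c1 (Suc i)" "C 1 = c2 (Suc i)"
    "\<And>r. r \<in> {0..1} \<Longrightarrow> C r \<in> {c1 (Suc i)..c2 (Suc i)} \<and> - xp (Suc i) (C r) \<le> x2 r \<and> x2 r \<le> 0 \<and> y2 r \<le> 0 \<and>
       Hb (- y2 r) + (lam / 2 * (x2 r)\<^sup>2 + \<mu> (Suc i) * G (- x2 r)) = C r"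
    "\<And>r. r \<in> {0..1} \<Longrightarrow> \<exists>u\<in>{0..1}. gp.reaches (t (Suc i) - s i) (- xs u, - ys u) (x2 r, y2 r) 0 1"
  proof (rule gp.crossing_II_III[of "\<lambda>s. - xs s" "\<lambda>s. - ys s" "- x_plus i" ?\<rho>1 ?\<rho>2 "t (Suc i) - s i"])
    show "?\<rho>1 x = 1 / - hb (- y)" if "0 < y" "y \<le> - ym" "Hb (- y) = lam / 2 * ((- x_plus i)\<^sup>2 - x\<^sup>2)" for x y
      using Hm_inv_Hb[of "- y", OF _ _ that(3)] that(1,2) by simp
    show "?\<rho>2 x = 1 / - (- hb (- y))" if "- yp \<le> y" "y < 0" "Hb (- y) = lam / 2 * ((- x_plus i)\<^sup>2 - x\<^sup>2)" for x y
      using Hp_inv_Hb[of "- y", OF _ _ that(3)] that(1,2) by simp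
    show "(LBINT x=ereal a..ereal (- x_plus i). ?\<rho>1 x) + (LBINT x=ereal b..ereal (- x_plus i). ?\<rho>2 x) \<le> t (Suc i) - s i"
      if "a \<le> 0" "\<mu> i * G (- a) = c2 i - lam / 2 * (- x_plus i)\<^sup>2" "b \<le> 0"
        "\<mu> (Suc i) * G (- b) = c2 (Suc i) - lam / 2 * (- x_plus i)\<^sup>2" for a b
    proof -
      have "xr1 i = - a"
        unfolding xr1_def Ginv_arg[OF i'(1) F_xp[OF i'(1) c2_mem[OF i'(1)]]]
        by (rule Gp_inv_eqI) (use that(1,2) \<mu>_pos[OF i'(1)] in \<open>simp_all add: eq_divide_eq mult.commute\<close>)
      moreover have "xr2 i = - b"
        unfolding xr2_def Ginv_arg[OF i'(2) F_xp[OF i'(2) c2_mem[OF i'(2)]]]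
        by (rule Gp_inv_eqI) (use that(3,4) \<mu>_pos[OF i'(2)] in \<open>simp_all add: eq_divide_eq mult.commute\<close>)
      ultimately show ?thesis
        using S interval_integral_reflect[of "ereal a" "ereal (- x_plus i)" ?\<rho>1]
          interval_integral_reflect[of "ereal b" "ereal (- x_plus i)" ?\<rho>2] by (simp add: S_IV_I_def)
    qed
    show "- x_plus i = max (- xp i (c1 i)) (- xp (Suc i) (c1 (Suc i)))" by (simp add: x_plus_def minus_min_eq_max)
  qed (use p in \<open>auto simp: axis_path_def F_eq intro!: continuous_intros\<close>)
  have y2: "- y2 r \<in> {ym..yp}" if "r \<in> {0..1}" for r
    using o(6)[OF that] xm_neg[OF i'(2), of "C r"] by (intro orbit_y[OF i'(2), of "C r" "- x2 r"]) (auto simp: F_eq)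
  show ?thesis unfolding stretched_def
  proof (rule exI[of _ "\<lambda>r. - x2 r"], rule exI[of _ "\<lambda>r. - y2 r"], rule exI[of _ C], intro conjI ballI)
    fix r :: real assume r: "r \<in> {0..1}"
    obtain u where u: "u \<in> {0..1}" "gp.reaches (t (Suc i) - s i) (- xs u, - ys u) (x2 r, y2 r) 0 1" using o(7)[OF r] by blast
    have "ys u \<in> {ym..yp}" using p u(1) by (auto simp: axis_path_def)
    then have "gap_sol i (xs u, ys u) (- x2 r, - y2 r) 0 1"
      using gap_sol_of_reaches_rotated[OF i, of "xs u" "ys u" "- x2 r" "- y2 r"] u(2) y2[OF r] by simp
    then show "\<exists>u\<in>{0..1}. gap_sol i (xs u, ys u) (- x2 r, - y2 r) 0 1" using u(1) by blast
    show "C r \<in> {c1 (Suc i)..c2 (Suc i)}" "- x2 r \<in> {xm (Suc i) (C r)..xp (Suc i) (C r)}"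
      "Hb (- y2 r) + F (Suc i) (- x2 r) = C r" "0 \<le> xsign QI * (- x2 r)" "0 \<le> ysign QI * (- y2 r)"
      using o(6)[OF r] xm_neg[OF i'(2), of "C r"] by (auto simp: F_eq)
  qed (use o in \<open>auto intro!: continuous_intros\<close>)
qed

end

section \<open>Chains of connecting paths\<close>

text \<open>Consecutive pieces share a node, at which they have to agree; the step gives the last
  node to the later piece.\<close>

lemma glue_pieces:
  fixes b :: "nat \<Rightarrow> real" and u :: "nat \<Rightarrow> real \<Rightarrow> 'a"
  assumes "\<And>k. k < n \<Longrightarrow> b k < b (Suc k)" "\<And>k. Suc k < n \<Longrightarrow> u k (b (Suc k)) = u (Suc k) (b (Suc k))"
  shows "\<exists>z. \<forall>k<n. \<forall>\<tau>\<in>{b k..b (Suc k)}. z \<tau> = u k \<tau>"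
  using assms
proof (induction n)
  case 0 then show ?case by simp
next
  case (Suc n)
  have "\<exists>z. \<forall>k<n. \<forall>\<tau>\<in>{b k..b (Suc k)}. z \<tau> = u k \<tau>"
    by (rule Suc.IH) (simp_all add: Suc.prems)
  then obtain z where z: "\<And>k \<tau>. k < n \<Longrightarrow> \<tau> \<in> {b k..b (Suc k)} \<Longrightarrow> z \<tau> = u k \<tau>" by blast
  have le: "b k \<le> b n" if "k \<le> n" for k
    using that
  proof (induction rule: dec_induct)
    case (step j)
    then show ?case using Suc.prems(1)[of j] by simp
  qed simp
  define w where "w \<tau> = (if \<tau> < b n then z \<tau> else u n \<tau>)" for \<tau>
  have "w \<tau> = u k \<tau>" if k: "k < Suc n" and \<tau>: "\<tau> \<in> {b k..b (Suc k)}" for k \<tau>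
  proof (cases "k = n")
    case True then show ?thesis using \<tau> by (simp add: w_def)
  next
    case False
    then have kn: "k < n" "Suc k \<le> n" using k by auto
    show ?thesis
    proof (cases "\<tau> < b n")
      case True then show ?thesis using z[OF kn(1) \<tau>] by (simp add: w_def)
    next
      case False
      have "Suc k = n"
      proof (rule ccontr)
        assume "Suc k \<noteq> n"
        then have "Suc (Suc k) \<le> n" using kn by simp
        then have "b (Suc k) < b n" using Suc.prems(1)[of "Suc k"] le[of "Suc (Suc k)"] by simp
        then show False using False \<tau> by simp
      qed
      then have "\<tau> = b (Suc k)" using False \<tau> by simp
      then show ?thesis using Suc.prems(2)[of k] \<open>Suc k = n\<close> by (simp add: w_def)
    qed
  qed
  then show ?case by blast
qed

lemma piecewise_sol_glue:
  fixes b :: "nat \<Rightarrow> real"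
  assumes "0 < n" "\<And>k. k < n \<Longrightarrow> piecewise_sol h w (b k) (b (Suc k)) x y"
  shows "piecewise_sol h w (b 0) (b n) x y"
  using assms
proof (induction n rule: nat_induct_non_zero)
  case (Suc n)
  have "piecewise_sol h w (b 0) (b n) x y" by (rule Suc.IH) (simp add: Suc.prems)
  then show ?case by (rule piecewise_sol_join) (simp add: Suc.prems)
qed simp

lemma partition_cover:
  fixes b :: "nat \<Rightarrow> real"
  assumes "0 < n" "\<tau> \<in> {b 0..b n}"
  shows "\<exists>k<n. \<tau> \<in> {b k..b (Suc k)}"
  using assms
proof (induction n rule: nat_induct_non_zero)
  case (Suc n)
  show ?case
  proof (cases "\<tau> \<le> b n")
    case True
    then have "\<exists>k<n. \<tau> \<in> {b k..b (Suc k)}" using Suc.prems by (intro Suc.IH) simp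
    then show ?thesis using less_SucI by blast
  next
    case False
    then show ?thesis using Suc.prems by (intro exI[of _ n]) simp
  qed
qed auto

lemma has_exactly_zeros_unique: "has_exactly_zeros u A n \<Longrightarrow> has_exactly_zeros u A n' \<Longrightarrow> n = n'"
  by (simp add: has_exactly_zeros_def)

text \<open>The Fashoda theorem in the rectangle with the angle as first coordinate and the level as
  second: one path joins the vertical sides, the other the horizontal ones.\<close>

lemma rectangle_paths_meet:
  fixes C V C' V' :: "real \<Rightarrow> real"
  assumes c: "continuous_on {0..1} C" "continuous_on {0..1} V" "continuous_on {0..1} C'" "continuous_on {0..1} V'"
    and r: "C ` {0..1} \<subseteq> {c1..c2}" "V ` {0..1} \<subseteq> {0..1}" "C' ` {0..1} \<subseteq> {c1..c2}" "V' ` {0..1} \<subseteq> {0..1}"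
    and e: "V 0 = 0" "V 1 = 1" "C' 0 = c1" "C' 1 = c2"
  obtains a b where "a \<in> {0..1}" "b \<in> {0..1}" "C a = C' b" "V a = V' b"
proof -
  define f where "f a = (\<chi> i. if i = 1 then V a else C a :: real^2)" for a
  define g where "g b = (\<chi> i. if i = 1 then V' b else C' b :: real^2)" for b
  let ?a = "\<chi> i. if i = 1 then 0 else c1 :: real^2" and ?b = "\<chi> i. if i = 1 then 1 else c2 :: real^2"
  have "continuous_on {0..1} f" unfolding f_def
  proof (rule continuous_on_vec_lambda)
    show "continuous_on {0..1} (\<lambda>a. if i = 1 then V a else C a)" for i :: 2 using c by (cases "i = 1") auto
  qed
  then have pf: "path f" by (simp add: path_def)
  have "continuous_on {0..1} g" unfolding g_def
  proof (rule continuous_on_vec_lambda)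
    show "continuous_on {0..1} (\<lambda>a. if i = 1 then V' a else C' a)" for i :: 2 using c by (cases "i = 1") auto
  qed
  then have pg: "path g" by (simp add: path_def)
  have n21: "(2::2) \<noteq> 1" by simp
  obtain z where z: "z \<in> path_image f" "z \<in> path_image g"
  proof (rule fashoda[OF pf pg, of ?a ?b])
    show "path_image f \<subseteq> cbox ?a ?b"
      using r(1,2) by (auto simp: path_image_def f_def mem_box_cart forall_2 image_subset_iff)
    show "path_image g \<subseteq> cbox ?a ?b"
      using r(3,4) by (auto simp: path_image_def g_def mem_box_cart forall_2 image_subset_iff)
  qed (use e n21 in \<open>auto simp: pathstart_def pathfinish_def f_def g_def\<close>)
  obtain a b where ab: "a \<in> {0..1}" "b \<in> {0..1}" "f a = g b" using z by (auto simp: path_image_def)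
  have "f a $ 1 = g b $ 1" "f a $ 2 = g b $ 2" using ab(3) by simp_all
  then have "V a = V' b" "C a = C' b" by (simp_all add: f_def g_def)
  then show ?thesis using that ab(1,2) by blast
qed

section \<open>Paths of states with an admissible past\<close>

context clamped_system begin

text \<open>R is any set that contains the states of such a path. Taking for R the states with a
  given kind of past lets the induction carry a path forward together with the fact that each of its
  points is the end of an orbit.\<close>

definition radial_path :: "nat \<Rightarrow> quadrant \<Rightarrow> (real \<times> real) set \<Rightarrow> bool" where
  "radial_path i q R \<longleftrightarrow> (\<exists>C V :: real \<Rightarrow> real. continuous_on {0..1} C \<and> C ` {0..1} \<subseteq> {c1 i..c2 i} \<and>
     continuous_on {0..1} V \<and> V ` {0..1} \<subseteq> {0..1} \<and> C 0 = c1 i \<and> C 1 = c2 i \<and> (\<forall>r\<in>{0..1}. P i q (C r) (V r) \<in> R))"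

definition angular_path :: "nat \<Rightarrow> quadrant \<Rightarrow> (real \<times> real) set \<Rightarrow> bool" where
  "angular_path i q R \<longleftrightarrow> (\<exists>C V :: real \<Rightarrow> real. continuous_on {0..1} C \<and> C ` {0..1} \<subseteq> {c1 i..c2 i} \<and>
     continuous_on {0..1} V \<and> V ` {0..1} \<subseteq> {0..1} \<and> V 0 = 0 \<and> V 1 = 1 \<and> (\<forall>r\<in>{0..1}. P i q (C r) (V r) \<in> R))"

definition twist_sol :: "nat \<Rightarrow> real \<times> real \<Rightarrow> real \<times> real \<Rightarrow> nat \<Rightarrow> nat \<Rightarrow> bool" where
  "twist_sol i = annulus_flow.crosses hb Hb (field i) (F i) (c1 i) (c2 i) (xm i) (xp i) (s i - t i)"

lemma twist_path:
  assumes i: "i \<le> m" and \<kappa>: "\<kappa> \<in> {QI, QIII}" and q: "q \<in> {QII, QIV}"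
    and de: "d \<in> {c1 i, c2 i}" "e \<in> {c1 i, c2 i}" "d \<noteq> e" and j: "1 \<le> j" "j \<le> \<beta> - \<alpha>"
    and slow: "quadrant_time i (qsucc \<kappa>) d + quadrant_time i (qsucc (qsucc \<kappa>)) d + real \<alpha> * period i d > s i - t i"
    and fast: "quadrant_time i \<kappa> e + quadrant_time i (qsucc \<kappa>) e + real \<beta> * period i e < s i - t i"
    and R: "radial_path i \<kappa> R"
  shows "angular_path i q {Z. \<exists>Y\<in>R. twist_sol i Y Z
       (if q = qsucc \<kappa> then 2 * (\<alpha> + j) else 2 * (\<alpha> + j) - 1) (if q = qsucc \<kappa> then 2 * (\<alpha> + j) + 1 else 2 * (\<alpha> + j))}"
proof -
  interpret A: annulus_flow hb Hb "field i" "F i" "c1 i" "c2 i" "xm i" "xp i" by (rule flow[OF i])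
  obtain T where T: "\<And>q. A.arc_time q (T q)" using A.arc_time_exists by metis
  have qt: "quadrant_time i p c = T p c 1" if "c \<in> {c1 i..c2 i}" for p c by (rule quadrant_time_eq[OF i T that])
  have dc: "d \<in> {c1 i..c2 i}" "e \<in> {c1 i..c2 i}" using de c1_less_c2[OF i] by auto
  have pe: "period i c = A.per T c" if "c \<in> {c1 i..c2 i}" for c
    by (simp add: period_def A.per_def qt[OF that] del: quadrant_time.simps)
  obtain C V :: "real \<Rightarrow> real" where CV: "continuous_on {0..1} C" "C ` {0..1} \<subseteq> {c1 i..c2 i}" "continuous_on {0..1} V"
    "V ` {0..1} \<subseteq> {0..1}" "C 0 = c1 i" "C 1 = c2 i" "\<And>r. r \<in> {0..1} \<Longrightarrow> P i \<kappa> (C r) (V r) \<in> R"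
    using R unfolding radial_path_def by blast
  let ?nx = "if q = qsucc \<kappa> then 2 * (\<alpha> + j) else 2 * (\<alpha> + j) - 1"
  let ?ny = "if q = qsucc \<kappa> then 2 * (\<alpha> + j) + 1 else 2 * (\<alpha> + j)"
  obtain C' V' :: "real \<Rightarrow> real" where o: "continuous_on {0..1} C'" "C' ` {0..1} \<subseteq> {c1 i..c2 i}"
    "continuous_on {0..1} V'" "V' ` {0..1} \<subseteq> {0..1}" "V' 0 = 0" "V' 1 = 1"
    "\<And>r. r \<in> {0..1} \<Longrightarrow> \<exists>u\<in>{0..1}. A.crosses (s i - t i) (P i \<kappa> (C u) (V u)) (P i q (C' r) (V' r)) ?nx ?ny"
  proof (rule A.twist[OF T \<kappa> q _ de j _ _ CV(1,2,5,6,3,4)])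
    show "0 < s i - t i" using t_less_s[OF i] by simp
    show "s i - t i < T (qsucc \<kappa>) d 1 + T (qsucc (qsucc \<kappa>)) d 1 + real \<alpha> * A.per T d"
      using slow by (simp add: qt[OF dc(1)] pe[OF dc(1)] del: quadrant_time.simps)
    show "T \<kappa> e 1 + T (qsucc \<kappa>) e 1 + real \<beta> * A.per T e < s i - t i"
      using fast by (simp add: qt[OF dc(2)] pe[OF dc(2)] del: quadrant_time.simps)
  qed (rule that; assumption)
  show ?thesis unfolding angular_path_def
  proof (rule exI[of _ C'], rule exI[of _ V'], intro conjI ballI o(1-6))
    fix r :: real assume "r \<in> {0..1}"
    from o(7)[OF this] show "P i q (C' r) (V' r) \<in> {Z. \<exists>Y\<in>R. twist_sol i Y Z ?nx ?ny}"
      using CV(7) unfolding twist_sol_def by blast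
  qed
qed

lemma gap_path:
  assumes i: "i < m" and q: "q \<in> {QII, QIV}" and \<kappa>: "\<kappa> \<in> {QI, QIII}"
    and S: "S_II_I i \<le> t (Suc i) - s i" "S_IV_III i \<le> t (Suc i) - s i" "S_IV_I i \<le> t (Suc i) - s i" "S_II_III i \<le> t (Suc i) - s i"
    and R: "angular_path i q R"
  shows "radial_path (Suc i) \<kappa> {Z. \<exists>Y\<in>R. gap_sol i Y Z
       (if (q, \<kappa>) \<in> {(QII, QI), (QIV, QIII)} then 1 else 0) (if (q, \<kappa>) \<in> {(QII, QI), (QIV, QIII)} then 0 else 1)}"
proof -
  have i': "i \<le> m" "Suc i \<le> m" using i by auto
  interpret A: annulus_flow hb Hb "field i" "F i" "c1 i" "c2 i" "xm i" "xp i" by (rule flow[OF i'(1)])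
  obtain C V :: "real \<Rightarrow> real" where CV: "continuous_on {0..1} C" "C ` {0..1} \<subseteq> {c1 i..c2 i}" "continuous_on {0..1} V"
    "V ` {0..1} \<subseteq> {0..1}" "V 0 = 0" "V 1 = 1" "\<And>r. r \<in> {0..1} \<Longrightarrow> P i q (C r) (V r) \<in> R"
    using R unfolding angular_path_def by blast
  define xs ys where "xs r = fst (P i q (C r) (V r))" and "ys r = snd (P i q (C r) (V r))" for r
  have cP: "continuous_on {0..1} (\<lambda>r. P i q (C r) (V r))" by (rule A.continuous_on_pos[OF CV(1,3,2,4)])
  have rng: "C r \<in> {c1 i..c2 i}" "V r \<in> {0..1}" if "r \<in> {0..1}" for r using CV(2,4) that by blast+
  have par: "A.param q v = 1 - v" for v using q by (auto simp: A.param_def)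
  have st: "Hb (ys r) + F i (xs r) = C r" "xs r \<in> {xm i (C r)..xp i (C r)}" "0 \<le> xsign q * xs r" "0 \<le> ysign q * ys r"
    if "r \<in> {0..1}" for r
    using A.pos_state(1-4)[OF rng[OF that], of q] by (auto simp: xs_def ys_def)
  have ax: "axis_path i q xs ys"
    unfolding axis_path_def
  proof (intro conjI ballI)
    show "continuous_on {0..1} xs" "continuous_on {0..1} ys"
      unfolding xs_def ys_def using cP by (auto intro!: continuous_intros)
    show "ys 0 = 0" using A.pos_state(6)[OF rng[of 0], of q] CV(5) par by (simp add: ys_def)
    show "xs 1 = 0" using A.pos_state(5)[OF rng[of 1], of q] CV(6) par by (simp add: xs_def)
    fix r :: real assume r: "r \<in> {0..1}"
    show "Hb (ys r) + F i (xs r) \<in> {c1 i..c2 i}" using st(1)[OF r] rng(1)[OF r] by simp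
    show "ys r \<in> {ym..yp}" using orbit_y[OF i'(1) rng(1)[OF r] st(2,1)[OF r]] .
  qed (use st in auto)
  let ?nx = "if (q, \<kappa>) \<in> {(QII, QI), (QIV, QIII)} then 1 else 0 :: nat"
  let ?ny = "if (q, \<kappa>) \<in> {(QII, QI), (QIV, QIII)} then 0 else 1 :: nat"
  have "stretched i \<kappa> xs ys ?nx ?ny"
    using q \<kappa> ax stretched_QII_QI[OF i _ S(1), of xs ys] stretched_QIV_QIII[OF i _ S(2), of xs ys]
      stretched_QIV_QI[OF i _ S(3), of xs ys] stretched_QII_QIII[OF i _ S(4), of xs ys] by auto
  then obtain x2 y2 C2 :: "real \<Rightarrow> real" where o: "continuous_on {0..1} x2" "continuous_on {0..1} C2"
     "C2 0 = c1 (Suc i)" "C2 1 = c2 (Suc i)"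
     "\<And>r. r \<in> {0..1} \<Longrightarrow> C2 r \<in> {c1 (Suc i)..c2 (Suc i)} \<and> x2 r \<in> {xm (Suc i) (C2 r)..xp (Suc i) (C2 r)} \<and>
        Hb (y2 r) + F (Suc i) (x2 r) = C2 r \<and> 0 \<le> xsign \<kappa> * x2 r \<and> 0 \<le> ysign \<kappa> * y2 r"
     "\<And>r. r \<in> {0..1} \<Longrightarrow> \<exists>u\<in>{0..1}. gap_sol i (xs u, ys u) (x2 r, y2 r) ?nx ?ny"
    unfolding stretched_def by blast
  obtain V2 where V2: "continuous_on {0..1} V2" "V2 ` {0..1} \<subseteq> {0..1}"
    "\<And>r. r \<in> {0..1} \<Longrightarrow> P (Suc i) \<kappa> (C2 r) (V2 r) = (x2 r, y2 r)"
    using coordinates[OF i'(2) o(1,2), of y2 \<kappa>] o(5) by blast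
  show ?thesis unfolding radial_path_def
  proof (rule exI[of _ C2], rule exI[of _ V2], intro conjI ballI o(2-4) V2(1,2))
    show "C2 ` {0..1} \<subseteq> {c1 (Suc i)..c2 (Suc i)}" using o(5) by blast
    fix r :: real assume r: "r \<in> {0..1}"
    obtain u where u: "u \<in> {0..1}" "gap_sol i (xs u, ys u) (x2 r, y2 r) ?nx ?ny" using o(6)[OF r] by blast
    have "(xs u, ys u) \<in> R" using CV(7)[OF u(1)] by (simp add: xs_def ys_def)
    then show "P (Suc i) \<kappa> (C2 r) (V2 r) \<in> {Z. \<exists>Y\<in>R. gap_sol i Y Z ?nx ?ny}" using u(2) V2(3)[OF r] by auto
  qed
qed

lemma radial_path_Int:
  assumes i: "i \<le> m" and R: "radial_path i q R" shows "radial_path i q (R \<inter> annulus_quadrant i q)"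
proof -
  obtain C V :: "real \<Rightarrow> real" where o: "continuous_on {0..1} C" "C ` {0..1} \<subseteq> {c1 i..c2 i}" "continuous_on {0..1} V"
    "V ` {0..1} \<subseteq> {0..1}" "C 0 = c1 i" "C 1 = c2 i" "\<And>r. r \<in> {0..1} \<Longrightarrow> P i q (C r) (V r) \<in> R"
    using R unfolding radial_path_def by blast
  have "P i q (C r) (V r) \<in> R \<inter> annulus_quadrant i q" if "r \<in> {0..1}" for r
  proof (rule IntI[OF o(7)[OF that] P_mem[OF i]])
    show "C r \<in> {c1 i..c2 i}" "V r \<in> {0..1}" using o(2,4) that by blast+
  qed
  then show ?thesis unfolding radial_path_def
    by (rule_tac exI[of _ C], rule_tac exI[of _ V]) (use o(1-6) in simp)
qed

lemma angular_path_Int: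
  assumes i: "i \<le> m" and R: "angular_path i q R" shows "angular_path i q (R \<inter> annulus_quadrant i q)"
proof -
  obtain C V :: "real \<Rightarrow> real" where o: "continuous_on {0..1} C" "C ` {0..1} \<subseteq> {c1 i..c2 i}" "continuous_on {0..1} V"
    "V ` {0..1} \<subseteq> {0..1}" "V 0 = 0" "V 1 = 1" "\<And>r. r \<in> {0..1} \<Longrightarrow> P i q (C r) (V r) \<in> R"
    using R unfolding angular_path_def by blast
  have "P i q (C r) (V r) \<in> R \<inter> annulus_quadrant i q" if "r \<in> {0..1}" for r
  proof (rule IntI[OF o(7)[OF that] P_mem[OF i]])
    show "C r \<in> {c1 i..c2 i}" "V r \<in> {0..1}" using o(2,4) that by blast+
  qed
  then show ?thesis unfolding angular_path_def
    by (rule_tac exI[of _ C], rule_tac exI[of _ V]) (use o(1-6) in simp)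
qed

lemma radial_path_of_arc:
  "i \<le> m \<Longrightarrow> connecting_arc i r \<Longrightarrow> r \<subseteq> annulus_quadrant i q \<Longrightarrow> radial_path i q r"
  unfolding radial_path_def by (erule (2) arc_coordinates) blast

lemma angular_radial_meet:
  assumes "angular_path i q R" "radial_path i q R'" shows "R \<inter> R' \<noteq> {}"
proof -
  obtain C V :: "real \<Rightarrow> real" where 1: "continuous_on {0..1} C" "C ` {0..1} \<subseteq> {c1 i..c2 i}" "continuous_on {0..1} V"
    "V ` {0..1} \<subseteq> {0..1}" "V 0 = 0" "V 1 = 1" "\<And>r. r \<in> {0..1} \<Longrightarrow> P i q (C r) (V r) \<in> R"
    using assms(1) unfolding angular_path_def by blast
  obtain C' V' :: "real \<Rightarrow> real" where 2: "continuous_on {0..1} C'" "C' ` {0..1} \<subseteq> {c1 i..c2 i}" "continuous_on {0..1} V'"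
    "V' ` {0..1} \<subseteq> {0..1}" "C' 0 = c1 i" "C' 1 = c2 i" "\<And>r. r \<in> {0..1} \<Longrightarrow> P i q (C' r) (V' r) \<in> R'"
    using assms(2) unfolding radial_path_def by blast
  obtain a b where "a \<in> {0..1}" "b \<in> {0..1}" "C a = C' b" "V a = V' b"
    by (rule rectangle_paths_meet[OF 1(1,3) 2(1,3) 1(2,4) 2(2,4) 1(5,6) 2(5,6)])
  then show ?thesis using 1(7)[of a] 2(7)[of b] by auto
qed

text \<open>The last annulus is not a special case here: \<open>q m\<close> is the quadrant of the
  target arc. \<open>n i\<close> stands for \<open>\<alpha> i + j i\<close>.\<close>

definition itinerary :: "(nat \<Rightarrow> quadrant) \<Rightarrow> (nat \<Rightarrow> quadrant) \<Rightarrow> (nat \<Rightarrow> nat) \<Rightarrow> (real \<Rightarrow> real) \<Rightarrow> (real \<Rightarrow> real) \<Rightarrow> bool" where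
  "itinerary \<kappa> q n x y \<longleftrightarrow>
     (\<forall>i\<le>m. (x (t i), y (t i)) \<in> annulus_quadrant i (\<kappa> i) \<and> (x (s i), y (s i)) \<in> annulus_quadrant i (q i) \<and>
        has_exactly_zeros x {t i<..<s i} (if q i = qsucc (\<kappa> i) then 2 * n i else 2 * n i - 1) \<and>
        has_exactly_zeros y {t i..s i} (if q i = qsucc (\<kappa> i) then 2 * n i + 1 else 2 * n i)) \<and>
     (\<forall>i<m. has_exactly_zeros x {s i..t (Suc i)} (if (q i, \<kappa> (Suc i)) \<in> {(QII, QI), (QIV, QIII)} then 1 else 0) \<and>
        has_exactly_zeros y {s i..t (Suc i)} (if (q i, \<kappa> (Suc i)) \<in> {(QII, QI), (QIV, QIII)} then 0 else 1))"

text \<open>No state can be chosen before the last interval, since the targets are met only there.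
  What is carried forward is a set of states containing a path across the current quadrant; once the
  last path meets \<open>rL\<close>, the chain is read off backwards from that point.\<close>

lemma chain_exists:
  fixes \<kappa> q :: "nat \<Rightarrow> quadrant" and d e :: "nat \<Rightarrow> real" and \<alpha> \<beta> j :: "nat \<Rightarrow> nat"
  assumes r0: "radial_path 0 (\<kappa> 0) r0" and rL: "radial_path m (q m) rL"
    and \<kappa>: "\<And>i. i \<le> m \<Longrightarrow> \<kappa> i \<in> {QI, QIII}" and q: "\<And>i. i \<le> m \<Longrightarrow> q i \<in> {QII, QIV}"
    and de: "\<And>i. i \<le> m \<Longrightarrow> d i \<in> {c1 i, c2 i} \<and> e i \<in> {c1 i, c2 i} \<and> d i \<noteq> e i"
    and j: "\<And>i. i \<le> m \<Longrightarrow> 1 \<le> j i \<and> j i \<le> \<beta> i - \<alpha> i"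
    and tw: "\<And>i p. i \<le> m \<Longrightarrow> p \<in> {QI, QIII} \<Longrightarrow>
       quadrant_time i (qsucc p) (d i) + quadrant_time i (qsucc (qsucc p)) (d i) + real (\<alpha> i) * period i (d i) > s i - t i \<and>
       quadrant_time i p (e i) + quadrant_time i (qsucc p) (e i) + real (\<beta> i) * period i (e i) < s i - t i"
    and S: "\<And>i. i < m \<Longrightarrow> S_II_I i \<le> t (Suc i) - s i \<and> S_IV_III i \<le> t (Suc i) - s i \<and>
       S_IV_I i \<le> t (Suc i) - s i \<and> S_II_III i \<le> t (Suc i) - s i"
  obtains A B where "A 0 \<in> r0" "B m \<in> rL"
    "\<And>i. i \<le> m \<Longrightarrow> A i \<in> annulus_quadrant i (\<kappa> i) \<and> B i \<in> annulus_quadrant i (q i) \<and>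
       twist_sol i (A i) (B i) (if q i = qsucc (\<kappa> i) then 2 * (\<alpha> i + j i) else 2 * (\<alpha> i + j i) - 1)
         (if q i = qsucc (\<kappa> i) then 2 * (\<alpha> i + j i) + 1 else 2 * (\<alpha> i + j i))"
    "\<And>i. i < m \<Longrightarrow> gap_sol i (B i) (A (Suc i)) (if (q i, \<kappa> (Suc i)) \<in> {(QII, QI), (QIV, QIII)} then 1 else 0)
         (if (q i, \<kappa> (Suc i)) \<in> {(QII, QI), (QIV, QIII)} then 0 else 1)"
proof -
  define tws where "tws i Y Z \<longleftrightarrow> twist_sol i Y Z (if q i = qsucc (\<kappa> i) then 2 * (\<alpha> i + j i) else 2 * (\<alpha> i + j i) - 1)
         (if q i = qsucc (\<kappa> i) then 2 * (\<alpha> i + j i) + 1 else 2 * (\<alpha> i + j i))" for i Y Z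
  define gps where "gps i Y Z \<longleftrightarrow> gap_sol i Y Z (if (q i, \<kappa> (Suc i)) \<in> {(QII, QI), (QIV, QIII)} then 1 else 0)
         (if (q i, \<kappa> (Suc i)) \<in> {(QII, QI), (QIV, QIII)} then 0 else 1)" for i Y Z
  \<comment> \<open>\<open>R i\<close> is the set of states at time \<open>t i\<close> that are
    reachable from \<open>r0\<close> by orbits with the prescribed quadrants and zero counts, and
    \<open>R' i\<close> the same at time \<open>s i\<close>.\<close>
  define R where "R = rec_nat (r0 \<inter> annulus_quadrant 0 (\<kappa> 0))
     (\<lambda>i X. {Z. \<exists>Y\<in>{Z. \<exists>Y\<in>X. tws i Y Z} \<inter> annulus_quadrant i (q i). gps i Y Z} \<inter> annulus_quadrant (Suc i) (\<kappa> (Suc i)))"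
  define R' where "R' i = {Z. \<exists>Y\<in>R i. tws i Y Z} \<inter> annulus_quadrant i (q i)" for i
  have R0: "R 0 = r0 \<inter> annulus_quadrant 0 (\<kappa> 0)" by (simp add: R_def)
  have RS: "R (Suc i) = {Z. \<exists>Y\<in>R' i. gps i Y Z} \<inter> annulus_quadrant (Suc i) (\<kappa> (Suc i))" for i
    by (simp add: R_def R'_def)
  have step: "angular_path i (q i) (R' i)" if "i \<le> m" "radial_path i (\<kappa> i) (R i)" for i
    unfolding R'_def tws_def
    by (intro angular_path_Int twist_path[where d = "d i" and e = "e i"]) (use that \<kappa> q de j tw in auto)
  have rad: "i \<le> m \<Longrightarrow> radial_path i (\<kappa> i) (R i)" for i
  proof (induction i)
    case 0 then show ?case unfolding R0 by (intro radial_path_Int r0) auto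
  next
    case (Suc i)
    then have "angular_path i (q i) (R' i)" by (intro step) auto
    then show ?case unfolding RS gps_def
      by (intro radial_path_Int gap_path) (use Suc \<kappa> q S in auto)
  qed
  \<comment> \<open>Unrolls the recursion: membership in \<open>R i\<close> is turned into the list
    of intermediate states.\<close>
  have hist: "i \<le> m \<Longrightarrow> Z \<in> R i \<Longrightarrow> \<exists>A B. A 0 \<in> r0 \<and> A i = Z \<and> (\<forall>k\<le>i. A k \<in> annulus_quadrant k (\<kappa> k)) \<and>
     (\<forall>k<i. B k \<in> annulus_quadrant k (q k) \<and> tws k (A k) (B k) \<and> gps k (B k) (A (Suc k)))" for i Z
  proof (induction i arbitrary: Z)
    case 0 then show ?case by (intro exI[of _ "\<lambda>_. Z"]) (auto simp: R0)
  next
    case (Suc i)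
    obtain Y where Y: "Y \<in> R' i" "gps i Y Z" "Z \<in> annulus_quadrant (Suc i) (\<kappa> (Suc i))" using Suc.prems RS by auto
    obtain W where W: "W \<in> R i" "tws i W Y" "Y \<in> annulus_quadrant i (q i)" using Y(1) by (auto simp: R'_def)
    obtain A B where AB: "A 0 \<in> r0" "A i = W" "\<forall>k\<le>i. A k \<in> annulus_quadrant k (\<kappa> k)"
     "\<forall>k<i. B k \<in> annulus_quadrant k (q k) \<and> tws k (A k) (B k) \<and> gps k (B k) (A (Suc k))"
      using Suc.IH[of W] Suc.prems W(1) by auto
    show ?case
      by (rule exI[of _ "A(Suc i := Z)"], rule exI[of _ "B(i := Y)"])
         (use AB W Y in \<open>auto simp: less_Suc_eq le_Suc_eq\<close>)
  qed
  obtain Z where Z: "Z \<in> R' m" "Z \<in> rL" using angular_radial_meet[OF step[OF order_refl rad[OF order_refl]] rL] by auto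
  obtain W where W: "W \<in> R m" "tws m W Z" "Z \<in> annulus_quadrant m (q m)" using Z(1) by (auto simp: R'_def)
  obtain A B where AB: "A 0 \<in> r0" "A m = W" "\<forall>k\<le>m. A k \<in> annulus_quadrant k (\<kappa> k)"
     "\<forall>k<m. B k \<in> annulus_quadrant k (q k) \<and> tws k (A k) (B k) \<and> gps k (B k) (A (Suc k))"
    using hist[OF order_refl W(1)] by blast
  show ?thesis
  proof (rule that[of A "B(m := Z)"])
    show "A i \<in> annulus_quadrant i (\<kappa> i) \<and> (B(m := Z)) i \<in> annulus_quadrant i (q i) \<and>
       twist_sol i (A i) ((B(m := Z)) i) (if q i = qsucc (\<kappa> i) then 2 * (\<alpha> i + j i) else 2 * (\<alpha> i + j i) - 1)
         (if q i = qsucc (\<kappa> i) then 2 * (\<alpha> i + j i) + 1 else 2 * (\<alpha> i + j i))" if "i \<le> m" for i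
      using AB W that unfolding tws_def[symmetric] by (cases "i = m") auto
    show "gap_sol i ((B(m := Z)) i) (A (Suc i)) (if (q i, \<kappa> (Suc i)) \<in> {(QII, QI), (QIV, QIII)} then 1 else 0)
         (if (q i, \<kappa> (Suc i)) \<in> {(QII, QI), (QIV, QIII)} then 0 else 1)" if "i < m" for i
      using AB(4) that unfolding gps_def[symmetric] by auto
  qed (use AB(1) Z(2) in auto)
qed

text \<open>Twist and gap pieces, shifted to their time intervals, agree at the nodes because
  consecutive pieces share the state \<open>A i\<close> or \<open>B i\<close>; the zero counts are
  inherited interval by interval.\<close>

lemma solution_of_chain:
  fixes \<kappa> q :: "nat \<Rightarrow> quadrant" and n :: "nat \<Rightarrow> nat"
  assumes A0: "A 0 \<in> r0" and Bm: "B m \<in> rL"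
    and tw: "\<And>i. i \<le> m \<Longrightarrow> A i \<in> annulus_quadrant i (\<kappa> i) \<and> B i \<in> annulus_quadrant i (q i) \<and>
       twist_sol i (A i) (B i) (if q i = qsucc (\<kappa> i) then 2 * n i else 2 * n i - 1)
         (if q i = qsucc (\<kappa> i) then 2 * n i + 1 else 2 * n i)"
    and gp: "\<And>i. i < m \<Longrightarrow> gap_sol i (B i) (A (Suc i)) (if (q i, \<kappa> (Suc i)) \<in> {(QII, QI), (QIV, QIII)} then 1 else 0)
         (if (q i, \<kappa> (Suc i)) \<in> {(QII, QI), (QIV, QIII)} then 0 else 1)"
  shows "\<exists>(x, y)\<in>bvp_solutions r0 rL. itinerary \<kappa> q n x y"
proof -
  define nx ny where "nx i = (if q i = qsucc (\<kappa> i) then 2 * n i else 2 * n i - 1)"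
    and "ny i = (if q i = qsucc (\<kappa> i) then 2 * n i + 1 else 2 * n i)" for i
  define gx gy where "gx i = (if (q i, \<kappa> (Suc i)) \<in> {(QII, QI), (QIV, QIII)} then 1 else 0 :: nat)"
    and "gy i = (if (q i, \<kappa> (Suc i)) \<in> {(QII, QI), (QIV, QIII)} then 0 else 1 :: nat)" for i
  define w where "w \<tau> z = - lam * z - a \<tau> * g z" for \<tau> z
  have twist_piece: "\<exists>x y. piecewise_sol hb w (t i) (s i) x y \<and> (x (t i), y (t i)) = A i \<and> (x (s i), y (s i)) = B i \<and>
     (\<forall>\<tau>\<in>{t i..s i}. y \<tau> \<in> {ym..yp}) \<and> has_exactly_zeros x {t i<..<s i} (nx i) \<and> has_exactly_zeros y {t i..s i} (ny i)"
    if i: "i \<le> m" for i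
  proof -
    interpret AF: annulus_flow hb Hb "field i" "F i" "c1 i" "c2 i" "xm i" "xp i" by (rule flow[OF i])
    obtain x y where xy: "piecewise_sol hb (\<lambda>_ x. - field i x) 0 (s i - t i) x y" "(x 0, y 0) = A i"
      "(x (s i - t i), y (s i - t i)) = B i"
      "\<forall>\<tau>\<in>{0..s i - t i}. \<exists>c\<in>{c1 i..c2 i}. Hb (y \<tau>) + F i (x \<tau>) = c \<and> x \<tau> \<in> {xm i c..xp i c}"
      "has_exactly_zeros x {0<..<s i - t i} (nx i)" "has_exactly_zeros y {0..s i - t i} (ny i)"
      using tw[OF i] unfolding twist_sol_def AF.crosses_def nx_def[symmetric] ny_def[symmetric] by blast
    have 1: "piecewise_sol hb (\<lambda>\<tau>. (\<lambda>_ x. - field i x) (\<tau> - t i)) (t i) (s i) (\<lambda>\<tau>. x (\<tau> - t i)) (\<lambda>\<tau>. y (\<tau> - t i))"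
      using piecewise_sol_shift[OF xy(1), of "t i"] by simp
    have 2: "piecewise_sol hb w (t i) (s i) (\<lambda>\<tau>. x (\<tau> - t i)) (\<lambda>\<tau>. y (\<tau> - t i))"
    proof (rule piecewise_sol_cong[OF 1])
      show "w \<tau> = (\<lambda>_ x. - field i x) (\<tau> - t i)" if "\<tau> \<in> {t i<..<s i}" for \<tau>
        using weight_on[OF i, of \<tau>] that by (auto simp: w_def fun_eq_iff)
    qed simp
    have im1: "(+) (t i) ` {0<..<s i - t i} = {t i<..<s i}"
    proof (intro set_eqI iffI)
      fix \<tau> assume "\<tau> \<in> {t i<..<s i}"
      then have "\<tau> - t i \<in> {0<..<s i - t i}" by auto
      then show "\<tau> \<in> (+) (t i) ` {0<..<s i - t i}" by (rule rev_image_eqI) simp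
    qed auto
    have im2: "(+) (t i) ` {0..s i - t i} = {t i..s i}" by simp
    have "y (\<tau> - t i) \<in> {ym..yp}" if "\<tau> \<in> {t i..s i}" for \<tau>
    proof -
      have "\<tau> - t i \<in> {0..s i - t i}" using that by auto
      then show ?thesis using bspec[OF xy(4)] orbit_y[OF i] by blast
    qed
    moreover have "has_exactly_zeros (\<lambda>\<tau>. x (\<tau> - t i)) {t i<..<s i} (nx i)"
      unfolding im1[symmetric] has_exactly_zeros_shift using xy(5) by simp
    moreover have "has_exactly_zeros (\<lambda>\<tau>. y (\<tau> - t i)) {t i..s i} (ny i)"
      unfolding im2[symmetric] has_exactly_zeros_shift using xy(6) by simp
    ultimately show ?thesis
      by (rule_tac exI[of _ "\<lambda>\<tau>. x (\<tau> - t i)"], rule_tac exI[of _ "\<lambda>\<tau>. y (\<tau> - t i)"]) (use 2 xy(2,3) in simp)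
  qed
  have gap_piece: "\<exists>x y. piecewise_sol hb w (s i) (t (Suc i)) x y \<and> (x (s i), y (s i)) = B i \<and> (x (t (Suc i)), y (t (Suc i))) = A (Suc i) \<and>
     (\<forall>\<tau>\<in>{s i..t (Suc i)}. y \<tau> \<in> {ym..yp}) \<and> has_exactly_zeros x {s i..t (Suc i)} (gx i) \<and> has_exactly_zeros y {s i..t (Suc i)} (gy i)"
    if i: "i < m" for i
  proof -
    obtain x y where xy: "smooth_sol hb (\<lambda>x. lam * x) (t (Suc i) - s i) x y" "(x 0, y 0) = B i"
      "(x (t (Suc i) - s i), y (t (Suc i) - s i)) = A (Suc i)"
      "\<forall>\<tau>\<in>{0..t (Suc i) - s i}. y \<tau> \<in> {ym..yp}"
      "has_exactly_zeros x {0..t (Suc i) - s i} (gx i)" "has_exactly_zeros y {0..t (Suc i) - s i} (gy i)"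
      using gp[OF i] unfolding gap_sol_def gx_def[symmetric] gy_def[symmetric] by blast
    have 1: "piecewise_sol hb (\<lambda>\<tau>. (\<lambda>_ x. - (lam * x)) (\<tau> - s i)) (s i) (t (Suc i)) (\<lambda>\<tau>. x (\<tau> - s i)) (\<lambda>\<tau>. y (\<tau> - s i))"
      using piecewise_sol_shift[OF piecewise_sol_of_smooth[OF xy(1)], of "s i"] by simp
    have 2: "piecewise_sol hb w (s i) (t (Suc i)) (\<lambda>\<tau>. x (\<tau> - s i)) (\<lambda>\<tau>. y (\<tau> - s i))"
    proof (rule piecewise_sol_cong[OF 1])
      show "w \<tau> = (\<lambda>_ x. - (lam * x)) (\<tau> - s i)" if "\<tau> \<in> {s i<..<t (Suc i)}" for \<tau>
        using weight_gap[OF i that] by (auto simp: w_def fun_eq_iff)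
    qed simp
    have im: "(+) (s i) ` {0..t (Suc i) - s i} = {s i..t (Suc i)}" by simp
    have "y (\<tau> - s i) \<in> {ym..yp}" if "\<tau> \<in> {s i..t (Suc i)}" for \<tau>
      using bspec[OF xy(4), of "\<tau> - s i"] that by auto
    moreover have "has_exactly_zeros (\<lambda>\<tau>. x (\<tau> - s i)) {s i..t (Suc i)} (gx i)" "has_exactly_zeros (\<lambda>\<tau>. y (\<tau> - s i)) {s i..t (Suc i)} (gy i)"
      unfolding im[symmetric] has_exactly_zeros_shift using xy(5,6) by simp_all
    ultimately show ?thesis
      by (rule_tac exI[of _ "\<lambda>\<tau>. x (\<tau> - s i)"], rule_tac exI[of _ "\<lambda>\<tau>. y (\<tau> - s i)"]) (use 2 xy(2,3) in simp)
  qed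
  obtain xa ya where tp: "\<And>i. i \<le> m \<Longrightarrow> piecewise_sol hb w (t i) (s i) (xa i) (ya i) \<and> (xa i (t i), ya i (t i)) = A i \<and>
     (xa i (s i), ya i (s i)) = B i \<and> (\<forall>\<tau>\<in>{t i..s i}. ya i \<tau> \<in> {ym..yp}) \<and>
     has_exactly_zeros (xa i) {t i<..<s i} (nx i) \<and> has_exactly_zeros (ya i) {t i..s i} (ny i)"
    using twist_piece by metis
  obtain xb yb where gpp: "\<And>i. i < m \<Longrightarrow> piecewise_sol hb w (s i) (t (Suc i)) (xb i) (yb i) \<and> (xb i (s i), yb i (s i)) = B i \<and>
     (xb i (t (Suc i)), yb i (t (Suc i))) = A (Suc i) \<and> (\<forall>\<tau>\<in>{s i..t (Suc i)}. yb i \<tau> \<in> {ym..yp}) \<and>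
     has_exactly_zeros (xb i) {s i..t (Suc i)} (gx i) \<and> has_exactly_zeros (yb i) {s i..t (Suc i)} (gy i)"
    using gap_piece by metis
  \<comment> \<open>The nodes in their order \<open>t 0, s 0, t 1, s 1, ...\<close>: pieces with
    even index belong to annuli, those with odd index to gaps.\<close>
  define b where "b k = (if even k then t (k div 2) else s (k div 2))" for k
  define u where "u k \<tau> = (if even k then (xa (k div 2) \<tau>, ya (k div 2) \<tau>) else (xb (k div 2) \<tau>, yb (k div 2) \<tau>))" for k \<tau>
  let ?n = "Suc (2 * m)"
  have k_cases: "(\<exists>i\<le>m. k = 2 * i) \<or> (\<exists>i<m. k = Suc (2 * i))" if "k < ?n" for k
    using that by (cases "even k") (auto elim!: evenE oddE)
  have ev: "b (2 * i) = t i" "b (Suc (2 * i)) = s i" "b (Suc (Suc (2 * i))) = t (Suc i)"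
    "u (2 * i) \<tau> = (xa i \<tau>, ya i \<tau>)" "u (Suc (2 * i)) \<tau> = (xb i \<tau>, yb i \<tau>)"
    "u (Suc (Suc (2 * i))) \<tau> = (xa (Suc i) \<tau>, ya (Suc i) \<tau>)" for i \<tau>
    by (simp_all add: b_def u_def)
  have "\<exists>z. \<forall>k<?n. \<forall>\<tau>\<in>{b k..b (Suc k)}. z \<tau> = u k \<tau>"
  proof (rule glue_pieces)
    show "b k < b (Suc k)" if "k < ?n" for k
      using k_cases[OF that] t_less_s s_less_t by (auto simp: ev)
    show "u k (b (Suc k)) = u (Suc k) (b (Suc k))" if "Suc k < ?n" for k
    proof -
      have "k < ?n" using that by simp
      from k_cases[OF this] show ?thesis
      proof (elim disjE exE conjE)
        fix i assume "i \<le> m" "k = 2 * i"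
        then show ?thesis using that tp[of i] gpp[of i] by (simp add: ev)
      next
        fix i assume "i < m" "k = Suc (2 * i)"
        then show ?thesis using tp[of "Suc i"] gpp[of i] by (simp add: ev)
      qed
    qed
  qed
  then obtain z where z: "\<And>k \<tau>. k < ?n \<Longrightarrow> \<tau> \<in> {b k..b (Suc k)} \<Longrightarrow> z \<tau> = u k \<tau>" by blast
  \<comment> \<open>Restricted to \<open>[0, L]\<close>, so that the pair is extensional as
    \<open>bvp_solutions\<close> demands.\<close>
  define x where "x = restrict (\<lambda>\<tau>. fst (z \<tau>)) {0..L}"
  define y where "y = restrict (\<lambda>\<tau>. snd (z \<tau>)) {0..L}"
  have bL: "b 0 = 0" "b ?n = L" using t_0 s_m by (simp_all add: b_def)
  have b_le: "b k \<le> b k'" if "k \<le> k'" "k' \<le> ?n" for k k'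
    using that
  proof (induction k' rule: dec_induct)
    case (step l)
    have "b l < b (Suc l)" using k_cases[of l] step.prems t_less_s s_less_t by (auto simp: ev)
    then show ?case using step by simp
  qed simp
  have in_0L: "\<tau> \<in> {0..L}" if "k < ?n" "\<tau> \<in> {b k..b (Suc k)}" for k \<tau>
    using b_le[of 0 k] b_le[of "Suc k" ?n] that bL by auto
  have xya: "x \<tau> = xa i \<tau>" "y \<tau> = ya i \<tau>" if "i \<le> m" "\<tau> \<in> {t i..s i}" for i \<tau>
    using z[of "2 * i" \<tau>] in_0L[of "2 * i" \<tau>] that by (simp_all add: ev x_def y_def)
  have xyb: "x \<tau> = xb i \<tau>" "y \<tau> = yb i \<tau>" if "i < m" "\<tau> \<in> {s i..t (Suc i)}" for i \<tau>
    using z[of "Suc (2 * i)" \<tau>] in_0L[of "Suc (2 * i)" \<tau>] that by (simp_all add: ev x_def y_def)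
  have sol: "piecewise_sol hb w 0 L x y"
  proof -
    have "piecewise_sol hb w (b 0) (b ?n) x y"
    proof (rule piecewise_sol_glue)
      fix k assume "k < ?n"
      from k_cases[OF this] show "piecewise_sol hb w (b k) (b (Suc k)) x y"
      proof (elim disjE exE conjE)
        fix i assume i: "i \<le> m" "k = 2 * i"
        have "piecewise_sol hb w (t i) (s i) x y"
          by (rule piecewise_sol_cong[where x = "xa i" and y = "ya i" and w = w]) (use tp[OF i(1)] xya[OF i(1)] in auto)
        then show ?thesis using i by (simp add: ev)
      next
        fix i assume i: "i < m" "k = Suc (2 * i)"
        have "piecewise_sol hb w (s i) (t (Suc i)) x y"
          by (rule piecewise_sol_cong[where x = "xb i" and y = "yb i" and w = w]) (use gpp[OF i(1)] xyb[OF i(1)] in auto)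
        then show ?thesis using i by (simp add: ev)
      qed
    qed simp
    then show ?thesis by (simp add: bL)
  qed
  \<comment> \<open>The ends of the gaps are assigned to the annulus intervals, because there the
    weight has the value of the annulus.\<close>
  have pieces: "(\<exists>i\<le>m. \<tau> \<in> {t i..s i}) \<or> (\<exists>i<m. \<tau> \<in> {s i<..<t (Suc i)})" if "\<tau> \<in> {0..L}" for \<tau>
  proof -
    have "\<exists>k<?n. \<tau> \<in> {b k..b (Suc k)}" by (rule partition_cover) (use that bL in auto)
    then obtain k where k: "k < ?n" "\<tau> \<in> {b k..b (Suc k)}" by blast
    from k_cases[OF k(1)] show ?thesis
    proof (elim disjE exE conjE)
      fix i assume "i \<le> m" "k = 2 * i"
      then show ?thesis using k(2) by (auto simp: ev)
    next
      fix i assume i: "i < m" "k = Suc (2 * i)"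
      then have "\<tau> \<in> {s i<..<t (Suc i)} \<or> \<tau> = s i \<or> \<tau> = t (Suc i)" using k(2) by (auto simp: ev)
      moreover have "s i \<in> {t i..s i}" "t (Suc i) \<in> {t (Suc i)..s (Suc i)}" using i t_less_s[of i] t_less_s[of "Suc i"] by auto
      moreover have "i \<le> m" "Suc i \<le> m" using i by auto
      ultimately show ?thesis using i(1) by blast
    qed
  qed
  have y_strip: "y \<tau> \<in> {ym..yp}" if "\<tau> \<in> {0..L}" for \<tau>
    using pieces[OF that]
  proof (elim disjE exE conjE)
    fix i assume "i \<le> m" "\<tau> \<in> {t i..s i}"
    then show ?thesis using tp[of i] xya[of i \<tau>] by auto
  next
    fix i assume "i < m" "\<tau> \<in> {s i<..<t (Suc i)}"
    then show ?thesis using gpp[of i] xyb[of i \<tau>] by auto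
  qed
  \<comment> \<open>A crude bound of the weight, enough to bound \<open>y'\<close> along the
    solution; on gaps the weight is 0.\<close>
  have a_bound: "\<bar>a \<tau>\<bar> \<le> (\<Sum>i\<le>m. \<mu> i)" if "\<tau> \<in> {0..L}" for \<tau>
    using pieces[OF that]
  proof (elim disjE exE conjE)
    fix i assume i: "i \<le> m" "\<tau> \<in> {t i..s i}"
    have "\<mu> i \<le> (\<Sum>i\<le>m. \<mu> i)" using i \<mu>_pos by (intro member_le_sum) (auto intro: less_imp_le)
    then show ?thesis using weight_on[OF i] \<mu>_pos[OF i(1)] by simp
  next
    fix i assume i: "i < m" "\<tau> \<in> {s i<..<t (Suc i)}"
    have "0 \<le> (\<Sum>i\<le>m. \<mu> i)" using \<mu>_pos by (intro sum_nonneg) (auto intro: less_imp_le)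
    then show ?thesis using weight_gap[OF i] by simp
  qed
  have "caratheodory_solution rm rp h w 0 L x y"
  proof -
    have cx: "continuous_on {0..L} x" using sol by (simp add: piecewise_sol_def)
    have "bounded (x ` {0..L})" by (intro compact_imp_bounded compact_continuous_image compact_Icc cx)
    then obtain Bx where "\<forall>v\<in>x ` {0..L}. norm v \<le> Bx" unfolding bounded_iff by blast
    then have Bx: "\<bar>x \<tau>\<bar> \<le> Bx" if "\<tau> \<in> {0..L}" for \<tau> using that by auto
    have "bounded ((\<lambda>\<tau>. g (x \<tau>)) ` {0..L})"
      by (intro compact_imp_bounded compact_continuous_image compact_Icc continuous_on_compose2[OF g_cont cx]) auto
    then obtain Bg where "\<forall>v\<in>(\<lambda>\<tau>. g (x \<tau>)) ` {0..L}. norm v \<le> Bg" unfolding bounded_iff by blast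
    then have Bg: "\<bar>g (x \<tau>)\<bar> \<le> Bg" if "\<tau> \<in> {0..L}" for \<tau> using that by auto
    show ?thesis
    proof (rule caratheodory_of_piecewise[OF sol y_strip])
      fix \<tau> assume t: "\<tau> \<in> {0..L}"
      have "\<bar>w \<tau> (x \<tau>)\<bar> \<le> \<bar>lam * x \<tau>\<bar> + \<bar>a \<tau> * g (x \<tau>)\<bar>" 
        using abs_triangle_ineq4[of "- lam * x \<tau>" "a \<tau> * g (x \<tau>)"] by (simp add: w_def)
      also have "\<dots> \<le> \<bar>lam\<bar> * Bx + (\<Sum>i\<le>m. \<mu> i) * Bg"
        unfolding abs_mult using Bx[OF t] Bg[OF t] a_bound[OF t] order_trans[OF abs_ge_zero a_bound[OF t]]
        by (intro add_mono mult_mono) auto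
      finally show "\<bar>w \<tau> (x \<tau>)\<bar> \<le> \<bar>lam\<bar> * Bx + (\<Sum>i\<le>m. \<mu> i) * Bg" .
    qed
  qed
  moreover have endpoints: "(x (t i), y (t i)) = A i" "(x (s i), y (s i)) = B i" if "i \<le> m" for i
    using tp[OF that] xya[OF that, of "t i"] xya[OF that, of "s i"] t_less_s[OF that] by auto
  ultimately have "(x, y) \<in> bvp_solutions r0 rL"
    using endpoints(1)[of 0] endpoints(2)[of m] A0 Bm t_0 s_m
    by (auto simp: bvp_solutions_def w_def[abs_def] x_def y_def)
  moreover have "itinerary \<kappa> q n x y"
    unfolding itinerary_def nx_def[symmetric] ny_def[symmetric] gx_def[symmetric] gy_def[symmetric]
  proof (intro conjI allI impI)
    fix i assume i: "i \<le> m"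
    show "(x (t i), y (t i)) \<in> annulus_quadrant i (\<kappa> i)" "(x (s i), y (s i)) \<in> annulus_quadrant i (q i)"
      using endpoints[OF i] tw[OF i] by auto
    show "has_exactly_zeros x {t i<..<s i} (nx i)"
      by (rule has_exactly_zeros_cong[of _ _ "xa i", THEN iffD2]) (use tp[OF i] xya[OF i] in auto)
    show "has_exactly_zeros y {t i..s i} (ny i)"
      by (rule has_exactly_zeros_cong[of _ _ "ya i", THEN iffD2]) (use tp[OF i] xya[OF i] in auto)
  next
    fix i assume i: "i < m"
    show "has_exactly_zeros x {s i..t (Suc i)} (gx i)"
      by (rule has_exactly_zeros_cong[of _ _ "xb i", THEN iffD2]) (use gpp[OF i] xyb[OF i] in auto)
    show "has_exactly_zeros y {s i..t (Suc i)} (gy i)"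
      by (rule has_exactly_zeros_cong[of _ _ "yb i", THEN iffD2]) (use gpp[OF i] xyb[OF i] in auto)
  qed
  ultimately show ?thesis by blast
qed

section \<open>Distinct codes belong to distinct solutions\<close>

lemma quadrants_disjoint:
  assumes i: "i \<le> m" and z: "z \<in> annulus_quadrant i q" "z \<in> annulus_quadrant i q'"
    and q: "{q, q'} \<subseteq> {QI, QIII} \<or> {q, q'} \<subseteq> {QII, QIV}"
  shows "q = q'"
proof (rule ccontr)
  assume n: "q \<noteq> q'"
  obtain x y where xy: "z = (x, y)" by (metis surj_pair)
  have "x = 0 \<and> y = 0"
    using z q n unfolding xy mem_annulus_quadrant[OF i] by (cases q; cases q') auto
  then have "0 \<in> {c1 i..c2 i}" using z(1) Hb_0 F_0 unfolding xy mem_annulus_quadrant[OF i] by auto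
  then show False using c1_pos[OF i] by simp
qed

text \<open>Opposite closed quadrants meet only at the origin, which no annulus contains. So the
  states at \<open>t i\<close> and \<open>s i\<close> determine the two quadrants, these determine
  which formula counts the zeros of x, and the count determines \<open>n i\<close>.\<close>

lemma itinerary_unique:
  assumes 1: "itinerary \<kappa> q n x y" and 2: "itinerary \<kappa>' q' n' x y" and i: "i \<le> m"
    and \<kappa>: "\<kappa> i \<in> {QI, QIII}" "\<kappa>' i \<in> {QI, QIII}" and q: "q i \<in> {QII, QIV}" "q' i \<in> {QII, QIV}"
    and n: "1 \<le> n i" "1 \<le> n' i"
  shows "\<kappa> i = \<kappa>' i" "q i = q' i" "n i = n' i"
proof -
  show k: "\<kappa> i = \<kappa>' i"
    using 1 2 i \<kappa> quadrants_disjoint[OF i, of "(x (t i), y (t i))" "\<kappa> i" "\<kappa>' i"] unfolding itinerary_def by auto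
  show qq: "q i = q' i"
    using 1 2 i q quadrants_disjoint[OF i, of "(x (s i), y (s i))" "q i" "q' i"] unfolding itinerary_def by auto
  have "has_exactly_zeros x {t i<..<s i} (if q i = qsucc (\<kappa> i) then 2 * n i else 2 * n i - 1)"
    "has_exactly_zeros x {t i<..<s i} (if q i = qsucc (\<kappa> i) then 2 * n' i else 2 * n' i - 1)"
    using 1 2 i k qq unfolding itinerary_def by auto
  then have "(if q i = qsucc (\<kappa> i) then 2 * n i else 2 * n i - 1) = (if q i = qsucc (\<kappa> i) then 2 * n' i else 2 * n' i - 1)"
    by (rule has_exactly_zeros_unique)
  then show "n i = n' i" using n by (auto split: if_splits)
qed

end

theorem theorem6p2:
  fixes m :: nat and L lam :: real
    and t s \<mu> c1 c2 d e :: "nat \<Rightarrow> real"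
    and a h g :: "real \<Rightarrow> real"
    and rm rp :: ereal
    and xm xp :: "nat \<Rightarrow> real \<Rightarrow> real"
    and r0 rL :: "(real \<times> real) set"
    and \<alpha> \<beta> :: "nat \<Rightarrow> nat"
  assumes setting: "annular_system m L t s \<mu> a rm rp h g lam c1 c2 xm xp"
    and lam_neg: "lam < 0"
    and arcs_strip: "\<forall>i<m. annular_system.transition_arcs_in_strip \<mu> rm rp h g lam c1 c2 xm xp i"
    and r0_arc: "annular_system.connecting_arc \<mu> rm rp h g lam c1 c2 xm xp 0 r0"
    and rL_arc: "annular_system.connecting_arc \<mu> rm rp h g lam c1 c2 xm xp m rL"
    and r0_quadrant:
      "r0 \<subseteq> annular_system.annulus_quadrant \<mu> rm rp h g lam c1 c2 xm xp 0 QI \<or>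
       r0 \<subseteq> annular_system.annulus_quadrant \<mu> rm rp h g lam c1 c2 xm xp 0 QIII"
    and rL_quadrant:
      "rL \<subseteq> annular_system.annulus_quadrant \<mu> rm rp h g lam c1 c2 xm xp m QII \<or>
       rL \<subseteq> annular_system.annulus_quadrant \<mu> rm rp h g lam c1 c2 xm xp m QIV"
    and d_e: "\<forall>i\<le>m. d i \<in> {c1 i, c2 i} \<and> e i \<in> {c1 i, c2 i} \<and> d i \<noteq> e i"
    and \<alpha>_less_\<beta>: "\<forall>i\<le>m. \<alpha> i < \<beta> i"
    and twist:
      "let T = annular_system.quadrant_time \<mu> rm rp h g lam xm xp;
           P = annular_system.period \<mu> rm rp h g lam xm xp
       in \<forall>i\<le>m. \<forall>\<kappa>\<in>{QI, QIII}.
            T i (qsucc \<kappa>) (d i) + T i (qsucc (qsucc \<kappa>)) (d i) + real (\<alpha> i) * P i (d i) > s i - t i \<and>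
            T i \<kappa> (e i) + T i (qsucc \<kappa>) (e i) + real (\<beta> i) * P i (e i) < s i - t i"
    and transition:
      "\<forall>i<m. annular_system.S_II_I \<mu> rp h g lam c1 c2 i \<le> t (Suc i) - s i \<and>
             annular_system.S_IV_III \<mu> rm h g lam c1 c2 i \<le> t (Suc i) - s i \<and>
             annular_system.S_IV_I \<mu> rm rp h g lam c1 c2 xp i \<le> t (Suc i) - s i \<and>
             annular_system.S_II_III \<mu> rm rp h g lam c1 c2 xm i \<le> t (Suc i) - s i"
  shows
    "let A = annular_system.annulus_quadrant \<mu> rm rp h g lam c1 c2 xm xp;
         Sol = annular_system.bvp_solutions L a rm rp h g lam r0 rL
     in (\<exists>S \<subseteq> Sol. finite S \<and> card S = 4 ^ m * (\<Prod>i\<le>m. \<beta> i - \<alpha> i)) \<and>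
        (\<forall>\<kappa>\<^sub>0\<in>{QI, QIII}. \<forall>q\<^sub>L\<in>{QII, QIV}. r0 \<subseteq> A 0 \<kappa>\<^sub>0 \<and> rL \<subseteq> A m q\<^sub>L \<longrightarrow>
          (\<forall>(\<kappa> :: nat \<Rightarrow> quadrant) (q :: nat \<Rightarrow> quadrant) (j :: nat \<Rightarrow> nat).
             \<kappa> 0 = \<kappa>\<^sub>0 \<and> (\<forall>i\<in>{1..m}. \<kappa> i \<in> {QI, QIII}) \<and>
             (\<forall>i<m. q i \<in> {QII, QIV}) \<and>
             (\<forall>i\<le>m. 1 \<le> j i \<and> j i \<le> \<beta> i - \<alpha> i) \<longrightarrow>
             (\<exists>(x, y)\<in>Sol.
                (\<forall>i\<le>m. (x (t i), y (t i)) \<in> A i (\<kappa> i)) \<and>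
                (\<forall>i<m. (x (s i), y (s i)) \<in> A i (q i)) \<and>
                (\<forall>i<m.
                   (q i = qpred (\<kappa> i) \<longrightarrow>
                      has_exactly_zeros x {t i<..<s i} (2 * (\<alpha> i + j i) - 1) \<and>
                      has_exactly_zeros y {t i..s i} (2 * (\<alpha> i + j i))) \<and>
                   (q i = qsucc (\<kappa> i) \<longrightarrow>
                      has_exactly_zeros x {t i<..<s i} (2 * (\<alpha> i + j i)) \<and>
                      has_exactly_zeros y {t i..s i} (2 * (\<alpha> i + j i) + 1)) \<and>
                   ((q i, \<kappa> (Suc i)) \<in> {(QII, QI), (QIV, QIII)} \<longrightarrow>
                      has_exactly_zeros x {s i..t (Suc i)} 1 \<and>
                      has_exactly_zeros y {s i..t (Suc i)} 0) \<and>
                   ((q i, \<kappa> (Suc i)) \<in> {(QIV, QI), (QII, QIII)} \<longrightarrow>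
                      has_exactly_zeros x {s i..t (Suc i)} 0 \<and>
                      has_exactly_zeros y {s i..t (Suc i)} 1)) \<and>
                (q\<^sub>L = qpred (\<kappa> m) \<longrightarrow>
                   has_exactly_zeros x {t m<..<s m} (2 * (\<alpha> m + j m) - 1) \<and>
                   has_exactly_zeros y {t m..s m} (2 * (\<alpha> m + j m))) \<and>
                (q\<^sub>L = qsucc (\<kappa> m) \<longrightarrow>
                   has_exactly_zeros x {t m<..<s m} (2 * (\<alpha> m + j m)) \<and>
                   has_exactly_zeros y {t m..s m} (2 * (\<alpha> m + j m) + 1)))))"
proof -
  interpret annular_system m L t s \<mu> a rm rp h g lam c1 c2 xm xp by (rule setting)
  obtain ym yp where strip: "rm < ereal ym" "ym < 0" "0 < yp" "ereal yp < rp"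
    "\<And>i c x. i \<le> m \<Longrightarrow> c \<in> {c1 i..c2 i} \<Longrightarrow> x \<in> {xm i c..xp i c} \<Longrightarrow> c - F i x \<le> H yp \<and> c - F i x \<le> H ym"
    using common_strip by blast
  interpret clamped_system m L t s \<mu> a rm rp h g lam c1 c2 xm xp ym yp
    by unfold_locales (use lam_neg strip in auto)
  have existence: "\<exists>(x, y)\<in>bvp_solutions r0 rL. itinerary \<kappa> q (\<lambda>i. \<alpha> i + j i) x y"
    if code: "r0 \<subseteq> annulus_quadrant 0 (\<kappa> 0)" "rL \<subseteq> annulus_quadrant m (q m)"
      "\<And>i. i \<le> m \<Longrightarrow> \<kappa> i \<in> {QI, QIII}" "\<And>i. i \<le> m \<Longrightarrow> q i \<in> {QII, QIV}" "\<And>i. i \<le> m \<Longrightarrow> 1 \<le> j i \<and> j i \<le> \<beta> i - \<alpha> i"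
    for \<kappa> q j
  proof -
    obtain A B where "A 0 \<in> r0" "B m \<in> rL"
      "\<And>i. i \<le> m \<Longrightarrow> A i \<in> annulus_quadrant i (\<kappa> i) \<and> B i \<in> annulus_quadrant i (q i) \<and>
         twist_sol i (A i) (B i) (if q i = qsucc (\<kappa> i) then 2 * (\<alpha> i + j i) else 2 * (\<alpha> i + j i) - 1)
           (if q i = qsucc (\<kappa> i) then 2 * (\<alpha> i + j i) + 1 else 2 * (\<alpha> i + j i))"
      "\<And>i. i < m \<Longrightarrow> gap_sol i (B i) (A (Suc i)) (if (q i, \<kappa> (Suc i)) \<in> {(QII, QI), (QIV, QIII)} then 1 else 0)
           (if (q i, \<kappa> (Suc i)) \<in> {(QII, QI), (QIV, QIII)} then 0 else 1)"
    proof (rule chain_exists[of \<kappa> r0 q rL d e j \<beta> \<alpha>])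
      show "radial_path 0 (\<kappa> 0) r0" by (rule radial_path_of_arc[OF _ r0_arc code(1)]) simp
      show "radial_path m (q m) rL" by (rule radial_path_of_arc[OF _ rL_arc code(2)]) simp
      show "quadrant_time i (qsucc p) (d i) + quadrant_time i (qsucc (qsucc p)) (d i) + real (\<alpha> i) * period i (d i) > s i - t i \<and>
         quadrant_time i p (e i) + quadrant_time i (qsucc p) (e i) + real (\<beta> i) * period i (e i) < s i - t i"
        if "i \<le> m" "p \<in> {QI, QIII}" for i p
        using twist that unfolding Let_def by blast
    qed (use code(3-5) d_e transition in blast)+
    then show ?thesis by (rule solution_of_chain)
  qed
  obtain \<kappa>0 where \<kappa>0: "\<kappa>0 \<in> {QI, QIII}" "r0 \<subseteq> annulus_quadrant 0 \<kappa>0" using r0_quadrant by blast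
  obtain qL where qL: "qL \<in> {QII, QIV}" "rL \<subseteq> annulus_quadrant m qL" using rL_quadrant by blast
  have count: "\<exists>S \<subseteq> bvp_solutions r0 rL. finite S \<and> card S = 4 ^ m * (\<Prod>i\<le>m. \<beta> i - \<alpha> i)"
  proof -
    \<comment> \<open>The codes: \<open>\<kappa> 0\<close> and \<open>q m\<close> are fixed by the
      arcs, which leaves m choices of each kind of quadrant. Extensional functions make the set
      finite and let equality be tested on the index ranges.\<close>
    define I where "I = (\<Pi>\<^sub>E i\<in>{1..m}. {QI, QIII}) \<times> (\<Pi>\<^sub>E i\<in>{..<m}. {QII, QIV}) \<times> (\<Pi>\<^sub>E i\<in>{..m}. {1..\<beta> i - \<alpha> i})"
    define K :: "(nat \<Rightarrow> quadrant) \<Rightarrow> nat \<Rightarrow> quadrant" where "K \<kappa> i = (if i = 0 then \<kappa>0 else \<kappa> i)" for \<kappa> i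
    define Q :: "(nat \<Rightarrow> quadrant) \<Rightarrow> nat \<Rightarrow> quadrant" where "Q q i = (if i = m then qL else q i)" for q i
    define Z where "Z p z \<longleftrightarrow> z \<in> bvp_solutions r0 rL \<and>
      itinerary (K (fst p)) (Q (fst (snd p))) (\<lambda>i. \<alpha> i + snd (snd p) i) (fst z) (snd z)" for p z
    have rng: "K (fst p) i \<in> {QI, QIII}" "Q (fst (snd p)) i \<in> {QII, QIV}"
      "1 \<le> snd (snd p) i \<and> snd (snd p) i \<le> \<beta> i - \<alpha> i" if p: "p \<in> I" and i: "i \<le> m" for p i
    proof -
      have p': "fst p \<in> (\<Pi>\<^sub>E i\<in>{1..m}. {QI, QIII})" "fst (snd p) \<in> (\<Pi>\<^sub>E i\<in>{..<m}. {QII, QIV})"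
        "snd (snd p) \<in> (\<Pi>\<^sub>E i\<in>{..m}. {1..\<beta> i - \<alpha> i})" using p by (auto simp: I_def)
      show "K (fst p) i \<in> {QI, QIII}" using PiE_mem[OF p'(1), of i] i \<kappa>0(1) by (auto simp: K_def)
      show "Q (fst (snd p)) i \<in> {QII, QIV}" using PiE_mem[OF p'(2), of i] i qL(1) by (auto simp: Q_def)
      show "1 \<le> snd (snd p) i \<and> snd (snd p) i \<le> \<beta> i - \<alpha> i" using PiE_mem[OF p'(3), of i] i by auto
    qed
    have "\<exists>z. Z p z" if "p \<in> I" for p
      using existence[of "K (fst p)" "Q (fst (snd p))" "snd (snd p)"] rng[OF that] \<kappa>0(2) qL(2)
      by (force simp: Z_def K_def Q_def)
    \<comment> \<open>One solution is picked for each code; by \<open>itinerary_unique\<close> the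
      code can be recovered from it, so the picked solutions are as many as the codes.\<close>
    then obtain \<Phi> where \<Phi>: "\<And>p. p \<in> I \<Longrightarrow> Z p (\<Phi> p)" by metis
    have inj: "inj_on \<Phi> I"
    proof (rule inj_onI)
      fix p p' assume p: "p \<in> I" "p' \<in> I" "\<Phi> p = \<Phi> p'"
      have it: "itinerary (K (fst p)) (Q (fst (snd p))) (\<lambda>i. \<alpha> i + snd (snd p) i) (fst (\<Phi> p)) (snd (\<Phi> p))"
        "itinerary (K (fst p')) (Q (fst (snd p'))) (\<lambda>i. \<alpha> i + snd (snd p') i) (fst (\<Phi> p)) (snd (\<Phi> p))"
        using \<Phi>[OF p(1)] \<Phi>[OF p(2)] p(3) by (simp_all add: Z_def)
      have eq: "K (fst p) i = K (fst p') i" "Q (fst (snd p)) i = Q (fst (snd p')) i" "snd (snd p) i = snd (snd p') i"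
        if i: "i \<le> m" for i
        using itinerary_unique[OF it i rng(1)[OF p(1) i] rng(1)[OF p(2) i] rng(2)[OF p(1) i] rng(2)[OF p(2) i]]
          rng(3)[OF p(1) i] rng(3)[OF p(2) i] by simp_all
      have p1: "fst p \<in> (\<Pi>\<^sub>E i\<in>{1..m}. {QI, QIII})" "fst (snd p) \<in> (\<Pi>\<^sub>E i\<in>{..<m}. {QII, QIV})"
        "snd (snd p) \<in> (\<Pi>\<^sub>E i\<in>{..m}. {1..\<beta> i - \<alpha> i})" using p(1) by (auto simp: I_def)
      have p2: "fst p' \<in> (\<Pi>\<^sub>E i\<in>{1..m}. {QI, QIII})" "fst (snd p') \<in> (\<Pi>\<^sub>E i\<in>{..<m}. {QII, QIV})"
        "snd (snd p') \<in> (\<Pi>\<^sub>E i\<in>{..m}. {1..\<beta> i - \<alpha> i})" using p(2) by (auto simp: I_def)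
      have "fst p = fst p'"
      proof (rule PiE_ext[OF p1(1) p2(1)])
        fix i assume "i \<in> {1..m}"
        then show "fst p i = fst p' i" using eq(1)[of i] by (simp add: K_def)
      qed
      moreover have "fst (snd p) = fst (snd p')"
      proof (rule PiE_ext[OF p1(2) p2(2)])
        fix i assume "i \<in> {..<m}"
        then show "fst (snd p) i = fst (snd p') i" using eq(2)[of i] by (simp add: Q_def)
      qed
      moreover have "snd (snd p) = snd (snd p')"
        by (rule PiE_ext[OF p1(3) p2(3)]) (use eq(3) in simp)
      ultimately show "p = p'" by (simp add: prod_eq_iff)
    qed
    have "card I = 2 ^ m * (2 ^ m * (\<Prod>i\<le>m. \<beta> i - \<alpha> i))"
      unfolding I_def by (simp add: card_cartesian_product card_PiE numeral_2_eq_2[symmetric])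
    then have card: "card I = 4 ^ m * (\<Prod>i\<le>m. \<beta> i - \<alpha> i)"
      by (simp add: mult.assoc[symmetric] power_mult_distrib[symmetric])
    have "finite I" unfolding I_def by (intro finite_cartesian_product finite_PiE) auto
    moreover have "\<Phi> ` I \<subseteq> bvp_solutions r0 rL" using \<Phi> by (auto simp: Z_def)
    ultimately show ?thesis
      using card card_image[OF inj] by (intro exI[of _ "\<Phi> ` I"]) auto
  qed
  have nodal: "\<exists>(x, y)\<in>bvp_solutions r0 rL.
                (\<forall>i\<le>m. (x (t i), y (t i)) \<in> annulus_quadrant i (\<kappa> i)) \<and>
                (\<forall>i<m. (x (s i), y (s i)) \<in> annulus_quadrant i (q i)) \<and>
                (\<forall>i<m.
                   (q i = qpred (\<kappa> i) \<longrightarrow>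
                      has_exactly_zeros x {t i<..<s i} (2 * (\<alpha> i + j i) - 1) \<and>
                      has_exactly_zeros y {t i..s i} (2 * (\<alpha> i + j i))) \<and>
                   (q i = qsucc (\<kappa> i) \<longrightarrow>
                      has_exactly_zeros x {t i<..<s i} (2 * (\<alpha> i + j i)) \<and>
                      has_exactly_zeros y {t i..s i} (2 * (\<alpha> i + j i) + 1)) \<and>
                   ((q i, \<kappa> (Suc i)) \<in> {(QII, QI), (QIV, QIII)} \<longrightarrow>
                      has_exactly_zeros x {s i..t (Suc i)} 1 \<and>
                      has_exactly_zeros y {s i..t (Suc i)} 0) \<and>
                   ((q i, \<kappa> (Suc i)) \<in> {(QIV, QI), (QII, QIII)} \<longrightarrow>
                      has_exactly_zeros x {s i..t (Suc i)} 0 \<and>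
                      has_exactly_zeros y {s i..t (Suc i)} 1)) \<and>
                (q\<^sub>L = qpred (\<kappa> m) \<longrightarrow>
                   has_exactly_zeros x {t m<..<s m} (2 * (\<alpha> m + j m) - 1) \<and>
                   has_exactly_zeros y {t m..s m} (2 * (\<alpha> m + j m))) \<and>
                (q\<^sub>L = qsucc (\<kappa> m) \<longrightarrow>
                   has_exactly_zeros x {t m<..<s m} (2 * (\<alpha> m + j m)) \<and>
                   has_exactly_zeros y {t m..s m} (2 * (\<alpha> m + j m) + 1))"
    if ends: "\<kappa>\<^sub>0 \<in> {QI, QIII}" "q\<^sub>L \<in> {QII, QIV}" "r0 \<subseteq> annulus_quadrant 0 \<kappa>\<^sub>0 \<and> rL \<subseteq> annulus_quadrant m q\<^sub>L"
      and seq: "\<kappa> 0 = \<kappa>\<^sub>0 \<and> (\<forall>i\<in>{1..m}. \<kappa> i \<in> {QI, QIII}) \<and> (\<forall>i<m. q i \<in> {QII, QIV}) \<and> (\<forall>i\<le>m. 1 \<le> j i \<and> j i \<le> \<beta> i - \<alpha> i)"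
    for \<kappa>\<^sub>0 q\<^sub>L and \<kappa> q :: "nat \<Rightarrow> quadrant" and j :: "nat \<Rightarrow> nat"
  proof -
    have \<kappa>: "\<kappa> i \<in> {QI, QIII}" if "i \<le> m" for i using seq ends(1) that by (cases "i = 0") auto
    have q: "(q(m := q\<^sub>L)) i \<in> {QII, QIV}" if "i \<le> m" for i using seq ends(2) that by auto
    obtain x y where xy: "(x, y) \<in> bvp_solutions r0 rL" "itinerary \<kappa> (q(m := q\<^sub>L)) (\<lambda>i. \<alpha> i + j i) x y"
      using existence[of \<kappa> "q(m := q\<^sub>L)" j] \<kappa> q ends(3) seq by auto
    \<comment> \<open>The two entries of the classification exclude each other, so the conditional
      in \<open>itinerary\<close> splits into the two separate implications.\<close>
    have pred: "qpred (\<kappa> i) \<noteq> qsucc (\<kappa> i)" for i by (cases "\<kappa> i") auto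
    have tw: "(x (t i), y (t i)) \<in> annulus_quadrant i (\<kappa> i)" "(x (s i), y (s i)) \<in> annulus_quadrant i ((q(m := q\<^sub>L)) i)"
      "has_exactly_zeros x {t i<..<s i} (if (q(m := q\<^sub>L)) i = qsucc (\<kappa> i) then 2 * (\<alpha> i + j i) else 2 * (\<alpha> i + j i) - 1)"
      "has_exactly_zeros y {t i..s i} (if (q(m := q\<^sub>L)) i = qsucc (\<kappa> i) then 2 * (\<alpha> i + j i) + 1 else 2 * (\<alpha> i + j i))"
      if "i \<le> m" for i using xy(2) that unfolding itinerary_def by blast+
    have gp: "has_exactly_zeros x {s i..t (Suc i)} (if (q i, \<kappa> (Suc i)) \<in> {(QII, QI), (QIV, QIII)} then 1 else 0)"
      "has_exactly_zeros y {s i..t (Suc i)} (if (q i, \<kappa> (Suc i)) \<in> {(QII, QI), (QIV, QIII)} then 0 else 1)"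
      if "i < m" for i using xy(2) that unfolding itinerary_def by auto
    show ?thesis
    proof (rule bexI[OF _ xy(1)], unfold prod.case, intro conjI allI impI)
      fix i assume i: "i < m"
      then have i': "i \<le> m" "i \<noteq> m" by auto
      show "(x (s i), y (s i)) \<in> annulus_quadrant i (q i)" using tw(2)[OF i'(1)] i'(2) by simp
      show "has_exactly_zeros x {t i<..<s i} (2 * (\<alpha> i + j i) - 1)" "has_exactly_zeros y {t i..s i} (2 * (\<alpha> i + j i))"
        if "q i = qpred (\<kappa> i)" using tw(3,4)[OF i'(1)] i'(2) that pred[of i] by simp_all
      show "has_exactly_zeros x {t i<..<s i} (2 * (\<alpha> i + j i))" "has_exactly_zeros y {t i..s i} (2 * (\<alpha> i + j i) + 1)"
        if "q i = qsucc (\<kappa> i)" using tw(3,4)[OF i'(1)] i'(2) that by simp_all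
      show "has_exactly_zeros x {s i..t (Suc i)} 1" "has_exactly_zeros y {s i..t (Suc i)} 0"
        if "(q i, \<kappa> (Suc i)) \<in> {(QII, QI), (QIV, QIII)}" using gp[OF i] that by auto
      show "has_exactly_zeros x {s i..t (Suc i)} 0" "has_exactly_zeros y {s i..t (Suc i)} 1"
        if "(q i, \<kappa> (Suc i)) \<in> {(QIV, QI), (QII, QIII)}" using gp[OF i] that by auto
    next
      show "has_exactly_zeros x {t m<..<s m} (2 * (\<alpha> m + j m) - 1)" "has_exactly_zeros y {t m..s m} (2 * (\<alpha> m + j m))"
        if "q\<^sub>L = qpred (\<kappa> m)" using tw(3,4)[OF order_refl] that pred[of m] by simp_all
      show "has_exactly_zeros x {t m<..<s m} (2 * (\<alpha> m + j m))" "has_exactly_zeros y {t m..s m} (2 * (\<alpha> m + j m) + 1)"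
        if "q\<^sub>L = qsucc (\<kappa> m)" using tw(3,4)[OF order_refl] that by simp_all
    qed (rule tw(1))
  qed
  show ?thesis
    unfolding Let_def
  proof (intro conjI ballI allI impI)
    show "\<exists>S\<subseteq>bvp_solutions r0 rL. finite S \<and> card S = 4 ^ m * (\<Prod>i\<le>m. \<beta> i - \<alpha> i)" by (rule count)
  qed (rule nodal; assumption)
qed

end
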